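(* In the setting and notation of the context, the multiplication in $(\mathcal U\mathrm{Jen}_*(P)\rtimes H)e$ induces an isomorphism of algebras $$\mathfrak A\otimes_k\mathfrak M\xrightarrow{\ \cong\ }(\mathcal U\mathrm{Jen}_*(P)\rtimes H)e.$$
   Context: Setup. $p$ is a prime, $k$ an algebraically closed field of characteristic $p$; in groups $[g,h]=ghg^{-1}h^{-1}$. $P$ is a finite $p$-group, $L$ an abelian $p'$-subgroup of $\mathrm{Aut}(P)$, and $\alpha\in H^2(L,k^\times)$, represented by a $2$-cocycle of the same order. Associated to $\alpha$ is a central extension $1\to Z\to H\to L\to1$ of finite $p'$-groups and a faithful character $\chi\colon Z\to k^\times$ with $Z=[H,H]$ and $\alpha(x,y)=\chi(\hat x\hat y\,\widehat{xy}^{\,-1})$ for some choice of inverse images $\hat x\in H$ of $x\in L$. $H$ acts on $P$ via $H\to L$; $e=\frac1{|Z|}\sum_{z\in Z}\chi(z^{-1})z$. Characters. $\mathrm{Irr}(Z(H)|\chi)$ is the set of homomorphisms $\phi\colon Z(H)\to k^\times$ extending $\chi$, and $e_\phi=\frac1{|Z(H)|}\sum_{h\in Z(H)}\phi(h^{-1})h$. Fix $\phi_0\in \mathrm{Irr}(Z(H)|\chi)$ and for each $\phi$ a $\xi_\phi\in\mathrm{Hom}(H/Z,k^\times)$ (inflated to $H$) restricting to $\phi\phi_0^{-1}$ on $Z(H)$, with $\xi_{\phi_0}=1$. For $\psi\in\mathrm{Hom}(H/Z,k^\times)$ write $\phi\psi$ for $\phi\cdot\psi|_{Z(H)}$. The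 map $\rho\colon H\to\mathrm{Hom}(H,k^\times)$, $\rho(g)(h)=\chi([h,g])$, has kernel $Z(H)$ and image $\mathrm{Hom}(H/Z(H),k^\times)$. For each $\psi,\phi$ choose $g_{\psi,\phi}\in H$ with $\rho(g_{\psi,\phi})=\xi_{\phi\psi}\xi_\phi^{-1}\psi^{-1}$. $\mathfrak M\subseteq kHe$ is the image of the (matrix) algebra $kHe_{\phi_0}$ under the unital injective algebra homomorphism $he_{\phi_0}\mapsto\sum_{\phi}\xi_\phi(h)^{-1}he_\phi$ ($h\in H$). Jennings Lie algebra. $F_r(P)=\{g\in P\mid g-1\in J^r(kP)\}$ and $\mathrm{Jen}_*(P)=\bigoplus_{r\ge1}k\otimes_{\mathbb F_p}F_r(P)/F_{r+1}(P)$, a $p$-restricted Lie algebra with bracket induced by commutators and $p$-map by $p$-th powers in $P$; $H$ acts on it and on its restricted universal enveloping algebra $\mathcal U\mathrm{Jen}_*(P)$. Choose a basis $w_1,\dots,w_n$ ($p^n=|P|$) of $\mathrm{Jen}_*(P)$ of homogeneous $H$-eigenvectors, ${}^gw_i=\psi_i(g)w_i$ with $\psi_i\in\mathrm{Hom}(H/Z,k^\times)$. Put $g_{i,\phi}=g_{\psi_i,\phi}$ and $\mathsf w_{i,\phi}=g_{i,\phi}w_ie_\phi$. $\mathfrak A$ is the subalgebra of $(\mathcal U\mathrm{Jen}_*(P)\rtimes H)e$ generated by all the $e_\phi$ and $\mathsf w_{i,\phi}$. *)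

theory Defs
  imports "HOL-Algebra.Algebra" "HOL-Algebra.Algebraic_Closure_Type"
begin

section \<open>Characters and second cohomology with coefficients in the units of a field\<close>

abbreviation units_grp :: "'k::field monoid" where
  "units_grp \<equiv> mult_of ring_of_type_algebra"

definition grp_center :: "('g, 'm) monoid_scheme \<Rightarrow> 'g set" where
  "grp_center G = {z \<in> carrier G. \<forall>g\<in>carrier G. z \<otimes>\<^bsub>G\<^esub> g = g \<otimes>\<^bsub>G\<^esub> z}"

definition grp_commutator :: "('g, 'm) monoid_scheme \<Rightarrow> 'g \<Rightarrow> 'g \<Rightarrow> 'g" where
  "grp_commutator G g h = g \<otimes>\<^bsub>G\<^esub> h \<otimes>\<^bsub>G\<^esub> inv\<^bsub>G\<^esub> g \<otimes>\<^bsub>G\<^esub> inv\<^bsub>G\<^esub> h"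

text \<open>Normalization is not required of cocycles; the action on the coefficients is trivial.
  All functions here and below are extensional, so that sets of characters have the right size.\<close>

definition cocycles2 :: "('g, 'm) monoid_scheme \<Rightarrow> ('g \<times> 'g \<Rightarrow> 'k::field) monoid" where
  "cocycles2 G =
    \<lparr>carrier = {a \<in> carrier G \<times> carrier G \<rightarrow>\<^sub>E UNIV - {0}.
        \<forall>x\<in>carrier G. \<forall>y\<in>carrier G. \<forall>z\<in>carrier G.
          a (x, y) * a (x \<otimes>\<^bsub>G\<^esub> y, z) = a (y, z) * a (x, y \<otimes>\<^bsub>G\<^esub> z)},
     monoid.mult = (\<lambda>a b. \<lambda>u\<in>carrier G \<times> carrier G. a u * b u),
     one = (\<lambda>u\<in>carrier G \<times> carrier G. 1)\<rparr>"

definition coboundaries2 :: "('g, 'm) monoid_scheme \<Rightarrow> ('g \<times> 'g \<Rightarrow> 'k::field) set" where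
  "coboundaries2 G =
    {\<lambda>(x, y)\<in>carrier G \<times> carrier G. f x * f y * inverse (f (x \<otimes>\<^bsub>G\<^esub> y)) |f.
       f \<in> carrier G \<rightarrow> UNIV - {0}}"

definition cohomology2 :: "('g, 'm) monoid_scheme \<Rightarrow> ('g \<times> 'g \<Rightarrow> 'k::field) set monoid" where
  "cohomology2 G = cocycles2 G Mod coboundaries2 G"

text \<open>The group of characters of \<open>G/N\<close>, inflated to \<open>G\<close>.\<close>

definition inflated_chars :: "('g, 'm) monoid_scheme \<Rightarrow> 'g set \<Rightarrow> ('g \<Rightarrow> 'k::field) set" where
  "inflated_chars G N = (\<lambda>f. \<lambda>g\<in>carrier G. f (N #>\<^bsub>G\<^esub> g)) ` hom (G Mod N) units_grp"

definition chars_over ::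
  "('g, 'm) monoid_scheme \<Rightarrow> 'g set \<Rightarrow> ('g \<Rightarrow> 'k::field) \<Rightarrow> ('g \<Rightarrow> 'k) set" where
  "chars_over G Z chi =
    {phi \<in> hom (G\<lparr>carrier := grp_center G\<rparr>) units_grp \<inter> extensional (grp_center G).
       \<forall>z\<in>Z. phi z = chi z}"

definition char_twist ::
  "('g, 'm) monoid_scheme \<Rightarrow> ('g \<Rightarrow> 'k::field) \<Rightarrow> ('g \<Rightarrow> 'k) \<Rightarrow> ('g \<Rightarrow> 'k)" where
  "char_twist G phi psi = (\<lambda>z\<in>grp_center G. phi z * psi z)"

definition comm_char ::
  "('g, 'm) monoid_scheme \<Rightarrow> ('g \<Rightarrow> 'k::field) \<Rightarrow> 'g \<Rightarrow> ('g \<Rightarrow> 'k)" where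
  "comm_char G chi g = (\<lambda>h\<in>carrier G. chi (grp_commutator G h g))"

section \<open>Vector spaces and (not necessarily commutative) algebras over a field\<close>

text \<open>The record \<^type>\<open>module\<close> is used for vector spaces and for algebras over the field
  given by the type \<open>'k\<close>; for a mere vector space \<^const>\<open>monoid.mult\<close> and \<^const>\<open>monoid.one\<close>
  carry no meaning.\<close>

definition alg_hom ::
  "('k, 'a, 'm) module_scheme \<Rightarrow> ('k, 'b, 'n) module_scheme \<Rightarrow> ('a \<Rightarrow> 'b) set" where
  "alg_hom A B = {f \<in> ring_hom A B. \<forall>c. \<forall>x\<in>carrier A. f (c \<odot>\<^bsub>A\<^esub> x) = c \<odot>\<^bsub>B\<^esub> f x}"

definition alg_iso ::
  "('k, 'a, 'm) module_scheme \<Rightarrow> ('k, 'b, 'n) module_scheme \<Rightarrow> ('a \<Rightarrow> 'b) set" where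
  "alg_iso A B = {f \<in> alg_hom A B. bij_betw f (carrier A) (carrier B)}"

inductive_set lin_span :: "('k, 'a, 'm) module_scheme \<Rightarrow> 'a set \<Rightarrow> 'a set"
  for V and S where
    zero: "\<zero>\<^bsub>V\<^esub> \<in> lin_span V S"
  | add: "x \<in> S \<Longrightarrow> y \<in> lin_span V S \<Longrightarrow> (c \<odot>\<^bsub>V\<^esub> x) \<oplus>\<^bsub>V\<^esub> y \<in> lin_span V S"

inductive_set gen_subalg :: "('k, 'a, 'm) module_scheme \<Rightarrow> 'a set \<Rightarrow> 'a set"
  for A and S where
    one: "\<one>\<^bsub>A\<^esub> \<in> gen_subalg A S"
  | gen: "x \<in> S \<Longrightarrow> x \<in> gen_subalg A S"
  | add: "x \<in> gen_subalg A S \<Longrightarrow> y \<in> gen_subalg A S \<Longrightarrow> x \<oplus>\<^bsub>A\<^esub> y \<in> gen_subalg A S"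
  | mult: "x \<in> gen_subalg A S \<Longrightarrow> y \<in> gen_subalg A S \<Longrightarrow> x \<otimes>\<^bsub>A\<^esub> y \<in> gen_subalg A S"
  | smult: "x \<in> gen_subalg A S \<Longrightarrow> c \<odot>\<^bsub>A\<^esub> x \<in> gen_subalg A S"

text \<open>The algebra \<open>A e\<close> with unit \<open>e\<close>, for a central idempotent \<open>e\<close> of \<open>A\<close>.\<close>

definition corner_alg :: "('k, 'a) module \<Rightarrow> 'a \<Rightarrow> ('k, 'a) module" where
  "corner_alg A e = A\<lparr>carrier := (\<lambda>x. x \<otimes>\<^bsub>A\<^esub> e) ` carrier A, one := e\<rparr>"

text \<open>Quotient of a vector space by a subspace, or of an algebra by a two-sided ideal:
  \<^const>\<open>FactRing\<close> together with the induced scalar multiplication.\<close>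

definition quot_alg :: "('k, 'a, 'm) module_scheme \<Rightarrow> 'a set \<Rightarrow> ('k, 'a set) module" where
  "quot_alg A I =
    \<lparr>carrier = carrier (A Quot I), monoid.mult = monoid.mult (A Quot I), one = monoid.one (A Quot I),
     ring.zero = ring.zero (A Quot I), add = ring.add (A Quot I),
     module.smult = (\<lambda>c Y. \<Union>x\<in>Y. I +>\<^bsub>A\<^esub> (c \<odot>\<^bsub>A\<^esub> x))\<rparr>"

text \<open>The vector space with basis \<open>Y\<close>; vectors are finitely supported coefficient functions.\<close>

definition free_vs :: "'x set \<Rightarrow> ('k::field, 'x \<Rightarrow> 'k) module" where
  "free_vs Y =
    \<lparr>carrier = {f. finite {x. f x \<noteq> 0} \<and> {x. f x \<noteq> 0} \<subseteq> Y},
     monoid.mult = undefined, one = undefined,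
     ring.zero = (\<lambda>_. 0), add = (\<lambda>f g x. f x + g x), module.smult = (\<lambda>c f x. c * f x)\<rparr>"

definition basis_elt :: "'x \<Rightarrow> ('x \<Rightarrow> 'k::field)" where
  "basis_elt x = (\<lambda>y. if y = x then 1 else 0)"

definition push_forward :: "('x \<Rightarrow> 'y) \<Rightarrow> ('x \<Rightarrow> 'k::field) \<Rightarrow> ('y \<Rightarrow> 'k)" where
  "push_forward s f = (\<lambda>y. \<Sum>x | f x \<noteq> 0 \<and> s x = y. f x)"

text \<open>The algebra of a monoid; for a group this is the group algebra.\<close>

definition monoid_alg :: "('x, 'm) monoid_scheme \<Rightarrow> ('k::field, 'x \<Rightarrow> 'k) module" where
  "monoid_alg S = (free_vs (carrier S))
    \<lparr>monoid.mult := (\<lambda>f g x. \<Sum>(a, b) | f a \<noteq> 0 \<and> g b \<noteq> 0 \<and> a \<otimes>\<^bsub>S\<^esub> b = x. f a * g b),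
     one := basis_elt \<one>\<^bsub>S\<^esub>\<rparr>"

definition free_alg :: "'x set \<Rightarrow> ('k::field, 'x list \<Rightarrow> 'k) module" where
  "free_alg Y = monoid_alg \<lparr>carrier = lists Y, monoid.mult = (@), one = []\<rparr>"

definition dsum_vs :: "'i set \<Rightarrow> ('i \<Rightarrow> ('k, 'a) module) \<Rightarrow> ('k, 'i \<Rightarrow> 'a) module" where
  "dsum_vs I V =
    \<lparr>carrier = {v \<in> (\<Pi>\<^sub>E i\<in>I. carrier (V i)). finite {i \<in> I. v i \<noteq> \<zero>\<^bsub>V i\<^esub>}},
     monoid.mult = undefined, one = undefined,
     ring.zero = (\<lambda>i\<in>I. \<zero>\<^bsub>V i\<^esub>),
     add = (\<lambda>u v. \<lambda>i\<in>I. u i \<oplus>\<^bsub>V i\<^esub> v i),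
     module.smult = (\<lambda>c v. \<lambda>i\<in>I. c \<odot>\<^bsub>V i\<^esub> v i)\<rparr>"

definition indexed_basis :: "('k::field, 'a, 'm) module_scheme \<Rightarrow> nat \<Rightarrow> (nat \<Rightarrow> 'a) \<Rightarrow> bool" where
  "indexed_basis V n w \<longleftrightarrow>
    w ` {1..n} \<subseteq> carrier V \<and>
    (\<forall>v\<in>carrier V. \<exists>c. v = (\<Oplus>\<^bsub>V\<^esub>i\<in>{1..n}. c i \<odot>\<^bsub>V\<^esub> w i)) \<and>
    (\<forall>c. (\<Oplus>\<^bsub>V\<^esub>i\<in>{1..n}. c i \<odot>\<^bsub>V\<^esub> w i) = \<zero>\<^bsub>V\<^esub> \<longrightarrow> (\<forall>i\<in>{1..n}. c i = 0))"

text \<open>Tensor product of two algebras: the free vector space on the pairs, with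
  \<open>(a, b) (a', b') = (a a', b b')\<close>, modulo the bilinearity relations. The span of these
  relations is a two-sided ideal.\<close>

definition tensor_rels ::
  "('k::field, 'a) module \<Rightarrow> ('k, 'b) module \<Rightarrow> ('a \<times> 'b \<Rightarrow> 'k) set" where
  "tensor_rels A B = (let T = monoid_alg (A \<times>\<times> B) in
     {basis_elt (a \<oplus>\<^bsub>A\<^esub> a', b) \<ominus>\<^bsub>T\<^esub> basis_elt (a, b) \<ominus>\<^bsub>T\<^esub> basis_elt (a', b) |a a' b.
        a \<in> carrier A \<and> a' \<in> carrier A \<and> b \<in> carrier B} \<union>
     {basis_elt (a, b \<oplus>\<^bsub>B\<^esub> b') \<ominus>\<^bsub>T\<^esub> basis_elt (a, b) \<ominus>\<^bsub>T\<^esub> basis_elt (a, b') |a b b'.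
        a \<in> carrier A \<and> b \<in> carrier B \<and> b' \<in> carrier B} \<union>
     {basis_elt (c \<odot>\<^bsub>A\<^esub> a, b) \<ominus>\<^bsub>T\<^esub> c \<odot>\<^bsub>T\<^esub> basis_elt (a, b) |c a b.
        a \<in> carrier A \<and> b \<in> carrier B} \<union>
     {basis_elt (a, c \<odot>\<^bsub>B\<^esub> b) \<ominus>\<^bsub>T\<^esub> c \<odot>\<^bsub>T\<^esub> basis_elt (a, b) |c a b.
        a \<in> carrier A \<and> b \<in> carrier B})"

definition tensor_ideal ::
  "('k::field, 'a) module \<Rightarrow> ('k, 'b) module \<Rightarrow> ('a \<times> 'b \<Rightarrow> 'k) set" where
  "tensor_ideal A B = lin_span (monoid_alg (A \<times>\<times> B)) (tensor_rels A B)"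

definition tensor_alg ::
  "('k::field, 'a) module \<Rightarrow> ('k, 'b) module \<Rightarrow> ('k, ('a \<times> 'b \<Rightarrow> 'k) set) module" where
  "tensor_alg A B = quot_alg (monoid_alg (A \<times>\<times> B)) (tensor_ideal A B)"

definition pure_tensor ::
  "('k::field, 'a) module \<Rightarrow> ('k, 'b) module \<Rightarrow> 'a \<Rightarrow> 'b \<Rightarrow> ('a \<times> 'b \<Rightarrow> 'k) set" where
  "pure_tensor A B a b = tensor_ideal A B +>\<^bsub>monoid_alg (A \<times>\<times> B)\<^esub> basis_elt (a, b)"

section \<open>The Jennings Lie algebra of a group\<close>

text \<open>The Jacobson radical of a noncommutative ring: the intersection of its maximal left
  ideals. The library's \<^const>\<open>maximalideal\<close> is about two-sided ideals.\<close>

definition left_ideal :: "'a set \<Rightarrow> ('a, 'm) ring_scheme \<Rightarrow> bool" where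
  "left_ideal I R \<longleftrightarrow>
    additive_subgroup I R \<and> (\<forall>x\<in>carrier R. \<forall>a\<in>I. x \<otimes>\<^bsub>R\<^esub> a \<in> I)"

definition maximal_left_ideal :: "'a set \<Rightarrow> ('a, 'm) ring_scheme \<Rightarrow> bool" where
  "maximal_left_ideal I R \<longleftrightarrow> left_ideal I R \<and> I \<noteq> carrier R \<and>
    (\<forall>J. left_ideal J R \<and> I \<subseteq> J \<longrightarrow> J = I \<or> J = carrier R)"

definition jacobson_radical :: "('a, 'm) ring_scheme \<Rightarrow> 'a set" where
  "jacobson_radical R = {x \<in> carrier R. \<forall>I. maximal_left_ideal I R \<longrightarrow> x \<in> I}"

primrec ideal_power :: "('a, 'm) ring_scheme \<Rightarrow> 'a set \<Rightarrow> nat \<Rightarrow> 'a set" where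
  "ideal_power R I 0 = carrier R"
| "ideal_power R I (Suc r) = ideal_power R I r \<cdot>\<^bsub>R\<^esub> I"

definition jen_filt :: "'k::field itself \<Rightarrow> ('p, 'm) monoid_scheme \<Rightarrow> nat \<Rightarrow> 'p set" where
  "jen_filt _ P r = (let kP = monoid_alg P :: ('k, 'p \<Rightarrow> 'k) module in
     {g \<in> carrier P. basis_elt g \<ominus>\<^bsub>kP\<^esub> \<one>\<^bsub>kP\<^esub> \<in> ideal_power kP (jacobson_radical kP) r})"

text \<open>Extension of scalars from the prime field, for an elementary abelian \<open>p\<close>-group \<open>V\<close> in
  multiplicative notation and \<open>'k\<close> of characteristic \<open>p\<close>. The class of \<open>basis_elt x\<close> is the
  tensor \<open>1 \<otimes> x\<close>; compatibility with scalars from the prime field follows from additivity.\<close>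

definition scalar_ext_rels :: "('v, 'm) monoid_scheme \<Rightarrow> ('v \<Rightarrow> 'k::field) set" where
  "scalar_ext_rels V = (let F = free_vs (carrier V) in
     lin_span F {basis_elt (x \<otimes>\<^bsub>V\<^esub> y) \<ominus>\<^bsub>F\<^esub> basis_elt x \<ominus>\<^bsub>F\<^esub> basis_elt y |x y.
       x \<in> carrier V \<and> y \<in> carrier V})"

definition scalar_ext :: "('v, 'm) monoid_scheme \<Rightarrow> ('k::field, ('v \<Rightarrow> 'k) set) module" where
  "scalar_ext V = quot_alg (free_vs (carrier V)) (scalar_ext_rels V)"

definition jen_factor :: "'k::field itself \<Rightarrow> 'p monoid \<Rightarrow> nat \<Rightarrow> 'p set monoid" where
  "jen_factor K P r = P\<lparr>carrier := jen_filt K P r\<rparr> Mod jen_filt K P (Suc r)"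

type_synonym ('p, 'k) jen = "nat \<Rightarrow> ('p set \<Rightarrow> 'k) set"

definition jen_vs :: "'p monoid \<Rightarrow> ('k::field, ('p, 'k) jen) module" where
  "jen_vs P = dsum_vs {1..} (\<lambda>r. scalar_ext (jen_factor TYPE('k) P r))"

text \<open>The homogeneous element \<open>1 \<otimes> g F\<^sub>r\<^sub>+\<^sub>1(P)\<close> of degree \<open>r\<close>, for \<open>g\<close> in \<open>F\<^sub>r(P)\<close>.\<close>

definition jen_class :: "'p monoid \<Rightarrow> nat \<Rightarrow> 'p \<Rightarrow> ('p, 'k::field) jen" where
  "jen_class P r g = (\<lambda>s\<in>{1..}.
     if s = r
     then scalar_ext_rels (jen_factor TYPE('k) P r)
       +>\<^bsub>free_vs (carrier (jen_factor TYPE('k) P r))\<^esub> basis_elt (jen_filt TYPE('k) P (Suc r) #>\<^bsub>P\<^esub> g)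
     else \<zero>\<^bsub>scalar_ext (jen_factor TYPE('k) P s)\<^esub>)"

definition jen_homogeneous :: "'p monoid \<Rightarrow> ('p, 'k::field) jen \<Rightarrow> bool" where
  "jen_homogeneous P v \<longleftrightarrow>
    (\<exists>r\<ge>1. \<forall>s\<ge>1. s \<noteq> r \<longrightarrow> v s = \<zero>\<^bsub>scalar_ext (jen_factor TYPE('k) P s)\<^esub>)"

text \<open>The map induced by an automorphism of \<open>P\<close>: it sends \<open>jen_class P r g\<close> to
  \<open>jen_class P r (s g)\<close>. Elements of a quotient are cosets, hence the images.\<close>

definition jen_map :: "('p \<Rightarrow> 'p) \<Rightarrow> ('p, 'k::field) jen \<Rightarrow> ('p, 'k) jen" where
  "jen_map s v = (\<lambda>r\<in>{1..}. push_forward (image s) ` v r)"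

section \<open>Restricted Lie algebras and restricted enveloping algebras\<close>

text \<open>\<open>ad_coeff V brk x y m j\<close> is the coefficient of \<open>t\<^sup>j\<close> in \<open>ad(t x + y)\<^sup>m (x)\<close>. It enters
  Jacobson's formula \<open>(x + y)\<^sup>[\<^sup>p\<^sup>] = x\<^sup>[\<^sup>p\<^sup>] + y\<^sup>[\<^sup>p\<^sup>] + \<Sum> s\<^sub>i(x, y)\<close>, where \<open>i s\<^sub>i(x, y)\<close> is the
  coefficient of \<open>t\<^sup>i\<^sup>-\<^sup>1\<close> in \<open>ad(t x + y)\<^sup>p\<^sup>-\<^sup>1 (x)\<close>.\<close>

primrec ad_coeff ::
  "('k, 'v, 'm) module_scheme \<Rightarrow> ('v \<Rightarrow> 'v \<Rightarrow> 'v) \<Rightarrow> 'v \<Rightarrow> 'v \<Rightarrow> nat \<Rightarrow> nat \<Rightarrow> 'v" where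
  "ad_coeff V brk x y 0 j = (if j = 0 then x else \<zero>\<^bsub>V\<^esub>)"
| "ad_coeff V brk x y (Suc m) j =
    brk y (ad_coeff V brk x y m j) \<oplus>\<^bsub>V\<^esub>
    (if j = 0 then \<zero>\<^bsub>V\<^esub> else brk x (ad_coeff V brk x y m (j - 1)))"

locale restricted_lie_algebra =
  module "ring_of_type_algebra :: 'k::field ring" V for V :: "('k::field, 'v) module" +
  fixes p :: nat and brk :: "'v \<Rightarrow> 'v \<Rightarrow> 'v" and pmap :: "'v \<Rightarrow> 'v"
  assumes prime_p: "Factorial_Ring.prime p" and char_p: "CHAR('k) = p"
    and brk_closed: "\<lbrakk>x \<in> carrier V; y \<in> carrier V\<rbrakk> \<Longrightarrow> brk x y \<in> carrier V"
    and brk_add_left: "\<lbrakk>x \<in> carrier V; x' \<in> carrier V; y \<in> carrier V\<rbrakk> \<Longrightarrow>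
      brk (x \<oplus>\<^bsub>V\<^esub> x') y = brk x y \<oplus>\<^bsub>V\<^esub> brk x' y"
    and brk_add_right: "\<lbrakk>x \<in> carrier V; y \<in> carrier V; y' \<in> carrier V\<rbrakk> \<Longrightarrow>
      brk x (y \<oplus>\<^bsub>V\<^esub> y') = brk x y \<oplus>\<^bsub>V\<^esub> brk x y'"
    and brk_smult_left: "\<lbrakk>x \<in> carrier V; y \<in> carrier V\<rbrakk> \<Longrightarrow>
      brk (c \<odot>\<^bsub>V\<^esub> x) y = c \<odot>\<^bsub>V\<^esub> brk x y"
    and brk_smult_right: "\<lbrakk>x \<in> carrier V; y \<in> carrier V\<rbrakk> \<Longrightarrow>
      brk x (c \<odot>\<^bsub>V\<^esub> y) = c \<odot>\<^bsub>V\<^esub> brk x y"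
    and brk_alt: "x \<in> carrier V \<Longrightarrow> brk x x = \<zero>\<^bsub>V\<^esub>"
    and jacobi: "\<lbrakk>x \<in> carrier V; y \<in> carrier V; z \<in> carrier V\<rbrakk> \<Longrightarrow>
      brk x (brk y z) \<oplus>\<^bsub>V\<^esub> brk y (brk z x) \<oplus>\<^bsub>V\<^esub> brk z (brk x y) = \<zero>\<^bsub>V\<^esub>"
    and pmap_closed: "x \<in> carrier V \<Longrightarrow> pmap x \<in> carrier V"
    and pmap_smult: "x \<in> carrier V \<Longrightarrow> pmap (c \<odot>\<^bsub>V\<^esub> x) = (c ^ p) \<odot>\<^bsub>V\<^esub> pmap x"
    and pmap_ad: "\<lbrakk>x \<in> carrier V; y \<in> carrier V\<rbrakk> \<Longrightarrow> brk (pmap x) y = (brk x ^^ p) y"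
    and pmap_add: "\<lbrakk>x \<in> carrier V; y \<in> carrier V\<rbrakk> \<Longrightarrow>
      pmap (x \<oplus>\<^bsub>V\<^esub> y) = pmap x \<oplus>\<^bsub>V\<^esub> pmap y \<oplus>\<^bsub>V\<^esub>
        (\<Oplus>\<^bsub>V\<^esub>i\<in>{1..<p}. inverse (of_nat i) \<odot>\<^bsub>V\<^esub> ad_coeff V brk x y (p - 1) (i - 1))"

text \<open>The restricted Lie algebra structure on the Jennings space. Since the elements
  \<open>jen_class P r g\<close> span, bracket and \<open>p\<close>-map are determined by these conditions.\<close>

definition jen_restricted_lie ::
  "nat \<Rightarrow> 'p monoid \<Rightarrow> (('p, 'k::field) jen \<Rightarrow> ('p, 'k) jen \<Rightarrow> ('p, 'k) jen) \<Rightarrow>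
    (('p, 'k) jen \<Rightarrow> ('p, 'k) jen) \<Rightarrow> bool" where
  "jen_restricted_lie p P brk pmap \<longleftrightarrow>
    restricted_lie_algebra (jen_vs P) p brk pmap \<and>
    (\<forall>r\<ge>1. \<forall>s\<ge>1. \<forall>g\<in>jen_filt TYPE('k) P r. \<forall>h\<in>jen_filt TYPE('k) P s.
       brk (jen_class P r g) (jen_class P s h) = jen_class P (r + s) (grp_commutator P g h)) \<and>
    (\<forall>r\<ge>1. \<forall>g\<in>jen_filt TYPE('k) P r.
       pmap (jen_class P r g) = jen_class P (p * r) (g [^]\<^bsub>P\<^esub> p))"

text \<open>The free algebra on the set \<open>V\<close> modulo the relations making \<open>V\<close> map linearly, brackets
  to commutators and the \<open>p\<close>-map to \<open>p\<close>-th powers; equivalently, the tensor algebra of \<open>V\<close>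
  modulo the last two families.\<close>

definition uenv_rels ::
  "nat \<Rightarrow> ('k::field, 'v) module \<Rightarrow> ('v \<Rightarrow> 'v \<Rightarrow> 'v) \<Rightarrow> ('v \<Rightarrow> 'v) \<Rightarrow> ('v list \<Rightarrow> 'k) set" where
  "uenv_rels p V brk pmap = (let T = free_alg (carrier V); Y = (\<lambda>v. basis_elt [v]) in
     {Y (v \<oplus>\<^bsub>V\<^esub> w) \<ominus>\<^bsub>T\<^esub> Y v \<ominus>\<^bsub>T\<^esub> Y w |v w. v \<in> carrier V \<and> w \<in> carrier V} \<union>
     {Y (c \<odot>\<^bsub>V\<^esub> v) \<ominus>\<^bsub>T\<^esub> c \<odot>\<^bsub>T\<^esub> Y v |c v. v \<in> carrier V} \<union>
     {(Y v \<otimes>\<^bsub>T\<^esub> Y w) \<ominus>\<^bsub>T\<^esub> (Y w \<otimes>\<^bsub>T\<^esub> Y v) \<ominus>\<^bsub>T\<^esub> Y (brk v w) |v w. v \<in> carrier V \<and> w \<in> carrier V} \<union>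
     {Y v [^]\<^bsub>T\<^esub> p \<ominus>\<^bsub>T\<^esub> Y (pmap v) |v. v \<in> carrier V})"

definition uenv_ideal ::
  "nat \<Rightarrow> ('k::field, 'v) module \<Rightarrow> ('v \<Rightarrow> 'v \<Rightarrow> 'v) \<Rightarrow> ('v \<Rightarrow> 'v) \<Rightarrow> ('v list \<Rightarrow> 'k) set" where
  "uenv_ideal p V brk pmap = Idl\<^bsub>free_alg (carrier V)\<^esub> (uenv_rels p V brk pmap)"

definition uenv ::
  "nat \<Rightarrow> ('k::field, 'v) module \<Rightarrow> ('v \<Rightarrow> 'v \<Rightarrow> 'v) \<Rightarrow> ('v \<Rightarrow> 'v) \<Rightarrow>
    ('k, ('v list \<Rightarrow> 'k) set) module" where
  "uenv p V brk pmap = quot_alg (free_alg (carrier V)) (uenv_ideal p V brk pmap)"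

definition uenv_incl ::
  "nat \<Rightarrow> ('k::field, 'v) module \<Rightarrow> ('v \<Rightarrow> 'v \<Rightarrow> 'v) \<Rightarrow> ('v \<Rightarrow> 'v) \<Rightarrow> 'v \<Rightarrow> ('v list \<Rightarrow> 'k) set" where
  "uenv_incl p V brk pmap v = uenv_ideal p V brk pmap +>\<^bsub>free_alg (carrier V)\<^esub> basis_elt [v]"

text \<open>The map of enveloping algebras induced by an automorphism \<open>s\<close> of the restricted Lie
  algebra: it is multiplicative and sends \<open>uenv_incl \<dots> v\<close> to \<open>uenv_incl \<dots> (s v)\<close>.\<close>

definition uenv_map :: "('v \<Rightarrow> 'v) \<Rightarrow> ('v list \<Rightarrow> 'k::field) set \<Rightarrow> ('v list \<Rightarrow> 'k) set" where
  "uenv_map s Y = push_forward (map s) ` Y"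

section \<open>Skew group algebras and the matrix subalgebra\<close>

text \<open>\<open>U \<rtimes> H\<close> for an action of \<open>H\<close> on \<open>U\<close>, where \<open>H\<close> is finite: the function \<open>a\<close> stands for
  the sum of the \<open>a h \<cdot> h\<close>, and \<open>h u = (act h u) h\<close>.\<close>

definition skew_group_alg ::
  "('k, 'u) module \<Rightarrow> ('h, 'm) monoid_scheme \<Rightarrow> ('h \<Rightarrow> 'u \<Rightarrow> 'u) \<Rightarrow> ('k, 'h \<Rightarrow> 'u) module" where
  "skew_group_alg U H act =
    \<lparr>carrier = carrier H \<rightarrow>\<^sub>E carrier U,
     monoid.mult = (\<lambda>a b. \<lambda>g\<in>carrier H.
       (\<Oplus>\<^bsub>U\<^esub>h\<in>carrier H. a h \<otimes>\<^bsub>U\<^esub> act h (b (inv\<^bsub>H\<^esub> h \<otimes>\<^bsub>H\<^esub> g)))),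
     one = (\<lambda>g\<in>carrier H. if g = \<one>\<^bsub>H\<^esub> then \<one>\<^bsub>U\<^esub> else \<zero>\<^bsub>U\<^esub>),
     ring.zero = (\<lambda>g\<in>carrier H. \<zero>\<^bsub>U\<^esub>),
     add = (\<lambda>a b. \<lambda>g\<in>carrier H. a g \<oplus>\<^bsub>U\<^esub> b g),
     module.smult = (\<lambda>c a. \<lambda>g\<in>carrier H. c \<odot>\<^bsub>U\<^esub> a g)\<rparr>"

definition skew_coeff_incl :: "('k, 'u) module \<Rightarrow> ('h, 'm) monoid_scheme \<Rightarrow> 'u \<Rightarrow> ('h \<Rightarrow> 'u)" where
  "skew_coeff_incl U H u = (\<lambda>g\<in>carrier H. if g = \<one>\<^bsub>H\<^esub> then u else \<zero>\<^bsub>U\<^esub>)"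

definition skew_group_incl ::
  "('k, 'u) module \<Rightarrow> ('h, 'm) monoid_scheme \<Rightarrow> ('h \<Rightarrow> 'k) \<Rightarrow> ('h \<Rightarrow> 'u)" where
  "skew_group_incl U H f = (\<lambda>g\<in>carrier H. f g \<odot>\<^bsub>U\<^esub> \<one>\<^bsub>U\<^esub>)"

text \<open>The element \<open>1/|N| \<Sum>h\<in>N. phi (h\<inverse>) h\<close> of the group algebra.\<close>

definition char_idem ::
  "('h, 'm) monoid_scheme \<Rightarrow> 'h set \<Rightarrow> ('h \<Rightarrow> 'k::field) \<Rightarrow> ('h \<Rightarrow> 'k)" where
  "char_idem H N phi = (\<lambda>h. if h \<in> N then inverse (of_nat (card N)) * phi (inv\<^bsub>H\<^esub> h) else 0)"

text \<open>The linear map \<open>k H e\<^sub>\<phi>\<^sub>0 \<rightarrow> k H e\<close> with \<open>h e\<^sub>\<phi>\<^sub>0 \<mapsto> \<Sum>\<phi>\<in>I. \<xi>\<^sub>\<phi>(h)\<inverse> h e\<^sub>\<phi>\<close>, evaluated on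
  \<open>x = \<Sum>h. x(h) h = \<Sum>h. x(h) h e\<^sub>\<phi>\<^sub>0\<close>. See \<open>matrix_embedding_basis\<close> below.\<close>

definition matrix_embedding ::
  "('h, 'm) monoid_scheme \<Rightarrow> ('h \<Rightarrow> 'k::field) set \<Rightarrow> (('h \<Rightarrow> 'k) \<Rightarrow> 'h \<Rightarrow> 'k) \<Rightarrow>
    ('h \<Rightarrow> 'k) \<Rightarrow> ('h \<Rightarrow> 'k)" where
  "matrix_embedding H I xi x = (let kH = monoid_alg H in
     \<Oplus>\<^bsub>kH\<^esub>h\<in>carrier H. x h \<odot>\<^bsub>kH\<^esub>
       (\<Oplus>\<^bsub>kH\<^esub>phi\<in>I. inverse (xi phi h) \<odot>\<^bsub>kH\<^esub>
         (basis_elt h \<otimes>\<^bsub>kH\<^esub> char_idem H (grp_center H) phi)))"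

lemma abelian_monoid_monoid_alg:
  "abelian_monoid (monoid_alg S :: ('k::field, 'x \<Rightarrow> 'k) module)"
proof (rule abelian_monoidI, goal_cases)
  case (1 x y)
  then have "finite ({a. x a \<noteq> 0} \<union> {a. y a \<noteq> 0})"
    by (auto simp: monoid_alg_def free_vs_def)
  then have "finite {a. x a + y a \<noteq> 0}"
    by (rule rev_finite_subset) auto
  moreover have "{a. x a + y a \<noteq> 0} \<subseteq> {a. x a \<noteq> 0} \<union> {a. y a \<noteq> 0}"
    by auto
  ultimately show ?case
    using 1 by (auto simp: monoid_alg_def free_vs_def)
qed (auto simp: monoid_alg_def free_vs_def algebra_simps)

lemma finsum_monoid_alg_apply:
  fixes F :: "'i \<Rightarrow> 'x \<Rightarrow> 'k::field"
  assumes "finite I" "F \<in> I \<rightarrow> carrier (monoid_alg S)"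
  shows "(\<Oplus>\<^bsub>monoid_alg S\<^esub>i\<in>I. F i) y = (\<Sum>i\<in>I. F i y)"
proof -
  interpret abelian_monoid "monoid_alg S :: ('k, 'x \<Rightarrow> 'k) module"
    by (rule abelian_monoid_monoid_alg)
  show ?thesis
    using assms
  proof (induction I rule: finite_induct)
    case empty
    show ?case by (simp only: finsum_empty) (simp add: monoid_alg_def free_vs_def)
  next
    case (insert i I)
    then have "(\<Oplus>\<^bsub>monoid_alg S\<^esub>j\<in>insert i I. F j) = F i \<oplus>\<^bsub>monoid_alg S\<^esub> (\<Oplus>\<^bsub>monoid_alg S\<^esub>j\<in>I. F j)"
      by (intro finsum_insert) auto
    with insert show ?case by (simp add: monoid_alg_def free_vs_def Pi_def)
  qed
qed

lemma basis_elt_mult_apply: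
  fixes f :: "'g \<Rightarrow> 'k::field"
  assumes "group G" "h \<in> carrier G" "f \<in> carrier (monoid_alg G)"
  shows "(basis_elt h \<otimes>\<^bsub>monoid_alg G\<^esub> f) y =
    (if y \<in> carrier G then f (inv\<^bsub>G\<^esub> h \<otimes>\<^bsub>G\<^esub> y) else 0)"
proof -
  interpret group G by fact
  have f: "a \<in> carrier G" if "f a \<noteq> 0" for a
    using that assms(3) by (auto simp: monoid_alg_def free_vs_def)
  define D where "D = {(a, b). basis_elt h a \<noteq> (0::'k) \<and> f b \<noteq> 0 \<and> a \<otimes>\<^bsub>G\<^esub> b = y}"
  have D: "D = (if y \<in> carrier G \<and> f (inv\<^bsub>G\<^esub> h \<otimes>\<^bsub>G\<^esub> y) \<noteq> 0 then {(h, inv\<^bsub>G\<^esub> h \<otimes>\<^bsub>G\<^esub> y)} else {})"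
    unfolding D_def using f assms(2)
    by (auto simp: basis_elt_def m_assoc[symmetric] split: if_splits)
  have "(basis_elt h \<otimes>\<^bsub>monoid_alg G\<^esub> f) y = (\<Sum>(a, b)\<in>D. basis_elt h a * f b)"
    by (simp add: monoid_alg_def D_def)
  also have "\<dots> = (if y \<in> carrier G then f (inv\<^bsub>G\<^esub> h \<otimes>\<^bsub>G\<^esub> y) else 0)"
    unfolding D by (auto simp: basis_elt_def)
  finally show ?thesis .
qed

lemma matrix_embedding_basis:
  fixes phi0 :: "'h \<Rightarrow> 'k::field"
  assumes H: "group H" "finite (carrier H)" "of_nat (card (grp_center H)) \<noteq> (0::'k)"
    and I: "finite I" "I \<subseteq> chars_over H Z chi" and phi0: "phi0 \<in> chars_over H Z chi"
    and xi: "\<And>phi. phi \<in> I \<Longrightarrow> xi phi \<in> hom H units_grp"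
    and xi_center: "\<And>phi z. phi \<in> I \<Longrightarrow> z \<in> grp_center H \<Longrightarrow>
      xi phi z = phi z * inverse (phi0 z)"
    and h: "h \<in> carrier H"
  shows "matrix_embedding H I xi (basis_elt h \<otimes>\<^bsub>monoid_alg H\<^esub> char_idem H (grp_center H) phi0) =
    (\<Oplus>\<^bsub>monoid_alg H\<^esub>phi\<in>I. inverse (xi phi h) \<odot>\<^bsub>monoid_alg H\<^esub>
      (basis_elt h \<otimes>\<^bsub>monoid_alg H\<^esub> char_idem H (grp_center H) phi))"
proof
  fix y
  interpret group H by fact
  let ?C = "grp_center H" and ?kH = "monoid_alg H :: ('k, 'h \<Rightarrow> 'k) module"
  let ?e = "char_idem H ?C :: ('h \<Rightarrow> 'k) \<Rightarrow> 'h \<Rightarrow> 'k"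
  have C: "?C \<subseteq> carrier H" by (auto simp: grp_center_def)
  have C_mult: "z \<otimes>\<^bsub>H\<^esub> z' \<in> ?C" if "z \<in> ?C" "z' \<in> ?C" for z z'
    using that unfolding grp_center_def by (smt (verit) m_assoc m_closed mem_Collect_eq)
  have C_inv: "inv\<^bsub>H\<^esub> z \<in> ?C" if z: "z \<in> ?C" for z
  proof -
    have "inv\<^bsub>H\<^esub> z \<otimes>\<^bsub>H\<^esub> g = g \<otimes>\<^bsub>H\<^esub> inv\<^bsub>H\<^esub> z" if "g \<in> carrier H" for g
    proof -
      have "inv\<^bsub>H\<^esub> z \<otimes>\<^bsub>H\<^esub> g = inv\<^bsub>H\<^esub> (inv\<^bsub>H\<^esub> g \<otimes>\<^bsub>H\<^esub> z)"
        using z that C by (auto simp: inv_mult_group)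
      also have "inv\<^bsub>H\<^esub> g \<otimes>\<^bsub>H\<^esub> z = z \<otimes>\<^bsub>H\<^esub> inv\<^bsub>H\<^esub> g"
        using z that by (auto simp: grp_center_def)
      finally show ?thesis using z that C by (auto simp: inv_mult_group)
    qed
    with z C show ?thesis by (auto simp: grp_center_def)
  qed
  have char: "phi (z \<otimes>\<^bsub>H\<^esub> z') = phi z * phi z'" "phi z \<noteq> 0"
    if "phi \<in> chars_over H Z chi" "z \<in> ?C" "z' \<in> ?C" for phi z z'
    using that by (auto simp: chars_over_def hom_def ring_of_type_algebra_def Pi_def)
  have xih: "xi phi (g \<otimes>\<^bsub>H\<^esub> g') = xi phi g * xi phi g'" "xi phi g \<noteq> 0"
    if "phi \<in> I" "g \<in> carrier H" "g' \<in> carrier H" for phi g g'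
    using xi that by (auto simp: hom_def ring_of_type_algebra_def Pi_def)
  have e_in: "?e phi \<in> carrier ?kH" for phi
    using H(2) C by (auto simp: monoid_alg_def free_vs_def char_idem_def intro: rev_finite_subset)
  have carr: "f \<in> carrier ?kH \<longleftrightarrow> (\<forall>x. x \<notin> carrier H \<longrightarrow> f x = 0)" for f
    using H(2) by (auto simp: monoid_alg_def free_vs_def intro: rev_finite_subset)
  have be: "(basis_elt g \<otimes>\<^bsub>?kH\<^esub> ?e phi) x = (if x \<in> carrier H then ?e phi (inv\<^bsub>H\<^esub> g \<otimes>\<^bsub>H\<^esub> x) else 0)"
    if "g \<in> carrier H" for g phi x
    using basis_elt_mult_apply[OF H(1) that e_in] .
  define M where "M g = (\<Oplus>\<^bsub>?kH\<^esub>phi\<in>I. inverse (xi phi g) \<odot>\<^bsub>?kH\<^esub> (basis_elt g \<otimes>\<^bsub>?kH\<^esub> ?e phi))" for g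
  have M: "M g x = (if x \<in> carrier H then \<Sum>phi\<in>I. inverse (xi phi g) * ?e phi (inv\<^bsub>H\<^esub> g \<otimes>\<^bsub>H\<^esub> x) else 0)"
    if "g \<in> carrier H" for g x
  proof -
    have "(\<lambda>phi. inverse (xi phi g) \<odot>\<^bsub>?kH\<^esub> (basis_elt g \<otimes>\<^bsub>?kH\<^esub> ?e phi)) \<in> I \<rightarrow> carrier ?kH"
      using be[OF that] by (auto simp: carr) (simp add: monoid_alg_def free_vs_def)
    from finsum_monoid_alg_apply[OF I(1) this] show ?thesis
      unfolding M_def using be[OF that] by (simp add: monoid_alg_def free_vs_def)
  qed
  let ?x = "basis_elt h \<otimes>\<^bsub>?kH\<^esub> ?e phi0"
  have "matrix_embedding H I xi ?x y = (\<Oplus>\<^bsub>?kH\<^esub>g\<in>carrier H. ?x g \<odot>\<^bsub>?kH\<^esub> M g) y"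
    by (simp only: matrix_embedding_def M_def Let_def)
  also have "\<dots> = (\<Sum>g\<in>carrier H. ?x g * M g y)"
  proof -
    have "(\<lambda>g. ?x g \<odot>\<^bsub>?kH\<^esub> M g) \<in> carrier H \<rightarrow> carrier ?kH"
      using M by (auto simp: carr) (simp add: monoid_alg_def free_vs_def)
    from finsum_monoid_alg_apply[OF H(2) this] show ?thesis
      by (simp add: monoid_alg_def free_vs_def)
  qed
  also have "\<dots> = (\<Sum>g\<in>carrier H. ?e phi0 (inv\<^bsub>H\<^esub> h \<otimes>\<^bsub>H\<^esub> g) * M g y)"
    using be[OF h] by (intro sum.cong) auto
  also have "\<dots> = (\<Sum>z\<in>carrier H. ?e phi0 z * M (h \<otimes>\<^bsub>H\<^esub> z) y)"
    by (rule sum.reindex_bij_witness[of _ "\<lambda>z. h \<otimes>\<^bsub>H\<^esub> z" "\<lambda>g. inv\<^bsub>H\<^esub> h \<otimes>\<^bsub>H\<^esub> g"])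
      (use h in \<open>auto simp: m_assoc[symmetric]\<close>)
  also have "\<dots> = (\<Sum>z\<in>?C. ?e phi0 z * M (h \<otimes>\<^bsub>H\<^esub> z) y)"
    using H(2) C by (intro sum.mono_neutral_right) (auto simp: char_idem_def)
  also have "\<dots> = (\<Sum>z\<in>?C. inverse (of_nat (card ?C)) * M h y)"
  proof (rule sum.cong)
    fix z assume z: "z \<in> ?C"
    show "?e phi0 z * M (h \<otimes>\<^bsub>H\<^esub> z) y = inverse (of_nat (card ?C)) * M h y"
    proof (cases "y \<in> carrier H")
      case y: True
      have zc: "z \<in> carrier H" using z C by auto
      define t where "t = inv\<^bsub>H\<^esub> h \<otimes>\<^bsub>H\<^esub> y"
      have t: "t \<in> carrier H" using h y by (simp add: t_def)
      have eq: "inv\<^bsub>H\<^esub> (h \<otimes>\<^bsub>H\<^esub> z) \<otimes>\<^bsub>H\<^esub> y = inv\<^bsub>H\<^esub> z \<otimes>\<^bsub>H\<^esub> t"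
        using h zc y by (simp add: inv_mult_group m_assoc t_def)
      have tz: "inv\<^bsub>H\<^esub> z \<otimes>\<^bsub>H\<^esub> t \<in> ?C \<longleftrightarrow> t \<in> ?C"
      proof
        assume "inv\<^bsub>H\<^esub> z \<otimes>\<^bsub>H\<^esub> t \<in> ?C"
        from C_mult[OF z this] show "t \<in> ?C" using zc t by (simp add: m_assoc[symmetric])
      qed (use z C_mult C_inv in auto)
      have "phi0 (inv\<^bsub>H\<^esub> z) * (inverse (xi phi (h \<otimes>\<^bsub>H\<^esub> z)) * ?e phi (inv\<^bsub>H\<^esub> z \<otimes>\<^bsub>H\<^esub> t)) =
            inverse (xi phi h) * ?e phi t" if phi: "phi \<in> I" for phi
      proof (cases "t \<in> ?C")
        case False
        then show ?thesis using tz by (simp add: char_idem_def)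
      next
        case True
        have p: "phi \<in> chars_over H Z chi" using phi I by auto
        have one: "\<phi> (inv\<^bsub>H\<^esub> z) = inverse (\<phi> z)" if "\<phi> \<in> chars_over H Z chi" for \<phi>
        proof -
          have zz: "inv\<^bsub>H\<^esub> z \<otimes>\<^bsub>H\<^esub> z \<otimes>\<^bsub>H\<^esub> z = z" using zc by simp
          have "\<phi> (inv\<^bsub>H\<^esub> z) * \<phi> z * \<phi> z = \<phi> z"
            using char(1)[OF that] z C_inv C_mult zz by metis
          then show ?thesis using char(2)[OF that z z] by (simp add: field_simps)
        qed
        have "inv\<^bsub>H\<^esub> (inv\<^bsub>H\<^esub> z \<otimes>\<^bsub>H\<^esub> t) = inv\<^bsub>H\<^esub> t \<otimes>\<^bsub>H\<^esub> z"
          using zc t by (simp add: inv_mult_group)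
        then have a: "phi (inv\<^bsub>H\<^esub> (inv\<^bsub>H\<^esub> z \<otimes>\<^bsub>H\<^esub> t)) = phi (inv\<^bsub>H\<^esub> t) * phi z"
          using char(1)[OF p C_inv[OF True] z] by simp
        have b: "xi phi (h \<otimes>\<^bsub>H\<^esub> z) = xi phi h * (phi z * inverse (phi0 z))"
          using xih(1)[OF phi h zc] xi_center[OF phi z] by simp
        have nz: "phi z \<noteq> 0" "phi0 z \<noteq> 0"
          using char(2)[OF p z z] char(2)[OF phi0 z z] by auto
        have "phi0 (inv\<^bsub>H\<^esub> z) * (inverse (xi phi (h \<otimes>\<^bsub>H\<^esub> z)) * ?e phi (inv\<^bsub>H\<^esub> z \<otimes>\<^bsub>H\<^esub> t)) =
          inverse (phi0 z) * (inverse (xi phi h * (phi z * inverse (phi0 z))) *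
            (inverse (of_nat (card ?C)) * (phi (inv\<^bsub>H\<^esub> t) * phi z)))"
          using True tz by (simp add: char_idem_def a b one[OF phi0])
        also have "\<dots> = inverse (xi phi h) * ?e phi t"
          using True nz by (simp add: char_idem_def) (simp add: field_simps)
        finally show ?thesis .
      qed
      then have "phi0 (inv\<^bsub>H\<^esub> z) * M (h \<otimes>\<^bsub>H\<^esub> z) y = M h y"
        using M[of "h \<otimes>\<^bsub>H\<^esub> z"] M[OF h] h zc y eq
        by (simp add: sum_distrib_left t_def[symmetric])
      then show ?thesis using z by (simp add: char_idem_def mult.assoc)
    qed (use M h z C in auto)
  qed simp
  also have "\<dots> = M h y" using H(3) by simp
  finally show "matrix_embedding H I xi ?x y =
      (\<Oplus>\<^bsub>?kH\<^esub>phi\<in>I. inverse (xi phi h) \<odot>\<^bsub>?kH\<^esub> (basis_elt h \<otimes>\<^bsub>?kH\<^esub> ?e phi)) y"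
    by (simp add: M_def)
qed

end

(*
Let C be the center of H and let m_h in kHe be the image of h e_(phi_0), so that m_h e_phi is
xi_phi(h)^(-1) h e_phi. These elements satisfy m_g m_h = m_(gh) and m_z = phi_0(z) e for z in C,
hence M is spanned by the m_t for t in a transversal T of C in H, and m_g m_t m_g^(-1) = chi([g,t]) m_t.
The choice of g_(psi,phi) makes all generators of A commute with all m_h.

A relation sum_t a_t m_t = 0 with a_t in A is conjugated by all m_g. Since chi is faithful, the
characters g -> chi([g,t]) of H are distinct for distinct t in T, so averaging against their inverses
isolates a single term, whence a_t = 0; neither matrix units nor a basis of the restricted
enveloping algebra are needed. Conversely A M is a subalgebra containing all h e and w_i e,
because e is the sum of the e_phi, and so it is the whole algebra.

That e is the sum of the e_phi needs characters of C/Z separating points; these come from extending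
characters of subgroups one element at a time. That H acts on the restricted enveloping algebra
needs the Jennings filtration to be stable under automorphisms of P, and Jacobson's formula
to pass from the p-th powers of the homogeneous generators to the p-map.
*)
theory Submission
  imports Defs
begin

section \<open>Algebras over a field\<close>

text \<open>Why the generators commute with all \<open>m h\<close>: left multiplication by w_i moves
  the block of e_phi to that of e_(phi psi_i). Hence \<open>m h\<close> contributes xi_(phi
  psi_i)(h)^-1 on one side of g w_i e_phi and xi_phi(h)^-1 on the other, and passing h across w_i
  contributes psi_i(h). The total discrepancy is a character of H that is trivial on C, so it has
  the form chi([h,g]), and passing h across g cancels it.

  Injectivity does not come from counting dimensions but from a normal form: modulo the bilinearity
  relations every tensor is a sum of pure tensors of some a_t with m_t, t in T, and independence of
  the m_t over A then kills the kernel. Of the restricted enveloping algebra this argument sees only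
  that it is generated by H-eigenvectors, so it is carried out in a locale about an arbitrary
  algebra generated by an image of H and by eigenvectors.

  That |H| is prime to p enters through division: by |H| in the averaging, by |C| and |Z| in the
  idempotents, and in the existence of nontrivial roots of unity of orders dividing |C|.\<close>

locale vec_space = abelian_group V for V :: "('k::field, 'v, 'm) module_scheme" (structure) +
  assumes smult_closed [simp, intro]: "x \<in> carrier V \<Longrightarrow> c \<odot> x \<in> carrier V"
    and smult_add_left: "x \<in> carrier V \<Longrightarrow> (c + d) \<odot> x = c \<odot> x \<oplus> d \<odot> x"
    and smult_add_right: "\<lbrakk>x \<in> carrier V; y \<in> carrier V\<rbrakk> \<Longrightarrow> c \<odot> (x \<oplus> y) = c \<odot> x \<oplus> c \<odot> y"
    and smult_smult: "x \<in> carrier V \<Longrightarrow> c \<odot> (d \<odot> x) = (c * d) \<odot> x"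
    and smult_one [simp]: "x \<in> carrier V \<Longrightarrow> 1 \<odot> x = x"

locale field_algebra = vec_space A + ring A for A :: "('k::field, 'a, 'm) module_scheme" (structure) +
  assumes smult_mult_left: "\<lbrakk>x \<in> carrier A; y \<in> carrier A\<rbrakk> \<Longrightarrow> (c \<odot> x) \<otimes> y = c \<odot> (x \<otimes> y)"
    and smult_mult_right: "\<lbrakk>x \<in> carrier A; y \<in> carrier A\<rbrakk> \<Longrightarrow> x \<otimes> (c \<odot> y) = c \<odot> (x \<otimes> y)"

lemma vec_space_of_module:
  assumes "module (ring_of_type_algebra :: 'k::field ring) V"
  shows "vec_space V"
proof -
  interpret module "ring_of_type_algebra :: 'k ring" V by fact
  show ?thesis
    by (unfold_locales; use smult_l_distr smult_r_distr smult_assoc1 smult_one in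
      \<open>simp add: ring_of_type_algebra_def\<close>)
qed

context vec_space
begin

lemma smult_zero_left [simp]:
  assumes "x \<in> carrier V" shows "0 \<odot> x = \<zero>"
proof -
  have "0 \<odot> x \<oplus> 0 \<odot> x = 0 \<odot> x" using smult_add_left[OF assms, of 0 0] by simp
  then show ?thesis using assms by (simp add: add.r_cancel_one')
qed

lemma smult_zero_right [simp]: "c \<odot> \<zero> = \<zero>"
proof -
  have "c \<odot> \<zero> = c \<odot> (0 \<odot> \<zero>)" by simp
  also have "\<dots> = \<zero>" by (simp only: smult_smult zero_closed) simp
  finally show ?thesis .
qed

lemma a_inv_eq_smult:
  assumes "x \<in> carrier V" shows "\<ominus> x = (- 1) \<odot> x"
proof -
  have "(- 1) \<odot> x \<oplus> x = (- 1 + 1) \<odot> x"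
    using smult_add_left[OF assms, of "-1" 1] assms by simp
  then show ?thesis using assms by (simp add: minus_equality)
qed

lemma smult_cancel:
  assumes "c \<odot> x = \<zero>" "c \<noteq> 0" "x \<in> carrier V" shows "x = \<zero>"
proof -
  have "x = inverse c \<odot> (c \<odot> x)" using assms(2,3) by (simp add: smult_smult)
  then show ?thesis using assms(1) by simp
qed

lemma finsum_smult_right:
  assumes "f \<in> I \<rightarrow> carrier V"
  shows "c \<odot> (\<Oplus>i\<in>I. f i) = (\<Oplus>i\<in>I. c \<odot> f i)"
  using assms
proof (induction I rule: infinite_finite_induct)
  case (insert i I)
  then have "f i \<in> carrier V" "(\<lambda>i. c \<odot> f i) \<in> I \<rightarrow> carrier V" "f \<in> I \<rightarrow> carrier V" by auto
  with insert show ?case by (simp add: smult_add_right)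
qed auto

lemma finsum_smult_left:
  assumes "x \<in> carrier V" "finite I"
  shows "(\<Oplus>i\<in>I. f i \<odot> x) = (\<Sum>i\<in>I. f i) \<odot> x"
  using assms(2)
proof (induction I rule: finite_induct)
  case (insert i I)
  then have "(\<lambda>i. f i \<odot> x) \<in> I \<rightarrow> carrier V" using assms by auto
  with insert assms show ?case by (simp add: smult_add_left)
qed (simp add: assms)

end

lemma (in abelian_monoid) finsum_swap:
  assumes "\<And>i j. i \<in> I \<Longrightarrow> j \<in> J \<Longrightarrow> f i j \<in> carrier G" "finite I" "finite J"
  shows "(\<Oplus>i\<in>I. \<Oplus>j\<in>J. f i j) = (\<Oplus>j\<in>J. \<Oplus>i\<in>I. f i j)"
  using assms(2,1)
proof (induction I rule: finite_induct)
  case (insert i I)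
  then have 1: "(\<lambda>j. f i j) \<in> J \<rightarrow> carrier G" "(\<lambda>j. \<Oplus>i\<in>I. f i j) \<in> J \<rightarrow> carrier G"
    "(\<lambda>i. \<Oplus>j\<in>J. f i j) \<in> I \<rightarrow> carrier G" by (auto intro!: finsum_closed)
  have "(\<Oplus>i\<in>insert i I. \<Oplus>j\<in>J. f i j) = (\<Oplus>j\<in>J. f i j) \<oplus> (\<Oplus>j\<in>J. \<Oplus>i\<in>I. f i j)"
    using insert 1 by (simp add: finsum_closed)
  also have "\<dots> = (\<Oplus>j\<in>J. f i j \<oplus> (\<Oplus>i\<in>I. f i j))"
    using 1 by (simp add: finsum_addf)
  also have "\<dots> = (\<Oplus>j\<in>J. \<Oplus>i\<in>insert i I. f i j)"
  proof (rule finsum_cong')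
    fix j assume j: "j \<in> J"
    then have "(\<lambda>i. f i j) \<in> I \<rightarrow> carrier G" "f i j \<in> carrier G" using insert by auto
    then show "f i j \<oplus> (\<Oplus>i\<in>I. f i j) = (\<Oplus>i\<in>insert i I. f i j)" using insert by simp
  qed (use insert in \<open>auto intro!: finsum_closed\<close>)
  finally show ?case .
qed simp

lemma (in abelian_monoid) finsum_mono_neutral:
  assumes "finite J" "I \<subseteq> J" "f \<in> J \<rightarrow> carrier G" "\<And>i. i \<in> J - I \<Longrightarrow> f i = \<zero>"
  shows "(\<Oplus>i\<in>I. f i) = (\<Oplus>i\<in>J. f i)"
  by (rule add.finprod_mono_neutral_cong_left) (use assms in auto)

text \<open>The index set is arbitrary: over an infinite one both sums are zero by convention, and
  an additive map preserves zero.\<close>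

lemma finsum_hom:
  assumes "abelian_group A" "abelian_group B"
    and "\<And>x y. x \<in> carrier A \<Longrightarrow> y \<in> carrier A \<Longrightarrow> h (x \<oplus>\<^bsub>A\<^esub> y) = h x \<oplus>\<^bsub>B\<^esub> h y"
    and "\<And>x. x \<in> carrier A \<Longrightarrow> h x \<in> carrier B"
    and "f \<in> I \<rightarrow> carrier A"
  shows "h (\<Oplus>\<^bsub>A\<^esub>i\<in>I. f i) = (\<Oplus>\<^bsub>B\<^esub>i\<in>I. h (f i))"
proof -
  interpret A: abelian_group A by fact
  interpret B: abelian_group B by fact
  have "h \<zero>\<^bsub>A\<^esub> \<oplus>\<^bsub>B\<^esub> h \<zero>\<^bsub>A\<^esub> = h \<zero>\<^bsub>A\<^esub>" using assms(3)[of "\<zero>\<^bsub>A\<^esub>" "\<zero>\<^bsub>A\<^esub>"] by simp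
  then have h0: "h \<zero>\<^bsub>A\<^esub> = \<zero>\<^bsub>B\<^esub>" using assms(4)[of "\<zero>\<^bsub>A\<^esub>"] by (simp add: B.add.r_cancel_one')
  show ?thesis
    using assms(5)
  proof (induction I rule: infinite_finite_induct)
    case (insert i I)
    then have "f \<in> I \<rightarrow> carrier A" "f i \<in> carrier A" "(\<lambda>i. h (f i)) \<in> I \<rightarrow> carrier B"
      using assms(4) by auto
    with insert assms(3,4) show ?case by (simp add: A.finsum_closed)
  qed (simp_all add: h0)
qed

context field_algebra
begin

text \<open>Zero and negatives arise from the scalars 0 and -1, so they do not appear among the
  closure conditions.\<close>

lemma subalgebra:
  assumes "S \<subseteq> carrier A" "\<one> \<in> S" "\<And>x y. x \<in> S \<Longrightarrow> y \<in> S \<Longrightarrow> x \<oplus> y \<in> S"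
    and "\<And>x y. x \<in> S \<Longrightarrow> y \<in> S \<Longrightarrow> x \<otimes> y \<in> S" "\<And>c x. x \<in> S \<Longrightarrow> c \<odot> x \<in> S"
  shows "field_algebra (A\<lparr>carrier := S\<rparr>)"
proof -
  have S: "x \<in> carrier A" if "x \<in> S" for x using that assms(1) by auto
  have z: "\<zero> \<in> S" using assms(5)[OF assms(2), of 0] by simp
  have ab: "abelian_group (A\<lparr>carrier := S\<rparr>)"
  proof (rule abelian_groupI; simp)
    show "\<exists>y\<in>S. y \<oplus> x = \<zero>" if "x \<in> S" for x
      using assms(5)[OF that, of "-1"] S[OF that] a_inv_eq_smult[of x] l_neg[of x] by auto
  qed (use S z assms in \<open>auto simp: a_ac\<close>)
  have rg: "ring (A\<lparr>carrier := S\<rparr>)"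
  proof (rule ringI[OF ab])
    show "Group.monoid (A\<lparr>carrier := S\<rparr>)"
      by (rule monoidI) (use S assms in \<open>auto simp: m_assoc\<close>)
  qed (use S in \<open>auto simp: l_distr r_distr\<close>)
  show ?thesis
    by (intro field_algebra.intro vec_space.intro ab rg; unfold_locales)
      (use S assms in \<open>auto simp: smult_add_left smult_add_right smult_smult smult_mult_left smult_mult_right\<close>)
qed

lemma gen_subalg_carrier:
  assumes "S \<subseteq> carrier A" shows "gen_subalg A S \<subseteq> carrier A"
proof
  fix x assume "x \<in> gen_subalg A S"
  then show "x \<in> carrier A" by induction (use assms in auto)
qed

text \<open>The elements of the corner are the fixed points of right multiplication by
  \<open>e\<close>, a condition that is visibly stable under all operations; centrality makes
  \<open>e\<close> a unit on the left as well.\<close>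

lemma corner_algebra:
  assumes e: "e \<in> carrier A" "e \<otimes> e = e" "\<And>x. x \<in> carrier A \<Longrightarrow> e \<otimes> x = x \<otimes> e"
    and B: "B = A\<lparr>carrier := (\<lambda>x. x \<otimes> e) ` carrier A, one := e\<rparr>"
  shows "field_algebra B"
proof -
  define S where "S = (\<lambda>x. x \<otimes> e) ` carrier A"
  have "x \<in> carrier A \<and> x \<otimes> e = x" if "x \<in> S" for x
    using that e(1,2) by (auto simp: S_def m_assoc)
  then have S: "x \<in> S \<longleftrightarrow> x \<in> carrier A \<and> x \<otimes> e = x" for x
    unfolding S_def by (metis image_eqI)
  have B': "B = A\<lparr>carrier := S, one := e\<rparr>" using B by (simp add: S_def)
  have cl: "x \<oplus> y \<in> S" "x \<otimes> y \<in> S" "c \<odot> x \<in> S" if "x \<in> S" "y \<in> S" for x y c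
    using that e(1) unfolding S by (auto simp: l_distr m_assoc smult_mult_left)
  have z: "\<zero> \<in> S" "e \<in> S" using e(1,2) unfolding S by auto
  have eS: "e \<otimes> x = x" if "x \<in> S" for x using that e(3)[of x] by (simp add: S)
  have ab: "abelian_group B"
  proof (rule abelian_groupI; simp add: B')
    show "\<exists>y\<in>S. y \<oplus> x = \<zero>" if "x \<in> S" for x
    proof (rule bexI)
      have "x \<in> carrier A" using that by (simp only: S)
      then show "\<ominus> x \<oplus> x = \<zero>" "\<ominus> x \<in> S"
        using cl(3)[OF that that, of "-1"] by (simp_all only: l_neg a_inv_eq_smult[symmetric])
    qed
  qed (use S z cl in \<open>auto simp: a_ac\<close>)
  have rg: "ring B"
  proof (rule ringI[OF ab])
    show "Group.monoid B"
      by (rule monoidI; simp add: B') (use S cl z eS in \<open>auto simp: m_assoc\<close>)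
  qed (use S in \<open>auto simp: B' l_distr r_distr\<close>)
  show ?thesis
    by (intro field_algebra.intro vec_space.intro ab rg; unfold_locales; simp only: B'; simp)
      (use S cl in \<open>auto simp: smult_add_left smult_add_right smult_smult smult_mult_left smult_mult_right\<close>)
qed

end

section \<open>Monoid algebras and linear extension\<close>

lemma monoid_alg_carrier:
  "f \<in> carrier (monoid_alg S) \<longleftrightarrow> finite {x. f x \<noteq> 0} \<and> {x. f x \<noteq> 0} \<subseteq> carrier S"
  by (simp add: monoid_alg_def free_vs_def)

lemma monoid_alg_simps [simp]:
  "\<zero>\<^bsub>monoid_alg S\<^esub> = (\<lambda>_. 0)" "f \<oplus>\<^bsub>monoid_alg S\<^esub> g = (\<lambda>x. f x + g x)"
  "c \<odot>\<^bsub>monoid_alg S\<^esub> f = (\<lambda>x. c * f x)" "\<one>\<^bsub>monoid_alg S\<^esub> = basis_elt \<one>\<^bsub>S\<^esub>"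
  by (simp_all add: monoid_alg_def free_vs_def)

lemma basis_elt_carrier [simp]: "x \<in> carrier S \<Longrightarrow> basis_elt x \<in> carrier (monoid_alg S)"
  by (auto simp: monoid_alg_carrier basis_elt_def intro: rev_finite_subset[of "{x}"])

text \<open>The defining sum runs over an index set that depends on both factors. Over fixed finite
  supersets of the supports, products with different factors become sums over the same indices and
  can be compared term by term.\<close>

lemma monoid_alg_mult_apply:
  assumes "finite E" "finite F" "{x. f x \<noteq> 0} \<subseteq> E" "{x. g x \<noteq> 0} \<subseteq> F"
  shows "(f \<otimes>\<^bsub>monoid_alg S\<^esub> g) z = (\<Sum>x\<in>E. \<Sum>y\<in>F. if x \<otimes>\<^bsub>S\<^esub> y = z then f x * g y else 0)"
proof -
  have "(f \<otimes>\<^bsub>monoid_alg S\<^esub> g) z =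
    (\<Sum>(x, y)\<in>{(x, y). f x \<noteq> 0 \<and> g y \<noteq> 0 \<and> x \<otimes>\<^bsub>S\<^esub> y = z}. f x * g y)"
    by (simp add: monoid_alg_def)
  also have "\<dots> = (\<Sum>(x, y)\<in>E \<times> F. if x \<otimes>\<^bsub>S\<^esub> y = z then f x * g y else 0)"
    by (rule sum.mono_neutral_cong_left) (use assms in \<open>auto split: if_splits\<close>)
  finally show ?thesis using assms(1,2) by (simp add: sum.cartesian_product)
qed

lemma monoid_alg_supp_add:
  assumes "f \<in> carrier (monoid_alg S)" "g \<in> carrier (monoid_alg S)"
  shows "f \<oplus>\<^bsub>monoid_alg S\<^esub> g \<in> carrier (monoid_alg S)"
proof -
  have "{x. f x + g x \<noteq> 0} \<subseteq> {x. f x \<noteq> 0} \<union> {x. g x \<noteq> 0}" by auto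
  then show ?thesis
    using assms unfolding monoid_alg_carrier monoid_alg_simps
    by (blast intro: rev_finite_subset)
qed

lemma monoid_alg_supp_smult:
  assumes "f \<in> carrier (monoid_alg S)"
  shows "c \<odot>\<^bsub>monoid_alg S\<^esub> f \<in> carrier (monoid_alg S)"
  using assms unfolding monoid_alg_carrier
  by (auto intro: rev_finite_subset[of "{x. f x \<noteq> 0}"])

lemma monoid_alg_supp_zero: "(\<lambda>_. 0) \<in> carrier (monoid_alg S)"
  by (simp add: monoid_alg_carrier)

text \<open>Induction on a finite set containing the support, splitting off one coefficient at a
  time. It reduces identities between multilinear expressions to basis elements.\<close>

lemma monoid_alg_induct [consumes 1, case_names zero add]:
  assumes "f \<in> carrier (monoid_alg S)" "P (\<lambda>_. 0)"
    and "\<And>f c x. f \<in> carrier (monoid_alg S) \<Longrightarrow> P f \<Longrightarrow> x \<in> carrier S \<Longrightarrow>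
      P (c \<odot>\<^bsub>monoid_alg S\<^esub> basis_elt x \<oplus>\<^bsub>monoid_alg S\<^esub> f)"
  shows "P f"
proof -
  have "finite F \<Longrightarrow> F \<subseteq> carrier S \<Longrightarrow> {x. f x \<noteq> 0} \<subseteq> F \<Longrightarrow> P f" for F f
  proof (induction F arbitrary: f rule: finite_induct)
    case empty
    then have "f = (\<lambda>_. 0)" by auto
    then show ?case using assms(2) by simp
  next
    case (insert x F)
    define g where "g = f(x := 0)"
    have g: "{x. g x \<noteq> 0} \<subseteq> F" using insert.prems by (auto simp: g_def)
    have "P g" using insert g by auto
    moreover have "g \<in> carrier (monoid_alg S)"
      using g insert by (auto simp: monoid_alg_carrier intro: rev_finite_subset)
    moreover have "f = f x \<odot>\<^bsub>monoid_alg S\<^esub> basis_elt x \<oplus>\<^bsub>monoid_alg S\<^esub> g"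
      by (auto simp: g_def basis_elt_def)
    ultimately show ?case using assms(3)[of g x "f x"] insert.prems by auto
  qed
  from this[of "{x. f x \<noteq> 0}"] show ?thesis using assms(1) by (auto simp: monoid_alg_carrier)
qed

lemma monoid_alg_bilinear:
  assumes "f \<in> carrier (monoid_alg S)" "g \<in> carrier (monoid_alg S)" "h \<in> carrier (monoid_alg S)"
  shows "(f \<oplus>\<^bsub>monoid_alg S\<^esub> g) \<otimes>\<^bsub>monoid_alg S\<^esub> h =
      f \<otimes>\<^bsub>monoid_alg S\<^esub> h \<oplus>\<^bsub>monoid_alg S\<^esub> g \<otimes>\<^bsub>monoid_alg S\<^esub> h" (is ?A)
    and "h \<otimes>\<^bsub>monoid_alg S\<^esub> (f \<oplus>\<^bsub>monoid_alg S\<^esub> g) =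
      h \<otimes>\<^bsub>monoid_alg S\<^esub> f \<oplus>\<^bsub>monoid_alg S\<^esub> h \<otimes>\<^bsub>monoid_alg S\<^esub> g" (is ?B)
    and "(c \<odot>\<^bsub>monoid_alg S\<^esub> f) \<otimes>\<^bsub>monoid_alg S\<^esub> h =
      c \<odot>\<^bsub>monoid_alg S\<^esub> (f \<otimes>\<^bsub>monoid_alg S\<^esub> h)" (is ?C)
    and "h \<otimes>\<^bsub>monoid_alg S\<^esub> (c \<odot>\<^bsub>monoid_alg S\<^esub> f) =
      c \<odot>\<^bsub>monoid_alg S\<^esub> (h \<otimes>\<^bsub>monoid_alg S\<^esub> f)" (is ?D)
proof -
  let ?X = "{x. f x \<noteq> 0} \<union> {x. g x \<noteq> 0} \<union> {x. h x \<noteq> 0}"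
  have fin: "finite ?X" using assms by (auto simp: monoid_alg_carrier)
  note * = monoid_alg_mult_apply[OF fin fin, of _ _ S]
  have sub: "{x. f x \<noteq> 0} \<subseteq> ?X" "{x. g x \<noteq> 0} \<subseteq> ?X" "{x. h x \<noteq> 0} \<subseteq> ?X"
    "{x. f x + g x \<noteq> 0} \<subseteq> ?X" "{x. c * f x \<noteq> 0} \<subseteq> ?X" by auto
  show ?A ?B ?C ?D
    unfolding monoid_alg_simps
    by (auto simp: fun_eq_iff *[OF sub(1) sub(3)] *[OF sub(2) sub(3)] *[OF sub(3) sub(1)]
        *[OF sub(3) sub(2)] *[OF sub(3) sub(4)] *[OF sub(4) sub(3)] *[OF sub(3) sub(5)]
        *[OF sub(5) sub(3)] sum.distrib[symmetric] sum_distrib_left algebra_simps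
        intro!: sum.cong)
qed

lemma basis_elt_mult:
  "basis_elt x \<otimes>\<^bsub>monoid_alg S\<^esub> basis_elt y = (basis_elt (x \<otimes>\<^bsub>S\<^esub> y) :: 'x \<Rightarrow> 'k::field)"
proof
  fix z
  have "(basis_elt x \<otimes>\<^bsub>monoid_alg S\<^esub> basis_elt y) z =
      (\<Sum>a\<in>{x}. \<Sum>b\<in>{y}. if a \<otimes>\<^bsub>S\<^esub> b = z then basis_elt x a * basis_elt y b else (0::'k))"
    by (rule monoid_alg_mult_apply) (auto simp: basis_elt_def)
  then show "(basis_elt x \<otimes>\<^bsub>monoid_alg S\<^esub> basis_elt y) z = (basis_elt (x \<otimes>\<^bsub>S\<^esub> y) :: 'x \<Rightarrow> 'k) z"
    by (auto simp: basis_elt_def)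
qed

lemma monoid_alg_mult_zero:
  "(\<lambda>_. 0) \<otimes>\<^bsub>monoid_alg S\<^esub> f = (\<lambda>_. 0)" "f \<otimes>\<^bsub>monoid_alg S\<^esub> (\<lambda>_. 0) = (\<lambda>_. 0)"
  by (auto simp: monoid_alg_def)

lemma monoid_alg_vec_space: "vec_space (monoid_alg S :: ('k::field, 'x \<Rightarrow> 'k) module)"
proof (intro vec_space.intro vec_space_axioms.intro)
  show "abelian_group (monoid_alg S :: ('k, 'x \<Rightarrow> 'k) module)"
  proof (rule abelian_groupI)
    show "\<exists>y\<in>carrier (monoid_alg S). y \<oplus>\<^bsub>monoid_alg S\<^esub> x = \<zero>\<^bsub>monoid_alg S\<^esub>"
      if "x \<in> carrier (monoid_alg S)" for x :: "'x \<Rightarrow> 'k"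
      using monoid_alg_supp_smult[OF that, of "-1"] by (intro bexI) auto
  qed (auto simp: monoid_alg_supp_add[unfolded monoid_alg_simps] monoid_alg_supp_zero algebra_simps)
qed (auto simp: monoid_alg_supp_smult[unfolded monoid_alg_simps] algebra_simps)

text \<open>Both sides of associativity are trilinear, so it is checked on basis elements, where it
  is associativity in \<open>S\<close>; the arguments are freed one after the other, starting with
  the last.\<close>

lemma monoid_alg_field_algebra:
  assumes "Group.monoid S"
  shows "field_algebra (monoid_alg S :: ('k::field, 'x \<Rightarrow> 'k) module)"
proof -
  interpret S: Group.monoid S by fact
  let ?A = "monoid_alg S :: ('k, 'x \<Rightarrow> 'k) module"
  interpret vec_space ?A by (rule monoid_alg_vec_space)
  note [simp del] = monoid_alg_simps
  note zero = monoid_alg_simps(1)[of S, symmetric]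
  have zero_mult [simp]: "\<zero>\<^bsub>?A\<^esub> \<otimes>\<^bsub>?A\<^esub> f = \<zero>\<^bsub>?A\<^esub>" "f \<otimes>\<^bsub>?A\<^esub> \<zero>\<^bsub>?A\<^esub> = \<zero>\<^bsub>?A\<^esub>" for f
    by (simp_all add: monoid_alg_mult_zero monoid_alg_simps)
  have closed_basis: "basis_elt x \<otimes>\<^bsub>?A\<^esub> g \<in> carrier ?A" if "x \<in> carrier S" "g \<in> carrier ?A" for x g
    using that(2,1) by (induction rule: monoid_alg_induct)
      (auto simp: zero monoid_alg_bilinear basis_elt_mult)
  have closed: "f \<otimes>\<^bsub>?A\<^esub> g \<in> carrier ?A" if "f \<in> carrier ?A" "g \<in> carrier ?A" for f g
    using that by (induction rule: monoid_alg_induct) (auto simp: zero monoid_alg_bilinear closed_basis)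
  have assoc: "(f \<otimes>\<^bsub>?A\<^esub> g) \<otimes>\<^bsub>?A\<^esub> h = f \<otimes>\<^bsub>?A\<^esub> (g \<otimes>\<^bsub>?A\<^esub> h)"
    if f: "f \<in> carrier ?A" and g: "g \<in> carrier ?A" and h: "h \<in> carrier ?A" for f g h
  proof -
    have 1: "(basis_elt x \<otimes>\<^bsub>?A\<^esub> basis_elt y) \<otimes>\<^bsub>?A\<^esub> h = basis_elt x \<otimes>\<^bsub>?A\<^esub> (basis_elt y \<otimes>\<^bsub>?A\<^esub> h)"
      if "x \<in> carrier S" "y \<in> carrier S" for x y
      using h that by (induction rule: monoid_alg_induct)
        (auto simp: zero monoid_alg_bilinear basis_elt_mult S.m_assoc closed)
    have 2: "(basis_elt x \<otimes>\<^bsub>?A\<^esub> g) \<otimes>\<^bsub>?A\<^esub> h = basis_elt x \<otimes>\<^bsub>?A\<^esub> (g \<otimes>\<^bsub>?A\<^esub> h)"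
      if "x \<in> carrier S" for x
      using g that by (induction rule: monoid_alg_induct)
        (auto simp: zero monoid_alg_bilinear 1 closed h)
    show ?thesis
      using f by (induction rule: monoid_alg_induct)
        (auto simp: zero monoid_alg_bilinear 2 closed g h)
  qed
  have one: "basis_elt \<one>\<^bsub>S\<^esub> \<otimes>\<^bsub>?A\<^esub> f = f" "f \<otimes>\<^bsub>?A\<^esub> basis_elt \<one>\<^bsub>S\<^esub> = f" if "f \<in> carrier ?A" for f
    using that by (induction rule: monoid_alg_induct)
      (auto simp: zero monoid_alg_bilinear basis_elt_mult)
  have "ring ?A"
  proof (rule ringI[OF abelian_group_axioms])
    show "Group.monoid ?A"
      by (rule monoidI) (auto simp: closed assoc one monoid_alg_simps(4))
  qed (auto simp: monoid_alg_bilinear)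
  then show ?thesis
    by (intro field_algebra.intro vec_space_axioms field_algebra_axioms.intro)
      (auto simp: monoid_alg_bilinear)
qed

definition lin_ext :: "('k::field, 'b, 'm) module_scheme \<Rightarrow> ('x \<Rightarrow> 'b) \<Rightarrow> ('x \<Rightarrow> 'k) \<Rightarrow> 'b" where
  "lin_ext B h f = (\<Oplus>\<^bsub>B\<^esub>x\<in>{x. f x \<noteq> 0}. f x \<odot>\<^bsub>B\<^esub> h x)"

context vec_space
begin

lemma lin_ext_superset:
  assumes "finite E" "{x. f x \<noteq> 0} \<subseteq> E" "h \<in> E \<rightarrow> carrier V"
  shows "lin_ext V h f = (\<Oplus>x\<in>E. f x \<odot> h x)"
  unfolding lin_ext_def by (rule finsum_mono_neutral) (use assms in \<open>auto simp: Pi_iff\<close>)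

context
  fixes S :: "('x, 's) monoid_scheme" and h :: "'x \<Rightarrow> 'v"
  assumes h: "h \<in> carrier S \<rightarrow> carrier V"
begin

lemma lin_ext_closed [simp]: "f \<in> carrier (monoid_alg S) \<Longrightarrow> lin_ext V h f \<in> carrier V"
  unfolding lin_ext_def using h by (intro finsum_closed) (auto simp: monoid_alg_carrier)

lemma lin_ext_add:
  assumes "f \<in> carrier (monoid_alg S)" "g \<in> carrier (monoid_alg S)"
  shows "lin_ext V h (f \<oplus>\<^bsub>monoid_alg S\<^esub> g) = lin_ext V h f \<oplus> lin_ext V h g"
proof -
  \<comment> \<open>Cancellation can make the support of the sum smaller than this union, so all
    three sums are first extended to it.\<close>
  let ?X = "{x. f x \<noteq> 0} \<union> {x. g x \<noteq> 0}"
  have E: "finite ?X" "h \<in> ?X \<rightarrow> carrier V" using assms h by (auto simp: monoid_alg_carrier)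
  have "lin_ext V h (f \<oplus>\<^bsub>monoid_alg S\<^esub> g) = (\<Oplus>x\<in>?X. f x \<odot> h x \<oplus> g x \<odot> h x)"
    using E by (subst lin_ext_superset[of ?X]) (auto simp: smult_add_left Pi_iff simp del: finsum_addf intro!: finsum_cong')
  also have "\<dots> = (\<Oplus>x\<in>?X. f x \<odot> h x) \<oplus> (\<Oplus>x\<in>?X. g x \<odot> h x)"
    using E by (intro finsum_addf) auto
  also have "\<dots> = lin_ext V h f \<oplus> lin_ext V h g"
    using E by (intro arg_cong2[of _ _ _ _ "(\<oplus>)"] lin_ext_superset[symmetric]) auto
  finally show ?thesis .
qed

lemma lin_ext_smult:
  assumes "f \<in> carrier (monoid_alg S)"
  shows "lin_ext V h (c \<odot>\<^bsub>monoid_alg S\<^esub> f) = c \<odot> lin_ext V h f"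
proof -
  let ?X = "{x. f x \<noteq> 0}"
  have E: "finite ?X" "h \<in> ?X \<rightarrow> carrier V" using assms h by (auto simp: monoid_alg_carrier)
  have "lin_ext V h (c \<odot>\<^bsub>monoid_alg S\<^esub> f) = (\<Oplus>x\<in>?X. c \<odot> (f x \<odot> h x))"
    using E by (subst lin_ext_superset[of ?X]) (auto simp: smult_smult Pi_iff intro!: finsum_cong')
  also have "\<dots> = c \<odot> lin_ext V h f"
    unfolding lin_ext_def using E by (intro finsum_smult_right[symmetric]) auto
  finally show ?thesis .
qed

lemma lin_ext_basis: "x \<in> carrier S \<Longrightarrow> lin_ext V h (basis_elt x) = h x"
  using h by (subst lin_ext_superset[of "{x}"]) (auto simp: basis_elt_def Pi_iff)

end

end

text \<open>The universal property of the monoid algebra. It later yields the multiplication map on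
  tensors, the inclusion of the group algebra in the skew group algebra, and the maps induced by
  automorphisms.\<close>

lemma (in field_algebra) lin_ext_alg_hom:
  fixes S :: "('x, 's) monoid_scheme"
  assumes S: "Group.monoid S" and h: "h \<in> carrier S \<rightarrow> carrier A" "h \<one>\<^bsub>S\<^esub> = \<one>"
    and mult: "\<And>x y. x \<in> carrier S \<Longrightarrow> y \<in> carrier S \<Longrightarrow> h (x \<otimes>\<^bsub>S\<^esub> y) = h x \<otimes> h y"
  shows "lin_ext A h \<in> alg_hom (monoid_alg S) A"
proof -
  let ?M = "monoid_alg S :: ('k, 'x \<Rightarrow> 'k) module"
  interpret S: Group.monoid S by fact
  interpret M: field_algebra ?M by (rule monoid_alg_field_algebra[OF S])
  note [simp del] = monoid_alg_simps
  note zero = monoid_alg_simps(1)[of S, symmetric]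
  have z: "lin_ext A h \<zero>\<^bsub>?M\<^esub> = \<zero>" by (simp add: monoid_alg_simps lin_ext_def)
  note lin = lin_ext_add[OF h(1)] lin_ext_smult[OF h(1)] lin_ext_basis[OF h(1)] lin_ext_closed[OF h(1)]
  have hc: "x \<in> carrier S \<Longrightarrow> h x \<in> carrier A" for x using h by auto
  note ring_simps = M.l_distr M.r_distr l_distr r_distr M.smult_mult_left M.smult_mult_right
    smult_mult_left smult_mult_right
  have 1: "lin_ext A h (basis_elt x \<otimes>\<^bsub>?M\<^esub> g) = h x \<otimes> lin_ext A h g"
    if "x \<in> carrier S" "g \<in> carrier ?M" for x g
    using that(2,1) by (induction rule: monoid_alg_induct)
      (auto simp: zero z ring_simps basis_elt_mult lin hc mult)
  have 2: "lin_ext A h (f \<otimes>\<^bsub>?M\<^esub> g) = lin_ext A h f \<otimes> lin_ext A h g"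
    if f: "f \<in> carrier ?M" and g: "g \<in> carrier ?M" for f g
    using f by (induction rule: monoid_alg_induct)
      (auto simp: zero z ring_simps 1 g lin hc)
  show ?thesis
    by (auto simp: alg_hom_def lin 2 h intro!: ring_hom_memI) (simp add: monoid_alg_simps lin h)
qed

text \<open>Recognizing \<open>push_forward\<close> as a linear extension makes its linearity and
  multiplicativity instances of the general facts. Of the monoid \<open>S\<close> only the carrier
  matters here.\<close>

lemma push_forward_eq_lin_ext:
  assumes "finite {x. f x \<noteq> 0}" "\<And>x. f x \<noteq> 0 \<Longrightarrow> s x \<in> carrier S"
  shows "push_forward s f = lin_ext (monoid_alg S) (\<lambda>x. basis_elt (s x)) f"
proof
  fix y
  have "(\<lambda>x. f x \<odot>\<^bsub>monoid_alg S\<^esub> basis_elt (s x)) \<in> {x. f x \<noteq> 0} \<rightarrow> carrier (monoid_alg S)"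
    using assms(2) by (intro Pi_I monoid_alg_supp_smult) auto
  then have "lin_ext (monoid_alg S) (\<lambda>x. basis_elt (s x)) f y =
      (\<Sum>x\<in>{x. f x \<noteq> 0}. (f x \<odot>\<^bsub>monoid_alg S\<^esub> basis_elt (s x)) y)"
    unfolding lin_ext_def by (intro finsum_monoid_alg_apply assms(1))
  also have "\<dots> = push_forward s f y"
    unfolding push_forward_def using assms(1)
    by (intro sum.mono_neutral_cong_right) (auto simp: basis_elt_def)
  finally show "push_forward s f y = lin_ext (monoid_alg S) (\<lambda>x. basis_elt (s x)) f y" by simp
qed

text \<open>\<open>quot_alg A I\<close> and \<open>A Quot I\<close> are records of different types
  that agree in their ring fields; this carries the ring axioms over.\<close>

lemma ring_cong:
  assumes "ring R" "carrier S = carrier R" "monoid.mult S = monoid.mult R" "one S = one R"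
    "ring.zero S = ring.zero R" "add S = add R"
  shows "ring S"
proof -
  interpret R: ring R by fact
  show ?thesis
  proof (rule ringI)
    show "abelian_group S"
      by (rule abelian_groupI) (use R.a_inv_closed R.l_neg in \<open>auto simp: assms(2-) R.a_ac\<close>)
    show "Group.monoid S" by (rule monoidI) (auto simp: assms(2-) R.m_assoc)
  qed (auto simp: assms(2-) R.l_distr R.r_distr)
qed

section \<open>Quotients by two-sided ideals\<close>

context field_algebra
begin

text \<open>Multiplication by the scalar \<open>c\<close> is multiplication by the ring element
  \<open>c \<odot> \<one>\<close>, so a ring ideal is automatically a subspace.\<close>

lemma ideal_smult:
  assumes "ideal I A" "x \<in> I" shows "c \<odot> x \<in> I"
proof -
  interpret ideal I A by fact
  have x: "x \<in> carrier A" using assms(2) by (rule a_Hcarr)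
  have "(c \<odot> \<one>) \<otimes> x \<in> I" using assms(2) by (intro I_l_closed) auto
  then show ?thesis using x by (simp add: smult_mult_left)
qed

text \<open>The union in \<open>quot_alg\<close> runs over all representatives of a coset. They all
  give the same coset because the ideal is a subspace, so the union collapses.\<close>

lemma quot_alg_smult:
  assumes "ideal I A" "x \<in> carrier A"
  shows "c \<odot>\<^bsub>quot_alg A I\<^esub> (I +> x) = I +> (c \<odot> x)"
proof -
  interpret ideal I A by fact
  have "I +> (c \<odot> y) = I +> (c \<odot> x)" if "y \<in> I +> x" for y
  proof -
    from that obtain i where i: "i \<in> I" "y = i \<oplus> x" by (auto simp: a_r_coset_def')
    have "c \<odot> y = c \<odot> i \<oplus> c \<odot> x" using i assms a_Hcarr by (auto simp: smult_add_right)
    then have "c \<odot> y \<in> I +> (c \<odot> x)"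
      using ideal_smult[OF assms(1) i(1)] by (auto simp: a_r_coset_def')
    then show ?thesis
      using assms(2) by (intro a_repr_independence[symmetric]) (auto simp: a_subgroup)
  qed
  then have "(\<Union>y\<in>I +> x. I +> (c \<odot> y)) = (\<Union>y\<in>I +> x. I +> (c \<odot> x))" by simp
  also have "\<dots> = I +> (c \<odot> x)" using a_rcos_self[OF assms(2)] by auto
  finally show ?thesis by (simp add: quot_alg_def)
qed

lemma quot_alg_field_algebra:
  assumes "ideal I A" shows "field_algebra (quot_alg A I)"
proof -
  interpret ideal I A by fact
  interpret Q: ring "quot_alg A I"
    by (rule ring_cong[OF quotient_is_ring]) (simp_all add: quot_alg_def)
  have eq: "carrier (quot_alg A I) = (\<lambda>x. I +> x) ` carrier A"
    by (auto simp: quot_alg_def FactRing_simps)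
  have ops: "(I +> x) \<oplus>\<^bsub>quot_alg A I\<^esub> (I +> y) = I +> (x \<oplus> y)"
    "(I +> x) \<otimes>\<^bsub>quot_alg A I\<^esub> (I +> y) = I +> (x \<otimes> y)"
    if "x \<in> carrier A" "y \<in> carrier A" for x y
    using that by (simp_all add: quot_alg_def FactRing_def rcoset_mult_add a_rcos_sum)
  show ?thesis
    by (intro field_algebra.intro vec_space.intro vec_space_axioms.intro field_algebra_axioms.intro
        Q.ring_axioms Q.abelian_group_axioms; (unfold eq)?)
      (auto simp: ops quot_alg_smult[OF assms] smult_add_left smult_add_right smult_smult
        smult_mult_left smult_mult_right)
qed

lemma quot_alg_proj:
  assumes "ideal I A" shows "(\<lambda>x. I +> x) \<in> alg_hom A (quot_alg A I)"
proof -
  interpret ideal I A by fact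
  show ?thesis using rcos_ring_hom quot_alg_smult[OF assms]
    by (auto simp: alg_hom_def ring_hom_def quot_alg_def)
qed

end

section \<open>Tensor products of algebras\<close>

context vec_space
begin

text \<open>\<open>lin_span\<close> only adds a multiple of one generator at a time, so closure
  under arbitrary sums and scalars is itself an induction.\<close>

lemma lin_span_props:
  assumes "S \<subseteq> carrier V"
  shows lin_span_carrier: "x \<in> lin_span V S \<Longrightarrow> x \<in> carrier V"
    and lin_span_add: "x \<in> lin_span V S \<Longrightarrow> y \<in> lin_span V S \<Longrightarrow> x \<oplus> y \<in> lin_span V S"
    and lin_span_smult: "x \<in> lin_span V S \<Longrightarrow> c \<odot> x \<in> lin_span V S"
    and lin_span_base: "x \<in> S \<Longrightarrow> x \<in> lin_span V S"
proof -
  show carr: "x \<in> carrier V" if "x \<in> lin_span V S" for x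
    using that by induction (use assms in auto)
  have S: "x \<in> S \<Longrightarrow> x \<in> carrier V" for x using assms by auto
  show "x \<oplus> y \<in> lin_span V S" if "x \<in> lin_span V S" "y \<in> lin_span V S"
    using that by induction (auto simp: a_assoc S carr intro: lin_span.intros)
  show "c \<odot> x \<in> lin_span V S" if "x \<in> lin_span V S"
    using that by induction (auto simp: smult_add_right smult_smult S carr intro: lin_span.intros)
  show "x \<in> lin_span V S" if "x \<in> S"
    using lin_span.add[OF that lin_span.zero, where V = V and c = 1] that by (simp add: S)
qed

end

lemma quot_alg_carrier: "carrier (quot_alg A I) = (\<lambda>x. I +>\<^bsub>A\<^esub> x) ` carrier A"
  by (auto simp: quot_alg_def FactRing_simps)

lemma monoid_alg_minus:
  assumes "g \<in> carrier (monoid_alg S)"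
  shows "f \<ominus>\<^bsub>monoid_alg S\<^esub> g = (\<lambda>x. f x - g x :: 'k::field)"
proof -
  interpret vec_space "monoid_alg S :: ('k, 'a \<Rightarrow> 'k) module" by (rule monoid_alg_vec_space)
  show ?thesis using a_inv_eq_smult[OF assms] by (simp add: a_minus_def)
qed

text \<open>A criterion for multiplication to be an isomorphism. Multiplication defines an algebra
  map \<open>F\<close> from the algebra on pairs to \<open>B\<close> that kills the bilinearity
  relations. Conversely, modulo these relations every element is a sum of pairs
  \<open>(a t, m t)\<close> with \<open>t\<close> in \<open>T\<close>; its image is the sum of the
  \<open>a t \<otimes> m t\<close>, and if that vanishes then so do all \<open>a t\<close> by
  \<open>indep\<close>. So the kernel is exactly the span of the relations, and \<open>gen\<close>
  gives surjectivity.\<close>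

theorem tensor_alg_iso:
  fixes B :: "('k::field, 'b) module" and m :: "'t \<Rightarrow> 'b"
  assumes "field_algebra B" and AA: "field_algebra (B\<lparr>carrier := AA\<rparr>)" "AA \<subseteq> carrier B"
    and MM: "field_algebra (B\<lparr>carrier := MM\<rparr>)" "MM \<subseteq> carrier B"
    and comm: "\<And>x y. x \<in> AA \<Longrightarrow> y \<in> MM \<Longrightarrow> y \<otimes>\<^bsub>B\<^esub> x = x \<otimes>\<^bsub>B\<^esub> y"
    and T: "finite T" and m: "m \<in> T \<rightarrow> MM"
    and span: "\<And>y. y \<in> MM \<Longrightarrow> \<exists>c. y = (\<Oplus>\<^bsub>B\<^esub>t\<in>T. c t \<odot>\<^bsub>B\<^esub> m t)"
    and indep: "\<And>a t. a \<in> T \<rightarrow> AA \<Longrightarrow> (\<Oplus>\<^bsub>B\<^esub>t\<in>T. a t \<otimes>\<^bsub>B\<^esub> m t) = \<zero>\<^bsub>B\<^esub> \<Longrightarrow> t \<in> T \<Longrightarrow> a t = \<zero>\<^bsub>B\<^esub>"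
    and gen: "\<And>b. b \<in> carrier B \<Longrightarrow> \<exists>a\<in>T \<rightarrow> AA. b = (\<Oplus>\<^bsub>B\<^esub>t\<in>T. a t \<otimes>\<^bsub>B\<^esub> m t)"
  shows "\<exists>f\<in>alg_iso (tensor_alg (B\<lparr>carrier := AA\<rparr>) (B\<lparr>carrier := MM\<rparr>)) B.
    \<forall>x\<in>AA. \<forall>y\<in>MM. f (pure_tensor (B\<lparr>carrier := AA\<rparr>) (B\<lparr>carrier := MM\<rparr>) x y) = x \<otimes>\<^bsub>B\<^esub> y"
proof -
  interpret B: field_algebra B by fact
  let ?A = "B\<lparr>carrier := AA\<rparr>" and ?M = "B\<lparr>carrier := MM\<rparr>"
  interpret A: field_algebra ?A by fact
  interpret M: field_algebra ?M by fact
  let ?S = "?A \<times>\<times> ?M"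
  let ?D = "monoid_alg ?S :: ('k, 'b \<times> 'b \<Rightarrow> 'k) module"
  have S: "Group.monoid ?S" by (intro DirProd_monoid A.is_monoid M.is_monoid)
  interpret D: field_algebra ?D by (rule monoid_alg_field_algebra[OF S])
  have S_simps: "carrier ?S = AA \<times> MM" by simp
  have cA: "x \<oplus>\<^bsub>B\<^esub> y \<in> AA" "x \<otimes>\<^bsub>B\<^esub> y \<in> AA" "c \<odot>\<^bsub>B\<^esub> x \<in> AA" "\<zero>\<^bsub>B\<^esub> \<in> AA" "\<one>\<^bsub>B\<^esub> \<in> AA" "x \<in> carrier B"
    if "x \<in> AA" "y \<in> AA" for x y c
    using that AA(2) A.a_closed A.m_closed A.smult_closed A.zero_closed A.one_closed by auto
  have cM: "x \<oplus>\<^bsub>B\<^esub> y \<in> MM" "x \<otimes>\<^bsub>B\<^esub> y \<in> MM" "c \<odot>\<^bsub>B\<^esub> x \<in> MM" "\<zero>\<^bsub>B\<^esub> \<in> MM" "\<one>\<^bsub>B\<^esub> \<in> MM" "x \<in> carrier B"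
    if "x \<in> MM" "y \<in> MM" for x y c
    using that MM(2) M.a_closed M.m_closed M.smult_closed M.zero_closed M.one_closed by auto
  have cA1: "c \<odot>\<^bsub>B\<^esub> x \<in> AA" if "x \<in> AA" for x c using that cA(3) by blast
  have cM1: "c \<odot>\<^bsub>B\<^esub> x \<in> MM" if "x \<in> MM" for x c using that cM(3) by blast
  have cA0: "\<zero>\<^bsub>B\<^esub> \<in> AA" "\<one>\<^bsub>B\<^esub> \<in> AA" using A.zero_closed A.one_closed by auto
  have cM0: "\<zero>\<^bsub>B\<^esub> \<in> MM" "\<one>\<^bsub>B\<^esub> \<in> MM" using M.zero_closed M.one_closed by auto
  have bD: "basis_elt (x, y) \<in> carrier ?D" if "x \<in> AA" "y \<in> MM" for x y
    using that by (intro basis_elt_carrier) simp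
  have minus: "basis_elt (x, y) \<ominus>\<^bsub>?D\<^esub> basis_elt (x', y') \<ominus>\<^bsub>?D\<^esub> basis_elt (x'', y'') =
      (\<lambda>z. basis_elt (x, y) z - (basis_elt (x', y') z + basis_elt (x'', y'') z))"
    "basis_elt (x, y) \<ominus>\<^bsub>?D\<^esub> c \<odot>\<^bsub>?D\<^esub> basis_elt (x', y') =
      (\<lambda>z. basis_elt (x, y) z - c * basis_elt (x', y') z)"
    if "x' \<in> AA" "y' \<in> MM" "x'' \<in> AA" "y'' \<in> MM" for x x' x'' y y' y'' c
    using that D.smult_closed[OF bD, of x' y' c] by (simp_all add: monoid_alg_minus bD diff_diff_eq)
  let ?R = "tensor_rels ?A ?M" and ?J = "tensor_ideal ?A ?M"
  have R: "?R \<subseteq> carrier ?D"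
    unfolding tensor_rels_def Let_def
    by (auto simp: bD cA cM simp del: monoid_alg_simps intro!: D.minus_closed D.smult_closed)
  note J = D.lin_span_props[OF R, folded tensor_ideal_def]
  \<comment> \<open>Congruence modulo the span of the relations. At this stage the span is only
    known to be a subspace, so the reduction to normal form is done with differences of functions
    rather than in the quotient ring.\<close>
  define cong where "cong f g \<longleftrightarrow> (\<lambda>z. f z - g z) \<in> ?J" for f g :: "'b \<times> 'b \<Rightarrow> 'k"
  have J0: "(\<lambda>_. 0) \<in> ?J"
    using lin_span.zero[of ?D ?R] by (simp add: tensor_ideal_def)
  have cong_refl: "cong f f" for f using J0 by (simp add: cong_def)
  have cong_add: "cong (\<lambda>z. f z + f' z) (\<lambda>z. g z + g' z)" if "cong f g" "cong f' g'" for f f' g g'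
    using J(2)[OF that[unfolded cong_def]] by (simp add: cong_def algebra_simps)
  have cong_smult: "cong (\<lambda>z. c * f z) (\<lambda>z. c * g z)" if "cong f g" for f g c
    using J(3)[OF that[unfolded cong_def], of c] by (simp add: cong_def algebra_simps)
  have cong_trans [trans]: "cong f h" if "cong f g" "cong g h" for f g h
    using J(2)[OF that[unfolded cong_def]] by (simp add: cong_def algebra_simps)
  have cong_sum: "cong (\<lambda>z. \<Sum>i\<in>I. f i z) (\<lambda>z. \<Sum>i\<in>I. g i z)"
    if "\<And>i. i \<in> I \<Longrightarrow> cong (f i) (g i)" "finite I" for I :: "'t set" and f g
    using that(2,1) by (induction I rule: finite_induct) (auto intro: cong_refl cong_add)
  have cong_sym: "cong g f" if "cong f g" for f g
    using J(3)[OF that[unfolded cong_def], of "-1"] by (simp add: cong_def)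
  have rels: "cong (basis_elt (x \<oplus>\<^bsub>B\<^esub> x', y)) (\<lambda>z. basis_elt (x, y) z + basis_elt (x', y) z)"
    "cong (basis_elt (x, y \<oplus>\<^bsub>B\<^esub> y')) (\<lambda>z. basis_elt (x, y) z + basis_elt (x, y') z)"
    "cong (basis_elt (c \<odot>\<^bsub>B\<^esub> x, y)) (\<lambda>z. c * basis_elt (x, y) z)"
    "cong (basis_elt (x, c \<odot>\<^bsub>B\<^esub> y)) (\<lambda>z. c * basis_elt (x, y) z)"
    if "x \<in> AA" "x' \<in> AA" "y \<in> MM" "y' \<in> MM" for x x' y y' c
  proof -
    note [simp del] = monoid_alg_simps
    have "basis_elt (x \<oplus>\<^bsub>B\<^esub> x', y) \<ominus>\<^bsub>?D\<^esub> basis_elt (x, y) \<ominus>\<^bsub>?D\<^esub> basis_elt (x', y) \<in> ?R"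
      unfolding tensor_rels_def Let_def by (rule UnI1, rule UnI1, rule UnI1) (use that in auto)
    from J(4)[OF this] show "cong (basis_elt (x \<oplus>\<^bsub>B\<^esub> x', y)) (\<lambda>z. basis_elt (x, y) z + basis_elt (x', y) z)"
      using that by (simp add: minus cong_def)
    have "basis_elt (x, y \<oplus>\<^bsub>B\<^esub> y') \<ominus>\<^bsub>?D\<^esub> basis_elt (x, y) \<ominus>\<^bsub>?D\<^esub> basis_elt (x, y') \<in> ?R"
      unfolding tensor_rels_def Let_def by (rule UnI1, rule UnI1, rule UnI2) (use that in auto)
    from J(4)[OF this] show "cong (basis_elt (x, y \<oplus>\<^bsub>B\<^esub> y')) (\<lambda>z. basis_elt (x, y) z + basis_elt (x, y') z)"
      using that by (simp add: minus cong_def)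
    have "basis_elt (c \<odot>\<^bsub>B\<^esub> x, y) \<ominus>\<^bsub>?D\<^esub> c \<odot>\<^bsub>?D\<^esub> basis_elt (x, y) \<in> ?R"
      unfolding tensor_rels_def Let_def by (rule UnI1, rule UnI2) (use that in auto)
    from J(4)[OF this] show "cong (basis_elt (c \<odot>\<^bsub>B\<^esub> x, y)) (\<lambda>z. c * basis_elt (x, y) z)"
      using that by (simp add: minus cong_def)
    have "basis_elt (x, c \<odot>\<^bsub>B\<^esub> y) \<ominus>\<^bsub>?D\<^esub> c \<odot>\<^bsub>?D\<^esub> basis_elt (x, y) \<in> ?R"
      unfolding tensor_rels_def Let_def by (rule UnI2) (use that in auto)
    from J(4)[OF this] show "cong (basis_elt (x, c \<odot>\<^bsub>B\<^esub> y)) (\<lambda>z. c * basis_elt (x, y) z)"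
      using that by (simp add: minus cong_def)
  qed
  \<comment> \<open>The two scalar relations with scalar 0.\<close>
  have rel0: "cong (basis_elt (\<zero>\<^bsub>B\<^esub>, y)) (\<lambda>_. 0)" "cong (basis_elt (x, \<zero>\<^bsub>B\<^esub>)) (\<lambda>_. 0)"
    if "x \<in> AA" "y \<in> MM" for x y
    using rels(3)[OF that(1) that(1) that(2) that(2), of 0] rels(4)[OF that(1) that(1) that(2) that(2), of 0] that
    by (simp_all add: cA cM)
  have mc: "m t \<in> MM" "m t \<in> carrier B" if "t \<in> T" for t using m MM(2) that by auto
  have rel_sum: "(\<Oplus>\<^bsub>B\<^esub>t\<in>I. g t) \<in> MM \<and> cong (basis_elt (x, \<Oplus>\<^bsub>B\<^esub>t\<in>I. g t)) (\<lambda>z. \<Sum>t\<in>I. basis_elt (x, g t) z)"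
    if "x \<in> AA" "\<And>t. t \<in> I \<Longrightarrow> g t \<in> MM" "finite I" for I :: "'t set" and g x
    using that(3,2)
  proof (induction I rule: finite_induct)
    case empty
    show ?case using rel0(2)[OF that(1) cM0(1)] cM0 by simp
  next
    case (insert i I)
    then have fs: "(\<Oplus>\<^bsub>B\<^esub>t\<in>insert i I. g t) = g i \<oplus>\<^bsub>B\<^esub> (\<Oplus>\<^bsub>B\<^esub>t\<in>I. g t)"
      by (intro B.finsum_insert) (auto simp: cM)
    have IH: "(\<Oplus>\<^bsub>B\<^esub>t\<in>I. g t) \<in> MM" "cong (basis_elt (x, \<Oplus>\<^bsub>B\<^esub>t\<in>I. g t)) (\<lambda>z. \<Sum>t\<in>I. basis_elt (x, g t) z)"
      using insert by auto
    have "cong (basis_elt (x, g i \<oplus>\<^bsub>B\<^esub> (\<Oplus>\<^bsub>B\<^esub>t\<in>I. g t)))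
        (\<lambda>z. basis_elt (x, g i) z + basis_elt (x, \<Oplus>\<^bsub>B\<^esub>t\<in>I. g t) z)"
      using insert IH that(1) by (intro rels) auto
    also have "cong \<dots> (\<lambda>z. basis_elt (x, g i) z + (\<Sum>t\<in>I. basis_elt (x, g t) z))"
      by (intro cong_add cong_refl IH)
    finally show ?case unfolding fs using insert IH cM by auto
  qed
  \<comment> \<open>For a pair \<open>(x, y)\<close>, the second entry is expanded in the
    \<open>m t\<close> and the coefficients are then moved across to the first entry by the two
    scalar relations.\<close>
  have normal_form: "\<exists>a\<in>T \<rightarrow> AA. cong f (\<lambda>z. \<Sum>t\<in>T. basis_elt (a t, m t) z)" if "f \<in> carrier ?D" for f
    using that
  proof (induction rule: monoid_alg_induct)
    case zero
    have "cong (\<lambda>z. \<Sum>t\<in>T. basis_elt (\<zero>\<^bsub>B\<^esub>, m t) z) (\<lambda>z. \<Sum>t\<in>T. 0)"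
      by (intro cong_sum T rel0) (use mc cA0 in auto)
    then show ?case using cong_sym cA0 by (intro bexI[of _ "\<lambda>_. \<zero>\<^bsub>B\<^esub>"]) auto
  next
    case (add f c p)
    then obtain x y where p: "p = (x, y)" and xy: "x \<in> AA" "y \<in> MM" by auto
    obtain a where a: "a \<in> T \<rightarrow> AA" "cong f (\<lambda>z. \<Sum>t\<in>T. basis_elt (a t, m t) z)" using add by blast
    obtain d where d: "y = (\<Oplus>\<^bsub>B\<^esub>t\<in>T. d t \<odot>\<^bsub>B\<^esub> m t)" using span[OF xy(2)] by auto
    define x' where "x' = c \<odot>\<^bsub>B\<^esub> x"
    have x': "x' \<in> AA" using xy cA by (simp add: x'_def)
    have at: "a t \<in> AA" if "t \<in> T" for t using a that by auto
    have "cong (\<lambda>z. c * basis_elt (x, y) z) (basis_elt (x', y))"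
      unfolding x'_def using xy by (intro cong_sym[OF rels(3)]) auto
    also have "cong \<dots> (\<lambda>z. \<Sum>t\<in>T. basis_elt (x', d t \<odot>\<^bsub>B\<^esub> m t) z)"
      unfolding d using x' mc cM1 T by (intro rel_sum[THEN conjunct2]) auto
    also have "cong \<dots> (\<lambda>z. \<Sum>t\<in>T. basis_elt (d t \<odot>\<^bsub>B\<^esub> x', m t) z)"
    proof (intro cong_sum T)
      fix t assume t: "t \<in> T"
      have "cong (basis_elt (x', d t \<odot>\<^bsub>B\<^esub> m t)) (\<lambda>z. d t * basis_elt (x', m t) z)"
        using x' mc t cA1 cM1 by (intro rels(4)) auto
      also have "cong \<dots> (basis_elt (d t \<odot>\<^bsub>B\<^esub> x', m t))"
        using x' mc t cA1 cM1 by (intro cong_sym[OF rels(3)]) auto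
      finally show "cong (basis_elt (x', d t \<odot>\<^bsub>B\<^esub> m t)) (basis_elt (d t \<odot>\<^bsub>B\<^esub> x', m t))" .
    qed
    finally have "cong (\<lambda>z. c * basis_elt (x, y) z + f z)
      (\<lambda>z. (\<Sum>t\<in>T. basis_elt (d t \<odot>\<^bsub>B\<^esub> x', m t) z) + (\<Sum>t\<in>T. basis_elt (a t, m t) z))"
      using a(2) by (rule cong_add)
    also have "cong \<dots> (\<lambda>z. \<Sum>t\<in>T. basis_elt (d t \<odot>\<^bsub>B\<^esub> x' \<oplus>\<^bsub>B\<^esub> a t, m t) z)"
      unfolding sum.distrib[symmetric]
      using x' mc at cA1 by (intro cong_sum T cong_sym[OF rels(1)]) auto
    finally show ?case
      using x' at cA(1) cA1 by (intro bexI[of _ "\<lambda>t. d t \<odot>\<^bsub>B\<^esub> x' \<oplus>\<^bsub>B\<^esub> a t"]) (auto simp: p)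
  qed
  define F where "F = lin_ext B (\<lambda>(x, y). x \<otimes>\<^bsub>B\<^esub> y)"
  have h: "(\<lambda>(x, y). x \<otimes>\<^bsub>B\<^esub> y) \<in> carrier ?S \<rightarrow> carrier B" using cA cM by auto
  have F_hom: "F \<in> alg_hom ?D B"
    unfolding F_def
  proof (rule B.lin_ext_alg_hom[OF S h])
    fix p q assume "p \<in> carrier ?S" "q \<in> carrier ?S"
    then obtain x y x' y' where p: "p = (x, y)" "q = (x', y')" "x \<in> AA" "x' \<in> AA" "y \<in> MM" "y' \<in> MM"
      by auto
    then have c: "x \<in> carrier B" "x' \<in> carrier B" "y \<in> carrier B" "y' \<in> carrier B"
      using AA(2) MM(2) by auto
    \<comment> \<open>Multiplicativity of the multiplication map is where the two subalgebras have
      to commute.\<close>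
    have "(x \<otimes>\<^bsub>B\<^esub> x') \<otimes>\<^bsub>B\<^esub> (y \<otimes>\<^bsub>B\<^esub> y') = x \<otimes>\<^bsub>B\<^esub> ((x' \<otimes>\<^bsub>B\<^esub> y) \<otimes>\<^bsub>B\<^esub> y')"
      using c by (simp add: B.m_assoc)
    also have "x' \<otimes>\<^bsub>B\<^esub> y = y \<otimes>\<^bsub>B\<^esub> x'" using comm p by simp
    finally have "(x \<otimes>\<^bsub>B\<^esub> x') \<otimes>\<^bsub>B\<^esub> (y \<otimes>\<^bsub>B\<^esub> y') = (x \<otimes>\<^bsub>B\<^esub> y) \<otimes>\<^bsub>B\<^esub> (x' \<otimes>\<^bsub>B\<^esub> y')"
      using c by (simp add: B.m_assoc)
    then show "(case p \<otimes>\<^bsub>?S\<^esub> q of (x, y) \<Rightarrow> x \<otimes>\<^bsub>B\<^esub> y) =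
        (case p of (x, y) \<Rightarrow> x \<otimes>\<^bsub>B\<^esub> y) \<otimes>\<^bsub>B\<^esub> (case q of (x, y) \<Rightarrow> x \<otimes>\<^bsub>B\<^esub> y)"
      by (simp add: p)
  qed simp
  interpret F: ring_hom_ring ?D B F
    using F_hom by (intro ring_hom_ringI2 D.ring_axioms B.ring_axioms) (simp add: alg_hom_def)
  have F_smult: "F (c \<odot>\<^bsub>?D\<^esub> f) = c \<odot>\<^bsub>B\<^esub> F f" if "f \<in> carrier ?D" for c f
    using F_hom that by (simp add: alg_hom_def del: monoid_alg_simps)
  have F_basis: "F (basis_elt (x, y)) = x \<otimes>\<^bsub>B\<^esub> y" if "x \<in> AA" "y \<in> MM" for x y
    unfolding F_def using that by (subst B.lin_ext_basis[OF h]) auto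
  have F_minus: "F (f \<ominus>\<^bsub>?D\<^esub> g) = F f \<ominus>\<^bsub>B\<^esub> F g" if "f \<in> carrier ?D" "g \<in> carrier ?D" for f g
    using that by (simp add: a_minus_def F.hom_a_inv del: monoid_alg_simps)
  have F_rels: "F f = \<zero>\<^bsub>B\<^esub>" if "f \<in> ?R" for f
  proof -
    have cancel: "u \<oplus>\<^bsub>B\<^esub> v \<ominus>\<^bsub>B\<^esub> u \<ominus>\<^bsub>B\<^esub> v = \<zero>\<^bsub>B\<^esub>" "u \<ominus>\<^bsub>B\<^esub> u = \<zero>\<^bsub>B\<^esub>"
      if "u \<in> carrier B" "v \<in> carrier B" for u v
      using that by algebra+
    have c: "x \<in> AA \<Longrightarrow> x \<in> carrier B" "x \<in> MM \<Longrightarrow> x \<in> carrier B" for x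
      using AA(2) MM(2) by auto
    show ?thesis
      using that unfolding tensor_rels_def Let_def
      by (auto simp del: monoid_alg_simps simp: F_minus F_smult F_basis bD cA(1) cA1 cM(1) cM1 c
          B.l_distr B.r_distr B.smult_mult_left B.smult_mult_right cancel)
  qed
  have F_J: "F f = \<zero>\<^bsub>B\<^esub>" if "f \<in> ?J" for f
    using that unfolding tensor_ideal_def
  proof induction
    case (add f g c)
    have "f \<in> carrier ?D" "g \<in> carrier ?D" using add R J(1) by (auto simp: tensor_ideal_def)
    with add show ?case by (simp add: F_smult F_rels del: monoid_alg_simps)
  qed (use F.hom_zero in simp)
  have F_sum: "F (\<lambda>z. \<Sum>t\<in>I. basis_elt (a t, m t) z) = (\<Oplus>\<^bsub>B\<^esub>t\<in>I. a t \<otimes>\<^bsub>B\<^esub> m t) \<and>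
      (\<lambda>z. \<Sum>t\<in>I. basis_elt (a t, m t) z) \<in> carrier ?D"
    if "a \<in> T \<rightarrow> AA" "finite I" "I \<subseteq> T" for a I
    using that(2,3)
  proof (induction I rule: finite_induct)
    case empty
    show ?case using F.hom_zero D.zero_closed by simp
  next
    case (insert i I)
    have c: "a t \<in> AA" "m t \<in> MM" "a t \<in> carrier B" "m t \<in> carrier B" if "t \<in> insert i I" for t
      using insert that \<open>a \<in> T \<rightarrow> AA\<close> mc AA(2) by auto
    have b: "basis_elt (a i, m i) \<in> carrier ?D" using c by (simp add: bD)
    have "(\<lambda>z. \<Sum>t\<in>insert i I. basis_elt (a t, m t) z) =
        basis_elt (a i, m i) \<oplus>\<^bsub>?D\<^esub> (\<lambda>z. \<Sum>t\<in>I. basis_elt (a t, m t) z)"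
      using insert by simp
    moreover have "(\<Oplus>\<^bsub>B\<^esub>t\<in>insert i I. a t \<otimes>\<^bsub>B\<^esub> m t) = a i \<otimes>\<^bsub>B\<^esub> m i \<oplus>\<^bsub>B\<^esub> (\<Oplus>\<^bsub>B\<^esub>t\<in>I. a t \<otimes>\<^bsub>B\<^esub> m t)"
      using insert c by (intro B.finsum_insert) auto
    ultimately show ?case
      using insert b c by (simp add: F_basis del: monoid_alg_simps)
  qed
  have F_cong: "F f = F g" if "cong f g" "g \<in> carrier ?D" for f g
  proof -
    have "F f = F ((\<lambda>z. f z - g z) \<oplus>\<^bsub>?D\<^esub> g)" by simp
    also have "\<dots> = F (\<lambda>z. f z - g z) \<oplus>\<^bsub>B\<^esub> F g"
      using that(2) J(1)[OF that(1)[unfolded cong_def]] by (rule F.hom_add[rotated])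
    also have "F (\<lambda>z. f z - g z) = \<zero>\<^bsub>B\<^esub>" using that F_J by (simp add: cong_def)
    finally show ?thesis using that by simp
  qed
  have kernel: "a_kernel ?D B F = ?J"
  proof (intro equalityI subsetI)
    fix f assume f: "f \<in> ?J"
    from F_J[OF f] J(1)[OF f] show "f \<in> a_kernel ?D B F" unfolding a_kernel_def' by blast
  next
    fix f assume "f \<in> a_kernel ?D B F"
    then have f: "f \<in> carrier ?D" "F f = \<zero>\<^bsub>B\<^esub>" unfolding a_kernel_def' by blast+
    obtain a where a: "a \<in> T \<rightarrow> AA" "cong f (\<lambda>z. \<Sum>t\<in>T. basis_elt (a t, m t) z)"
      using normal_form[OF f(1)] by blast
    have s: "F (\<lambda>z. \<Sum>t\<in>T. basis_elt (a t, m t) z) = (\<Oplus>\<^bsub>B\<^esub>t\<in>T. a t \<otimes>\<^bsub>B\<^esub> m t)"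
      "(\<lambda>z. \<Sum>t\<in>T. basis_elt (a t, m t) z) \<in> carrier ?D"
      using F_sum[OF a(1) T subset_refl] by blast+
    have "(\<Oplus>\<^bsub>B\<^esub>t\<in>T. a t \<otimes>\<^bsub>B\<^esub> m t) = \<zero>\<^bsub>B\<^esub>"
      using F_cong[OF a(2) s(2)] f(2) unfolding s(1) by (rule trans[OF sym])
    then have at: "a t = \<zero>\<^bsub>B\<^esub>" if "t \<in> T" for t using indep[OF a(1) _ that] by blast
    have "cong (\<lambda>z. \<Sum>t\<in>T. basis_elt (a t, m t) z) (\<lambda>z. \<Sum>t\<in>T. 0)"
    proof (intro cong_sum T)
      fix t assume t: "t \<in> T"
      show "cong (basis_elt (a t, m t)) (\<lambda>z. 0)"
        unfolding at[OF t] by (rule rel0(1)[OF cA0(1) mc(1)[OF t]])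
    qed
    from cong_trans[OF a(2) this] show "f \<in> ?J" by (simp add: cong_def)
  qed
  have surj: "F ` carrier ?D = carrier B"
  proof (intro equalityI subsetI)
    fix b assume b: "b \<in> carrier B"
    obtain a where a: "a \<in> T \<rightarrow> AA" "b = (\<Oplus>\<^bsub>B\<^esub>t\<in>T. a t \<otimes>\<^bsub>B\<^esub> m t)"
      using gen[OF b] by (rule bexE)
    have "b = F (\<lambda>z. \<Sum>t\<in>T. basis_elt (a t, m t) z)"
      using F_sum[OF a(1) T subset_refl] a(2) by simp
    then show "b \<in> F ` carrier ?D" 
      using F_sum[OF a(1) T subset_refl] by (rule image_eqI[OF _ conjunct2])
  qed (use F.hom_closed in \<open>auto simp del: monoid_alg_simps\<close>)
  \<comment> \<open>That the span of the bilinearity relations is a two-sided ideal comes for free,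
    since it is the kernel of a ring homomorphism.\<close>
  have ideal: "ideal ?J ?D" using F.kernel_is_ideal kernel by simp
  interpret J: ideal ?J ?D by (rule ideal)
  define f where "f = (\<lambda>Y. the_elem (F ` Y))"
  have iso: "f \<in> ring_iso (?D Quot ?J) B"
    using F.FactRing_iso_set[OF surj] unfolding kernel f_def .
  have f_coset: "f (?J +>\<^bsub>?D\<^esub> g) = F g" if "g \<in> carrier ?D" for g
  proof -
    have "F ` (?J +>\<^bsub>?D\<^esub> g) = {F g}"
    proof (intro equalityI subsetI)
      fix b assume "b \<in> F ` (?J +>\<^bsub>?D\<^esub> g)"
      then obtain j where j: "j \<in> ?J" "b = F (j \<oplus>\<^bsub>?D\<^esub> g)" unfolding a_r_coset_def' by blast
      show "b \<in> {F g}"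
        unfolding j(2) F.hom_add[OF J(1)[OF j(1)] that] F_J[OF j(1)] using F.hom_closed[OF that] by simp
    qed (use J.a_rcos_self[OF that] in auto)
    then show ?thesis by (simp only: f_def the_elem_eq)
  qed
  have carr: "carrier (tensor_alg ?A ?M) = (\<lambda>g. ?J +>\<^bsub>?D\<^esub> g) ` carrier ?D"
    by (simp only: tensor_alg_def quot_alg_carrier)
  have "f (c \<odot>\<^bsub>tensor_alg ?A ?M\<^esub> Y) = c \<odot>\<^bsub>B\<^esub> f Y" if Y: "Y \<in> carrier (tensor_alg ?A ?M)" for c Y
  proof -
    obtain g where g: "g \<in> carrier ?D" "Y = ?J +>\<^bsub>?D\<^esub> g" using Y unfolding carr by (rule imageE)
    show ?thesis
      unfolding g(2) tensor_alg_def D.quot_alg_smult[OF ideal g(1)]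
      by (simp only: f_coset[OF g(1)] f_coset[OF D.smult_closed[OF g(1)]] F_smult[OF g(1)])
  qed
  moreover have "f \<in> ring_hom (tensor_alg ?A ?M) B" "bij_betw f (carrier (tensor_alg ?A ?M)) (carrier B)"
    using iso by (auto simp: ring_iso_def ring_hom_def tensor_alg_def quot_alg_def)
  ultimately have "f \<in> alg_iso (tensor_alg ?A ?M) B"
    by (simp add: alg_iso_def alg_hom_def)
  moreover have "\<forall>x\<in>AA. \<forall>y\<in>MM. f (pure_tensor ?A ?M x y) = x \<otimes>\<^bsub>B\<^esub> y"
  proof (intro ballI)
    fix x y assume xy: "x \<in> AA" "y \<in> MM"
    show "f (pure_tensor ?A ?M x y) = x \<otimes>\<^bsub>B\<^esub> y"
      unfolding pure_tensor_def f_coset[OF bD[OF xy]] by (rule F_basis[OF xy])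
  qed
  ultimately show ?thesis by blast
qed

section \<open>Skew group algebras\<close>

locale algebra_action = U: field_algebra U + H: group H
  for U :: "('k::field, 'u) module" and H :: "('h, 'm) monoid_scheme" +
  fixes act :: "'h \<Rightarrow> 'u \<Rightarrow> 'u"
  assumes finite_H: "finite (carrier H)"
    and act_hom: "h \<in> carrier H \<Longrightarrow> act h \<in> alg_hom U U"
    and act_mult: "\<lbrakk>g \<in> carrier H; h \<in> carrier H; x \<in> carrier U\<rbrakk> \<Longrightarrow>
      act (g \<otimes>\<^bsub>H\<^esub> h) x = act g (act h x)"
    and act_one: "x \<in> carrier U \<Longrightarrow> act \<one>\<^bsub>H\<^esub> x = x"
begin

abbreviation UH where "UH \<equiv> skew_group_alg U H act"

definition single :: "'h \<Rightarrow> 'u \<Rightarrow> 'h \<Rightarrow> 'u" where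
  "single h x = (\<lambda>g\<in>carrier H. if g = h then x else \<zero>\<^bsub>U\<^esub>)"

lemma act_closed [simp]: "\<lbrakk>h \<in> carrier H; x \<in> carrier U\<rbrakk> \<Longrightarrow> act h x \<in> carrier U"
  and act_add [simp]: "\<lbrakk>h \<in> carrier H; x \<in> carrier U; y \<in> carrier U\<rbrakk> \<Longrightarrow>
    act h (x \<oplus>\<^bsub>U\<^esub> y) = act h x \<oplus>\<^bsub>U\<^esub> act h y"
  and act_times [simp]: "\<lbrakk>h \<in> carrier H; x \<in> carrier U; y \<in> carrier U\<rbrakk> \<Longrightarrow>
    act h (x \<otimes>\<^bsub>U\<^esub> y) = act h x \<otimes>\<^bsub>U\<^esub> act h y"
  and act_smult [simp]: "\<lbrakk>h \<in> carrier H; x \<in> carrier U\<rbrakk> \<Longrightarrow> act h (c \<odot>\<^bsub>U\<^esub> x) = c \<odot>\<^bsub>U\<^esub> act h x"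
  using act_hom by (auto simp: alg_hom_def ring_hom_def Pi_iff)

lemma act_zero_one [simp]:
  assumes "h \<in> carrier H" shows "act h \<zero>\<^bsub>U\<^esub> = \<zero>\<^bsub>U\<^esub>" "act h \<one>\<^bsub>U\<^esub> = \<one>\<^bsub>U\<^esub>"
proof -
  have "act h (0 \<odot>\<^bsub>U\<^esub> \<zero>\<^bsub>U\<^esub>) = 0 \<odot>\<^bsub>U\<^esub> act h \<zero>\<^bsub>U\<^esub>" using assms by (intro act_smult) auto
  then show "act h \<zero>\<^bsub>U\<^esub> = \<zero>\<^bsub>U\<^esub>" using assms act_closed[OF assms U.zero_closed] by (simp del: act_smult)
  show "act h \<one>\<^bsub>U\<^esub> = \<one>\<^bsub>U\<^esub>" using act_hom[OF assms] by (auto simp: alg_hom_def ring_hom_def)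
qed

lemma UH_carrier: "a \<in> carrier UH \<longleftrightarrow> a \<in> carrier H \<rightarrow>\<^sub>E carrier U"
  by (simp add: skew_group_alg_def)

lemma UH_app [simp]: "a \<in> carrier UH \<Longrightarrow> g \<in> carrier H \<Longrightarrow> a g \<in> carrier U"
  by (auto simp: UH_carrier)

lemma UH_ops:
  "a \<oplus>\<^bsub>UH\<^esub> b = (\<lambda>g\<in>carrier H. a g \<oplus>\<^bsub>U\<^esub> b g)" "c \<odot>\<^bsub>UH\<^esub> a = (\<lambda>g\<in>carrier H. c \<odot>\<^bsub>U\<^esub> a g)"
  "\<zero>\<^bsub>UH\<^esub> = (\<lambda>g\<in>carrier H. \<zero>\<^bsub>U\<^esub>)" "\<one>\<^bsub>UH\<^esub> = single \<one>\<^bsub>H\<^esub> \<one>\<^bsub>U\<^esub>"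
  "a \<otimes>\<^bsub>UH\<^esub> b =
    (\<lambda>g\<in>carrier H. \<Oplus>\<^bsub>U\<^esub>h\<in>carrier H. a h \<otimes>\<^bsub>U\<^esub> act h (b (inv\<^bsub>H\<^esub> h \<otimes>\<^bsub>H\<^esub> g)))"
  by (simp_all add: skew_group_alg_def single_def)

lemma UH_eqI:
  assumes "a \<in> carrier UH" "b \<in> carrier UH" "\<And>g. g \<in> carrier H \<Longrightarrow> a g = b g"
  shows "a = b"
  using assms by (auto simp: UH_carrier intro: PiE_ext)

lemma single_closed [simp]: "x \<in> carrier U \<Longrightarrow> single h x \<in> carrier UH"
  by (auto simp: single_def UH_carrier)

lemma UH_vec_space: "vec_space UH"
proof (intro vec_space.intro vec_space_axioms.intro)
  show "abelian_group UH"
  proof (rule abelian_groupI)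
    fix a assume a: "a \<in> carrier UH"
    show "\<exists>b\<in>carrier UH. b \<oplus>\<^bsub>UH\<^esub> a = \<zero>\<^bsub>UH\<^esub>"
      by (rule bexI[of _ "\<lambda>g\<in>carrier H. \<ominus>\<^bsub>U\<^esub> a g"])
        (use a in \<open>auto simp: UH_ops UH_carrier PiE_iff U.l_neg\<close>)
  qed (auto simp: UH_ops UH_carrier PiE_iff U.a_ac extensional_def intro!: restrict_ext ext)
qed (auto simp: UH_ops UH_carrier PiE_iff U.smult_add_left U.smult_add_right U.smult_smult
    extensional_def intro!: restrict_ext ext)

lemma UH_mult_closed [simp]:
  assumes "a \<in> carrier UH" "b \<in> carrier UH" shows "a \<otimes>\<^bsub>UH\<^esub> b \<in> carrier UH"
  unfolding UH_carrier UH_ops using assms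
  by (intro restrict_PiE[THEN iffD2] Pi_I U.finsum_closed) auto

lemma UH_bilinear:
  assumes "a \<in> carrier UH" "b \<in> carrier UH" "d \<in> carrier UH"
  shows "(a \<oplus>\<^bsub>UH\<^esub> b) \<otimes>\<^bsub>UH\<^esub> d = a \<otimes>\<^bsub>UH\<^esub> d \<oplus>\<^bsub>UH\<^esub> b \<otimes>\<^bsub>UH\<^esub> d" (is ?A)
    and "d \<otimes>\<^bsub>UH\<^esub> (a \<oplus>\<^bsub>UH\<^esub> b) = d \<otimes>\<^bsub>UH\<^esub> a \<oplus>\<^bsub>UH\<^esub> d \<otimes>\<^bsub>UH\<^esub> b" (is ?B)
    and "(c \<odot>\<^bsub>UH\<^esub> a) \<otimes>\<^bsub>UH\<^esub> d = c \<odot>\<^bsub>UH\<^esub> (a \<otimes>\<^bsub>UH\<^esub> d)" (is ?C)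
    and "d \<otimes>\<^bsub>UH\<^esub> (c \<odot>\<^bsub>UH\<^esub> a) = c \<odot>\<^bsub>UH\<^esub> (d \<otimes>\<^bsub>UH\<^esub> a)" (is ?D)
proof -
  define M where "M a d g h = a h \<otimes>\<^bsub>U\<^esub> act h (d (inv\<^bsub>H\<^esub> h \<otimes>\<^bsub>H\<^esub> g))" for a d g h
  have M [simp]: "M a d g h \<in> carrier U"
    if "a \<in> carrier UH" "d \<in> carrier UH" "g \<in> carrier H" "h \<in> carrier H" for a d g h
    using that by (simp add: M_def)
  have mult: "a \<otimes>\<^bsub>UH\<^esub> d = (\<lambda>g\<in>carrier H. \<Oplus>\<^bsub>U\<^esub>h\<in>carrier H. M a d g h)" for a d
    by (simp add: UH_ops M_def)
  have lin: "M (a \<oplus>\<^bsub>UH\<^esub> b) d g h = M a d g h \<oplus>\<^bsub>U\<^esub> M b d g h" "M d (a \<oplus>\<^bsub>UH\<^esub> b) g h = M d a g h \<oplus>\<^bsub>U\<^esub> M d b g h"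
    "M (c \<odot>\<^bsub>UH\<^esub> a) d g h = c \<odot>\<^bsub>U\<^esub> M a d g h" "M d (c \<odot>\<^bsub>UH\<^esub> a) g h = c \<odot>\<^bsub>U\<^esub> M d a g h"
    if "g \<in> carrier H" "h \<in> carrier H" for g h
    using assms that
    by (simp_all add: M_def UH_ops U.l_distr U.r_distr U.smult_mult_left U.smult_mult_right)
  have "(\<Oplus>\<^bsub>U\<^esub>h\<in>carrier H. M (a \<oplus>\<^bsub>UH\<^esub> b) d g h) =
      (\<Oplus>\<^bsub>U\<^esub>h\<in>carrier H. M a d g h) \<oplus>\<^bsub>U\<^esub> (\<Oplus>\<^bsub>U\<^esub>h\<in>carrier H. M b d g h)"
    "(\<Oplus>\<^bsub>U\<^esub>h\<in>carrier H. M d (a \<oplus>\<^bsub>UH\<^esub> b) g h) =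
      (\<Oplus>\<^bsub>U\<^esub>h\<in>carrier H. M d a g h) \<oplus>\<^bsub>U\<^esub> (\<Oplus>\<^bsub>U\<^esub>h\<in>carrier H. M d b g h)"
    "(\<Oplus>\<^bsub>U\<^esub>h\<in>carrier H. M (c \<odot>\<^bsub>UH\<^esub> a) d g h) = c \<odot>\<^bsub>U\<^esub> (\<Oplus>\<^bsub>U\<^esub>h\<in>carrier H. M a d g h)"
    "(\<Oplus>\<^bsub>U\<^esub>h\<in>carrier H. M d (c \<odot>\<^bsub>UH\<^esub> a) g h) = c \<odot>\<^bsub>U\<^esub> (\<Oplus>\<^bsub>U\<^esub>h\<in>carrier H. M d a g h)"
    if g: "g \<in> carrier H" for g
    using assms g lin[OF g]
    by (simp_all add: U.finsum_smult_right Pi_iff U.finsum_addf[symmetric] cong: U.finsum_cong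
        del: U.finsum_addf)
  then show ?A ?B ?C ?D
    unfolding mult UH_ops(1,2) by (auto intro!: restrict_ext)
qed

text \<open>With \<open>single h x\<close> standing for \<open>x h\<close>, this is the rule (x h)(y
  k) = (x h(y)) (h k). Together with bilinearity it governs all products.\<close>

lemma single_mult:
  assumes "h \<in> carrier H" "k \<in> carrier H" "x \<in> carrier U" "y \<in> carrier U"
  shows "single h x \<otimes>\<^bsub>UH\<^esub> single k y = single (h \<otimes>\<^bsub>H\<^esub> k) (x \<otimes>\<^bsub>U\<^esub> act h y)"
proof (rule UH_eqI)
  fix g assume g: "g \<in> carrier H"
  have eq: "inv\<^bsub>H\<^esub> h \<otimes>\<^bsub>H\<^esub> g = k \<longleftrightarrow> g = h \<otimes>\<^bsub>H\<^esub> k"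
    using assms g H.inv_solve_left by metis
  have "(single h x \<otimes>\<^bsub>UH\<^esub> single k y) g =
      (\<Oplus>\<^bsub>U\<^esub>l\<in>carrier H. if h = l then x \<otimes>\<^bsub>U\<^esub> act l (single k y (inv\<^bsub>H\<^esub> l \<otimes>\<^bsub>H\<^esub> g)) else \<zero>\<^bsub>U\<^esub>)"
    using assms g by (auto simp: UH_ops single_def intro!: U.finsum_cong')
  also have "\<dots> = x \<otimes>\<^bsub>U\<^esub> act h (single k y (inv\<^bsub>H\<^esub> h \<otimes>\<^bsub>H\<^esub> g))"
    using assms g finite_H by (intro U.finsum_singleton) auto
  also have "\<dots> = single (h \<otimes>\<^bsub>H\<^esub> k) (x \<otimes>\<^bsub>U\<^esub> act h y) g"
    using assms g eq by (auto simp: single_def)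
  finally show "(single h x \<otimes>\<^bsub>UH\<^esub> single k y) g = single (h \<otimes>\<^bsub>H\<^esub> k) (x \<otimes>\<^bsub>U\<^esub> act h y) g" .
qed (use assms in auto)

text \<open>Since \<open>H\<close> is finite, every function from \<open>H\<close> to
  \<open>U\<close> is a finite sum of terms \<open>x h\<close>; the terms are split off one at a
  time.\<close>

lemma UH_induct [consumes 1, case_names zero add]:
  assumes "a \<in> carrier UH" "P \<zero>\<^bsub>UH\<^esub>"
    and "\<And>a h x. a \<in> carrier UH \<Longrightarrow> P a \<Longrightarrow> h \<in> carrier H \<Longrightarrow> x \<in> carrier U \<Longrightarrow> P (single h x \<oplus>\<^bsub>UH\<^esub> a)"
  shows "P a"
proof -
  have "finite F \<Longrightarrow> F \<subseteq> carrier H \<Longrightarrow> a \<in> carrier UH \<Longrightarrow> (\<And>g. g \<in> carrier H - F \<Longrightarrow> a g = \<zero>\<^bsub>U\<^esub>) \<Longrightarrow> P a"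
    for F a
  proof (induction F arbitrary: a rule: finite_induct)
    case empty
    then have "a = \<zero>\<^bsub>UH\<^esub>" by (auto simp: UH_ops UH_carrier PiE_iff extensional_def)
    then show ?case using assms(2) by simp
  next
    case (insert h F)
    define b where "b = (\<lambda>g\<in>carrier H. if g = h then \<zero>\<^bsub>U\<^esub> else a g)"
    have b: "b \<in> carrier UH" using insert.prems by (auto simp: b_def UH_carrier)
    have "P b" using insert.prems by (intro insert.IH b) (auto simp: b_def)
    moreover have "a = single h (a h) \<oplus>\<^bsub>UH\<^esub> b"
      by (rule UH_eqI) (use insert.prems b vec_space.axioms(1)[OF UH_vec_space] in
        \<open>auto simp: b_def single_def UH_ops UH_carrier PiE_iff\<close>)
    ultimately show ?case using assms(3)[OF b, of h "a h"] insert.prems by auto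
  qed
  from this[OF finite_H subset_refl assms(1)] show ?thesis by blast
qed

lemma UH_field_algebra: "field_algebra UH"
proof -
  interpret vec_space UH by (rule UH_vec_space)
  have zero_mult [simp]: "\<zero>\<^bsub>UH\<^esub> \<otimes>\<^bsub>UH\<^esub> a = \<zero>\<^bsub>UH\<^esub>" "a \<otimes>\<^bsub>UH\<^esub> \<zero>\<^bsub>UH\<^esub> = \<zero>\<^bsub>UH\<^esub>"
    if "a \<in> carrier UH" for a
    using UH_bilinear(3)[OF zero_closed that that, of 0] UH_bilinear(4)[OF zero_closed that that, of 0] that
    by simp_all
  have assoc: "(a \<otimes>\<^bsub>UH\<^esub> b) \<otimes>\<^bsub>UH\<^esub> d = a \<otimes>\<^bsub>UH\<^esub> (b \<otimes>\<^bsub>UH\<^esub> d)"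
    if a: "a \<in> carrier UH" and b: "b \<in> carrier UH" and d: "d \<in> carrier UH" for a b d
  proof -
    have 1: "(single h x \<otimes>\<^bsub>UH\<^esub> single g y) \<otimes>\<^bsub>UH\<^esub> d = single h x \<otimes>\<^bsub>UH\<^esub> (single g y \<otimes>\<^bsub>UH\<^esub> d)"
      if "h \<in> carrier H" "x \<in> carrier U" "g \<in> carrier H" "y \<in> carrier U" for h x g y
      using d that
      by (induction rule: UH_induct)
        (auto simp: UH_bilinear single_mult U.m_assoc H.m_assoc act_mult)
    have 2: "(single h x \<otimes>\<^bsub>UH\<^esub> b) \<otimes>\<^bsub>UH\<^esub> d = single h x \<otimes>\<^bsub>UH\<^esub> (b \<otimes>\<^bsub>UH\<^esub> d)"
      if "h \<in> carrier H" "x \<in> carrier U" for h x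
      using b that by (induction rule: UH_induct) (auto simp: UH_bilinear 1 d)
    show ?thesis
      using a by (induction rule: UH_induct) (auto simp: UH_bilinear 2 b d)
  qed
  have one: "\<one>\<^bsub>UH\<^esub> \<otimes>\<^bsub>UH\<^esub> a = a" "a \<otimes>\<^bsub>UH\<^esub> \<one>\<^bsub>UH\<^esub> = a" if "a \<in> carrier UH" for a
    using that by (induction rule: UH_induct) (auto simp: UH_bilinear UH_ops(4) single_mult act_one)
  have one_closed: "\<one>\<^bsub>UH\<^esub> \<in> carrier UH" by (simp add: UH_ops(4))
  have "ring UH"
  proof (rule ringI[OF abelian_group_axioms])
    show "Group.monoid UH"
      by (rule monoidI) (auto simp: assoc one one_closed)
  qed (auto simp: UH_bilinear)
  then show ?thesis
    by (intro field_algebra.intro UH_vec_space field_algebra_axioms.intro) (auto simp: UH_bilinear)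
qed

sublocale UH: field_algebra UH by (rule UH_field_algebra)

lemma skew_coeff_incl_eq: "skew_coeff_incl U H x = single \<one>\<^bsub>H\<^esub> x"
  by (simp add: skew_coeff_incl_def single_def)

lemma single_add_smult:
  assumes "x \<in> carrier U" "y \<in> carrier U"
  shows "single h (x \<oplus>\<^bsub>U\<^esub> y) = single h x \<oplus>\<^bsub>UH\<^esub> single h y" "single h (c \<odot>\<^bsub>U\<^esub> x) = c \<odot>\<^bsub>UH\<^esub> single h x"
  using assms by (auto simp: single_def UH_ops intro!: restrict_ext)

text \<open>Recasts the pointwise definition as a linear extension, so that
  \<open>lin_ext_alg_hom\<close> shows the inclusion of the group algebra to be
  multiplicative.\<close>

lemma skew_group_incl_eq:
  assumes "f \<in> carrier (monoid_alg H)"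
  shows "skew_group_incl U H f = lin_ext UH (\<lambda>h. single h \<one>\<^bsub>U\<^esub>) f"
proof (rule UH_eqI)
  have fin: "finite {h. f h \<noteq> 0}" "{h. f h \<noteq> 0} \<subseteq> carrier H"
    using assms by (auto simp: monoid_alg_carrier)
  show "lin_ext UH (\<lambda>h. single h \<one>\<^bsub>U\<^esub>) f \<in> carrier UH"
    using assms by (intro UH.lin_ext_closed[of _ H]) auto
  show "skew_group_incl U H f \<in> carrier UH"
    by (auto simp: skew_group_incl_def UH_carrier)
  fix g assume g: "g \<in> carrier H"
  have "lin_ext UH (\<lambda>h. single h \<one>\<^bsub>U\<^esub>) f g = (\<Oplus>\<^bsub>UH\<^esub>h\<in>carrier H. f h \<odot>\<^bsub>UH\<^esub> single h \<one>\<^bsub>U\<^esub>) g"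
    using fin finite_H by (subst UH.lin_ext_superset[of "carrier H"]) auto
  \<comment> \<open>Evaluation at \<open>g\<close> is additive, so it can be moved inside the
    sum.\<close>
  also have "\<dots> = (\<Oplus>\<^bsub>U\<^esub>h\<in>carrier H. (f h \<odot>\<^bsub>UH\<^esub> single h \<one>\<^bsub>U\<^esub>) g)"
    by (rule finsum_hom[where h = "\<lambda>a. a g" and A = UH and B = U])
      (use g in \<open>auto simp: UH.abelian_group_axioms U.abelian_group_axioms UH_ops(1)\<close>)
  also have "\<dots> = (\<Oplus>\<^bsub>U\<^esub>h\<in>carrier H. if g = h then f h \<odot>\<^bsub>U\<^esub> \<one>\<^bsub>U\<^esub> else \<zero>\<^bsub>U\<^esub>)"
    using g by (intro U.finsum_cong') (auto simp: UH_ops single_def)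
  also have "\<dots> = f g \<odot>\<^bsub>U\<^esub> \<one>\<^bsub>U\<^esub>"
    using g finite_H by (intro U.finsum_singleton) auto
  finally show "skew_group_incl U H f g = lin_ext UH (\<lambda>h. single h \<one>\<^bsub>U\<^esub>) f g"
    using g by (simp add: skew_group_incl_def)
qed

lemma skew_group_incl_alg_hom: "skew_group_incl U H \<in> alg_hom (monoid_alg H) UH"
proof -
  interpret kH: field_algebra "monoid_alg H :: ('k, 'h \<Rightarrow> 'k) module"
    by (rule monoid_alg_field_algebra) (rule H.is_monoid)
  have "lin_ext UH (\<lambda>h. single h \<one>\<^bsub>U\<^esub>) \<in> alg_hom (monoid_alg H) UH"
    by (rule UH.lin_ext_alg_hom) (auto simp: H.is_monoid UH_ops(4) single_mult)
  then show ?thesis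
    using kH.add.m_closed kH.m_closed kH.one_closed kH.smult_closed
    by (auto simp: alg_hom_def ring_hom_def skew_group_incl_eq simp del: monoid_alg_simps)
qed

lemma skew_group_incl_basis:
  "h \<in> carrier H \<Longrightarrow> skew_group_incl U H (basis_elt h) = single h \<one>\<^bsub>U\<^esub>"
  by (simp add: skew_group_incl_eq UH.lin_ext_basis[of _ H])

lemma single_decomp:
  assumes "h \<in> carrier H" "x \<in> carrier U"
  shows "single h x = skew_coeff_incl U H x \<otimes>\<^bsub>UH\<^esub> skew_group_incl U H (basis_elt h)"
  using assms by (simp add: skew_coeff_incl_eq skew_group_incl_basis single_mult)

lemma skew_commute:
  assumes "h \<in> carrier H" "x \<in> carrier U"
  shows "skew_group_incl U H (basis_elt h) \<otimes>\<^bsub>UH\<^esub> skew_coeff_incl U H x =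
    skew_coeff_incl U H (act h x) \<otimes>\<^bsub>UH\<^esub> skew_group_incl U H (basis_elt h)"
  using assms by (simp add: skew_coeff_incl_eq skew_group_incl_basis single_mult act_one)

lemma skew_coeff_incl_alg_hom: "skew_coeff_incl U H \<in> alg_hom U UH"
  by (auto simp: alg_hom_def ring_hom_def skew_coeff_incl_eq single_add_smult UH_ops(4) single_mult act_one)

end

section \<open>Characters of finite abelian groups\<close>

lemma ring_of_type_algebra_simps [simp]:
  "carrier ring_of_type_algebra = UNIV" "monoid.mult ring_of_type_algebra = (*)"
  "one ring_of_type_algebra = 1" "add ring_of_type_algebra = (+)" "ring.zero ring_of_type_algebra = 0"
  by (simp_all add: ring_of_type_algebra_def)



text \<open>A root of X^n - a; since \<open>n\<close> is positive, the leading and the constant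
  coefficient occupy different places.\<close>

lemma nth_root_ex:
  fixes a :: "'k::alg_closed_field"
  assumes "n > 0" shows "\<exists>y. y ^ n = a"
proof -
  obtain y where "(\<Sum>k\<le>n. (if k = n then 1 else if k = 0 then - a else 0) * y ^ k) = 0"
    using alg_closed[of n "\<lambda>k. if k = n then 1 else if k = 0 then - a else 0"] assms by auto
  also have "(\<Sum>k\<le>n. (if k = n then 1 else if k = 0 then - a else 0) * y ^ k) =
      (\<Sum>k\<le>n. if k = n then y ^ n else 0) + (\<Sum>k\<le>n. if k = 0 then - a else 0)"
    unfolding sum.distrib[symmetric] using assms by (intro sum.cong) auto
  also have "\<dots> = y ^ n - a" by simp
  finally show ?thesis by auto
qed

text \<open>A root of 1 + X + ... + X^(n-1), which divides X^n - 1. It is not 1, because the value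
  of this polynomial at 1 is \<open>of_nat n\<close>.\<close>

lemma nontrivial_root_of_unity_ex:
  assumes "n > 1" "of_nat n \<noteq> (0::'k::alg_closed_field)"
  shows "\<exists>y::'k. y ^ n = 1 \<and> y \<noteq> 1"
proof -
  obtain y :: 'k where "(\<Sum>k\<le>n - 1. 1 * y ^ k) = 0"
    using alg_closed[of "n - 1" "\<lambda>_. 1::'k"] assms by auto
  moreover have "{..n - 1} = {..<n}" using assms by auto
  ultimately have y: "(\<Sum>k<n. y ^ k) = 0" by simp
  then have "y ^ n - 1 = 0" by (simp add: power_diff_1_eq)
  moreover have "y \<noteq> 1" using y assms by auto
  ultimately show ?thesis by auto
qed

text \<open>\<open>n\<close> is the order of \<open>x\<close> modulo \<open>K\<close>: if some
  exponent \<open>d\<close> with power in \<open>K\<close> left a nonzero remainder on division by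
  \<open>n\<close>, this remainder would be a smaller such exponent.\<close>

lemma (in group) pow_mem_dvd:
  assumes K: "subgroup K G" and x: "x \<in> carrier G" and n: "n = (LEAST n. n > 0 \<and> x [^] n \<in> K)"
    and ex: "m > 0" "x [^] (m::nat) \<in> K" and d: "x [^] (d::nat) \<in> K"
  shows "n dvd d" "n > 0" "x [^] n \<in> K"
proof -
  interpret K: subgroup K G by fact
  show n0: "n > 0" and nK: "x [^] n \<in> K"
    using LeastI[of "\<lambda>n. n > 0 \<and> x [^] n \<in> K" m] ex unfolding n by auto
  have "x [^] (d div n * n) = (x [^] n) [^] (d div n)"
    using x by (simp add: nat_pow_pow mult.commute)
  moreover have "(x [^] n) [^] q \<in> K" for q :: nat by (induction q) (use nK in auto)
  ultimately have qK: "x [^] (d div n * n) \<in> K" by simp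
  have "x [^] d = x [^] (d div n * n) \<otimes> x [^] (d mod n)"
    using x by (simp add: nat_pow_mult)
  then have "x [^] (d mod n) = inv (x [^] (d div n * n)) \<otimes> x [^] d"
    using x by (simp add: m_assoc[symmetric])
  then have "x [^] (d mod n) \<in> K" using qK d by simp
  then have "d mod n = 0"
    using not_less_Least[of "d mod n" "\<lambda>n. n > 0 \<and> x [^] n \<in> K"] mod_less_divisor[OF n0, of d]
    unfolding n[symmetric] by auto
  then show "n dvd d" by auto
qed

text \<open>Extends \<open>phi\<close> to the subgroup generated by \<open>K\<close> and
  \<open>x\<close>, with a prescribed value \<open>y\<close> at \<open>x\<close>. If k x^i = k' x^j
  with i \<le> j, then x^(j-i) lies in \<open>K\<close>, so \<open>n\<close> divides j - i, and the
  condition on y^n makes the two candidate values agree. Keeping \<open>y\<close> free serves both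
  the extension of characters and their separation.\<close>

lemma (in comm_group) character_extend_step:
  fixes phi :: "'a \<Rightarrow> 'k::field"
  assumes fin: "finite (carrier G)" and K: "subgroup K G" and x: "x \<in> carrier G"
    and phi: "\<And>g h. g \<in> K \<Longrightarrow> h \<in> K \<Longrightarrow> phi (g \<otimes> h) = phi g * phi h" "\<And>g. g \<in> K \<Longrightarrow> phi g \<noteq> 0"
    and n: "n = (LEAST n. n > 0 \<and> x [^] n \<in> K)" and y: "y ^ n = phi (x [^] n)" "y \<noteq> 0"
  shows "\<exists>K' phi'. subgroup K' G \<and> K \<subseteq> K' \<and> x \<in> K' \<and> (\<forall>g\<in>K'. \<forall>h\<in>K'. phi' (g \<otimes> h) = phi' g * phi' h) \<and>
    (\<forall>g\<in>K'. phi' g \<noteq> 0) \<and> (\<forall>g\<in>K. phi' g = phi g) \<and> phi' x = y"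
proof -
  interpret K: subgroup K G by fact
  have one: "phi \<one> = 1" using phi(1)[of \<one> \<one>] phi(2)[of \<one>] by simp
  have oG: "Coset.order G > 0" "x [^] Coset.order G \<in> K" "x [^] Coset.order G = \<one>"
    using fin x pow_order_eq_1[OF x] by (auto simp: Coset.order_def card_gt_0_iff)
  note dvd = pow_mem_dvd[OF K x n oG(1,2)]
  have phi_pow: "phi (u [^] (q::nat)) = phi u ^ q \<and> u [^] q \<in> K" if "u \<in> K" for u q
    using that by (induction q) (auto simp: phi one)
  have wd0: "phi k * y ^ i = phi k' * y ^ j"
    if "k \<in> K" "k' \<in> K" "k \<otimes> x [^] i = k' \<otimes> x [^] j" "i \<le> j" for k k' and i j :: nat
  proof -
    have kc: "k \<in> carrier G" "k' \<in> carrier G" using that by auto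
    have "k' \<otimes> x [^] j = k' \<otimes> x [^] (j - i) \<otimes> x [^] i"
      using x kc that(4) by (simp add: m_assoc nat_pow_mult)
    then have eq: "k = k' \<otimes> x [^] (j - i)" using that(3) x kc by simp
    then have "x [^] (j - i) = inv k' \<otimes> k" using x kc by (simp add: m_assoc[symmetric])
    then have xK: "x [^] (j - i) \<in> K" using that by simp
    then obtain q where q: "j - i = n * q" using dvd(1) by auto
    have "phi (x [^] (j - i)) = y ^ (j - i)"
      using phi_pow[OF dvd(3)[OF xK], of q] y x by (simp add: q nat_pow_pow power_mult)
    then have "phi k = phi k' * y ^ (j - i)" using eq phi(1)[OF that(2) xK] by simp
    then show ?thesis using that(4) by (simp add: power_add[symmetric])
  qed
  have wd: "phi k * y ^ i = phi k' * y ^ j"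
    if "k \<in> K" "k' \<in> K" "k \<otimes> x [^] i = k' \<otimes> x [^] j" for k k' and i j :: nat
    using wd0[OF that] wd0[OF that(2,1) that(3)[symmetric]] by (cases "i \<le> j") auto
  define K' where "K' = (\<Union>j::nat. (\<lambda>k. k \<otimes> x [^] j) ` K)"
  define phi' where "phi' g = (SOME v. \<exists>k\<in>K. \<exists>j::nat. g = k \<otimes> x [^] j \<and> v = phi k * y ^ j)" for g
  have phi': "phi' (k \<otimes> x [^] j) = phi k * y ^ j" if "k \<in> K" for k and j :: nat
    unfolding phi'_def
  proof (rule some_equality)
    fix v assume "\<exists>k'\<in>K. \<exists>i::nat. k \<otimes> x [^] j = k' \<otimes> x [^] i \<and> v = phi k' * y ^ i"
    then show "v = phi k * y ^ j" using wd[OF that] by metis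
  qed (use that in auto)
  have mem: "k \<otimes> x [^] j \<in> K'" if "k \<in> K" for k and j :: nat
    using that by (auto simp: K'_def)
  have K'E: "\<exists>k\<in>K. \<exists>j::nat. g = k \<otimes> x [^] j" if "g \<in> K'" for g using that by (auto simp: K'_def)
  have prod: "(k \<otimes> x [^] i) \<otimes> (k' \<otimes> x [^] j) = (k \<otimes> k') \<otimes> x [^] (i + j)" if "k \<in> K" "k' \<in> K" for k k' and i j :: nat
    using that x by (simp add: nat_pow_mult[symmetric] m_ac)
  have "subgroup K' G"
  proof (rule subgroupI)
    show "K' \<subseteq> carrier G" using x by (auto simp: K'_def)
    show "K' \<noteq> {}" using mem[of \<one> 0] by auto
    fix a b assume ab: "a \<in> K'" "b \<in> K'"
    then show "a \<otimes> b \<in> K'" using K'E prod mem K.m_closed by metis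
    obtain k and j :: nat where a: "a = k \<otimes> x [^] j" "k \<in> K" using K'E ab by blast
    \<comment> \<open>\<open>K'\<close> is built with natural exponents only, so the inverse of x^j
      has to be written as a positive power; with N the order of the group, it is
      x^(j(N-1)).\<close>
    have "x [^] j \<otimes> x [^] (j * (Coset.order G - 1)) = (x [^] Coset.order G) [^] j"
    proof -
      have "j + j * (Coset.order G - 1) = Coset.order G * j"
        using oG(1) by (cases "Coset.order G") simp_all
      then show ?thesis using x by (simp only: nat_pow_mult nat_pow_pow)
    qed
    then have "x [^] j \<otimes> x [^] (j * (Coset.order G - 1)) = \<one>" using oG(3) by simp
    then have "inv (x [^] j) = x [^] (j * (Coset.order G - 1))"
      using x by (intro comm_inv_char) auto
    then have "inv a = inv k \<otimes> x [^] (j * (Coset.order G - 1))" using a x by (simp add: inv_mult)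
    then show "inv a \<in> K'" using mem a by simp
  qed
  moreover have "K \<subseteq> K'"
  proof
    fix k assume "k \<in> K" then show "k \<in> K'" using mem[of k 0] by simp
  qed
  moreover have "x \<in> K'" using mem[of \<one> 1] x by simp
  moreover have "phi' (g \<otimes> h) = phi' g * phi' h" if "g \<in> K'" "h \<in> K'" for g h
  proof -
    obtain k k' and i j :: nat where gh: "g = k \<otimes> x [^] i" "h = k' \<otimes> x [^] j" and k: "k \<in> K" "k' \<in> K"
      using K'E \<open>g \<in> K'\<close> \<open>h \<in> K'\<close> by metis
    show ?thesis unfolding gh prod[OF k] using k by (simp add: phi' phi(1) power_add)
  qed
  moreover have "phi' g \<noteq> 0" if "g \<in> K'" for g using K'E[OF that] phi' phi(2) y(2) by auto
  moreover have "phi' g = phi g" if "g \<in> K" for g using phi'[OF that, of 0] that by simp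
  moreover have "phi' x = y" using phi'[of \<one> 1] x one by simp
  ultimately show ?thesis by blast
qed

text \<open>The extension property of the divisible group of units: a suitable \<open>y\<close>
  exists as an n-th root in the algebraically closed field, and each step enlarges
  \<open>K\<close>.\<close>

lemma (in comm_group) character_extend:
  fixes phi :: "'a \<Rightarrow> 'k::alg_closed_field"
  assumes fin: "finite (carrier G)" and K: "subgroup K G"
    and phi: "\<And>g h. g \<in> K \<Longrightarrow> h \<in> K \<Longrightarrow> phi (g \<otimes> h) = phi g * phi h" "\<And>g. g \<in> K \<Longrightarrow> phi g \<noteq> 0"
  shows "\<exists>psi \<in> hom G units_grp. \<forall>g\<in>K. psi g = phi g"
  using K phi
proof (induction "card (carrier G) - card K" arbitrary: K phi rule: less_induct)
  case less
  interpret K: subgroup K G by (rule less.prems)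
  show ?case
  proof (cases "K = carrier G")
    case True
    then show ?thesis using less.prems by (intro bexI[of _ phi]) (auto simp: hom_def)
  next
    case False
    then obtain x where x: "x \<in> carrier G" "x \<notin> K" using K.subset by auto
    define n :: nat where "n = (LEAST n. n > 0 \<and> x [^] n \<in> K)"
    have oG: "Coset.order G > 0" "x [^] Coset.order G \<in> K"
      using fin x pow_order_eq_1[OF x(1)] by (auto simp: Coset.order_def card_gt_0_iff)
    note nK = pow_mem_dvd[OF less.prems(1) x(1) n_def oG oG(2)]
    obtain y where y: "y ^ n = phi (x [^] n)" using nth_root_ex[OF nK(2)] by auto
    have "y \<noteq> 0" using y nK(2) less.prems(3)[OF nK(3)] by (auto simp: power_0_left)
    from character_extend_step[OF fin less.prems(1) x(1) less.prems(2,3) n_def y this]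
    obtain K' phi' where K': "subgroup K' G" "K \<subseteq> K'" "x \<in> K'"
      "\<And>g h. g \<in> K' \<Longrightarrow> h \<in> K' \<Longrightarrow> phi' (g \<otimes> h) = phi' g * phi' h" "\<And>g. g \<in> K' \<Longrightarrow> phi' g \<noteq> 0"
      "\<And>g. g \<in> K \<Longrightarrow> phi' g = phi g" by blast
    have sub: "K' \<subseteq> carrier G" using K'(1) by (rule subgroup.subset)
    have "card K < card K'" using K'(2,3) x(2) finite_subset[OF sub fin] by (intro psubset_card_mono) auto
    moreover have "card K' \<le> card (carrier G)" using sub fin by (rule card_mono[rotated])
    ultimately have "card (carrier G) - card K' < card (carrier G) - card K" by linarith
    from less.hyps[OF this K'(1,4,5)] obtain psi where "psi \<in> hom G units_grp" "\<forall>g\<in>K'. psi g = phi' g"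
      by auto
    then show ?thesis using K'(2,6) by (intro bexI[of _ psi]) auto
  qed
qed

text \<open>The trivial character of \<open>K\<close> is extended by sending \<open>x\<close> to a
  nontrivial n-th root of unity, with \<open>n\<close> the order of \<open>x\<close> modulo
  \<open>K\<close>. Such a root exists because \<open>n\<close> exceeds 1 and divides the group
  order, hence is nonzero in the field.\<close>

lemma (in comm_group) character_separates:
  assumes fin: "finite (carrier G)" "of_nat (card (carrier G)) \<noteq> (0::'k::alg_closed_field)"
    and K: "subgroup K G" and x: "x \<in> carrier G" "x \<notin> K"
  shows "\<exists>psi \<in> hom G (units_grp :: 'k monoid). (\<forall>g\<in>K. psi g = 1) \<and> psi x \<noteq> 1"
proof -
  define n :: nat where "n = (LEAST n. n > 0 \<and> x [^] n \<in> K)"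
  have oG: "Coset.order G > 0" "x [^] Coset.order G \<in> K"
    using fin x pow_order_eq_1[OF x(1)] subgroup.one_closed[OF K] by (auto simp: Coset.order_def card_gt_0_iff)
  note nK = pow_mem_dvd[OF K x(1) n_def oG oG(2)]
  have "n \<noteq> 1" using nK(3) x by auto
  then have "n > 1" using nK(2) by simp
  moreover have "of_nat n \<noteq> (0::'k)"
    using nK(1) fin(2) unfolding Coset.order_def by (metis dvdE mult_eq_0_iff of_nat_mult)
  ultimately obtain y :: 'k where y: "y ^ n = 1" "y \<noteq> 1" using nontrivial_root_of_unity_ex by blast
  have "y \<noteq> 0" using y nK(2) by (auto simp: power_0_left)
  then have "\<exists>K' phi'. subgroup K' G \<and> K \<subseteq> K' \<and> x \<in> K' \<and> (\<forall>g\<in>K'. \<forall>h\<in>K'. phi' (g \<otimes> h) = phi' g * phi' h) \<and>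
    (\<forall>g\<in>K'. phi' g \<noteq> 0) \<and> (\<forall>g\<in>K. phi' g = 1) \<and> phi' x = y"
    using y(1) by (intro character_extend_step[OF fin(1) K x(1) _ _ n_def]) auto
  then obtain K' phi' where K': "subgroup K' G" "K \<subseteq> K'" "x \<in> K'"
    "\<And>g h. g \<in> K' \<Longrightarrow> h \<in> K' \<Longrightarrow> phi' (g \<otimes> h) = phi' g * phi' h" "\<And>g. g \<in> K' \<Longrightarrow> phi' g \<noteq> 0"
    "\<And>g. g \<in> K \<Longrightarrow> phi' g = (1::'k)" "phi' x = y" by blast
  from character_extend[OF fin(1) K'(1,4,5)] obtain psi
    where "psi \<in> hom G units_grp" "\<forall>g\<in>K'. psi g = phi' g" by auto
  then show ?thesis using K' y by (intro bexI[of _ psi]) auto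
qed

text \<open>Translation by \<open>x\<close> multiplies the sum by \<open>psi x\<close>, which
  differs from 1. The group may be nonabelian, as \<open>H\<close> itself will be a case of
  it.\<close>

lemma (in group) sum_nontrivial_character:
  fixes psi :: "'a \<Rightarrow> 'k::field"
  assumes "psi \<in> hom G units_grp" "x \<in> carrier G" "psi x \<noteq> 1"
  shows "(\<Sum>g\<in>carrier G. psi g) = 0"
proof -
  have "(\<Sum>g\<in>carrier G. psi g) = (\<Sum>g\<in>carrier G. psi (x \<otimes> g))"
    by (rule sum.reindex_bij_witness[of _ "\<lambda>g. x \<otimes> g" "\<lambda>g. inv x \<otimes> g"])
      (use assms(2) in \<open>auto simp: m_assoc[symmetric]\<close>)
  also have "\<dots> = psi x * (\<Sum>g\<in>carrier G. psi g)"
    using assms(1,2) by (auto simp: hom_def sum_distrib_left intro!: sum.cong)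
  finally show ?thesis using assms(3) by simp
qed

text \<open>Characters take values among the roots of X^N - 1, with N the group order, and
  extensionality leaves no freedom outside the group.\<close>

lemma (in group) finite_characters:
  assumes "finite (carrier G)"
  shows "finite (hom G (units_grp :: 'k::field monoid) \<inter> extensional (carrier G))"
proof (rule finite_subset)
  let ?N = "Coset.order G"
  have N: "?N > 0" using assms by (auto simp: Coset.order_def card_gt_0_iff)
  define q where "q = (monom 1 ?N - 1 :: 'k poly)"
  have "coeff q ?N = 1" using N by (simp add: q_def)
  then have "q \<noteq> 0" by auto
  then have fin: "finite {y. poly q y = 0}" by (rule poly_roots_finite)
  show "hom G units_grp \<inter> extensional (carrier G) \<subseteq> carrier G \<rightarrow>\<^sub>E {y. poly q y = 0}"
  proof
    fix psi :: "'a \<Rightarrow> 'k" assume psi: "psi \<in> hom G units_grp \<inter> extensional (carrier G)"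
    have mult: "psi (g \<otimes> h) = psi g * psi h" if "g \<in> carrier G" "h \<in> carrier G" for g h
      using psi that by (auto simp: hom_def)
    have "psi \<one> \<noteq> 0" using psi by (auto simp: hom_def)
    then have one: "psi \<one> = 1" using mult[of \<one> \<one>] by simp
    have "poly q (psi x) = 0" if x: "x \<in> carrier G" for x
    proof -
      have "psi (x [^] (m::nat)) = psi x ^ m" for m
        using x by (induction m) (simp_all add: one mult)
      from this[of ?N] have "psi x ^ ?N = 1" using pow_order_eq_1[OF x] one by simp
      then show ?thesis by (simp add: q_def poly_monom)
    qed
    with psi show "psi \<in> carrier G \<rightarrow>\<^sub>E {y. poly q y = 0}" by (auto simp: PiE_iff)
  qed
  show "finite (carrier G \<rightarrow>\<^sub>E {y. poly q y = 0})" using assms fin by (rule finite_PiE)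
qed

text \<open>The number of characters trivial on \<open>K\<close> is only computed in \<open>'k\<close>, by summing all
  values of these characters in two ways.\<close>

lemma (in comm_group) sum_characters_over:
  fixes phi0 :: "'a \<Rightarrow> 'k::alg_closed_field"
  assumes fin: "finite (carrier G)" "of_nat (card (carrier G)) \<noteq> (0::'k)"
    and K: "subgroup K G" and phi0: "phi0 \<in> hom G units_grp \<inter> extensional (carrier G)"
    and x: "x \<in> carrier G"
  shows "(\<Sum>phi\<in>{phi \<in> hom G units_grp \<inter> extensional (carrier G). \<forall>g\<in>K. phi g = phi0 g}. phi x) =
    (if x \<in> K then of_nat (card (carrier G)) / of_nat (card K) * phi0 x else 0)"
proof -
  interpret K: subgroup K G by fact
  let ?Ch = "hom G (units_grp :: 'k monoid) \<inter> extensional (carrier G)"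
  \<comment> \<open>The annihilator of \<open>K\<close>; the characters agreeing with
    \<open>phi0\<close> on \<open>K\<close> are the products of \<open>phi0\<close> with elements of
    \<open>D\<close>.\<close>
  define D where "D = {psi \<in> ?Ch. \<forall>g\<in>K. psi g = 1}"
  have finD: "finite D" using finite_characters[OF fin(1), where 'k = 'k] unfolding D_def by (rule rev_finite_subset) auto
  have prod: "(\<lambda>g\<in>carrier G. psi g * psi' g) \<in> ?Ch" "(\<lambda>g\<in>carrier G. psi g * inverse (psi' g)) \<in> ?Ch"
    if "psi \<in> ?Ch" "psi' \<in> ?Ch" for psi psi'
    using that by (auto simp: hom_def Pi_iff)
  have nz: "psi g \<noteq> 0" if "psi \<in> ?Ch" "g \<in> carrier G" for psi g using that by (auto simp: hom_def)
  have sumD: "(\<Sum>psi\<in>D. psi x) = 0" if x: "x \<in> carrier G" "x \<notin> K" for x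
  proof -
    obtain psi0 :: "'a \<Rightarrow> 'k" where p: "psi0 \<in> hom G units_grp" "\<forall>g\<in>K. psi0 g = 1" "psi0 x \<noteq> 1"
      using character_separates[OF fin K x] by blast
    define psi where "psi = restrict psi0 (carrier G)"
    have psi: "psi \<in> D" "psi x \<noteq> 1"
      using p x by (auto simp: psi_def D_def hom_def Pi_iff)
    have inD: "psi \<in> ?Ch" using psi by (simp add: D_def)
    \<comment> \<open>Multiplication by the separating character \<open>psi\<close> permutes
      \<open>D\<close>, so the sum equals \<open>psi x\<close> times itself.\<close>
    have "(\<Sum>phi\<in>D. phi x) = (\<Sum>phi\<in>D. psi x * phi x)"
    proof (rule sum.reindex_bij_witness[of _ "\<lambda>phi. \<lambda>g\<in>carrier G. psi g * phi g"
          "\<lambda>phi. \<lambda>g\<in>carrier G. phi g * inverse (psi g)"])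
      fix phi assume phi: "phi \<in> D"
      then have Ch: "phi \<in> ?Ch" by (simp add: D_def)
      show "(\<lambda>g\<in>carrier G. psi g * (\<lambda>g\<in>carrier G. phi g * inverse (psi g)) g) = phi"
        "(\<lambda>g\<in>carrier G. (\<lambda>g\<in>carrier G. psi g * phi g) g * inverse (psi g)) = phi"
        using Ch nz[OF inD] by (auto simp: fun_eq_iff extensional_def)
      show "(\<lambda>g\<in>carrier G. phi g * inverse (psi g)) \<in> D" "(\<lambda>g\<in>carrier G. psi g * phi g) \<in> D"
        using prod(1)[OF inD Ch] prod(2)[OF Ch inD] phi psi(1) by (auto simp: D_def)
      show "psi x * (\<lambda>g\<in>carrier G. phi g * inverse (psi g)) x = phi x"
        using nz[OF inD] x by simp
    qed
    also have "\<dots> = psi x * (\<Sum>phi\<in>D. phi x)" by (simp add: sum_distrib_left)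
    finally show ?thesis using psi(2) by simp
  qed
  \<comment> \<open>Every value on \<open>K\<close> is 1. Outside \<open>K\<close> the sum over
    \<open>D\<close> vanishes, so the sum may be extended to the whole group, where only the trivial
    character survives.\<close>
  have "of_nat (card K) * of_nat (card D) = (\<Sum>g\<in>K. \<Sum>psi\<in>D. psi g :: 'k)"
  proof -
    have "(\<Sum>g\<in>K. \<Sum>psi\<in>D. psi g) = (\<Sum>g\<in>K. \<Sum>psi\<in>D. 1 :: 'k)"
      by (intro sum.cong) (auto simp: D_def)
    then show ?thesis by simp
  qed
  also have "\<dots> = (\<Sum>g\<in>carrier G. \<Sum>psi\<in>D. psi g)"
    using fin(1) sumD by (intro sum.mono_neutral_left) auto
  also have "\<dots> = (\<Sum>psi\<in>D. \<Sum>g\<in>carrier G. psi g)" by (rule sum.swap)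
  also have "\<dots> = (\<Sum>psi\<in>{\<lambda>g\<in>carrier G. 1}. \<Sum>g\<in>carrier G. psi g)"
  proof (rule sum.mono_neutral_right[OF finD])
    show "{\<lambda>g\<in>carrier G. 1} \<subseteq> D" by (auto simp: D_def hom_def)
    show "\<forall>psi\<in>D - {\<lambda>g\<in>carrier G. 1}. (\<Sum>g\<in>carrier G. psi g) = 0"
    proof
      fix psi assume psi: "psi \<in> D - {\<lambda>g\<in>carrier G. 1}"
      then obtain g where "g \<in> carrier G" "psi g \<noteq> 1"
        by (auto simp: D_def fun_eq_iff extensional_def split: if_splits)
      then show "(\<Sum>g\<in>carrier G. psi g) = 0" using psi sum_nontrivial_character by (auto simp: D_def)
    qed
  qed
  also have "\<dots> = of_nat (card (carrier G))" by simp
  finally have cardD: "of_nat (card D) = (of_nat (card (carrier G)) / of_nat (card K) :: 'k)"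
    using fin(2) by (metis mult_eq_0_iff nonzero_mult_div_cancel_left)
  have "(\<Sum>phi\<in>{phi \<in> ?Ch. \<forall>g\<in>K. phi g = phi0 g}. phi x) = (\<Sum>psi\<in>D. phi0 x * psi x)"
  proof (rule sum.reindex_bij_witness[of _ "\<lambda>phi. \<lambda>g\<in>carrier G. phi0 g * phi g"
        "\<lambda>phi. \<lambda>g\<in>carrier G. phi g * inverse (phi0 g)"])
    fix phi assume phi: "phi \<in> {phi \<in> ?Ch. \<forall>g\<in>K. phi g = phi0 g}"
    then have Ch: "phi \<in> ?Ch" by blast
    show "(\<lambda>g\<in>carrier G. phi0 g * (\<lambda>g\<in>carrier G. phi g * inverse (phi0 g)) g) = phi"
      using Ch nz[OF phi0] by (auto simp: fun_eq_iff extensional_def)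
    show "(\<lambda>g\<in>carrier G. phi g * inverse (phi0 g)) \<in> D"
      using prod(2)[OF Ch phi0] phi nz[OF phi0] by (auto simp: D_def)
    show "phi0 x * (\<lambda>g\<in>carrier G. phi g * inverse (phi0 g)) x = phi x"
      using nz[OF phi0] x by simp
  next
    fix phi assume phi: "phi \<in> D"
    then have Ch: "phi \<in> ?Ch" by (simp add: D_def)
    show "(\<lambda>g\<in>carrier G. (\<lambda>g\<in>carrier G. phi0 g * phi g) g * inverse (phi0 g)) = phi"
      using Ch nz[OF phi0] by (auto simp: fun_eq_iff extensional_def)
    show "(\<lambda>g\<in>carrier G. phi0 g * phi g) \<in> {phi \<in> ?Ch. \<forall>g\<in>K. phi g = phi0 g}"
      using prod(1)[OF phi0 Ch] phi by (auto simp: D_def)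
  qed
  also have "\<dots> = phi0 x * (\<Sum>psi\<in>D. psi x)" by (simp add: sum_distrib_left)
  also have "(\<Sum>psi\<in>D. psi x) = (if x \<in> K then of_nat (card (carrier G)) / of_nat (card K) else 0)"
  proof (cases "x \<in> K")
    case True
    then have "(\<Sum>psi\<in>D. psi x) = (\<Sum>psi\<in>D. 1)" by (intro sum.cong) (auto simp: D_def)
    then show ?thesis using True cardD by simp
  qed (use sumD x in auto)
  finally show ?thesis by simp
qed

section \<open>Splitting off the matrix algebra\<close>

lemma (in group) subgroup_grp_center: "subgroup (grp_center G) G"
proof (rule subgroupI)
  show "grp_center G \<noteq> {}" using one_closed by (auto simp: grp_center_def intro!: exI[of _ \<one>])
  fix a assume a: "a \<in> grp_center G"
  then have ac: "a \<in> carrier G" "\<And>g. g \<in> carrier G \<Longrightarrow> a \<otimes> g = g \<otimes> a" by (auto simp: grp_center_def)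
  have "inv a \<otimes> g = g \<otimes> inv a" if g: "g \<in> carrier G" for g
  proof -
    have "inv a \<otimes> g = inv a \<otimes> (g \<otimes> a) \<otimes> inv a" using ac(1) g by (simp add: m_assoc)
    also have "\<dots> = inv a \<otimes> (a \<otimes> g) \<otimes> inv a" using ac(2)[OF g] by simp
    also have "\<dots> = g \<otimes> inv a" using ac(1) g by (simp add: m_assoc[symmetric])
    finally show ?thesis .
  qed
  then show "inv a \<in> grp_center G" using ac(1) by (simp add: grp_center_def)
  fix b assume "b \<in> grp_center G"
  then have bc: "b \<in> carrier G" "\<And>g. g \<in> carrier G \<Longrightarrow> b \<otimes> g = g \<otimes> b" by (auto simp: grp_center_def)
  have "a \<otimes> b \<otimes> g = g \<otimes> (a \<otimes> b)" if g: "g \<in> carrier G" for g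
    using ac bc g by (metis m_assoc)
  then show "a \<otimes> b \<in> grp_center G" using ac(1) bc(1) by (simp add: grp_center_def)
qed (auto simp: grp_center_def)

text \<open>The setting reduced to what the argument uses. \<open>K h\<close> plays the role of
  \<open>h\<close> and \<open>W i\<close> that of w_i; the whole algebra enters only through
  \<open>generated\<close> and the eigenvector rule \<open>K_W\<close>. The assumption
  \<open>gg\<close> is the defining equation of g_(psi,phi), evaluated at \<open>h\<close>.\<close>

locale twisted_action = R: field_algebra R + H: group H
  for R :: "('k::alg_closed_field, 'r) module" (structure) and H :: "('h, 'm) monoid_scheme" +
  fixes K :: "'h \<Rightarrow> 'r" and Z :: "'h set" and chi :: "'h \<Rightarrow> 'k"
    and phi0 :: "'h \<Rightarrow> 'k" and xi :: "('h \<Rightarrow> 'k) \<Rightarrow> 'h \<Rightarrow> 'k"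
    and I :: "'i set" and W :: "'i \<Rightarrow> 'r" and psi :: "'i \<Rightarrow> 'h \<Rightarrow> 'k" and gg :: "'i \<Rightarrow> ('h \<Rightarrow> 'k) \<Rightarrow> 'h"
  assumes finite_H: "finite (carrier H)" and card_H: "of_nat (card (carrier H)) \<noteq> (0::'k)"
    and K_closed [simp]: "h \<in> carrier H \<Longrightarrow> K h \<in> carrier R"
    and K_mult: "\<lbrakk>g \<in> carrier H; h \<in> carrier H\<rbrakk> \<Longrightarrow> K (g \<otimes>\<^bsub>H\<^esub> h) = K g \<otimes> K h"
    and K_one: "K \<one>\<^bsub>H\<^esub> = \<one>"
    and Z_subgroup: "subgroup Z H" and Z_center: "Z \<subseteq> grp_center H"
    and commutator_Z: "\<lbrakk>g \<in> carrier H; h \<in> carrier H\<rbrakk> \<Longrightarrow> grp_commutator H g h \<in> Z"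
    and chi_hom: "chi \<in> hom (H\<lparr>carrier := Z\<rparr>) units_grp" and chi_inj: "inj_on chi Z"
    and phi0: "phi0 \<in> chars_over H Z chi"
    and xi_hom: "phi \<in> chars_over H Z chi \<Longrightarrow> xi phi \<in> hom H units_grp"
    and xi_center: "\<lbrakk>phi \<in> chars_over H Z chi; z \<in> grp_center H\<rbrakk> \<Longrightarrow> xi phi z = phi z * inverse (phi0 z)"
    and W_closed [simp]: "i \<in> I \<Longrightarrow> W i \<in> carrier R"
    and psi_hom: "i \<in> I \<Longrightarrow> psi i \<in> hom H units_grp" and psi_Z: "\<lbrakk>i \<in> I; z \<in> Z\<rbrakk> \<Longrightarrow> psi i z = 1"
    and K_W: "\<lbrakk>h \<in> carrier H; i \<in> I\<rbrakk> \<Longrightarrow> K h \<otimes> W i = psi i h \<odot> (W i \<otimes> K h)"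
    and gg_closed [simp]: "\<lbrakk>i \<in> I; phi \<in> chars_over H Z chi\<rbrakk> \<Longrightarrow> gg i phi \<in> carrier H"
    and gg: "\<lbrakk>i \<in> I; phi \<in> chars_over H Z chi; h \<in> carrier H\<rbrakk> \<Longrightarrow>
      chi (grp_commutator H h (gg i phi)) =
        xi (char_twist H phi (psi i)) h * inverse (xi phi h) * inverse (psi i h)"
    and generated: "carrier R \<subseteq> gen_subalg R (K ` carrier H \<union> W ` I)"
begin

abbreviation C where "C \<equiv> grp_center H"
abbreviation Irr where "Irr \<equiv> chars_over H Z chi"

sublocale C: subgroup C H by (rule H.subgroup_grp_center)
sublocale Z: subgroup Z H by (rule Z_subgroup)

lemma C_commute: "\<lbrakk>z \<in> C; g \<in> carrier H\<rbrakk> \<Longrightarrow> z \<otimes>\<^bsub>H\<^esub> g = g \<otimes>\<^bsub>H\<^esub> z"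
  unfolding grp_center_def by blast

lemma comm_group_C: "comm_group (H\<lparr>carrier := C\<rparr>)"
proof -
  interpret C: group "H\<lparr>carrier := C\<rparr>" by (rule C.subgroup_is_group) (rule H.is_group)
  show ?thesis
  proof (rule C.group_comm_groupI)
    fix x y assume "x \<in> carrier (H\<lparr>carrier := C\<rparr>)" "y \<in> carrier (H\<lparr>carrier := C\<rparr>)"
    then show "x \<otimes>\<^bsub>H\<lparr>carrier := C\<rparr>\<^esub> y = y \<otimes>\<^bsub>H\<lparr>carrier := C\<rparr>\<^esub> x"
      using C_commute[of x y] C.subset by auto
  qed
qed

lemma finite_C: "finite C" and finite_Z: "finite Z"
  using finite_H C.subset Z.subset finite_subset by auto

lemma card_C: "of_nat (card C) \<noteq> (0::'k)" and card_Z: "of_nat (card Z) \<noteq> (0::'k)"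
proof -
  have "card N dvd card (carrier H)" if "subgroup N H" for N
    using H.lagrange[OF that] by (metis Coset.order_def dvd_triv_right)
  then have "of_nat (card N) \<noteq> (0::'k)" if "subgroup N H" for N
    using that card_H by (metis dvdE mult_eq_0_iff of_nat_mult)
  then show "of_nat (card C) \<noteq> (0::'k)" "of_nat (card Z) \<noteq> (0::'k)"
    using C.subgroup_axioms Z_subgroup by auto
qed

text \<open>Phrased for a subgroup \<open>N\<close> so that one set of rules serves
  \<open>Z\<close>, the center and \<open>H\<close> itself.\<close>

lemma hom_props:
  assumes "f \<in> hom (H\<lparr>carrier := N\<rparr>) (units_grp :: 'k monoid)" "subgroup N H"
  shows hom_times: "\<And>x y. x \<in> N \<Longrightarrow> y \<in> N \<Longrightarrow> f (x \<otimes>\<^bsub>H\<^esub> y) = f x * f y"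
    and hom_nz: "\<And>x. x \<in> N \<Longrightarrow> f x \<noteq> 0"
    and hom_inv: "\<And>x. x \<in> N \<Longrightarrow> f (inv\<^bsub>H\<^esub> x) = inverse (f x)"
    and hom_one: "f \<one>\<^bsub>H\<^esub> = 1"
proof -
  interpret N: subgroup N H by fact
  show m: "f (x \<otimes>\<^bsub>H\<^esub> y) = f x * f y" if "x \<in> N" "y \<in> N" for x y
    using that assms(1) by (auto simp: hom_def)
  show nz: "f x \<noteq> 0" if "x \<in> N" for x using that assms(1) by (auto simp: hom_def)
  show one: "f \<one>\<^bsub>H\<^esub> = 1" using m[of "\<one>\<^bsub>H\<^esub>" "\<one>\<^bsub>H\<^esub>"] nz[of "\<one>\<^bsub>H\<^esub>"] by simp
  show "f (inv\<^bsub>H\<^esub> x) = inverse (f x)" if x: "x \<in> N" for x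
    using m[of x "inv\<^bsub>H\<^esub> x"] x one nz[OF x] by (simp add: field_simps)
qed

lemma Irr_hom: "phi \<in> Irr \<Longrightarrow> phi \<in> hom (H\<lparr>carrier := C\<rparr>) units_grp"
  and Irr_chi: "phi \<in> Irr \<Longrightarrow> z \<in> Z \<Longrightarrow> phi z = chi z"
  by (auto simp: chars_over_def)

lemmas Irr_props = hom_props[OF Irr_hom C.subgroup_axioms]
lemmas chi_props = hom_props[OF chi_hom Z_subgroup]

lemma H_self: "f \<in> hom H units_grp \<Longrightarrow> f \<in> hom (H\<lparr>carrier := carrier H\<rparr>) units_grp"
  by simp

lemmas xi_props = hom_props[OF H_self[OF xi_hom] H.subgroup_self]
lemmas psi_props = hom_props[OF H_self[OF psi_hom] H.subgroup_self]

text \<open>\<open>psi i\<close> is trivial on \<open>Z\<close>, so the twist still restricts to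
  \<open>chi\<close> there.\<close>

lemma char_twist_Irr:
  assumes "phi \<in> Irr" "i \<in> I" shows "char_twist H phi (psi i) \<in> Irr"
  using assms Irr_props[OF assms(1)] psi_props[OF assms(2)] psi_Z[OF assms(2)] Z_center C.subset
  by (auto simp: chars_over_def char_twist_def hom_def Pi_iff subset_iff)

lemma finite_Irr: "finite Irr"
proof -
  interpret CG: comm_group "H\<lparr>carrier := C\<rparr>" by (rule comm_group_C)
  show ?thesis
    using CG.finite_characters[where 'k = 'k] finite_C
    by (auto simp: chars_over_def intro: rev_finite_subset)
qed

section \<open>The idempotents attached to characters of Z and of the center\<close>

definition avg :: "'h set \<Rightarrow> ('h \<Rightarrow> 'k) \<Rightarrow> 'r" where
  "avg N f = (\<Oplus>z\<in>N. (inverse (of_nat (card N)) * f (inv\<^bsub>H\<^esub> z)) \<odot> K z)"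

abbreviation E where "E \<equiv> avg C"
definition e where "e = avg Z chi"

lemma avg_closed [simp]: "N \<subseteq> carrier H \<Longrightarrow> avg N f \<in> carrier R"
  unfolding avg_def by (auto intro!: R.finsum_closed)

lemma E_closed [simp]: "E f \<in> carrier R" and e_closed [simp]: "e \<in> carrier R"
  by (simp_all add: C.subset Z.subset e_def)

text \<open>Multiplication by \<open>z0\<close> permutes \<open>N\<close> and shifts the
  coefficients by the factor \<open>f z0\<close>.\<close>

lemma K_avg:
  assumes N: "subgroup N H" and f: "f \<in> hom (H\<lparr>carrier := N\<rparr>) units_grp" and z0: "z0 \<in> N"
  shows "K z0 \<otimes> avg N f = f z0 \<odot> avg N f"
proof -
  interpret N: subgroup N H by fact
  have fin: "finite N" using finite_H N.subset finite_subset by blast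
  have z0': "z0 \<in> carrier H" using z0 by simp
  let ?c = "\<lambda>z. inverse (of_nat (card N)) * f (inv\<^bsub>H\<^esub> z)"
  have img: "(\<lambda>z. z0 \<otimes>\<^bsub>H\<^esub> z) ` N = N"
  proof (intro equalityI subsetI)
    fix z assume "z \<in> N"
    then show "z \<in> (\<lambda>z. z0 \<otimes>\<^bsub>H\<^esub> z) ` N"
      using z0 by (intro image_eqI[of _ _ "inv\<^bsub>H\<^esub> z0 \<otimes>\<^bsub>H\<^esub> z"]) (auto simp: H.m_assoc[symmetric])
  qed (use z0 in auto)
  have "f z0 \<odot> avg N f = (\<Oplus>z\<in>N. f z0 \<odot> (?c z \<odot> K z))"
    unfolding avg_def by (intro R.finsum_smult_right) auto
  also have "\<dots> = (\<Oplus>z\<in>(\<lambda>z. z0 \<otimes>\<^bsub>H\<^esub> z) ` N. f z0 \<odot> (?c z \<odot> K z))" by (simp only: img)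
  also have "\<dots> = (\<Oplus>z\<in>N. f z0 \<odot> (?c (z0 \<otimes>\<^bsub>H\<^esub> z) \<odot> K (z0 \<otimes>\<^bsub>H\<^esub> z)))"
    using z0 by (intro R.finsum_reindex) (auto simp: inj_on_def)
  also have "\<dots> = (\<Oplus>z\<in>N. K z0 \<otimes> (?c z \<odot> K z))"
  proof (rule R.finsum_cong')
    fix z assume z: "z \<in> N"
    have "f (inv\<^bsub>H\<^esub> (z0 \<otimes>\<^bsub>H\<^esub> z)) = f (inv\<^bsub>H\<^esub> z) * inverse (f z0)"
      using z z0 by (simp add: H.inv_mult_group hom_props[OF f N])
    then show "f z0 \<odot> (?c (z0 \<otimes>\<^bsub>H\<^esub> z) \<odot> K (z0 \<otimes>\<^bsub>H\<^esub> z)) = K z0 \<otimes> (?c z \<odot> K z)"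
      using z z0 hom_nz[OF f N z0] by (simp add: K_mult R.smult_smult R.smult_mult_right) (simp add: field_simps)
  qed (use z0 in auto)
  also have "\<dots> = K z0 \<otimes> avg N f"
    unfolding avg_def using fin z0 by (intro R.finsum_rdistr[symmetric]) auto
  finally show ?thesis by simp
qed

lemma K_avg_commute:
  assumes N: "N \<subseteq> C" and h: "h \<in> carrier H"
  shows "K h \<otimes> avg N f = avg N f \<otimes> K h"
proof -
  have fin: "finite N" "N \<subseteq> carrier H" using finite_C C.subset N finite_subset by auto
  let ?c = "\<lambda>z. inverse (of_nat (card N)) * f (inv\<^bsub>H\<^esub> z)"
  have "K h \<otimes> avg N f = (\<Oplus>z\<in>N. K h \<otimes> (?c z \<odot> K z))"
    unfolding avg_def using fin h by (intro R.finsum_rdistr) auto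
  also have "\<dots> = (\<Oplus>z\<in>N. (?c z \<odot> K z) \<otimes> K h)"
  proof (rule R.finsum_cong')
    fix z assume z: "z \<in> N"
    have "K h \<otimes> K z = K z \<otimes> K h"
      using z N h fin C_commute[of z h] by (simp add: K_mult[symmetric] subset_iff)
    then show "K h \<otimes> (?c z \<odot> K z) = (?c z \<odot> K z) \<otimes> K h"
      using z fin h by (simp add: R.smult_mult_left R.smult_mult_right subset_iff)
  qed (use fin h in auto)
  also have "\<dots> = avg N f \<otimes> K h"
    unfolding avg_def using fin h by (intro R.finsum_ldistr[symmetric]) auto
  finally show ?thesis .
qed

text \<open>Moving \<open>W i\<close> across \<open>K z\<close> costs the factor psi_i(z^-1). The
  coefficients of \<open>avg\<close> involve \<open>f\<close> at z^-1 too, so this factor is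
  absorbed by twisting \<open>f\<close> with \<open>psi i\<close>. Over \<open>Z\<close> the twist
  is trivial, over the center it permutes the blocks.\<close>

lemma W_avg:
  assumes N: "N \<subseteq> carrier H" and i: "i \<in> I"
  shows "W i \<otimes> avg N f = avg N (\<lambda>z. f z * psi i z) \<otimes> W i"
proof -
  have fin: "finite N" using finite_H N finite_subset by auto
  let ?c = "\<lambda>z. inverse (of_nat (card N)) * f (inv\<^bsub>H\<^esub> z)"
  have "W i \<otimes> avg N f = (\<Oplus>z\<in>N. W i \<otimes> (?c z \<odot> K z))"
    unfolding avg_def using fin N i by (intro R.finsum_rdistr) auto
  also have "\<dots> = (\<Oplus>z\<in>N. ((inverse (of_nat (card N)) * (f (inv\<^bsub>H\<^esub> z) * psi i (inv\<^bsub>H\<^esub> z))) \<odot> K z) \<otimes> W i)"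
  proof (rule R.finsum_cong')
    fix z assume z: "z \<in> N"
    then have zH: "z \<in> carrier H" using N by auto
    have "W i \<otimes> K z = psi i (inv\<^bsub>H\<^esub> z) \<odot> (K z \<otimes> W i)"
      using zH i psi_props(2)[OF i, of z] by (simp add: K_W R.smult_smult psi_props(3))
    then show "W i \<otimes> (?c z \<odot> K z) =
        ((inverse (of_nat (card N)) * (f (inv\<^bsub>H\<^esub> z) * psi i (inv\<^bsub>H\<^esub> z))) \<odot> K z) \<otimes> W i"
      using zH i by (simp add: R.smult_mult_left R.smult_mult_right R.smult_smult mult.assoc)
  qed (use N i in auto)
  also have "\<dots> = avg N (\<lambda>z. f z * psi i z) \<otimes> W i"
    unfolding avg_def using fin N i by (intro R.finsum_ldistr[symmetric]) auto
  finally show ?thesis .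
qed

lemma avg_cong: "subgroup N H \<Longrightarrow> (\<And>z. z \<in> N \<Longrightarrow> f z = f' z) \<Longrightarrow> avg N f = avg N f'"
  unfolding avg_def using subgroup.subset[of N H]
  by (intro R.finsum_cong') (auto simp: subgroup.m_inv_closed)

lemma W_E: "\<lbrakk>i \<in> I; phi \<in> Irr\<rbrakk> \<Longrightarrow> W i \<otimes> E phi = E (char_twist H phi (psi i)) \<otimes> W i"
  by (simp add: W_avg C.subset avg_cong[OF C.subgroup_axioms, of "\<lambda>z. phi z * psi i z" "char_twist H phi (psi i)"]
      char_twist_def)

lemma W_e: "i \<in> I \<Longrightarrow> W i \<otimes> e = e \<otimes> W i"
  by (simp add: e_def W_avg Z.subset avg_cong[OF Z_subgroup, of "\<lambda>z. chi z * psi i z" chi] psi_Z)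

lemmas K_E = K_avg[OF C.subgroup_axioms Irr_hom] and K_E_commute = K_avg_commute[OF subset_refl]
lemmas K_e = K_avg[OF Z_subgroup chi_hom, folded e_def]
  and K_e_commute = K_avg_commute[OF Z_center, of _ chi, folded e_def]

lemma E_E:
  assumes "phi \<in> Irr" "rho \<in> Irr"
  shows "E rho \<otimes> E phi = (if phi = rho then E phi else \<zero>)"
proof -
  interpret CG: comm_group "H\<lparr>carrier := C\<rparr>" by (rule comm_group_C)
  let ?c = "\<lambda>z. inverse (of_nat (card C)) * rho (inv\<^bsub>H\<^esub> z)"
  have CH: "z \<in> C \<Longrightarrow> z \<in> carrier H" for z using C.subset by auto
  have "E rho \<otimes> E phi = (\<Oplus>z\<in>C. (?c z \<odot> K z) \<otimes> E phi)"
    unfolding avg_def[of C rho] using finite_C CH by (intro R.finsum_ldistr) auto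
  also have "\<dots> = (\<Oplus>z\<in>C. (?c z * phi z) \<odot> E phi)"
    by (rule R.finsum_cong') (auto simp: CH R.smult_mult_left K_E[OF assms(1)] R.smult_smult)
  also have "\<dots> = (\<Sum>z\<in>C. ?c z * phi z) \<odot> E phi"
    using finite_C by (intro R.finsum_smult_left) auto
  also have "(\<Sum>z\<in>C. ?c z * phi z) = inverse (of_nat (card C)) * (\<Sum>z\<in>C. inverse (rho z) * phi z)"
    by (auto simp: sum_distrib_left Irr_props(3)[OF assms(2)] mult.assoc intro!: sum.cong)
  also have "(\<Sum>z\<in>C. inverse (rho z) * phi z) = (if phi = rho then of_nat (card C) else 0)"
  proof (cases "phi = rho")
    case True
    then have "(\<Sum>z\<in>C. inverse (rho z) * phi z) = (\<Sum>z\<in>C. 1)"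
      using Irr_props(2)[OF assms(2)] by (intro sum.cong) auto
    then show ?thesis using True by simp
  next
    case False
    have "phi \<in> extensional C" "rho \<in> extensional C" using assms by (auto simp: chars_over_def)
    \<comment> \<open>Both characters are extensional on the center, so being different they differ
      at some central element.\<close>
    then obtain z where z: "z \<in> C" "phi z \<noteq> rho z" using False by (metis extensionalityI)
    have "(\<lambda>z. inverse (rho z) * phi z) \<in> hom (H\<lparr>carrier := C\<rparr>) units_grp"
      using Irr_props[OF assms(1)] Irr_props[OF assms(2)] by (auto simp: hom_def)
    from CG.sum_nontrivial_character[OF this, of z] z Irr_props(2)[OF assms(2) z(1)] show ?thesis
      using False by (auto simp: field_simps)
  qed
  finally show ?thesis using card_C by simp
qed

text \<open>After interchanging the sums, the coefficient of \<open>K z\<close> is 1/|C| times the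
  sum of all phi(z^-1). By \<open>sum_characters_over\<close> this is chi(z^-1)/|Z| for
  \<open>z\<close> in \<open>Z\<close> and zero for the other central elements.\<close>

lemma sum_E: "(\<Oplus>phi\<in>Irr. E phi) = e"
proof -
  interpret CG: comm_group "H\<lparr>carrier := C\<rparr>" by (rule comm_group_C)
  have CH: "z \<in> C \<Longrightarrow> z \<in> carrier H" for z using C.subset by auto
  have ZG: "subgroup Z (H\<lparr>carrier := C\<rparr>)"
    by (rule H.subgroup_incl[OF Z_subgroup C.subgroup_axioms Z_center])
  let ?Ch = "hom (H\<lparr>carrier := C\<rparr>) (units_grp :: 'k monoid) \<inter> extensional C"
  have Irr: "Irr = {phi \<in> ?Ch. \<forall>g\<in>Z. phi g = phi0 g}"
    using Irr_chi[OF phi0] by (auto simp: chars_over_def)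
  have phi0_Ch: "phi0 \<in> ?Ch" using phi0 by (simp add: Irr)
  have sum: "(\<Sum>phi\<in>Irr. phi z) = (if z \<in> Z then of_nat (card C) / of_nat (card Z) * chi z else 0)"
    if "z \<in> C" for z
    using CG.sum_characters_over[of Z phi0 z] finite_C card_C ZG phi0_Ch that
    unfolding Irr by (simp add: Irr_chi[OF phi0])
  let ?d = "inverse (of_nat (card C)) :: 'k"
  have "(\<Oplus>phi\<in>Irr. E phi) = (\<Oplus>z\<in>C. \<Oplus>phi\<in>Irr. (?d * phi (inv\<^bsub>H\<^esub> z)) \<odot> K z)"
    unfolding avg_def using finite_C finite_Irr CH by (intro R.finsum_swap) auto
  also have "\<dots> = (\<Oplus>z\<in>C. (\<Sum>phi\<in>Irr. ?d * phi (inv\<^bsub>H\<^esub> z)) \<odot> K z)"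
    using finite_Irr CH by (intro R.finsum_cong' R.finsum_smult_left) auto
  also have "\<dots> = (\<Oplus>z\<in>C. (if z \<in> Z then inverse (of_nat (card Z)) * chi (inv\<^bsub>H\<^esub> z) else 0) \<odot> K z)"
  proof (rule R.finsum_cong')
    fix z assume z: "z \<in> C"
    have "inv\<^bsub>H\<^esub> z \<in> Z \<longleftrightarrow> z \<in> Z" using z CH Z.m_inv_closed by (metis H.inv_inv)
    then have "(\<Sum>phi\<in>Irr. ?d * phi (inv\<^bsub>H\<^esub> z)) = (if z \<in> Z then inverse (of_nat (card Z)) * chi (inv\<^bsub>H\<^esub> z) else 0)"
      unfolding sum_distrib_left[symmetric] using sum[of "inv\<^bsub>H\<^esub> z"] z card_C by (auto simp: field_simps)
    then show "(\<Sum>phi\<in>Irr. ?d * phi (inv\<^bsub>H\<^esub> z)) \<odot> K z =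
        (if z \<in> Z then inverse (of_nat (card Z)) * chi (inv\<^bsub>H\<^esub> z) else 0) \<odot> K z" by simp
  qed (use CH in auto)
  also have "\<dots> = (\<Oplus>z\<in>Z. (if z \<in> Z then inverse (of_nat (card Z)) * chi (inv\<^bsub>H\<^esub> z) else 0) \<odot> K z)"
    using finite_C Z_center CH by (intro R.finsum_mono_neutral[symmetric]) auto
  also have "\<dots> = e"
    unfolding e_def avg_def using Z.subset by (intro R.finsum_cong') auto
  finally show ?thesis .
qed

lemma times_e:
  assumes "x \<in> carrier R"
  shows "x \<otimes> e = (\<Oplus>phi\<in>Irr. x \<otimes> E phi)" "e \<otimes> x = (\<Oplus>phi\<in>Irr. E phi \<otimes> x)"
  unfolding sum_E[symmetric] using assms finite_Irr
  by (auto intro!: R.finsum_rdistr R.finsum_ldistr)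

lemma E_sum:
  assumes "phi \<in> Irr" "F \<in> Irr \<rightarrow> carrier R"
  shows "(\<Oplus>rho\<in>Irr. F rho \<otimes> E rho) \<otimes> E phi = F phi \<otimes> E phi"
proof -
  have "(\<Oplus>rho\<in>Irr. F rho \<otimes> E rho) \<otimes> E phi = (\<Oplus>rho\<in>Irr. F rho \<otimes> E rho \<otimes> E phi)"
    using assms finite_Irr by (intro R.finsum_ldistr) auto
  also have "\<dots> = (\<Oplus>rho\<in>Irr. if phi = rho then F rho \<otimes> E rho else \<zero>)"
    using assms by (intro R.finsum_cong') (auto simp: R.m_assoc E_E Pi_iff)
  also have "\<dots> = F phi \<otimes> E phi"
    using assms finite_Irr by (intro R.finsum_singleton) auto
  finally show ?thesis .
qed

lemma e_E: "phi \<in> Irr \<Longrightarrow> e \<otimes> E phi = E phi"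
  using E_sum[of phi "\<lambda>_. \<one>"] by (simp add: sum_E)

lemma E_e: "phi \<in> Irr \<Longrightarrow> E phi \<otimes> e = E phi"
proof -
  assume phi: "phi \<in> Irr"
  have "E phi \<otimes> e = (\<Oplus>rho\<in>Irr. if phi = rho then E rho else \<zero>)"
    unfolding times_e(1)[OF E_closed] using phi by (intro R.finsum_cong') (auto simp: E_E)
  also have "\<dots> = E phi" using phi finite_Irr by (intro R.finsum_singleton) auto
  finally show ?thesis .
qed

lemma e_e: "e \<otimes> e = e"
proof -
  have "e \<otimes> e = (\<Oplus>phi\<in>Irr. E phi)"
    unfolding times_e(1)[OF e_closed] by (intro R.finsum_cong') (auto simp: e_E)
  then show ?thesis by (simp add: sum_E)
qed

text \<open>It suffices to commute with generators: with \<open>K h\<close> because \<open>Z\<close>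
  is central, and with \<open>W i\<close> because \<open>psi i\<close> is trivial on
  \<open>Z\<close>.\<close>

lemma e_central:
  assumes "x \<in> carrier R" shows "e \<otimes> x = x \<otimes> e"
proof -
  have gens: "K ` carrier H \<union> W ` I \<subseteq> carrier R" by auto
  have "x \<in> gen_subalg R (K ` carrier H \<union> W ` I)" using assms generated by auto
  then show ?thesis
  proof induction
    case (gen x)
    then show ?case by (auto simp: K_e_commute W_e)
  next
    case (mult x y)
    have c: "x \<in> carrier R" "y \<in> carrier R" using mult.hyps R.gen_subalg_carrier[OF gens] by auto
    have "e \<otimes> (x \<otimes> y) = x \<otimes> (e \<otimes> y)"
      using c mult.IH(1) R.m_assoc[of e x y] R.m_assoc[of x e y] by simp
    also have "\<dots> = x \<otimes> y \<otimes> e" using c mult.IH(2) R.m_assoc[of x y e] by simp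
    finally show ?case .
  qed (use R.gen_subalg_carrier[OF gens] in
      \<open>auto simp: R.l_distr R.r_distr R.smult_mult_left R.smult_mult_right subset_iff\<close>)
qed

section \<open>The corner algebra and the elements m_h\<close>

abbreviation B where "B \<equiv> corner_alg R e"

lemma B_simps [simp]:
  "monoid.mult B = monoid.mult R" "add B = add R" "ring.zero B = ring.zero R"
  "module.smult B = module.smult R" "one B = e"
  by (simp_all add: corner_alg_def)

lemma B_carrier: "x \<in> carrier B \<longleftrightarrow> x \<in> carrier R \<and> x \<otimes> e = x"
proof
  assume "x \<in> carrier B"
  then obtain y where "y \<in> carrier R" "x = y \<otimes> e" by (auto simp: corner_alg_def)
  then show "x \<in> carrier R \<and> x \<otimes> e = x" by (simp add: R.m_assoc e_e)
next
  assume "x \<in> carrier R \<and> x \<otimes> e = x"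
  then have "x \<in> (\<lambda>x. x \<otimes> e) ` carrier R" by (metis image_eqI)
  then show "x \<in> carrier B" by (simp add: corner_alg_def)
qed

lemma B_field_algebra: "field_algebra B"
  by (rule R.corner_algebra[OF e_closed e_e e_central]) (simp_all add: corner_alg_def)

sublocale B: field_algebra B by (rule B_field_algebra)

lemma finsum_B:
  assumes "f \<in> T \<rightarrow> carrier B" shows "(\<Oplus>\<^bsub>B\<^esub>t\<in>T. f t) = (\<Oplus>t\<in>T. f t)"
  using finsum_hom[OF B.abelian_group_axioms R.abelian_group_axioms, of "\<lambda>x. x" f T] assms
  by (simp add: B_carrier)

text \<open>An element of \<open>B\<close> equals its product with \<open>e\<close>, the sum of the
  \<open>E phi\<close>, so equations in \<open>B\<close> can be verified block by block.\<close>

lemma B_eqI: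
  assumes "x \<in> carrier B" "y \<in> carrier B" "\<And>phi. phi \<in> Irr \<Longrightarrow> x \<otimes> E phi = y \<otimes> E phi"
  shows "x = y"
proof -
  have "x \<otimes> e = y \<otimes> e"
    unfolding times_e(1)[OF assms(1)[unfolded B_carrier, THEN conjunct1]]
      times_e(1)[OF assms(2)[unfolded B_carrier, THEN conjunct1]]
    using assms(2,3) by (intro R.finsum_cong') (auto simp: B_carrier)
  then show ?thesis using assms(1,2) unfolding B_carrier by metis
qed

definition m :: "'h \<Rightarrow> 'r" where
  "m h = (\<Oplus>phi\<in>Irr. inverse (xi phi h) \<odot> (K h \<otimes> E phi))"

lemma m_R [simp]: "h \<in> carrier H \<Longrightarrow> m h \<in> carrier R"
  unfolding m_def by (intro R.finsum_closed) auto

lemma m_E: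
  assumes "h \<in> carrier H" "phi \<in> Irr"
  shows "m h \<otimes> E phi = inverse (xi phi h) \<odot> (K h \<otimes> E phi)"
proof -
  have "m h = (\<Oplus>phi\<in>Irr. (inverse (xi phi h) \<odot> K h) \<otimes> E phi)"
    unfolding m_def using assms by (intro R.finsum_cong') (auto simp: R.smult_mult_left)
  then have "m h \<otimes> E phi = (inverse (xi phi h) \<odot> K h) \<otimes> E phi"
    using E_sum[OF assms(2), of "\<lambda>rho. inverse (xi rho h) \<odot> K h"] assms(1) by auto
  then show ?thesis using assms by (simp add: R.smult_mult_left)
qed

lemma E_m:
  assumes "h \<in> carrier H" "phi \<in> Irr"
  shows "E phi \<otimes> m h = m h \<otimes> E phi"
proof -
  have "E phi \<otimes> m h = (\<Oplus>rho\<in>Irr. E phi \<otimes> (inverse (xi rho h) \<odot> (K h \<otimes> E rho)))"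
    unfolding m_def using assms finite_Irr by (intro R.finsum_rdistr) auto
  also have "\<dots> = (\<Oplus>rho\<in>Irr. (inverse (xi rho h) \<odot> (K h \<otimes> E rho)) \<otimes> E phi)"
  proof (rule R.finsum_cong')
    fix rho assume rho: "rho \<in> Irr"
    have "E phi \<otimes> (K h \<otimes> E rho) = K h \<otimes> (E phi \<otimes> E rho)"
      using assms by (simp add: R.m_assoc[symmetric] K_E_commute[symmetric])
    also have "\<dots> = K h \<otimes> E rho \<otimes> E phi"
      using assms rho by (simp add: R.m_assoc E_E)
    finally show "E phi \<otimes> (inverse (xi rho h) \<odot> (K h \<otimes> E rho)) =
        (inverse (xi rho h) \<odot> (K h \<otimes> E rho)) \<otimes> E phi"
      using assms by (simp add: R.smult_mult_left R.smult_mult_right)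
  qed (use assms in auto)
  also have "\<dots> = m h \<otimes> E phi"
    unfolding m_def using assms finite_Irr by (intro R.finsum_ldistr[symmetric]) auto
  finally show ?thesis .
qed

lemma m_B [simp]: "h \<in> carrier H \<Longrightarrow> m h \<in> carrier B"
proof -
  assume h: "h \<in> carrier H"
  have "m h \<otimes> e = (\<Oplus>phi\<in>Irr. m h \<otimes> E phi)" using h by (simp add: times_e)
  also have "\<dots> = m h" unfolding m_def[of h] by (rule R.finsum_cong') (auto simp: h m_E[unfolded m_def])
  finally show ?thesis using h by (simp add: B_carrier)
qed

lemma e_B [simp]: "e \<in> carrier B" and E_B [simp]: "phi \<in> Irr \<Longrightarrow> E phi \<in> carrier B"
  by (simp_all add: B_carrier e_e E_e)

text \<open>On each block \<open>m h\<close> is a multiple of \<open>K h\<close>, with a factor that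
  is multiplicative in \<open>h\<close>, and \<open>K h\<close> commutes with the block
  idempotents.\<close>

lemma m_mult:
  assumes "g \<in> carrier H" "h \<in> carrier H" shows "m (g \<otimes>\<^bsub>H\<^esub> h) = m g \<otimes> m h"
proof (rule B_eqI)
  show "m g \<otimes> m h \<in> carrier B" using B.m_closed[of "m g" "m h"] assms by simp
  fix phi assume phi: "phi \<in> Irr"
  have "m g \<otimes> m h \<otimes> E phi = inverse (xi phi h) \<odot> (m g \<otimes> (K h \<otimes> E phi))"
    using assms phi by (simp add: R.m_assoc m_E R.smult_mult_right)
  also have "\<dots> = inverse (xi phi h) \<odot> (m g \<otimes> E phi \<otimes> K h)"
    using assms by (simp add: K_E_commute R.m_assoc)
  also have "\<dots> = (inverse (xi phi h) * inverse (xi phi g)) \<odot> (K g \<otimes> E phi \<otimes> K h)"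
    using assms phi by (simp add: m_E R.smult_mult_left R.smult_smult)
  also have "\<dots> = inverse (xi phi (g \<otimes>\<^bsub>H\<^esub> h)) \<odot> (K (g \<otimes>\<^bsub>H\<^esub> h) \<otimes> E phi)"
    using assms phi by (simp add: R.m_assoc K_E_commute[symmetric] K_mult xi_props(1) mult.commute)
  also have "\<dots> = m (g \<otimes>\<^bsub>H\<^esub> h) \<otimes> E phi" using assms phi by (simp add: m_E)
  finally show "m (g \<otimes>\<^bsub>H\<^esub> h) \<otimes> E phi = m g \<otimes> m h \<otimes> E phi" by simp
qed (use assms in simp)

text \<open>On the block of \<open>phi\<close>, \<open>K z\<close> acts by phi(z) and
  \<open>xi phi z\<close> is phi(z)/phi0(z). The quotient phi0(z) is the same on all blocks, which
  is what the choice of the \<open>xi phi\<close> achieves.\<close>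

lemma m_center: "z \<in> C \<Longrightarrow> m z = phi0 z \<odot> e"
proof -
  assume z: "z \<in> C"
  then have zH: "z \<in> carrier H" using C.subset by auto
  show ?thesis
  proof (rule B_eqI)
    show "phi0 z \<odot> e \<in> carrier B" using B.smult_closed[OF e_B] by simp
    fix phi assume phi: "phi \<in> Irr"
    show "m z \<otimes> E phi = phi0 z \<odot> e \<otimes> E phi"
      using z zH phi Irr_props(2)[OF phi z] Irr_props(2)[OF phi0 z]
      by (simp add: m_E K_E xi_center R.smult_smult R.smult_mult_left e_E field_simps)
  qed (use zH in simp)
qed

lemma m_one: "m \<one>\<^bsub>H\<^esub> = e"
  using m_center[of "\<one>\<^bsub>H\<^esub>"] Irr_props(4)[OF phi0] by simp

definition V where "V i phi = K (gg i phi) \<otimes> W i \<otimes> E phi"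

lemma V_B [simp]: "\<lbrakk>i \<in> I; phi \<in> Irr\<rbrakk> \<Longrightarrow> V i phi \<in> carrier B"
  by (simp add: B_carrier V_def R.m_assoc E_e)

lemma V_R [simp]: "\<lbrakk>i \<in> I; phi \<in> Irr\<rbrakk> \<Longrightarrow> V i phi \<in> carrier R"
  using V_B B_carrier by blast

text \<open>\<open>W i\<close> carries the block of \<open>phi\<close> to that of its twist, and the
  group element in front commutes with block idempotents. So left multiplication of
  \<open>V i phi\<close> by \<open>m h\<close> only sees the twisted block.\<close>

lemma E_V:
  assumes "i \<in> I" "phi \<in> Irr"
  shows "E (char_twist H phi (psi i)) \<otimes> V i phi = V i phi"
proof -
  let ?t = "char_twist H phi (psi i)"
  have t: "?t \<in> Irr" using assms by (simp add: char_twist_Irr)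
  have "V i phi = K (gg i phi) \<otimes> (E ?t \<otimes> W i)"
    using assms by (simp add: V_def R.m_assoc W_E)
  also have "\<dots> = E ?t \<otimes> (K (gg i phi) \<otimes> W i)"
    using assms by (simp add: R.m_assoc[symmetric] K_E_commute)
  finally have V: "V i phi = E ?t \<otimes> (K (gg i phi) \<otimes> W i)" .
  have "E ?t \<otimes> V i phi = E ?t \<otimes> E ?t \<otimes> (K (gg i phi) \<otimes> W i)"
    unfolding V using assms by (simp add: R.m_assoc)
  then show ?thesis unfolding E_E[OF t t] using V by simp
qed

text \<open>With t the twist of phi by psi_i and Y the monomial below, the left side is xi_t(h)^-1
  chi([h,g]) Y and the right side is xi_phi(h)^-1 psi_i(h)^-1 Y. The assumption \<open>gg\<close>
  says precisely that these scalars agree.\<close>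

lemma m_V:
  assumes i: "i \<in> I" and phi: "phi \<in> Irr" and h: "h \<in> carrier H"
  shows "m h \<otimes> V i phi = V i phi \<otimes> m h"
proof -
  let ?t = "char_twist H phi (psi i)" and ?g = "gg i phi"
  define c where "c = grp_commutator H h ?g"
  have g: "?g \<in> carrier H" using i phi by simp
  have t: "?t \<in> Irr" using assms by (simp add: char_twist_Irr)
  have c: "c \<in> Z" "c \<in> C" "c \<in> carrier H" "chi c \<noteq> 0"
    using commutator_Z[OF h g] Z_center Z.subset chi_props(2) by (auto simp: c_def)
  have hg: "h \<otimes>\<^bsub>H\<^esub> ?g = ?g \<otimes>\<^bsub>H\<^esub> h \<otimes>\<^bsub>H\<^esub> c"
  proof -
    have "h \<otimes>\<^bsub>H\<^esub> ?g = c \<otimes>\<^bsub>H\<^esub> (?g \<otimes>\<^bsub>H\<^esub> h)"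
    proof -
      have "inv\<^bsub>H\<^esub> ?g \<otimes>\<^bsub>H\<^esub> (?g \<otimes>\<^bsub>H\<^esub> h) = h"
        using h g by (simp add: H.m_assoc[symmetric])
      then show ?thesis using h g by (simp add: c_def grp_commutator_def H.m_assoc)
    qed
    then show ?thesis using C_commute[OF c(2), of "?g \<otimes>\<^bsub>H\<^esub> h"] h g by simp
  qed
  \<comment> \<open>The common monomial of which both products turn out to be multiples.\<close>
  let ?Y = "K ?g \<otimes> K h \<otimes> W i \<otimes> E phi"
  have Y: "?Y \<in> carrier R" using g h i by simp
  have "K h \<otimes> V i phi = K (h \<otimes>\<^bsub>H\<^esub> ?g) \<otimes> W i \<otimes> E phi"
    using g h i by (simp add: V_def K_mult R.m_assoc)
  also have "\<dots> = K ?g \<otimes> K h \<otimes> (K c \<otimes> W i) \<otimes> E phi"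
    unfolding hg using g h i c by (simp add: K_mult R.m_assoc)
  \<comment> \<open>The commutator \<open>c\<close> lies in \<open>Z\<close>: it passes
    \<open>W i\<close> because \<open>psi i\<close> is trivial there, and it acts on the block of
    \<open>phi\<close> by the scalar \<open>chi c\<close>.\<close>
  also have "K c \<otimes> W i = W i \<otimes> K c" using K_W[OF c(3) i] psi_Z[OF i c(1)] c i by simp
  also have "K ?g \<otimes> K h \<otimes> (W i \<otimes> K c) \<otimes> E phi = K ?g \<otimes> K h \<otimes> W i \<otimes> (K c \<otimes> E phi)"
    using g h i c by (simp add: R.m_assoc)
  also have "K c \<otimes> E phi = chi c \<odot> E phi" using K_E[OF phi c(2)] Irr_chi[OF phi c(1)] by simp
  finally have KV: "K h \<otimes> V i phi = chi c \<odot> ?Y" using g h i by (simp add: R.smult_mult_right)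
  have "m h \<otimes> V i phi = m h \<otimes> E ?t \<otimes> V i phi"
    using h i phi E_V[OF i phi] by (simp add: R.m_assoc)
  also have "\<dots> = inverse (xi ?t h) \<odot> (K h \<otimes> E ?t \<otimes> V i phi)"
    using h i phi t by (simp add: m_E R.smult_mult_left)
  also have "\<dots> = (inverse (xi ?t h) * chi c) \<odot> ?Y"
    using h i phi Y E_V[OF i phi] by (simp add: R.m_assoc[of "K h"] KV R.smult_smult)
  also have "inverse (xi ?t h) * chi c = inverse (xi phi h) * inverse (psi i h)"
    using gg[OF i phi h] xi_props(2)[OF t h] by (simp add: c_def)
  finally have 1: "m h \<otimes> V i phi = (inverse (xi phi h) * inverse (psi i h)) \<odot> ?Y" .
  have WK: "W i \<otimes> K h = inverse (psi i h) \<odot> (K h \<otimes> W i)"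
    using K_W[OF h i] psi_props(2)[OF i h] h i by (simp add: R.smult_smult)
  have "V i phi \<otimes> m h = K ?g \<otimes> W i \<otimes> (m h \<otimes> E phi)"
    using g h i phi by (simp add: V_def R.m_assoc E_m)
  also have "\<dots> = inverse (xi phi h) \<odot> (K ?g \<otimes> (W i \<otimes> K h) \<otimes> E phi)"
    using g h i phi by (simp add: m_E R.smult_mult_right R.m_assoc)
  also have "\<dots> = (inverse (xi phi h) * inverse (psi i h)) \<odot> ?Y"
    unfolding WK using g h i phi
    by (simp add: R.smult_mult_right R.smult_mult_left R.smult_smult R.m_assoc)
  finally show ?thesis using 1 by simp
qed

abbreviation gens where "gens \<equiv> E ` Irr \<union> {V i phi |i phi. i \<in> I \<and> phi \<in> Irr}"
definition AA where "AA = gen_subalg B gens"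
text \<open>Given as a span because the group algebra, where the embedding is defined, is not part
  of this locale; the two descriptions are matched at the end.\<close>

definition MM where "MM = {\<Oplus>h\<in>carrier H. c h \<odot> m h |c. True}"

lemma gens_B: "gens \<subseteq> carrier B" by auto

lemma AA_B: "AA \<subseteq> carrier B" unfolding AA_def by (rule B.gen_subalg_carrier[OF gens_B])

lemma AA_R [simp]: "x \<in> AA \<Longrightarrow> x \<in> carrier R" using AA_B B_carrier by blast

lemma AA_closed:
  "e \<in> AA" "x \<in> gens \<Longrightarrow> x \<in> AA" "x \<in> AA \<Longrightarrow> y \<in> AA \<Longrightarrow> x \<oplus> y \<in> AA"
  "x \<in> AA \<Longrightarrow> y \<in> AA \<Longrightarrow> x \<otimes> y \<in> AA" "x \<in> AA \<Longrightarrow> c \<odot> x \<in> AA" "\<zero> \<in> AA"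
proof -
  show e: "e \<in> AA" using gen_subalg.one[of B] by (simp add: AA_def)
  show smult: "c \<odot> x \<in> AA" if "x \<in> AA" for c x
    using that gen_subalg.smult[of x B gens c] by (simp add: AA_def)
  show "\<zero> \<in> AA" using smult[OF e, of 0] by simp
  show "x \<oplus> y \<in> AA" "x \<otimes> y \<in> AA" if "x \<in> AA" "y \<in> AA"
    using that gen_subalg.add[of x B gens y] gen_subalg.mult[of x B gens y] by (simp_all add: AA_def)
  show "x \<in> AA" if "x \<in> gens" using gen_subalg.gen[OF that, of B] by (simp add: AA_def)
qed

lemma AA_commute:
  assumes h: "h \<in> carrier H" and x: "x \<in> AA" shows "m h \<otimes> x = x \<otimes> m h"
  using x unfolding AA_def
proof induction
  case one
  show ?case using e_central[OF m_R[OF h]] by simp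
next
  case (gen x)
  then show ?case using m_V[OF _ _ h] E_m[OF h] by auto
next
  case (add x y)
  then have "x \<in> carrier R" "y \<in> carrier R" using AA_R by (auto simp: AA_def)
  with add.IH h show ?case by (simp add: R.l_distr R.r_distr)
next
  case (mult x y)
  then have c: "x \<in> carrier R" "y \<in> carrier R" using AA_R by (auto simp: AA_def)
  have "m h \<otimes> (x \<otimes> y) = x \<otimes> (m h \<otimes> y)"
    using c h mult.IH(1) R.m_assoc[of "m h" x y] R.m_assoc[of x "m h" y] by simp
  also have "\<dots> = x \<otimes> y \<otimes> m h" using c h mult.IH(2) R.m_assoc[of x y "m h"] by simp
  finally show ?case by simp
next
  case (smult x c)
  then have "x \<in> carrier R" using AA_R by (auto simp: AA_def)
  with smult.IH h show ?case by (simp add: R.smult_mult_left R.smult_mult_right)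
qed

text \<open>A transversal by choice: the predicate under \<open>SOME\<close> depends only on the
  coset of \<open>h\<close> modulo the center, so all elements of a coset receive the same
  representative.\<close>

definition rep where "rep h = (SOME t. t \<in> carrier H \<and> inv\<^bsub>H\<^esub> t \<otimes>\<^bsub>H\<^esub> h \<in> C)"
definition T where "T = rep ` carrier H"

lemma rep_props:
  assumes "h \<in> carrier H"
  shows "rep h \<in> carrier H" "inv\<^bsub>H\<^esub> (rep h) \<otimes>\<^bsub>H\<^esub> h \<in> C"
  using someI[of "\<lambda>t. t \<in> carrier H \<and> inv\<^bsub>H\<^esub> t \<otimes>\<^bsub>H\<^esub> h \<in> C" h] assms C.one_closed
  unfolding rep_def by auto

lemma rep_eq:
  assumes "g \<in> carrier H" "h \<in> carrier H" "inv\<^bsub>H\<^esub> g \<otimes>\<^bsub>H\<^esub> h \<in> C"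
  shows "rep g = rep h"
proof -
  have "inv\<^bsub>H\<^esub> t \<otimes>\<^bsub>H\<^esub> g \<in> C \<longleftrightarrow> inv\<^bsub>H\<^esub> t \<otimes>\<^bsub>H\<^esub> h \<in> C" if t: "t \<in> carrier H" for t
  proof
    assume "inv\<^bsub>H\<^esub> t \<otimes>\<^bsub>H\<^esub> g \<in> C"
    from C.m_closed[OF this assms(3)] show "inv\<^bsub>H\<^esub> t \<otimes>\<^bsub>H\<^esub> h \<in> C"
      using assms t by (simp add: H.m_assoc[of "inv\<^bsub>H\<^esub> t"] H.m_assoc[of g, symmetric])
  next
    assume "inv\<^bsub>H\<^esub> t \<otimes>\<^bsub>H\<^esub> h \<in> C"
    from C.m_closed[OF this C.m_inv_closed[OF assms(3)]] show "inv\<^bsub>H\<^esub> t \<otimes>\<^bsub>H\<^esub> g \<in> C"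
      using assms t by (simp add: H.inv_mult_group H.m_assoc[of "inv\<^bsub>H\<^esub> t"] H.m_assoc[of h, symmetric])
  qed
  then show ?thesis unfolding rep_def by (metis (no_types, lifting))
qed

lemma T_H: "t \<in> T \<Longrightarrow> t \<in> carrier H" by (auto simp: T_def rep_props)

lemma T_unique: "\<lbrakk>s \<in> T; t \<in> T; inv\<^bsub>H\<^esub> s \<otimes>\<^bsub>H\<^esub> t \<in> C\<rbrakk> \<Longrightarrow> s = t"
proof -
  assume st: "s \<in> T" "t \<in> T" "inv\<^bsub>H\<^esub> s \<otimes>\<^bsub>H\<^esub> t \<in> C"
  have "rep t = t" if "t \<in> T" for t
    using that rep_eq[OF rep_props(1) _ rep_props(2)] by (auto simp: T_def)
  then show ?thesis using rep_eq[OF T_H T_H] st by metis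
qed

lemma finite_T: "finite T" by (simp add: T_def finite_H)

lemma m_rep: "h \<in> carrier H \<Longrightarrow> m h = phi0 (inv\<^bsub>H\<^esub> (rep h) \<otimes>\<^bsub>H\<^esub> h) \<odot> m (rep h)"
proof -
  assume h: "h \<in> carrier H"
  let ?z = "inv\<^bsub>H\<^esub> (rep h) \<otimes>\<^bsub>H\<^esub> h"
  have "m h = m (rep h \<otimes>\<^bsub>H\<^esub> ?z)" using h rep_props[OF h] by (simp add: H.m_assoc[symmetric])
  also have "\<dots> = m (rep h) \<otimes> m ?z" using h rep_props[OF h] by (intro m_mult) auto
  also have "\<dots> = phi0 ?z \<odot> (m (rep h) \<otimes> e)"
    using rep_props[OF h] by (simp add: m_center R.smult_mult_right)
  also have "m (rep h) \<otimes> e = m (rep h)" using m_B[OF rep_props(1)[OF h]] by (simp add: B_carrier)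
  finally show ?thesis .
qed

text \<open>Sorting the terms by cosets of the center: \<open>m h\<close> is a scalar multiple of
  \<open>m (rep h)\<close>.\<close>

lemma MM_span:
  assumes "y \<in> MM" shows "\<exists>c. y = (\<Oplus>t\<in>T. c t \<odot> m t)"
proof -
  obtain c where y: "y = (\<Oplus>h\<in>carrier H. c h \<odot> m h)" using assms by (auto simp: MM_def)
  define d where "d h = c h * phi0 (inv\<^bsub>H\<^esub> (rep h) \<otimes>\<^bsub>H\<^esub> h)" for h
  \<comment> \<open>The inner sum has a single nonzero term; writing it this way lets the two sums
    be interchanged.\<close>
  have "y = (\<Oplus>h\<in>carrier H. \<Oplus>t\<in>T. (if rep h = t then d h else 0) \<odot> m t)"
    unfolding y
  proof (rule R.finsum_cong')
    fix h assume h: "h \<in> carrier H"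
    have "(\<Oplus>t\<in>T. (if rep h = t then d h else 0) \<odot> m t) = (\<Oplus>t\<in>T. if rep h = t then d h \<odot> m t else \<zero>)"
      by (rule R.finsum_cong') (auto simp: T_H)
    also have "\<dots> = d h \<odot> m (rep h)"
      using h finite_T by (intro R.finsum_singleton) (auto simp: T_def rep_props)
    also have "\<dots> = c h \<odot> m h"
      using m_rep[OF h] rep_props[OF h] by (simp add: d_def R.smult_smult)
    finally show "c h \<odot> m h = (\<Oplus>t\<in>T. (if rep h = t then d h else 0) \<odot> m t)" by simp
  qed (auto intro!: R.finsum_closed simp: T_H)
  also have "\<dots> = (\<Oplus>t\<in>T. \<Oplus>h\<in>carrier H. (if rep h = t then d h else 0) \<odot> m t)"
    by (rule R.finsum_swap) (auto simp: finite_H finite_T T_H)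
  also have "\<dots> = (\<Oplus>t\<in>T. (\<Sum>h\<in>carrier H. if rep h = t then d h else 0) \<odot> m t)"
    by (intro R.finsum_cong' R.finsum_smult_left) (auto simp: finite_H T_H)
  finally show ?thesis by (intro exI[of _ "\<lambda>t. \<Sum>h\<in>carrier H. if rep h = t then d h else 0"])
qed

end

section \<open>Independence of the m_t over the subalgebra A\<close>

context twisted_action
begin

lemma AA_funcset: "\<lbrakk>a \<in> T \<rightarrow> AA; t \<in> T\<rbrakk> \<Longrightarrow> a t \<in> AA \<and> a t \<in> carrier R"
  using AA_R by blast

text \<open>Commutators are central, which turns \<open>g\<close> to [g,t] into a homomorphism to
  \<open>Z\<close>.\<close>

lemma commutator_props:
  assumes "g \<in> carrier H" "h \<in> carrier H" "t \<in> carrier H"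
  shows "chi (grp_commutator H (g \<otimes>\<^bsub>H\<^esub> h) t) = chi (grp_commutator H g t) * chi (grp_commutator H h t)"
    and "g \<otimes>\<^bsub>H\<^esub> t \<otimes>\<^bsub>H\<^esub> inv\<^bsub>H\<^esub> g = grp_commutator H g t \<otimes>\<^bsub>H\<^esub> t"
proof -
  let ?c = "\<lambda>g. grp_commutator H g t"
  have cH: "?c g \<in> carrier H" "?c h \<in> carrier H" "?c h \<in> C"
    using commutator_Z[OF assms(1,3)] commutator_Z[OF assms(2,3)] Z_center Z.subset by auto
  show conj: "g \<otimes>\<^bsub>H\<^esub> t \<otimes>\<^bsub>H\<^esub> inv\<^bsub>H\<^esub> g = ?c g \<otimes>\<^bsub>H\<^esub> t"
    using assms by (simp add: grp_commutator_def H.m_assoc)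
  have "?c (g \<otimes>\<^bsub>H\<^esub> h) = g \<otimes>\<^bsub>H\<^esub> (h \<otimes>\<^bsub>H\<^esub> t \<otimes>\<^bsub>H\<^esub> inv\<^bsub>H\<^esub> h) \<otimes>\<^bsub>H\<^esub> inv\<^bsub>H\<^esub> g \<otimes>\<^bsub>H\<^esub> inv\<^bsub>H\<^esub> t"
    using assms by (simp add: grp_commutator_def H.m_assoc H.inv_mult_group)
  also have "h \<otimes>\<^bsub>H\<^esub> t \<otimes>\<^bsub>H\<^esub> inv\<^bsub>H\<^esub> h = ?c h \<otimes>\<^bsub>H\<^esub> t"
    using assms by (simp add: grp_commutator_def H.m_assoc)
  also have "g \<otimes>\<^bsub>H\<^esub> (?c h \<otimes>\<^bsub>H\<^esub> t) = ?c h \<otimes>\<^bsub>H\<^esub> (g \<otimes>\<^bsub>H\<^esub> t)"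
    using assms cH C_commute[OF cH(3) assms(1)] by (simp add: H.m_assoc[symmetric])
  also have "?c h \<otimes>\<^bsub>H\<^esub> (g \<otimes>\<^bsub>H\<^esub> t) \<otimes>\<^bsub>H\<^esub> inv\<^bsub>H\<^esub> g \<otimes>\<^bsub>H\<^esub> inv\<^bsub>H\<^esub> t = ?c h \<otimes>\<^bsub>H\<^esub> ?c g"
    using assms cH by (simp add: grp_commutator_def[of H g t] H.m_assoc)
  finally show "chi (?c (g \<otimes>\<^bsub>H\<^esub> h)) = chi (?c g) * chi (?c h)"
    using commutator_Z[OF assms(1,3)] commutator_Z[OF assms(2,3)] by (simp add: chi_props(1))
qed

lemma m_conj:
  assumes "g \<in> carrier H" "t \<in> carrier H"
  shows "m g \<otimes> m t \<otimes> m (inv\<^bsub>H\<^esub> g) = chi (grp_commutator H g t) \<odot> m t"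
proof -
  let ?c = "grp_commutator H g t"
  have c: "?c \<in> Z" "?c \<in> C" "?c \<in> carrier H"
    using commutator_Z[OF assms] Z_center Z.subset by auto
  have "m g \<otimes> m t \<otimes> m (inv\<^bsub>H\<^esub> g) = m (?c \<otimes>\<^bsub>H\<^esub> t)"
    using assms by (simp add: m_mult[symmetric] commutator_props(2))
  also have "\<dots> = chi ?c \<odot> (e \<otimes> m t)"
    using assms c by (simp add: m_mult m_center Irr_chi[OF phi0 c(1)] R.smult_mult_left)
  also have "e \<otimes> m t = m t" using e_central[OF m_R] m_B B_carrier assms by simp
  finally show ?thesis .
qed

text \<open>The summand is a character of \<open>H\<close> in \<open>g\<close>. If it were trivial,
  injectivity of \<open>chi\<close> would give [g,s] = [g,t] for all \<open>g\<close>; then s^-1 t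
  is central and \<open>s\<close>, \<open>t\<close> lie in the same coset of the center, so they
  coincide.\<close>

lemma commutator_character_sum:
  assumes "s \<in> T" "t \<in> T"
  shows "(\<Sum>g\<in>carrier H. inverse (chi (grp_commutator H g s)) * chi (grp_commutator H g t)) =
    (if s = t then of_nat (card (carrier H)) else 0)"
proof -
  have st: "s \<in> carrier H" "t \<in> carrier H" using assms T_H by auto
  have nz: "chi (grp_commutator H g s) \<noteq> 0" "chi (grp_commutator H g t) \<noteq> 0" if "g \<in> carrier H" for g
    using that st commutator_Z chi_props(2) by auto
  show ?thesis
  proof (cases "s = t")
    case True
    then have "(\<Sum>g\<in>carrier H. inverse (chi (grp_commutator H g s)) * chi (grp_commutator H g t)) =
        (\<Sum>g\<in>carrier H. 1)" using nz by (intro sum.cong) auto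
    then show ?thesis using True by simp
  next
    case False
    let ?f = "\<lambda>g. inverse (chi (grp_commutator H g s)) * chi (grp_commutator H g t)"
    have "?f \<in> hom H units_grp" using st nz by (auto simp: hom_def commutator_props(1))
    moreover have "\<exists>g\<in>carrier H. ?f g \<noteq> 1"
    proof (rule ccontr)
      assume "\<not> ?thesis"
      then have "chi (grp_commutator H g s) = chi (grp_commutator H g t)" if "g \<in> carrier H" for g
        using that nz[OF that] by (auto simp: field_simps)
      then have eq: "grp_commutator H g s = grp_commutator H g t" if "g \<in> carrier H" for g
        using that chi_inj commutator_Z st by (auto simp: inj_on_def)
      \<comment> \<open>Conjugation by \<open>g\<close> multiplies \<open>s\<close> and
        \<open>t\<close> by the same central element, so it fixes this quotient.\<close>
      let ?z = "inv\<^bsub>H\<^esub> s \<otimes>\<^bsub>H\<^esub> t"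
      have "?z \<otimes>\<^bsub>H\<^esub> g = g \<otimes>\<^bsub>H\<^esub> ?z" if g: "g \<in> carrier H" for g
      proof -
        let ?c = "grp_commutator H g s"
        have c: "?c \<in> C" "?c \<in> carrier H" using commutator_Z[OF g st(1)] Z_center Z.subset by auto
        have s: "g \<otimes>\<^bsub>H\<^esub> s = ?c \<otimes>\<^bsub>H\<^esub> s \<otimes>\<^bsub>H\<^esub> g"
          using commutator_props(2)[OF g g st(1)] g st c by (metis H.inv_solve_right H.m_closed H.inv_closed)
        have t: "g \<otimes>\<^bsub>H\<^esub> t = ?c \<otimes>\<^bsub>H\<^esub> t \<otimes>\<^bsub>H\<^esub> g"
          using commutator_props(2)[OF g g st(2)] g st c eq[OF g] by (metis H.inv_solve_right H.m_closed H.inv_closed)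
        have "s \<otimes>\<^bsub>H\<^esub> (g \<otimes>\<^bsub>H\<^esub> ?z) = inv\<^bsub>H\<^esub> ?c \<otimes>\<^bsub>H\<^esub> (?c \<otimes>\<^bsub>H\<^esub> s \<otimes>\<^bsub>H\<^esub> g) \<otimes>\<^bsub>H\<^esub> ?z"
          using g st c by (simp add: H.m_assoc[symmetric])
        also have "\<dots> = inv\<^bsub>H\<^esub> ?c \<otimes>\<^bsub>H\<^esub> (g \<otimes>\<^bsub>H\<^esub> s) \<otimes>\<^bsub>H\<^esub> ?z" using s by simp
        also have "\<dots> = inv\<^bsub>H\<^esub> ?c \<otimes>\<^bsub>H\<^esub> (g \<otimes>\<^bsub>H\<^esub> (s \<otimes>\<^bsub>H\<^esub> ?z))"
          using g st c by (simp add: H.m_assoc)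
        also have "s \<otimes>\<^bsub>H\<^esub> ?z = t" using st by (simp add: H.m_assoc[symmetric])
        also have "inv\<^bsub>H\<^esub> ?c \<otimes>\<^bsub>H\<^esub> (g \<otimes>\<^bsub>H\<^esub> t) = t \<otimes>\<^bsub>H\<^esub> g"
          unfolding t using g st c by (simp add: H.m_assoc[symmetric])
        also have "t \<otimes>\<^bsub>H\<^esub> g = s \<otimes>\<^bsub>H\<^esub> (?z \<otimes>\<^bsub>H\<^esub> g)"
          using g st by (simp add: H.m_assoc[symmetric])
        finally show ?thesis using g st by (metis H.l_cancel H.m_closed H.inv_closed)
      qed
      moreover have "?z \<in> carrier H" using st by simp
      ultimately have "?z \<in> C" unfolding grp_center_def by blast
      then show False using T_unique[OF assms] False by simp
    qed
    ultimately show ?thesis using H.sum_nontrivial_character False by auto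
  qed
qed

text \<open>Conjugating a relation by \<open>m g\<close> multiplies the summand at \<open>t\<close> by \<open>chi [g, t]\<close>, so averaging
  over \<open>g\<close> against the inverse of \<open>chi [g, s]\<close> isolates the summand at \<open>s\<close>.\<close>

lemma AA_independent:
  assumes a: "a \<in> T \<rightarrow> AA" and zero: "(\<Oplus>t\<in>T. a t \<otimes> m t) = \<zero>" and s: "s \<in> T"
  shows "a s = \<zero>"
proof -
  have at: "a t \<in> AA" "a t \<in> carrier R" if "t \<in> T" for t using AA_funcset[OF a that] by auto
  have mt: "m t \<in> carrier R" if "t \<in> T" for t using that T_H by simp
  \<comment> \<open>The coefficients \<open>a t\<close> commute with \<open>m g\<close>, so
    conjugation affects only the factors \<open>m t\<close>.\<close>
  have rel: "(\<Oplus>t\<in>T. chi (grp_commutator H g t) \<odot> (a t \<otimes> m t)) = \<zero>" if g: "g \<in> carrier H" for g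
  proof -
    have "(\<Oplus>t\<in>T. chi (grp_commutator H g t) \<odot> (a t \<otimes> m t)) =
        (\<Oplus>t\<in>T. m g \<otimes> (a t \<otimes> m t) \<otimes> m (inv\<^bsub>H\<^esub> g))"
    proof (rule R.finsum_cong')
      fix t assume t: "t \<in> T"
      have "m g \<otimes> (a t \<otimes> m t) \<otimes> m (inv\<^bsub>H\<^esub> g) = (m g \<otimes> a t) \<otimes> m t \<otimes> m (inv\<^bsub>H\<^esub> g)"
        using g at[OF t] mt[OF t] by (simp add: R.m_assoc)
      also have "\<dots> = a t \<otimes> (m g \<otimes> m t \<otimes> m (inv\<^bsub>H\<^esub> g))"
        using g at[OF t] mt[OF t] by (simp add: AA_commute R.m_assoc)
      also have "\<dots> = chi (grp_commutator H g t) \<odot> (a t \<otimes> m t)"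
        using g at[OF t] T_H[OF t] by (simp add: m_conj R.smult_mult_right)
      finally show "chi (grp_commutator H g t) \<odot> (a t \<otimes> m t) = m g \<otimes> (a t \<otimes> m t) \<otimes> m (inv\<^bsub>H\<^esub> g)"
        by simp
    qed (use g at mt in auto)
    also have "\<dots> = (\<Oplus>t\<in>T. m g \<otimes> (a t \<otimes> m t)) \<otimes> m (inv\<^bsub>H\<^esub> g)"
      using g at mt finite_T by (intro R.finsum_ldistr[symmetric]) auto
    also have "(\<Oplus>t\<in>T. m g \<otimes> (a t \<otimes> m t)) = m g \<otimes> (\<Oplus>t\<in>T. a t \<otimes> m t)"
      using g at mt finite_T by (intro R.finsum_rdistr[symmetric]) auto
    finally show ?thesis using g zero by simp
  qed
  let ?f = "\<lambda>g t. inverse (chi (grp_commutator H g s)) * chi (grp_commutator H g t)"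
  have "\<zero> = (\<Oplus>g\<in>carrier H. inverse (chi (grp_commutator H g s)) \<odot>
      (\<Oplus>t\<in>T. chi (grp_commutator H g t) \<odot> (a t \<otimes> m t)))"
    using rel by (simp cong: R.finsum_cong)
  also have "\<dots> = (\<Oplus>g\<in>carrier H. \<Oplus>t\<in>T. ?f g t \<odot> (a t \<otimes> m t))"
  proof (rule R.finsum_cong')
    fix g assume g: "g \<in> carrier H"
    have "inverse (chi (grp_commutator H g s)) \<odot> (\<Oplus>t\<in>T. chi (grp_commutator H g t) \<odot> (a t \<otimes> m t)) =
      (\<Oplus>t\<in>T. inverse (chi (grp_commutator H g s)) \<odot> (chi (grp_commutator H g t) \<odot> (a t \<otimes> m t)))"
      using at mt by (intro R.finsum_smult_right) auto
    also have "\<dots> = (\<Oplus>t\<in>T. ?f g t \<odot> (a t \<otimes> m t))"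
      using at mt by (intro R.finsum_cong') (auto simp: R.smult_smult)
    finally show "inverse (chi (grp_commutator H g s)) \<odot> (\<Oplus>t\<in>T. chi (grp_commutator H g t) \<odot> (a t \<otimes> m t)) =
      (\<Oplus>t\<in>T. ?f g t \<odot> (a t \<otimes> m t))" .
  qed (use at mt in \<open>auto intro!: R.finsum_closed\<close>)
  also have "\<dots> = (\<Oplus>t\<in>T. \<Oplus>g\<in>carrier H. ?f g t \<odot> (a t \<otimes> m t))"
    using at mt by (intro R.finsum_swap) (auto simp: finite_T finite_H)
  also have "\<dots> = (\<Oplus>t\<in>T. (\<Sum>g\<in>carrier H. ?f g t) \<odot> (a t \<otimes> m t))"
    using at mt by (intro R.finsum_cong' R.finsum_smult_left) (auto simp: finite_H)
  also have "\<dots> = (\<Oplus>t\<in>T. if s = t then of_nat (card (carrier H)) \<odot> (a t \<otimes> m t) else \<zero>)"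
    using at mt by (intro R.finsum_cong') (auto simp: commutator_character_sum[OF s])
  also have "\<dots> = of_nat (card (carrier H)) \<odot> (a s \<otimes> m s)"
    using at mt s finite_T by (intro R.finsum_singleton) auto
  finally have "a s \<otimes> m s = \<zero>"
    using R.smult_cancel[OF _ card_H] at[OF s] mt[OF s] by simp
  \<comment> \<open>\<open>m s\<close> is invertible in the corner algebra, with inverse the value
    of \<open>m\<close> at the inverse of \<open>s\<close>, and can be cancelled.\<close>
  then have "a s \<otimes> m s \<otimes> m (inv\<^bsub>H\<^esub> s) = \<zero>" using T_H[OF s] by simp
  moreover have "a s \<otimes> m s \<otimes> m (inv\<^bsub>H\<^esub> s) = a s \<otimes> e"
    using at[OF s] T_H[OF s] by (simp add: R.m_assoc m_mult[symmetric] m_one)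
  moreover have "a s \<otimes> e = a s" using AA_B at[OF s] B_carrier by blast
  ultimately show ?thesis by simp
qed

section \<open>The products of A and the m_t exhaust the corner algebra\<close>

definition AAM where "AAM = {\<Oplus>t\<in>T. a t \<otimes> m t |a. a \<in> T \<rightarrow> AA}"

lemma AAM_R: "x \<in> AAM \<Longrightarrow> x \<in> carrier R"
  unfolding AAM_def using T_H AA_funcset by (auto intro!: R.finsum_closed)

lemma AAM_zero: "\<zero> \<in> AAM"
proof -
  have "\<zero> = (\<Oplus>t\<in>T. \<zero> \<otimes> m t)" using T_H by (simp cong: R.finsum_cong)
  then show ?thesis unfolding AAM_def using AA_closed(6) by (intro CollectI exI[of _ "\<lambda>_. \<zero>"]) auto
qed

lemma AAM_add: "\<lbrakk>x \<in> AAM; y \<in> AAM\<rbrakk> \<Longrightarrow> x \<oplus> y \<in> AAM"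
proof -
  assume "x \<in> AAM" "y \<in> AAM"
  then obtain a b where ab: "a \<in> T \<rightarrow> AA" "b \<in> T \<rightarrow> AA" "x = (\<Oplus>t\<in>T. a t \<otimes> m t)" "y = (\<Oplus>t\<in>T. b t \<otimes> m t)"
    unfolding AAM_def by blast
  then have c: "a t \<in> carrier R" "b t \<in> carrier R" if "t \<in> T" for t using that AA_funcset by auto
  have "x \<oplus> y = (\<Oplus>t\<in>T. a t \<otimes> m t \<oplus> b t \<otimes> m t)"
    unfolding ab(3,4) using c T_H by (intro R.finsum_addf[symmetric]) auto
  also have "\<dots> = (\<Oplus>t\<in>T. (a t \<oplus> b t) \<otimes> m t)"
    using c T_H by (intro R.finsum_cong') (auto simp: R.l_distr)
  finally show ?thesis unfolding AAM_def using ab(1,2) AA_closed(3)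
    by (intro CollectI exI[of _ "\<lambda>t. a t \<oplus> b t"]) auto
qed

lemma AAM_smult: "x \<in> AAM \<Longrightarrow> c \<odot> x \<in> AAM"
proof -
  assume "x \<in> AAM"
  then obtain a where a: "a \<in> T \<rightarrow> AA" "x = (\<Oplus>t\<in>T. a t \<otimes> m t)" unfolding AAM_def by blast
  then have ac: "a t \<in> carrier R" if "t \<in> T" for t using that AA_funcset by auto
  have "c \<odot> x = (\<Oplus>t\<in>T. c \<odot> (a t \<otimes> m t))"
    unfolding a(2) using ac T_H by (intro R.finsum_smult_right) auto
  also have "\<dots> = (\<Oplus>t\<in>T. (c \<odot> a t) \<otimes> m t)"
    using ac T_H by (intro R.finsum_cong') (auto simp: R.smult_mult_left)
  finally show ?thesis unfolding AAM_def using a(1) AA_closed(5)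
    by (intro CollectI exI[of _ "\<lambda>t. c \<odot> a t"]) auto
qed

lemma AAM_sum: "(\<And>i. i \<in> J \<Longrightarrow> f i \<in> AAM) \<Longrightarrow> (\<Oplus>i\<in>J. f i) \<in> AAM"
proof (induction J rule: infinite_finite_induct)
  case (insert i J)
  then have "(\<Oplus>i\<in>insert i J. f i) = f i \<oplus> (\<Oplus>i\<in>J. f i)"
    by (intro R.finsum_insert) (auto simp: AAM_R)
  with insert show ?case by (simp add: AAM_add)
qed (auto simp: AAM_zero)

lemma AAM_base:
  assumes a: "a \<in> AA" and h: "h \<in> carrier H" shows "a \<otimes> m h \<in> AAM"
proof -
  define b where "b = phi0 (inv\<^bsub>H\<^esub> (rep h) \<otimes>\<^bsub>H\<^esub> h) \<odot> a"
  have b: "b \<in> AA" "b \<in> carrier R" using a AA_closed(5) AA_R by (auto simp: b_def)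
  have "a \<otimes> m h = b \<otimes> m (rep h)"
    unfolding m_rep[OF h] b_def using a rep_props[OF h] by (simp add: R.smult_mult_left R.smult_mult_right)
  also have "\<dots> = (\<Oplus>t\<in>T. if rep h = t then b \<otimes> m t else \<zero>)"
    using b h T_H finite_T by (intro R.finsum_singleton[symmetric]) (auto simp: T_def)
  also have "\<dots> = (\<Oplus>t\<in>T. (if rep h = t then b else \<zero>) \<otimes> m t)"
    using b T_H by (intro R.finsum_cong') auto
  finally show ?thesis unfolding AAM_def using b AA_closed(6)
    by (intro CollectI exI[of _ "\<lambda>t. if rep h = t then b else \<zero>"]) auto
qed

text \<open>Coefficients move past the \<open>m t\<close> because they commute, and the product of
  \<open>m t\<close> and \<open>m s\<close> is \<open>m\<close> of the group product. This need not
  be a transversal element, which is why \<open>AAM_base\<close> is stated for all of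
  \<open>H\<close>.\<close>

lemma AAM_mult: "\<lbrakk>x \<in> AAM; y \<in> AAM\<rbrakk> \<Longrightarrow> x \<otimes> y \<in> AAM"
proof -
  assume "x \<in> AAM" and y: "y \<in> AAM"
  then obtain a b where ab: "a \<in> T \<rightarrow> AA" "b \<in> T \<rightarrow> AA" "x = (\<Oplus>t\<in>T. a t \<otimes> m t)" "y = (\<Oplus>t\<in>T. b t \<otimes> m t)"
    unfolding AAM_def by blast
  have c: "a t \<in> AA" "b t \<in> AA" "a t \<in> carrier R" "b t \<in> carrier R" "m t \<in> carrier R" if "t \<in> T" for t
    using that AA_funcset[OF ab(1)] AA_funcset[OF ab(2)] T_H by auto
  have "x \<otimes> y = (\<Oplus>t\<in>T. a t \<otimes> m t \<otimes> y)"
    unfolding ab(3) using c finite_T AAM_R[OF y] by (intro R.finsum_ldistr) auto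
  also have "\<dots> \<in> AAM"
  proof (rule AAM_sum)
    fix t assume t: "t \<in> T"
    have "a t \<otimes> m t \<otimes> y = (\<Oplus>s\<in>T. a t \<otimes> m t \<otimes> (b s \<otimes> m s))"
      unfolding ab(4) using c t finite_T by (intro R.finsum_rdistr) auto
    also have "\<dots> \<in> AAM"
    proof (rule AAM_sum)
      fix s assume s: "s \<in> T"
      have "a t \<otimes> m t \<otimes> (b s \<otimes> m s) = a t \<otimes> (m t \<otimes> b s) \<otimes> m s"
        using c t s by (simp add: R.m_assoc)
      also have "\<dots> = a t \<otimes> b s \<otimes> m (t \<otimes>\<^bsub>H\<^esub> s)"
        using c t s T_H by (simp add: AA_commute R.m_assoc m_mult)
      also have "\<dots> \<in> AAM" using c t s T_H AA_closed(4) by (intro AAM_base) auto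
      finally show "a t \<otimes> m t \<otimes> (b s \<otimes> m s) \<in> AAM" .
    qed
    finally show "a t \<otimes> m t \<otimes> y \<in> AAM" .
  qed
  finally show ?thesis .
qed

lemma AA_AAM: "a \<in> AA \<Longrightarrow> a \<in> AAM"
  using AAM_base[of a "\<one>\<^bsub>H\<^esub>"] AA_B B_carrier[of a] by (auto simp: m_one)

text \<open>On each block the definition of \<open>m h\<close> can be solved for \<open>K h\<close>,
  with coefficient \<open>xi phi h\<close> and the idempotent \<open>E phi\<close> from
  \<open>AA\<close>.\<close>

lemma K_e_AAM:
  assumes h: "h \<in> carrier H" shows "K h \<otimes> e \<in> AAM"
  unfolding times_e(1)[OF K_closed[OF h]]
proof (rule AAM_sum)
  fix phi assume phi: "phi \<in> Irr"
  have "K h \<otimes> E phi = xi phi h \<odot> (E phi \<otimes> m h)"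
    using h phi xi_props(2)[OF phi h] by (simp add: E_m m_E R.smult_smult)
  also have "\<dots> \<in> AAM" using phi h AA_closed(2) by (intro AAM_smult AAM_base) auto
  finally show "K h \<otimes> E phi \<in> AAM" .
qed

text \<open>The group element built into \<open>V i phi\<close> is undone by its inverse, which is
  available in the span by \<open>K_e_AAM\<close>.\<close>

lemma W_e_AAM:
  assumes i: "i \<in> I" shows "W i \<otimes> e \<in> AAM"
  unfolding times_e(1)[OF W_closed[OF i]]
proof (rule AAM_sum)
  fix phi assume phi: "phi \<in> Irr"
  let ?g = "gg i phi"
  have g: "?g \<in> carrier H" using i phi by simp
  have "(K (inv\<^bsub>H\<^esub> ?g) \<otimes> e) \<otimes> V i phi = K (inv\<^bsub>H\<^esub> ?g) \<otimes> (V i phi \<otimes> e)"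
    using g i phi by (simp add: R.m_assoc e_central)
  also have "V i phi \<otimes> e = V i phi" using V_B[OF i phi] B_carrier by blast
  also have "K (inv\<^bsub>H\<^esub> ?g) \<otimes> V i phi = W i \<otimes> E phi"
    using g i by (simp add: V_def R.m_assoc[symmetric] K_mult[symmetric] K_one)
  finally have "W i \<otimes> E phi = (K (inv\<^bsub>H\<^esub> ?g) \<otimes> e) \<otimes> V i phi" by simp
  also have "\<dots> \<in> AAM" using g i phi by (intro AAM_mult K_e_AAM AA_AAM AA_closed(2)) auto
  finally show "W i \<otimes> E phi \<in> AAM" .
qed

text \<open>Multiplication by the central idempotent \<open>e\<close> respects products, so it is
  enough to place the images of the generators of \<open>R\<close> in the span.\<close>

lemma B_subset_AAM: "carrier B \<subseteq> AAM"
proof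
  fix x assume x: "x \<in> carrier B"
  have gens: "K ` carrier H \<union> W ` I \<subseteq> carrier R" by auto
  have "y \<otimes> e \<in> AAM" if "y \<in> gen_subalg R (K ` carrier H \<union> W ` I)" for y
    using that
  proof induction
    case one
    then show ?case using AA_AAM[OF AA_closed(1)] by simp
  next
    case (gen y)
    then show ?case by (auto simp: K_e_AAM W_e_AAM)
  next
    case (add y z)
    then have "y \<in> carrier R" "z \<in> carrier R" using R.gen_subalg_carrier[OF gens] by auto
    with add.IH show ?case by (simp add: R.l_distr AAM_add)
  next
    case (mult y z)
    then have c: "y \<in> carrier R" "z \<in> carrier R" using R.gen_subalg_carrier[OF gens] by auto
    then have "y \<otimes> z \<otimes> e = (y \<otimes> e) \<otimes> (z \<otimes> e)"
      using R.m_assoc[of y e "z \<otimes> e"] e_central[of "z \<otimes> e"] by (simp add: R.m_assoc e_e)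
    then show ?case using AAM_mult[OF mult.IH] by simp
  next
    case (smult y c)
    then have "y \<in> carrier R" using R.gen_subalg_carrier[OF gens] by auto
    with smult.IH show ?case by (simp add: R.smult_mult_left AAM_smult)
  qed
  then show "x \<in> AAM" using x generated B_carrier[of x] by (metis subsetD)
qed

lemma MM_R: "y \<in> MM \<Longrightarrow> y \<in> carrier R" and MM_B: "MM \<subseteq> carrier B"
proof -
  show R: "y \<in> carrier R" if "y \<in> MM" for y using that by (auto simp: MM_def intro!: R.finsum_closed)
  show "MM \<subseteq> carrier B"
  proof
    fix y assume "y \<in> MM"
    then obtain c where y: "y = (\<Oplus>h\<in>carrier H. c h \<odot> m h)" by (auto simp: MM_def)
    have cm: "(\<lambda>h. c h \<odot> m h) \<in> carrier H \<rightarrow> carrier B" using B.smult_closed m_B by auto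
    show "y \<in> carrier B" using B.finsum_closed[OF cm] unfolding y finsum_B[OF cm] .
  qed
qed

lemma m_MM: "h \<in> carrier H \<Longrightarrow> m h \<in> MM"
proof -
  assume h: "h \<in> carrier H"
  have "m h = (\<Oplus>g\<in>carrier H. if h = g then m g else \<zero>)"
    using h finite_H by (intro R.finsum_singleton[symmetric]) auto
  also have "\<dots> = (\<Oplus>g\<in>carrier H. (if h = g then 1 else 0) \<odot> m g)"
    by (intro R.finsum_cong') auto
  finally show ?thesis unfolding MM_def by (intro CollectI exI[of _ "\<lambda>g. if h = g then 1 else 0"]) simp
qed

lemma MM_closed:
  "x \<in> MM \<Longrightarrow> y \<in> MM \<Longrightarrow> x \<oplus> y \<in> MM" "x \<in> MM \<Longrightarrow> c \<odot> x \<in> MM" "x \<in> MM \<Longrightarrow> y \<in> MM \<Longrightarrow> x \<otimes> y \<in> MM"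
proof -
  show add: "x \<oplus> y \<in> MM" if "x \<in> MM" "y \<in> MM" for x y
  proof -
    obtain a b where ab: "x = (\<Oplus>h\<in>carrier H. a h \<odot> m h)" "y = (\<Oplus>h\<in>carrier H. b h \<odot> m h)"
      using \<open>x \<in> MM\<close> \<open>y \<in> MM\<close> by (auto simp: MM_def)
    have "x \<oplus> y = (\<Oplus>h\<in>carrier H. a h \<odot> m h \<oplus> b h \<odot> m h)"
      unfolding ab by (intro R.finsum_addf[symmetric]) auto
    also have "\<dots> = (\<Oplus>h\<in>carrier H. (a h + b h) \<odot> m h)"
      by (intro R.finsum_cong') (auto simp: R.smult_add_left)
    finally show ?thesis unfolding MM_def by (intro CollectI exI[of _ "\<lambda>h. a h + b h"]) simp
  qed
  show smult: "c \<odot> x \<in> MM" if "x \<in> MM" for c x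
  proof -
    obtain a where a: "x = (\<Oplus>h\<in>carrier H. a h \<odot> m h)" using \<open>x \<in> MM\<close> by (auto simp: MM_def)
    have "c \<odot> x = (\<Oplus>h\<in>carrier H. c \<odot> (a h \<odot> m h))"
      unfolding a by (intro R.finsum_smult_right) auto
    also have "\<dots> = (\<Oplus>h\<in>carrier H. (c * a h) \<odot> m h)"
      by (intro R.finsum_cong') (auto simp: R.smult_smult)
    finally show ?thesis unfolding MM_def by (intro CollectI exI[of _ "\<lambda>h. c * a h"]) simp
  qed
  have zero: "\<zero> \<in> MM" using smult[OF m_MM[OF H.one_closed], of 0] by simp
  have sum: "(\<Oplus>i\<in>J. f i) \<in> MM" if "\<And>i. i \<in> J \<Longrightarrow> f i \<in> MM" for J :: "'h set" and f
    using that
  proof (induction J rule: infinite_finite_induct)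
    case (insert i J)
    then have "(\<Oplus>i\<in>insert i J. f i) = f i \<oplus> (\<Oplus>i\<in>J. f i)"
      by (intro R.finsum_insert) (auto simp: MM_R)
    with insert show ?case by (simp add: add)
  qed (auto simp: zero)
  show "x \<otimes> y \<in> MM" if xy: "x \<in> MM" "y \<in> MM"
  proof -
    obtain a b where ab: "x = (\<Oplus>h\<in>carrier H. a h \<odot> m h)" "y = (\<Oplus>h\<in>carrier H. b h \<odot> m h)"
      using xy unfolding MM_def by blast
    have "x \<otimes> y = (\<Oplus>g\<in>carrier H. a g \<odot> m g \<otimes> y)"
      unfolding ab(1) using finite_H MM_R[OF that(2)] by (intro R.finsum_ldistr) auto
    also have "\<dots> \<in> MM"
    proof (rule sum)
      fix g assume g: "g \<in> carrier H"
      have "a g \<odot> m g \<otimes> y = (\<Oplus>h\<in>carrier H. (a g \<odot> m g) \<otimes> (b h \<odot> m h))"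
        unfolding ab(2) using finite_H g by (intro R.finsum_rdistr) auto
      also have "\<dots> \<in> MM"
      proof (rule sum)
        fix h assume h: "h \<in> carrier H"
        have "(a g \<odot> m g) \<otimes> (b h \<odot> m h) = a g \<odot> (b h \<odot> m (g \<otimes>\<^bsub>H\<^esub> h))"
          using g h by (simp add: R.smult_mult_left R.smult_mult_right m_mult R.smult_smult mult.commute)
        then show "(a g \<odot> m g) \<otimes> (b h \<odot> m h) \<in> MM" using g h by (simp add: smult m_MM)
      qed
      finally show "a g \<odot> m g \<otimes> y \<in> MM" .
    qed
    finally show ?thesis .
  qed
qed

theorem tensor_iso:
  "\<exists>f\<in>alg_iso (tensor_alg (B\<lparr>carrier := AA\<rparr>) (B\<lparr>carrier := MM\<rparr>)) B.
    \<forall>x\<in>AA. \<forall>y\<in>MM. f (pure_tensor (B\<lparr>carrier := AA\<rparr>) (B\<lparr>carrier := MM\<rparr>) x y) = x \<otimes>\<^bsub>B\<^esub> y"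
proof (rule tensor_alg_iso[OF B_field_algebra _ AA_B _ MM_B])
  show "field_algebra (B\<lparr>carrier := AA\<rparr>)"
    by (rule B.subalgebra[OF AA_B]) (simp_all add: AA_closed)
  have "e \<in> MM" using m_MM[OF H.one_closed] by (simp add: m_one)
  then show "field_algebra (B\<lparr>carrier := MM\<rparr>)"
    by (intro B.subalgebra[OF MM_B]) (simp_all add: MM_closed)
  have mB: "(\<lambda>t. c t \<odot> m t) \<in> T \<rightarrow> carrier B" for c using B.smult_closed m_B T_H by auto
  have aB: "(\<lambda>t. a t \<otimes> m t) \<in> T \<rightarrow> carrier B" if "a \<in> T \<rightarrow> AA" for a
    using B.m_closed m_B T_H that AA_B by (simp add: Pi_iff subset_iff)
  show "y \<otimes>\<^bsub>B\<^esub> x = x \<otimes>\<^bsub>B\<^esub> y" if x: "x \<in> AA" and y: "y \<in> MM" for x y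
  proof -
    obtain c where c: "y = (\<Oplus>h\<in>carrier H. c h \<odot> m h)" using y by (auto simp: MM_def)
    have "y \<otimes> x = (\<Oplus>h\<in>carrier H. (c h \<odot> m h) \<otimes> x)"
      unfolding c using x finite_H by (intro R.finsum_ldistr) auto
    also have "\<dots> = (\<Oplus>h\<in>carrier H. x \<otimes> (c h \<odot> m h))"
      using x by (intro R.finsum_cong') (auto simp: R.smult_mult_left R.smult_mult_right AA_commute)
    also have "\<dots> = x \<otimes> y"
      unfolding c using x finite_H by (intro R.finsum_rdistr[symmetric]) auto
    finally show ?thesis by simp
  qed
  show "finite T" by (rule finite_T)
  show "m \<in> T \<rightarrow> MM" using m_MM T_H by auto
  show "\<exists>c. y = (\<Oplus>\<^bsub>B\<^esub>t\<in>T. c t \<odot>\<^bsub>B\<^esub> m t)" if "y \<in> MM" for y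
    using MM_span[OF that] by (simp add: finsum_B[OF mB])
  show "a t = \<zero>\<^bsub>B\<^esub>" if "a \<in> T \<rightarrow> AA" "(\<Oplus>\<^bsub>B\<^esub>t\<in>T. a t \<otimes>\<^bsub>B\<^esub> m t) = \<zero>\<^bsub>B\<^esub>" "t \<in> T" for a t
    using AA_independent[OF that(1) _ that(3)] that(2) by (simp add: finsum_B[OF aB[OF that(1)]])
  show "\<exists>a\<in>T \<rightarrow> AA. b = (\<Oplus>\<^bsub>B\<^esub>t\<in>T. a t \<otimes>\<^bsub>B\<^esub> m t)" if b: "b \<in> carrier B" for b
  proof -
    obtain a where a: "a \<in> T \<rightarrow> AA" "b = (\<Oplus>t\<in>T. a t \<otimes> m t)"
      using b B_subset_AAM by (auto simp: AAM_def)
    then show ?thesis by (intro bexI[of _ a]) (simp_all add: finsum_B[OF aB])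
  qed
qed

end

section \<open>Automorphisms of the Jennings Lie algebra\<close>

lemma free_vs_simps:
  "f \<in> carrier (free_vs Y) \<longleftrightarrow> finite {x. f x \<noteq> 0} \<and> {x. f x \<noteq> 0} \<subseteq> Y"
  "\<zero>\<^bsub>free_vs Y\<^esub> = (\<lambda>_. 0)" "f \<oplus>\<^bsub>free_vs Y\<^esub> g = (\<lambda>x. f x + g x)" "c \<odot>\<^bsub>free_vs Y\<^esub> f = (\<lambda>x. c * f x)"
  by (simp_all add: free_vs_def)

lemma vec_space_cong:
  assumes "vec_space V" "carrier W = carrier V" "ring.zero W = ring.zero V" "add W = add V"
    "module.smult W = module.smult V"
  shows "vec_space W"
proof -
  interpret vec_space V by fact
  have "abelian_group W"
    by (rule abelian_groupI) (use l_neg a_inv_closed in \<open>auto simp: assms(2-) a_ac\<close>)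
  then show ?thesis
    by (intro vec_space.intro vec_space_axioms.intro)
      (auto simp: assms(2-) smult_add_left smult_add_right smult_smult)
qed

text \<open>The vector space under a monoid algebra depends only on the carrier of the monoid. With
  an arbitrary product filled in, facts about monoid algebras become facts about free vector
  spaces.\<close>

lemma free_vs_carrier: "carrier (free_vs Y) = carrier (monoid_alg \<lparr>carrier = Y, monoid.mult = u, one = v\<rparr>)"
  by (simp add: monoid_alg_def)

lemma free_vs_vec_space: "vec_space (free_vs Y :: ('k::field, 'x \<Rightarrow> 'k) module)"
proof (rule vec_space_cong[OF monoid_alg_vec_space])
  show "carrier (free_vs Y :: ('k, 'x \<Rightarrow> 'k) module) =
    carrier (monoid_alg \<lparr>carrier = Y, monoid.mult = undefined, one = undefined\<rparr>)"
    by (rule free_vs_carrier)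
qed (simp_all add: monoid_alg_def)

lemma free_vs_minus:
  assumes "g \<in> carrier (free_vs Y)"
  shows "f \<ominus>\<^bsub>free_vs Y\<^esub> g = (\<lambda>x. f x - g x :: 'k::field)"
proof -
  interpret vec_space "free_vs Y :: ('k, 'a \<Rightarrow> 'k) module" by (rule free_vs_vec_space)
  show ?thesis using a_inv_eq_smult[OF assms] by (simp add: a_minus_def free_vs_simps)
qed

lemma basis_elt_free_vs: "x \<in> Y \<Longrightarrow> basis_elt x \<in> carrier (free_vs Y)"
  by (auto simp: free_vs_simps basis_elt_def intro: rev_finite_subset[of "{x}"])

lemma free_vs_induct [consumes 1, case_names zero add]:
  assumes "f \<in> carrier (free_vs Y)" "P (\<lambda>_. 0)"
    and "\<And>f c x. f \<in> carrier (free_vs Y) \<Longrightarrow> P f \<Longrightarrow> x \<in> Y \<Longrightarrow> P (\<lambda>z. c * basis_elt x z + f z)"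
  shows "P f"
proof -
  let ?S = "\<lparr>carrier = Y, monoid.mult = undefined, one = undefined\<rparr>"
  have "f \<in> carrier (monoid_alg ?S)" using assms(1) by (simp add: monoid_alg_def)
  then show ?thesis
    by (induction rule: monoid_alg_induct) (use assms(2,3) in \<open>auto simp: monoid_alg_carrier free_vs_simps\<close>)
qed

lemma push_forward_linear:
  fixes f g :: "'x \<Rightarrow> 'k::field" and s :: "'x \<Rightarrow> 'y"
  shows "finite {x. f x \<noteq> 0} \<Longrightarrow> finite {x. g x \<noteq> 0} \<Longrightarrow>
      push_forward s (\<lambda>x. f x + g x) = (\<lambda>y. push_forward s f y + push_forward s g y)"
    and "finite {x. f x \<noteq> 0} \<Longrightarrow> push_forward s (\<lambda>x. c * f x) = (\<lambda>y. c * push_forward s f y)"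
    and "push_forward s (basis_elt x) = (basis_elt (s x) :: 'y \<Rightarrow> 'k)"
    and "push_forward s (\<lambda>_. 0) = (\<lambda>_. 0 :: 'k)"
    and "finite {x. f x \<noteq> 0} \<Longrightarrow> (\<And>x. f x \<noteq> 0 \<Longrightarrow> s x \<in> Y) \<Longrightarrow> push_forward s f \<in> carrier (free_vs Y)"
proof -
  let ?S = "\<lambda>Y. \<lparr>carrier = Y, monoid.mult = undefined, one = undefined\<rparr>"
  interpret M: vec_space "monoid_alg (?S UNIV) :: ('k, 'y \<Rightarrow> 'k) module" by (rule monoid_alg_vec_space)
  have h: "(\<lambda>x. basis_elt (s x)) \<in> carrier (?S UNIV) \<rightarrow> carrier (monoid_alg (?S UNIV))" by auto
  have eq: "push_forward s f = lin_ext (monoid_alg (?S UNIV)) (\<lambda>x. basis_elt (s x)) f"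
    if "finite {x. f x \<noteq> 0}" for f :: "'x \<Rightarrow> 'k"
    using that by (rule push_forward_eq_lin_ext) auto
  have fin_add: "finite {x. f x + g x \<noteq> 0}" if "finite {x. f x \<noteq> 0}" "finite {x. g x \<noteq> 0}" for f g :: "'x \<Rightarrow> 'k"
    using monoid_alg_supp_add[of f "?S UNIV" g] that by (simp add: monoid_alg_carrier)
  show "push_forward s (\<lambda>x. f x + g x) = (\<lambda>y. push_forward s f y + push_forward s g y)"
    if "finite {x. f x \<noteq> 0}" "finite {x. g x \<noteq> 0}"
    using M.lin_ext_add[OF h, of f g] that by (simp add: eq fin_add monoid_alg_carrier)
  show "push_forward s (\<lambda>x. c * f x) = (\<lambda>y. c * push_forward s f y)" if "finite {x. f x \<noteq> 0}"
  proof -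
    have "finite {x. c * f x \<noteq> 0}" using that by (rule rev_finite_subset) auto
    then show ?thesis using M.lin_ext_smult[OF h, of f c] that by (simp add: eq monoid_alg_carrier)
  qed
  have fb: "finite {z. basis_elt x z \<noteq> (0::'k)}" by (simp add: basis_elt_def)
  show "push_forward s (basis_elt x) = (basis_elt (s x) :: 'y \<Rightarrow> 'k)"
    using M.lin_ext_basis[OF h, of x] by (simp add: eq[OF fb])
  show "push_forward s (\<lambda>_. 0) = (\<lambda>_. 0 :: 'k)" by (simp add: push_forward_def)
  show "push_forward s f \<in> carrier (free_vs Y)"
    if f: "finite {x. f x \<noteq> 0}" "\<And>x. f x \<noteq> 0 \<Longrightarrow> s x \<in> Y"
  proof -
    have "{y. push_forward s f y \<noteq> 0} \<subseteq> s ` {x. f x \<noteq> 0}"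
      unfolding push_forward_def by (auto elim!: sum.not_neutral_contains_not_neutral)
    then show ?thesis using f by (auto simp: free_vs_simps intro: finite_subset)
  qed
qed

text \<open>Functoriality, with the composite compared only on \<open>Y\<close>. This matters
  because automorphisms and their inverses cancel only on the carrier.\<close>

lemma push_forward_comp_cong:
  fixes f :: "'x \<Rightarrow> 'k::field" and t :: "'x \<Rightarrow> 'y" and s :: "'y \<Rightarrow> 'z"
  assumes "f \<in> carrier (free_vs Y)" "\<And>x. x \<in> Y \<Longrightarrow> s (t x) = r x"
  shows "push_forward s (push_forward t f) = push_forward r f"
  using assms(1)
proof (induction rule: free_vs_induct)
  case zero
  show ?case by (simp add: push_forward_linear)
next
  case (add f c x)
  have fin: "finite {x. f x \<noteq> 0}" using add by (simp add: free_vs_simps)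
  have finb: "finite {z. c * basis_elt x z \<noteq> 0}" for x :: 'y and c :: 'k
    by (rule rev_finite_subset[of "{x}"]) (auto simp: basis_elt_def)
  have finb1: "finite {z. basis_elt x z \<noteq> (0::'k)}" for x :: 'y by (simp add: basis_elt_def)
  have finp: "finite {y. push_forward u f y \<noteq> 0}" for u :: "'x \<Rightarrow> 'y"
    using push_forward_linear(5)[OF fin, of u UNIV] by (simp add: free_vs_simps)
  have finb': "finite {z. c * basis_elt x z \<noteq> 0}" "finite {z. basis_elt x z \<noteq> (0::'k)}" for x :: 'x and c :: 'k
    by (rule rev_finite_subset[of "{x}"]; auto simp: basis_elt_def)+
  show ?case
    using add by (simp add: push_forward_linear fin finb finb1 finb' finp assms(2))
qed

lemma push_forward_id:
  fixes f :: "'x \<Rightarrow> 'k::field"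
  assumes "f \<in> carrier (free_vs Y)" "\<And>x. x \<in> Y \<Longrightarrow> s x = x"
  shows "push_forward s f = f"
  using assms(1)
proof (induction rule: free_vs_induct)
  case (add f c x)
  have "finite {x. f x \<noteq> 0}" using add by (simp add: free_vs_simps)
  moreover have "finite {z. c * basis_elt x z \<noteq> 0}" "finite {z. basis_elt x z \<noteq> (0::'k)}"
    by (rule rev_finite_subset[of "{x}"]; auto simp: basis_elt_def)+
  ultimately show ?case using add by (simp add: push_forward_linear assms(2))
qed (simp add: push_forward_linear)

lemma push_forward_alg_hom:
  assumes S: "Group.monoid S" "Group.monoid S'" and s: "s \<in> carrier S \<rightarrow> carrier S'" "s \<one>\<^bsub>S\<^esub> = \<one>\<^bsub>S'\<^esub>"
    and mult: "\<And>x y. x \<in> carrier S \<Longrightarrow> y \<in> carrier S \<Longrightarrow> s (x \<otimes>\<^bsub>S\<^esub> y) = s x \<otimes>\<^bsub>S'\<^esub> s y"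
  shows "push_forward s \<in> alg_hom (monoid_alg S) (monoid_alg S' :: ('k::field, 'y \<Rightarrow> 'k) module)"
proof -
  interpret M: field_algebra "monoid_alg S :: ('k, 'a \<Rightarrow> 'k) module"
    by (rule monoid_alg_field_algebra[OF S(1)])
  interpret M': field_algebra "monoid_alg S' :: ('k, 'y \<Rightarrow> 'k) module"
    by (rule monoid_alg_field_algebra[OF S(2)])
  have hom: "lin_ext (monoid_alg S') (\<lambda>x. basis_elt (s x)) \<in> alg_hom (monoid_alg S) (monoid_alg S' :: ('k, 'y \<Rightarrow> 'k) module)"
    using s mult by (intro M'.lin_ext_alg_hom[OF S(1)]) (auto simp: basis_elt_mult Pi_iff)
  have eq: "push_forward s f = lin_ext (monoid_alg S') (\<lambda>x. basis_elt (s x)) f"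
    if "f \<in> carrier (monoid_alg S)" for f :: "'a \<Rightarrow> 'k"
    using that s(1) by (intro push_forward_eq_lin_ext) (auto simp: monoid_alg_carrier)
  show ?thesis
    using hom M.add.m_closed M.m_closed M.one_closed M.smult_closed
    by (auto simp: alg_hom_def ring_hom_def eq simp del: monoid_alg_simps)
qed

section \<open>Ring automorphisms, the Jacobson radical and its powers\<close>

lemma left_ideal_image:
  fixes R (structure)
  assumes "ring R" "h \<in> ring_iso R R" "left_ideal J R" shows "left_ideal (h ` J) R"
proof -
  interpret ring R by fact
  have hom: "h \<in> ring_hom R R" and bij: "h ` carrier R = carrier R"
    using assms(2) by (auto simp: ring_iso_def bij_betw_def)
  note hom_simps = ring_hom_mult[OF hom] ring_hom_add[OF hom] ring_hom_closed[OF hom]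
  interpret J: additive_subgroup J R using assms(3) by (simp add: left_ideal_def)
  have Jm: "x \<otimes> a \<in> J" if "x \<in> carrier R" "a \<in> J" for x a using assms(3) that by (simp add: left_ideal_def)
  interpret h: ring_hom_ring R R h by (rule ring_hom_ringI2) (use hom in \<open>auto intro: ring_axioms\<close>)
  have "additive_subgroup (h ` J) R"
  proof (intro additive_subgroup.intro add.subgroupI)
    fix a b assume "a \<in> h ` J" "b \<in> h ` J"
    then obtain x y where xy: "x \<in> J" "y \<in> J" "a = h x" "b = h y" by auto
    show "a \<oplus> b \<in> h ` J" using xy by (auto intro!: image_eqI[of _ _ "x \<oplus> y"])
    show "\<ominus> a \<in> h ` J" using xy by (auto intro!: image_eqI[of _ _ "\<ominus> x"])
  next
    show "h ` J \<noteq> {}" using J.zero_closed by blast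
  qed (use J.a_subset ring_hom_closed[OF hom] in auto)
  moreover have "x \<otimes> a \<in> h ` J" if "x \<in> carrier R" "a \<in> h ` J" for x a
  proof -
    obtain y where y: "y \<in> carrier R" "x = h y" using \<open>x \<in> carrier R\<close> bij by (metis imageE)
    obtain b where b: "b \<in> J" "a = h b" using \<open>a \<in> h ` J\<close> by auto
    show ?thesis using y b Jm by (auto intro!: image_eqI[of _ _ "y \<otimes> b"])
  qed
  ultimately show ?thesis by (simp add: left_ideal_def)
qed

lemma jacobson_radical_iso:
  assumes R: "ring R" and h: "h \<in> ring_iso R R" and g: "g \<in> ring_iso R R"
    and inv: "\<And>x. x \<in> carrier R \<Longrightarrow> h (g x) = x" "\<And>x. x \<in> carrier R \<Longrightarrow> g (h x) = x"
    and x: "x \<in> jacobson_radical R"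
  shows "h x \<in> jacobson_radical R"
proof -
  have sub: "J \<subseteq> carrier R" if "left_ideal J R" for J
    using that additive_subgroup.a_subset by (auto simp: left_ideal_def)
  have hg: "h ` g ` J = J" "g ` h ` J = J" if "left_ideal J R" for J
    using sub[OF that] inv by (auto simp: image_image image_iff subset_iff)
  have hc: "h ` carrier R = carrier R" "g ` carrier R = carrier R"
    using h g by (auto simp: ring_iso_def bij_betw_def)
  have xc: "x \<in> carrier R" using x by (simp add: jacobson_radical_def)
  have "h x \<in> I" if I: "maximal_left_ideal I R" for I
  proof -
    have Il: "left_ideal I R" using I by (simp add: maximal_left_ideal_def)
    have "maximal_left_ideal (g ` I) R"
      unfolding maximal_left_ideal_def
    proof (intro conjI allI impI)
      show "left_ideal (g ` I) R" by (rule left_ideal_image[OF R g Il])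
      show "g ` I \<noteq> carrier R" using hg(1)[OF Il] hc(1) I by (metis maximal_left_ideal_def)
      fix J assume J: "left_ideal J R \<and> g ` I \<subseteq> J"
      then have "left_ideal (h ` J) R" using left_ideal_image[OF R h] by blast
      moreover have "h ` g ` I \<subseteq> h ` J" using J by (intro image_mono) blast
      ultimately have "left_ideal (h ` J) R" "I \<subseteq> h ` J" unfolding hg(1)[OF Il] by blast+
      then have "h ` J = I \<or> h ` J = carrier R" using I by (simp add: maximal_left_ideal_def)
      then show "J = g ` I \<or> J = carrier R" using hg(2)[of J] J hc(2) by metis
    qed
    then have "x \<in> g ` I" using x by (simp add: jacobson_radical_def)
    then show ?thesis using inv(1) sub[OF Il] by auto
  qed
  moreover have "h x \<in> carrier R" using xc hc(1) by auto
  ultimately show ?thesis by (simp add: jacobson_radical_def)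
qed

lemma ideal_power_hom:
  assumes R: "ring R" and h: "h \<in> ring_hom R R" and I: "I \<subseteq> carrier R" "\<And>x. x \<in> I \<Longrightarrow> h x \<in> I"
  shows "x \<in> ideal_power R I r \<Longrightarrow> x \<in> carrier R \<and> h x \<in> ideal_power R I r"
proof (induction r arbitrary: x)
  case 0
  then show ?case using ring_hom_closed[OF h] by simp
next
  case (Suc r)
  interpret ring R by fact
  have "x \<in> ideal_power R I r \<cdot>\<^bsub>R\<^esub> I" using Suc.prems by simp
  then have "x \<in> carrier R \<and> h x \<in> ideal_power R I r \<cdot>\<^bsub>R\<^esub> I"
  proof induction
    case (prod i j)
    have "j \<in> carrier R" using prod I(1) by blast
    with prod show ?case using Suc.IH[of i] I(2) ring_hom_mult[OF h, of i j]
      by (auto intro: ideal_prod.prod)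
  next
    case (sum a b)
    then show ?case using ring_hom_add[OF h, of a b] by (auto intro: ideal_prod.sum)
  qed
  then show ?case by simp
qed

section \<open>Extension of scalars from the prime field\<close>

lemma lin_span_free_vs: "lin_span (free_vs Y) S = lin_span (free_vs UNIV) S"
proof (intro equalityI subsetI)
  fix f assume "f \<in> lin_span (free_vs Y) S"
  then show "f \<in> lin_span (free_vs UNIV) S"
  proof induction
    case zero
    then show ?case using lin_span.zero[of "free_vs UNIV" S] by (simp add: free_vs_simps)
  next
    case (add x y c)
    then show ?case using lin_span.add[where V = "free_vs UNIV" and c = c] by (simp add: free_vs_simps)
  qed
next
  fix f assume "f \<in> lin_span (free_vs UNIV) S"
  then show "f \<in> lin_span (free_vs Y) S"
  proof induction
    case zero
    then show ?case using lin_span.zero[of "free_vs Y" S] by (simp add: free_vs_simps)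
  next
    case (add x y c)
    then show ?case using lin_span.add[where V = "free_vs Y" and c = c] by (simp add: free_vs_simps)
  qed
qed

text \<open>Spans in a free vector space do not depend on the ambient basis set, so the relations
  can be described by pointwise subtraction over the whole type, and the basis set can later be
  replaced by whichever one suits.\<close>

lemma scalar_ext_rels_eq:
  "scalar_ext_rels V = lin_span (free_vs UNIV)
    {\<lambda>z. basis_elt (x \<otimes>\<^bsub>V\<^esub> y) z - basis_elt x z - basis_elt y z :: 'k::field |x y. x \<in> carrier V \<and> y \<in> carrier V}"
proof -
  have "{basis_elt (x \<otimes>\<^bsub>V\<^esub> y) \<ominus>\<^bsub>free_vs (carrier V)\<^esub> basis_elt x \<ominus>\<^bsub>free_vs (carrier V)\<^esub> basis_elt y |x y.
      x \<in> carrier V \<and> y \<in> carrier V} =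
    {\<lambda>z. basis_elt (x \<otimes>\<^bsub>V\<^esub> y) z - basis_elt x z - basis_elt y z :: 'k |x y. x \<in> carrier V \<and> y \<in> carrier V}"
  proof (rule Collect_cong)
    fix u
    have eq: "basis_elt (x \<otimes>\<^bsub>V\<^esub> y) \<ominus>\<^bsub>free_vs (carrier V)\<^esub> basis_elt x \<ominus>\<^bsub>free_vs (carrier V)\<^esub> basis_elt y =
        (\<lambda>z. basis_elt (x \<otimes>\<^bsub>V\<^esub> y) z - basis_elt x z - basis_elt y z :: 'k)"
      if "x \<in> carrier V" "y \<in> carrier V" for x y
      using that by (simp add: free_vs_minus basis_elt_free_vs)
    show "(\<exists>x y. u = basis_elt (x \<otimes>\<^bsub>V\<^esub> y) \<ominus>\<^bsub>free_vs (carrier V)\<^esub> basis_elt x \<ominus>\<^bsub>free_vs (carrier V)\<^esub> basis_elt y \<and>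
          x \<in> carrier V \<and> y \<in> carrier V) =
        (\<exists>x y. u = (\<lambda>z. basis_elt (x \<otimes>\<^bsub>V\<^esub> y) z - basis_elt x z - basis_elt y z :: 'k) \<and>
          x \<in> carrier V \<and> y \<in> carrier V)"
      by (intro ex_cong1) (use eq in auto)
  qed
  then show ?thesis by (simp only: scalar_ext_rels_def Let_def lin_span_free_vs[of "carrier V"])
qed

lemma scalar_ext_rels_gens:
  "{\<lambda>z. basis_elt (x \<otimes>\<^bsub>V\<^esub> y) z - basis_elt x z - basis_elt y z :: 'k::field |x y. x \<in> carrier V \<and> y \<in> carrier V}
    \<subseteq> carrier (free_vs UNIV)"
proof -
  have "finite {z. basis_elt a z - basis_elt b z - basis_elt c z \<noteq> (0::'k)}" for a b c :: 'a
    by (rule finite_subset[of _ "{a, b, c}"]) (auto simp: basis_elt_def split: if_splits)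
  then show ?thesis by (auto simp: free_vs_simps)
qed

lemma scalar_ext_rels_subspace:
  fixes V :: "('v, 'm) monoid_scheme"
  shows "(\<lambda>_. 0) \<in> (scalar_ext_rels V :: ('v \<Rightarrow> 'k::field) set)"
    and "f \<in> scalar_ext_rels V \<Longrightarrow> g \<in> scalar_ext_rels V \<Longrightarrow> (\<lambda>z. f z + g z :: 'k) \<in> scalar_ext_rels V"
    and "f \<in> scalar_ext_rels V \<Longrightarrow> (\<lambda>z. c * f z :: 'k) \<in> scalar_ext_rels V"
    and "f \<in> scalar_ext_rels V \<Longrightarrow> finite {z. f z \<noteq> (0::'k)}"
proof -
  interpret vec_space "free_vs UNIV :: ('k, 'v \<Rightarrow> 'k) module" by (rule free_vs_vec_space)
  note span = lin_span_props[OF scalar_ext_rels_gens, folded scalar_ext_rels_eq, unfolded free_vs_simps]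
  show "(\<lambda>_. 0) \<in> (scalar_ext_rels V :: ('v \<Rightarrow> 'k) set)"
    using lin_span.zero[of "free_vs UNIV :: ('k, 'v \<Rightarrow> 'k) module"]
    by (simp only: scalar_ext_rels_eq free_vs_simps(2))
  show "(\<lambda>z. f z + g z) \<in> scalar_ext_rels V" if "f \<in> scalar_ext_rels V" "g \<in> scalar_ext_rels V"
    using span(2)[OF that] .
  show "(\<lambda>z. c * f z) \<in> scalar_ext_rels V" if "f \<in> scalar_ext_rels V" using span(3)[OF that] .
  show "finite {z. f z \<noteq> 0}" if "f \<in> scalar_ext_rels V" using span(1)[OF that] by simp
qed

text \<open>The coset of \<open>f\<close>, freed of any mention of the basis set and defined for
  every function \<open>f\<close>.\<close>

definition scalar_ext_class :: "('v, 'm) monoid_scheme \<Rightarrow> ('v \<Rightarrow> 'k::field) \<Rightarrow> ('v \<Rightarrow> 'k) set" where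
  "scalar_ext_class V f = (\<lambda>h z. h z + f z) ` scalar_ext_rels V"

lemma scalar_ext_class_eq: "scalar_ext_rels V +>\<^bsub>free_vs Y\<^esub> f = scalar_ext_class V f"
  by (auto simp: a_r_coset_def' free_vs_simps scalar_ext_class_def)

lemma scalar_ext_rels_coset:
  fixes f :: "'v \<Rightarrow> 'k::field"
  assumes "h \<in> scalar_ext_rels V"
  shows "scalar_ext_class V (\<lambda>z. h z + f z) = scalar_ext_class V f"
proof (intro equalityI subsetI)
  fix g assume "g \<in> scalar_ext_class V (\<lambda>z. h z + f z)"
  then obtain k where "k \<in> scalar_ext_rels V" "g = (\<lambda>z. (k z + h z) + f z)"
    by (auto simp: scalar_ext_class_def add.assoc)
  then show "g \<in> scalar_ext_class V f"
    unfolding scalar_ext_class_def using scalar_ext_rels_subspace(2)[OF _ assms]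
    by (intro image_eqI[where x = "\<lambda>z. k z + h z"]) auto
next
  fix g assume "g \<in> scalar_ext_class V f"
  then obtain k where k: "k \<in> scalar_ext_rels V" "g = (\<lambda>z. k z + f z)" by (auto simp: scalar_ext_class_def)
  have "(\<lambda>z. k z + (- 1) * h z) \<in> scalar_ext_rels V"
    by (intro scalar_ext_rels_subspace(2)[OF k(1)] scalar_ext_rels_subspace(3) assms)
  then show "g \<in> scalar_ext_class V (\<lambda>z. h z + f z)"
    unfolding scalar_ext_class_def k(2) by (rule image_eqI[rotated]) auto
qed

text \<open>The rules for sums and multiples hold for arbitrary functions, so computations with
  cosets produce no side conditions on supports.\<close>

lemma scalar_ext_ops:
  fixes V :: "('v, 'm) monoid_scheme" and f g :: "'v \<Rightarrow> 'k::field"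
  shows "carrier (scalar_ext V :: ('k, ('v \<Rightarrow> 'k) set) module) = scalar_ext_class V ` carrier (free_vs (carrier V))"
    and "\<zero>\<^bsub>scalar_ext V\<^esub> = (scalar_ext_class V (\<lambda>_. 0) :: ('v \<Rightarrow> 'k) set)"
    and "scalar_ext_class V f \<oplus>\<^bsub>scalar_ext V\<^esub> scalar_ext_class V g = scalar_ext_class V (\<lambda>z. f z + g z)"
    and "c \<odot>\<^bsub>scalar_ext V\<^esub> scalar_ext_class V f = scalar_ext_class V (\<lambda>z. c * f z)"
proof -
  show "carrier (scalar_ext V :: ('k, ('v \<Rightarrow> 'k) set) module) = scalar_ext_class V ` carrier (free_vs (carrier V))"
    by (simp add: scalar_ext_def quot_alg_carrier scalar_ext_class_eq)
  show "\<zero>\<^bsub>scalar_ext V\<^esub> = (scalar_ext_class V (\<lambda>_. 0) :: ('v \<Rightarrow> 'k) set)"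
    by (simp add: scalar_ext_def quot_alg_def FactRing_def scalar_ext_class_def)
  have "scalar_ext_class V f \<oplus>\<^bsub>scalar_ext V\<^esub> scalar_ext_class V g =
      (\<Union>h\<in>scalar_ext_rels V. \<Union>k\<in>scalar_ext_rels V. {\<lambda>z. (h z + f z) + (k z + g z)})"
    by (simp add: scalar_ext_def quot_alg_def FactRing_def set_add_def' scalar_ext_class_def free_vs_simps)
  also have "\<dots> = scalar_ext_class V (\<lambda>z. f z + g z)"
  proof (intro equalityI subsetI)
    fix u assume "u \<in> (\<Union>h\<in>scalar_ext_rels V. \<Union>k\<in>scalar_ext_rels V. {\<lambda>z. (h z + f z) + (k z + g z)})"
    then obtain h k where hk: "h \<in> scalar_ext_rels V" "k \<in> scalar_ext_rels V" "u = (\<lambda>z. (h z + f z) + (k z + g z))"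
      by blast
    then show "u \<in> scalar_ext_class V (\<lambda>z. f z + g z)"
      unfolding scalar_ext_class_def
      by (intro image_eqI[OF _ scalar_ext_rels_subspace(2)[OF hk(1,2)]]) (auto simp: algebra_simps)
  next
    fix u assume "u \<in> scalar_ext_class V (\<lambda>z. f z + g z)"
    then obtain h where "h \<in> scalar_ext_rels V" "u = (\<lambda>z. h z + (f z + g z))"
      by (auto simp: scalar_ext_class_def)
    then show "u \<in> (\<Union>h\<in>scalar_ext_rels V. \<Union>k\<in>scalar_ext_rels V. {\<lambda>z. (h z + f z) + (k z + g z)})"
      using scalar_ext_rels_subspace(1)[of V]
      by (intro UN_I[of h] UN_I[of "\<lambda>_. 0"]) (auto simp: add.assoc)
  qed
  finally show "scalar_ext_class V f \<oplus>\<^bsub>scalar_ext V\<^esub> scalar_ext_class V g = scalar_ext_class V (\<lambda>z. f z + g z)" .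
  have "c \<odot>\<^bsub>scalar_ext V\<^esub> scalar_ext_class V f =
      (\<Union>h\<in>scalar_ext_rels V. scalar_ext_class V (\<lambda>z. c * h z + c * f z))"
    by (simp add: scalar_ext_def quot_alg_def free_vs_simps scalar_ext_class_eq)
      (simp add: scalar_ext_class_def[of V f] algebra_simps)
  also have "\<dots> = (\<Union>h\<in>scalar_ext_rels V :: ('v \<Rightarrow> 'k) set. scalar_ext_class V (\<lambda>z. c * f z))"
    by (intro SUP_cong refl scalar_ext_rels_coset scalar_ext_rels_subspace(3))
  also have "\<dots> = scalar_ext_class V (\<lambda>z. c * f z)"
    using scalar_ext_rels_subspace(1)[of V] by auto
  finally show "c \<odot>\<^bsub>scalar_ext V\<^esub> scalar_ext_class V f = scalar_ext_class V (\<lambda>z. c * f z)" .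
qed

text \<open>The inverse is a parameter, which makes the situation symmetric: whatever is shown to be
  preserved by \<open>s\<close> is preserved by \<open>s'\<close>, and inclusions become
  equalities.\<close>

locale group_automorphism = P: group P for P :: "'p monoid" +
  fixes s s' :: "'p \<Rightarrow> 'p"
  assumes s_hom: "s \<in> hom P P" and s'_hom: "s' \<in> hom P P"
    and s'_s: "x \<in> carrier P \<Longrightarrow> s' (s x) = x" and s_s': "x \<in> carrier P \<Longrightarrow> s (s' x) = x"
begin

lemma inverse_automorphism: "group_automorphism P s' s"
  by (unfold_locales) (auto simp: s_hom s'_hom s'_s s_s')

lemma s_closed [simp]: "x \<in> carrier P \<Longrightarrow> s x \<in> carrier P" "x \<in> carrier P \<Longrightarrow> s' x \<in> carrier P"
  and s_mult: "\<lbrakk>x \<in> carrier P; y \<in> carrier P\<rbrakk> \<Longrightarrow> s (x \<otimes>\<^bsub>P\<^esub> y) = s x \<otimes>\<^bsub>P\<^esub> s y"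
  using s_hom s'_hom by (auto simp: hom_def)

lemma s_one: "s \<one>\<^bsub>P\<^esub> = \<one>\<^bsub>P\<^esub>"
  using s_mult[of "\<one>\<^bsub>P\<^esub>" "\<one>\<^bsub>P\<^esub>"] P.r_cancel_one'[of "s \<one>\<^bsub>P\<^esub>" "s \<one>\<^bsub>P\<^esub>"] by simp

lemma s_inv: "x \<in> carrier P \<Longrightarrow> s (inv\<^bsub>P\<^esub> x) = inv\<^bsub>P\<^esub> (s x)"
  using s_mult[of "inv\<^bsub>P\<^esub> x" x] by (intro P.inv_equality[symmetric]) (auto simp: s_one)

lemma s_pow: "x \<in> carrier P \<Longrightarrow> s (x [^]\<^bsub>P\<^esub> (m::nat)) = s x [^]\<^bsub>P\<^esub> m"
  by (induction m) (auto simp: s_one s_mult)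

lemma s_commutator:
  "\<lbrakk>x \<in> carrier P; y \<in> carrier P\<rbrakk> \<Longrightarrow> s (grp_commutator P x y) = grp_commutator P (s x) (s y)"
  by (simp add: grp_commutator_def s_mult s_inv)

lemma push_forward_kP:
  "push_forward s \<in> alg_hom (monoid_alg P) (monoid_alg P :: ('k::field, 'p \<Rightarrow> 'k) module)"
  by (rule push_forward_alg_hom) (auto simp: P.is_monoid s_one s_mult)

lemma push_forward_inverse:
  "f \<in> carrier (monoid_alg P) \<Longrightarrow> push_forward s (push_forward s' f) = (f :: 'p \<Rightarrow> 'k::field)"
  using push_forward_comp_cong[of f "carrier P" s s' "\<lambda>x. x"] push_forward_id[of f "carrier P" "\<lambda>x. x"]
  by (simp add: s_s' monoid_alg_def)

lemma push_forward_kP_iso: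
  "push_forward s \<in> ring_iso (monoid_alg P) (monoid_alg P :: ('k::field, 'p \<Rightarrow> 'k) module)"
proof -
  interpret inv: group_automorphism P s' s by (rule inverse_automorphism)
  have hom: "push_forward s \<in> ring_hom (monoid_alg P) (monoid_alg P :: ('k, 'p \<Rightarrow> 'k) module)"
    "push_forward s' \<in> ring_hom (monoid_alg P) (monoid_alg P :: ('k, 'p \<Rightarrow> 'k) module)"
    using push_forward_kP inv.push_forward_kP by (auto simp: alg_hom_def)
  have "bij_betw (push_forward s) (carrier (monoid_alg P)) (carrier (monoid_alg P :: ('k, 'p \<Rightarrow> 'k) module))"
    by (rule bij_betw_byWitness[where f' = "push_forward s'"])
      (use hom push_forward_inverse inv.push_forward_inverse in \<open>auto simp: ring_hom_def\<close>)
  then show ?thesis using hom(1) by (simp add: ring_iso_def)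
qed

text \<open>\<open>s\<close> extends to an automorphism of the group algebra; this preserves the
  Jacobson radical and its powers, and it sends g - 1 to s(g) - 1.\<close>

lemma jen_filt_closed:
  assumes "x \<in> jen_filt TYPE('k::field) P r" shows "s x \<in> jen_filt TYPE('k) P r"
proof -
  interpret inv: group_automorphism P s' s by (rule inverse_automorphism)
  let ?kP = "monoid_alg P :: ('k, 'p \<Rightarrow> 'k) module"
  interpret kP: field_algebra ?kP by (rule monoid_alg_field_algebra) (rule P.is_monoid)
  have iso: "push_forward s \<in> ring_iso ?kP ?kP" "push_forward s' \<in> ring_iso ?kP ?kP"
    by (rule push_forward_kP_iso inv.push_forward_kP_iso)+
  have hom: "push_forward s \<in> ring_hom ?kP ?kP" using iso by (simp add: ring_iso_def)
  have x: "x \<in> carrier P" "basis_elt x \<ominus>\<^bsub>?kP\<^esub> \<one>\<^bsub>?kP\<^esub> \<in> ideal_power ?kP (jacobson_radical ?kP) r"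
    using assms by (simp_all add: jen_filt_def Let_def)
  have "push_forward s (basis_elt x \<ominus>\<^bsub>?kP\<^esub> \<one>\<^bsub>?kP\<^esub>) \<in> ideal_power ?kP (jacobson_radical ?kP) r"
  proof (rule ideal_power_hom[OF kP.ring_axioms hom, THEN conjunct2])
    show "jacobson_radical ?kP \<subseteq> carrier ?kP" by (auto simp: jacobson_radical_def)
    show "push_forward s f \<in> jacobson_radical ?kP" if "f \<in> jacobson_radical ?kP" for f
      by (rule jacobson_radical_iso[OF kP.ring_axioms iso _ _ that])
        (auto simp: push_forward_inverse inv.push_forward_inverse)
  qed (rule x)
  also have "push_forward s (basis_elt x \<ominus>\<^bsub>?kP\<^esub> \<one>\<^bsub>?kP\<^esub>) = basis_elt (s x) \<ominus>\<^bsub>?kP\<^esub> \<one>\<^bsub>?kP\<^esub>"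
  proof -
    have f: "finite {z. basis_elt a z \<noteq> (0::'k)}" "finite {z. - basis_elt a z \<noteq> (0::'k)}" for a :: 'p
      by (auto simp: basis_elt_def)
    have "push_forward s (\<lambda>z. basis_elt x z + (- 1) * basis_elt \<one>\<^bsub>P\<^esub> z) =
        (\<lambda>z. basis_elt (s x) z + (- 1) * basis_elt \<one>\<^bsub>P\<^esub> z :: 'k)"
      using f by (subst push_forward_linear(1); simp add: push_forward_linear(3) s_one
          push_forward_linear(2)[of "basis_elt \<one>\<^bsub>P\<^esub>" s "-1", simplified])
    then show ?thesis
      using x(1) by (simp add: monoid_alg_minus)
  qed
  finally show ?thesis using x(1) by (simp add: jen_filt_def Let_def)
qed

end

lemma jen_factor_simps:
  "carrier (jen_factor K P r) = (\<lambda>g. jen_filt K P (Suc r) #>\<^bsub>P\<^esub> g) ` jen_filt K P r"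
  "x \<otimes>\<^bsub>jen_factor K P r\<^esub> y = x <#>\<^bsub>P\<^esub> y"
  by (auto simp: jen_factor_def FactGroup_def RCOSETS_def r_coset_def set_mult_def)

lemma jen_filt_carrier: "jen_filt K P r \<subseteq> carrier P"
  by (auto simp: jen_filt_def Let_def)

lemma jen_vs_simps:
  fixes P :: "'p monoid"
  shows "v \<in> carrier (jen_vs P :: ('k::field, ('p, 'k) jen) module) \<longleftrightarrow>
      v \<in> extensional {1..} \<and> (\<forall>r\<ge>1. v r \<in> carrier (scalar_ext (jen_factor TYPE('k) P r))) \<and>
      finite {r \<in> {1..}. v r \<noteq> scalar_ext_class (jen_factor TYPE('k) P r) (\<lambda>_. 0)}"
    and "(\<zero>\<^bsub>jen_vs P\<^esub> :: ('p, 'k) jen) = (\<lambda>r\<in>{1..}. scalar_ext_class (jen_factor TYPE('k) P r) (\<lambda>_. 0))"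
    and "u \<oplus>\<^bsub>jen_vs P\<^esub> v = (\<lambda>r\<in>{1..}. u r \<oplus>\<^bsub>scalar_ext (jen_factor TYPE('k) P r)\<^esub> v r)"
    and "c \<odot>\<^bsub>jen_vs P\<^esub> v = (\<lambda>r\<in>{1..}. c \<odot>\<^bsub>scalar_ext (jen_factor TYPE('k) P r)\<^esub> v r)"
  by (auto simp: jen_vs_def dsum_vs_def scalar_ext_ops(2) PiE_iff)

lemma jen_class_eq:
  "(jen_class P r g :: ('p, 'k::field) jen) = (\<lambda>q\<in>{1..}. scalar_ext_class (jen_factor TYPE('k) P q)
    (if q = r then basis_elt (jen_filt TYPE('k) P (Suc r) #>\<^bsub>P\<^esub> g) else (\<lambda>_. 0)))"
  by (rule ext) (auto simp: jen_class_def scalar_ext_class_eq scalar_ext_ops(2))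

lemma jen_class_closed:
  assumes "r \<ge> 1" "g \<in> jen_filt TYPE('k::field) P r"
  shows "(jen_class P r g :: ('p, 'k) jen) \<in> carrier (jen_vs P)"
proof -
  define w :: "('p, 'k) jen" where "w = jen_class P r g"
  have "w q = scalar_ext_class (jen_factor TYPE('k) P q) (\<lambda>_. 0)" if "q \<ge> 1" "q \<noteq> r" for q
    using that by (simp add: w_def jen_class_eq)
  then have "{q \<in> {1..}. w q \<noteq> scalar_ext_class (jen_factor TYPE('k) P q) (\<lambda>_. 0)} \<subseteq> {r}" by auto
  then have "finite {q \<in> {1..}. w q \<noteq> scalar_ext_class (jen_factor TYPE('k) P q) (\<lambda>_. 0)}"
    by (rule finite_subset) simp
  moreover have "w q \<in> carrier (scalar_ext (jen_factor TYPE('k) P q))" if "q \<ge> 1" for q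
    using assms that
    by (auto simp: w_def jen_class_eq scalar_ext_ops(1) jen_factor_simps free_vs_simps(1)
        simp del: free_vs_simps(1) intro!: imageI basis_elt_free_vs) (auto simp: free_vs_simps(1))
  moreover have "w \<in> extensional {1..}" by (simp add: w_def jen_class_eq)
  ultimately show ?thesis unfolding w_def[symmetric] jen_vs_simps(1) by blast
qed

text \<open>The homogeneous classes span: induction over the finitely many nonzero degrees and,
  within one degree, over the support of a representative. The vector space hypothesis will be
  supplied by the restricted Lie algebra structure.\<close>

lemma jen_induct [consumes 2, case_names zero add]:
  fixes v :: "('p, 'k::field) jen"
  assumes V: "vec_space (jen_vs P :: ('k, ('p, 'k) jen) module)" and v: "v \<in> carrier (jen_vs P)"
    and zero: "Q \<zero>\<^bsub>jen_vs P\<^esub>"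
    and add: "\<And>v c r g. v \<in> carrier (jen_vs P) \<Longrightarrow> Q v \<Longrightarrow> r \<ge> 1 \<Longrightarrow> g \<in> jen_filt TYPE('k) P r \<Longrightarrow>
      Q (c \<odot>\<^bsub>jen_vs P\<^esub> jen_class P r g \<oplus>\<^bsub>jen_vs P\<^esub> v)"
  shows "Q v"
proof -
  interpret vec_space "jen_vs P :: ('k, ('p, 'k) jen) module" by (rule V)
  let ?V = "\<lambda>r. jen_factor TYPE('k) P r"
  have "finite D \<Longrightarrow> D \<subseteq> {1..} \<Longrightarrow> v \<in> carrier (jen_vs P) \<Longrightarrow>
      (\<And>r. r \<ge> 1 \<Longrightarrow> r \<notin> D \<Longrightarrow> v r = scalar_ext_class (?V r) (\<lambda>_. 0)) \<Longrightarrow> Q v" for D v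
  proof (induction D arbitrary: v rule: finite_induct)
    case empty
    then have "v = \<zero>\<^bsub>jen_vs P\<^esub>" by (auto simp: jen_vs_simps fun_eq_iff extensional_def)
    then show ?case using zero by simp
  next
    case (insert r D)
    have r: "r \<ge> 1" using insert.prems(1) by auto
    \<comment> \<open>The component of degree \<open>r\<close> is cleared; it is then rebuilt by
      \<open>upd\<close>, one basis vector of a representative at a time.\<close>
    define v' where "v' = v(r := scalar_ext_class (?V r) (\<lambda>_. 0))"
    have fin: "finite {q \<in> {1..}. v q \<noteq> scalar_ext_class (?V q) (\<lambda>_. 0)}"
      using insert.prems(2) by (simp add: jen_vs_simps)
    have zero_in: "scalar_ext_class (?V q) (\<lambda>_. 0) \<in> carrier (scalar_ext (?V q))" for q
      by (auto simp: scalar_ext_ops(1) free_vs_simps(1))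
    have v': "v' \<in> carrier (jen_vs P)"
      using insert.prems(2) r zero_in
      by (auto simp: jen_vs_simps v'_def extensional_def intro: rev_finite_subset[OF fin])
    have Qv': "Q v'"
    proof (rule insert.IH)
      show "D \<subseteq> {1..}" using insert.prems(1) by simp
      show "v' q = scalar_ext_class (?V q) (\<lambda>_. 0)" if "q \<ge> 1" "q \<notin> D" for q
        using insert.prems(3)[of q] that by (simp add: v'_def)
    qed (rule v')
    obtain f where f: "f \<in> carrier (free_vs (carrier (?V r)))" "v r = scalar_ext_class (?V r) f"
      using insert.prems(2) r by (auto simp: jen_vs_simps scalar_ext_ops(1))
    define upd :: "_ \<Rightarrow> ('p, 'k) jen" where "upd f = v(r := scalar_ext_class (?V r) f)" for f
    have upd_in: "upd f \<in> carrier (jen_vs P)" if "f \<in> carrier (free_vs (carrier (?V r)))" for f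
    proof -
      have "finite {q \<in> {1..}. upd f q \<noteq> scalar_ext_class (?V q) (\<lambda>_. 0)}"
        by (rule finite_subset[of _ "insert r {q \<in> {1..}. v q \<noteq> scalar_ext_class (?V q) (\<lambda>_. 0)}"])
          (use fin in \<open>auto simp: upd_def\<close>)
      then show ?thesis
        using insert.prems(2) r that by (auto simp: jen_vs_simps upd_def extensional_def scalar_ext_ops(1))
    qed
    have "Q (upd f)"
      using f(1)
    proof (induction rule: free_vs_induct)
      case zero
      show ?case using Qv' by (simp only: upd_def v'_def)
    next
      case (add f c x)
      obtain g where g: "g \<in> jen_filt TYPE('k) P r" "x = jen_filt TYPE('k) P (Suc r) #>\<^bsub>P\<^esub> g"
        using add by (auto simp: jen_factor_simps)
      have "upd (\<lambda>z. c * basis_elt x z + f z) = c \<odot>\<^bsub>jen_vs P\<^esub> jen_class P r g \<oplus>\<^bsub>jen_vs P\<^esub> upd f"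
      proof
        fix q
        show "upd (\<lambda>z. c * basis_elt x z + f z) q = (c \<odot>\<^bsub>jen_vs P\<^esub> jen_class P r g \<oplus>\<^bsub>jen_vs P\<^esub> upd f) q"
        proof (cases "q \<ge> 1")
          case True
          show ?thesis
          proof (cases "q = r")
            case False
            obtain f' where "v q = scalar_ext_class (?V q) f'"
              using insert.prems(2) True by (auto simp: jen_vs_simps scalar_ext_ops(1))
            then show ?thesis using True False
              by (simp add: upd_def jen_vs_simps jen_class_eq scalar_ext_ops)
          qed (use True in \<open>simp add: upd_def jen_vs_simps jen_class_eq scalar_ext_ops g(2)\<close>)
        next
          case False
          then show ?thesis using r insert.prems(2) by (auto simp: upd_def jen_vs_simps extensional_def)
        qed
      qed
      then show ?case using assms(4)[OF upd_in[OF add.hyps(1)] add.IH r g(1)] by simp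
    qed
    moreover have "upd f = v" by (simp only: upd_def f(2)[symmetric] fun_upd_triv)
    ultimately show ?case by simp
  qed
  from this[of "{r \<in> {1..}. v r \<noteq> scalar_ext_class (?V r) (\<lambda>_. 0)}" v] v show ?thesis
    by (auto simp: jen_vs_simps)
qed

section \<open>The induced map on the Jennings Lie algebra\<close>

context group_automorphism
begin

lemma image_filt: "s ` jen_filt TYPE('k::field) P r = jen_filt TYPE('k) P r"
proof -
  interpret inv: group_automorphism P s' s by (rule inverse_automorphism)
  show ?thesis
  proof (intro equalityI subsetI)
    fix x assume x: "x \<in> jen_filt TYPE('k) P r"
    then have "x = s (s' x)" using jen_filt_carrier s_s' by (metis subsetD)
    then show "x \<in> s ` jen_filt TYPE('k) P r" using inv.jen_filt_closed[OF x] by blast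
  qed (use jen_filt_closed in auto)
qed

lemma image_coset:
  assumes "g \<in> carrier P"
  shows "s ` (jen_filt TYPE('k::field) P r #>\<^bsub>P\<^esub> g) = jen_filt TYPE('k) P r #>\<^bsub>P\<^esub> s g"
proof -
  have "s ` (jen_filt TYPE('k) P r #>\<^bsub>P\<^esub> g) = (\<lambda>h. s h \<otimes>\<^bsub>P\<^esub> s g) ` jen_filt TYPE('k) P r"
    using assms jen_filt_carrier[of "TYPE('k)" P r] s_mult
    by (auto simp: r_coset_def image_UN image_iff subset_iff intro!: bexI)
  also have "\<dots> = (s ` jen_filt TYPE('k) P r) #>\<^bsub>P\<^esub> s g" by (auto simp: r_coset_def)
  finally show ?thesis by (simp only: image_filt)
qed

lemma jen_factor_subset: "x \<in> carrier (jen_factor K P r) \<Longrightarrow> x \<subseteq> carrier P"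
  using jen_filt_carrier[of K P r] jen_filt_carrier[of K P "Suc r"]
  by (auto simp: jen_factor_simps r_coset_def subset_iff)

lemma image_jen_factor:
  assumes "x \<in> carrier (jen_factor TYPE('k::field) P r)"
  shows "s ` x \<in> carrier (jen_factor TYPE('k) P r)"
  using assms jen_filt_carrier[of "TYPE('k)" P r] jen_filt_closed[where 'k = 'k]
  by (auto simp: jen_factor_simps image_coset subset_iff)

lemma image_set_mult:
  assumes "x \<subseteq> carrier P" "y \<subseteq> carrier P"
  shows "s ` (x <#>\<^bsub>P\<^esub> y) = s ` x <#>\<^bsub>P\<^esub> s ` y"
  using assms s_mult by (force simp: set_mult_def image_iff subset_iff)

lemma image_inverse: "x \<subseteq> carrier P \<Longrightarrow> s ` s' ` x = x"
  using s_s' by (force simp: image_iff subset_iff)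

text \<open>\<open>image s\<close> and \<open>image s'\<close> are mutually inverse only on subsets
  of \<open>P\<close>, so the relations must be known to be supported there.\<close>

lemma scalar_ext_rels_supp:
  fixes f :: "'p set \<Rightarrow> 'k::field"
  assumes "f \<in> scalar_ext_rels (jen_factor TYPE('k) P r)"
  shows "f \<in> carrier (free_vs (Pow (carrier P)))"
proof -
  let ?V = "jen_factor TYPE('k) P r"
  interpret vec_space "free_vs (Pow (carrier P)) :: ('k, 'p set \<Rightarrow> 'k) module" by (rule free_vs_vec_space)
  have "(\<lambda>z. basis_elt (x \<otimes>\<^bsub>?V\<^esub> y) z - basis_elt x z - basis_elt y z :: 'k) \<in> carrier (free_vs (Pow (carrier P)))"
    if "x \<in> carrier ?V" "y \<in> carrier ?V" for x y
  proof -
    have "x \<otimes>\<^bsub>?V\<^esub> y \<subseteq> carrier P"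
      using jen_factor_subset[OF that(1)] jen_factor_subset[OF that(2)]
      by (auto simp: jen_factor_simps set_mult_def subset_iff)
    then have "{z. basis_elt (x \<otimes>\<^bsub>?V\<^esub> y) z - basis_elt x z - basis_elt y z \<noteq> (0::'k)} \<subseteq> Pow (carrier P)"
      using jen_factor_subset[OF that(1)] jen_factor_subset[OF that(2)]
      by (auto simp: basis_elt_def split: if_splits)
    moreover have "finite {z. basis_elt (x \<otimes>\<^bsub>?V\<^esub> y) z - basis_elt x z - basis_elt y z \<noteq> (0::'k)}"
      by (rule finite_subset[of _ "{x \<otimes>\<^bsub>?V\<^esub> y, x, y}"]) (auto simp: basis_elt_def split: if_splits)
    ultimately show ?thesis unfolding free_vs_simps(1) by blast
  qed
  then have gens: "{\<lambda>z. basis_elt (x \<otimes>\<^bsub>?V\<^esub> y) z - basis_elt x z - basis_elt y z :: 'k |x y. x \<in> carrier ?V \<and> y \<in> carrier ?V}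
    \<subseteq> carrier (free_vs (Pow (carrier P)))" by blast
  show ?thesis
    by (rule lin_span_carrier[OF gens]) (use assms in \<open>simp only: scalar_ext_rels_eq lin_span_free_vs[of "Pow (carrier P)"]\<close>)
qed

lemma push_forward_rels:
  fixes f :: "'p set \<Rightarrow> 'k::field"
  assumes "f \<in> scalar_ext_rels (jen_factor TYPE('k) P r)"
  shows "push_forward (image s) f \<in> scalar_ext_rels (jen_factor TYPE('k) P r)"
  using assms unfolding scalar_ext_rels_eq
proof induction
  case zero
  show ?case using lin_span.zero[of "free_vs UNIV"] by (simp add: free_vs_simps push_forward_linear)
next
  case (add f g c)
  let ?V = "jen_factor TYPE('k) P r"
  obtain x y where f: "f = (\<lambda>z. basis_elt (x \<otimes>\<^bsub>?V\<^esub> y) z - basis_elt x z - basis_elt y z)"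
    and xy: "x \<in> carrier ?V" "y \<in> carrier ?V" using add.hyps(1) by blast
  have fin: "finite {z. f z \<noteq> 0}" "finite {z. g z \<noteq> 0}"
    using subsetD[OF scalar_ext_rels_gens add.hyps(1)] add.hyps(2)
      scalar_ext_rels_subspace(4)[of g ?V, unfolded scalar_ext_rels_eq] by (auto simp: free_vs_simps(1))
  have b: "finite {z. basis_elt a z \<noteq> (0::'k)}" "finite {z. - basis_elt a z \<noteq> (0::'k)}"
    "finite {z. basis_elt a z + - basis_elt b z \<noteq> (0::'k)}" for a b :: "'p set"
    by (auto simp: basis_elt_def intro: finite_subset[of _ "{a, b}"])
  have neg: "push_forward (image s) (\<lambda>z. - basis_elt a z) = (\<lambda>z. - basis_elt (s ` a) z :: 'k)" for a
    using push_forward_linear(2)[OF b(1), of "image s" "-1" a] by (simp add: push_forward_linear(3))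
  \<comment> \<open>The differences are rewritten as sums with negatives, the form to which
    additivity of \<open>push_forward\<close> applies.\<close>
  have "push_forward (image s) f = push_forward (image s)
      (\<lambda>z. (basis_elt (x \<otimes>\<^bsub>?V\<^esub> y) z + - basis_elt x z) + - basis_elt y z)" unfolding f by simp
  also have "\<dots> = (\<lambda>z. (basis_elt (s ` (x \<otimes>\<^bsub>?V\<^esub> y)) z + - basis_elt (s ` x) z) + - basis_elt (s ` y) z)"
    by (simp only: push_forward_linear(1)[OF b(3) b(2)] push_forward_linear(1)[OF b(1) b(2)] neg push_forward_linear(3))
  also have "s ` (x \<otimes>\<^bsub>?V\<^esub> y) = s ` x \<otimes>\<^bsub>?V\<^esub> s ` y"
    using jen_factor_subset[OF xy(1)] jen_factor_subset[OF xy(2)]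
    by (simp add: jen_factor_simps(2) image_set_mult)
  finally have pf: "push_forward (image s) f \<in> {\<lambda>z. basis_elt (x \<otimes>\<^bsub>?V\<^esub> y) z - basis_elt x z - basis_elt y z :: 'k
      |x y. x \<in> carrier ?V \<and> y \<in> carrier ?V}"
    using image_jen_factor[OF xy(1)] image_jen_factor[OF xy(2)] by auto
  have "finite {z. c * f z \<noteq> 0}" using fin(1) by (rule rev_finite_subset) auto
  then have "push_forward (image s) (\<lambda>z. c * f z + g z) =
      (\<lambda>z. c * push_forward (image s) f z + push_forward (image s) g z)"
    using fin by (simp add: push_forward_linear)
  then show ?case
    using lin_span.add[OF pf add.IH, of c] by (simp add: free_vs_simps)
qed

text \<open>\<open>jen_map\<close> takes the image of a coset as a set. This is again a full coset
  only because the relations are mapped onto themselves, not merely into themselves; the inverse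
  automorphism provides this.\<close>

lemma push_forward_scalar_ext_class:
  fixes f :: "'p set \<Rightarrow> 'k::field"
  assumes f: "finite {z. f z \<noteq> 0}"
  shows "push_forward (image s) ` scalar_ext_class (jen_factor TYPE('k) P r) f =
    scalar_ext_class (jen_factor TYPE('k) P r) (push_forward (image s) f)"
proof -
  interpret inv: group_automorphism P s' s by (rule inverse_automorphism)
  let ?R = "scalar_ext_rels (jen_factor TYPE('k) P r) :: ('p set \<Rightarrow> 'k) set"
    and ?Q = "push_forward (image s) :: ('p set \<Rightarrow> 'k) \<Rightarrow> _"
  have add: "?Q (\<lambda>z. h z + f z) = (\<lambda>z. ?Q h z + ?Q f z)" if "h \<in> ?R" for h
    using push_forward_linear(1)[OF scalar_ext_rels_subspace(4)[OF that] f] .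
  have surj: "?Q (push_forward (image s') h) = h" if "h \<in> ?R" for h
    using push_forward_comp_cong[OF scalar_ext_rels_supp[OF that], of "image s" "image s'" "\<lambda>x. x"]
      push_forward_id[OF scalar_ext_rels_supp[OF that], of "\<lambda>x. x"] by (simp add: image_inverse)
  have "?Q ` scalar_ext_class (jen_factor TYPE('k) P r) f = (\<lambda>h z. ?Q h z + ?Q f z) ` ?R"
    unfolding scalar_ext_class_def image_image by (rule image_cong[OF refl add])
  also have "\<dots> = (\<lambda>h z. h z + ?Q f z) ` ?Q ` ?R" by (simp add: image_image)
  also have "?Q ` ?R = ?R"
  proof (intro equalityI subsetI)
    fix h assume "h \<in> ?R"
    then show "h \<in> ?Q ` ?R" using surj[of h] inv.push_forward_rels[of h r] by (metis image_eqI)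
  qed (use push_forward_rels in auto)
  finally show ?thesis by (simp only: scalar_ext_class_def)
qed

abbreviation jmap :: "('p, 'k::field) jen \<Rightarrow> ('p, 'k) jen" where "jmap \<equiv> jen_map s"

lemma jmap_class:
  assumes "x \<in> carrier P"
  shows "jmap (jen_class P r x) = (jen_class P r (s x) :: ('p, 'k::field) jen)"
proof
  fix q
  have "finite {z. (if q = r then basis_elt a else (\<lambda>_. 0)) z \<noteq> (0::'k)}" for a :: "'p set"
    by (auto simp: basis_elt_def)
  then show "jmap (jen_class P r x) q = (jen_class P r (s x) :: ('p, 'k) jen) q"
    by (auto simp: jen_map_def jen_class_eq push_forward_scalar_ext_class push_forward_linear image_coset[OF assms])
qed

lemma jen_component:
  fixes v :: "('p, 'k::field) jen"
  assumes "v \<in> carrier (jen_vs P)" "r \<ge> 1"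
  obtains f where "f \<in> carrier (free_vs (carrier (jen_factor TYPE('k) P r)))" "finite {z. f z \<noteq> 0}"
    "v r = scalar_ext_class (jen_factor TYPE('k) P r) f"
proof -
  have "v r \<in> scalar_ext_class (jen_factor TYPE('k) P r) ` carrier (free_vs (carrier (jen_factor TYPE('k) P r)))"
    using assms by (simp add: jen_vs_simps scalar_ext_ops(1))
  then obtain f where "f \<in> carrier (free_vs (carrier (jen_factor TYPE('k) P r)))"
    "v r = scalar_ext_class (jen_factor TYPE('k) P r) f" by blast
  then show thesis using that free_vs_simps(1)[of f] by blast
qed

text \<open>Checked degree by degree on representatives. The zero class goes to the zero class, so
  no new nonzero degrees arise and the support stays finite.\<close>

lemma jmap_linear:
  fixes u v :: "('p, 'k::field) jen"
  assumes u: "u \<in> carrier (jen_vs P)" and v: "v \<in> carrier (jen_vs P)"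
  shows "jmap v \<in> carrier (jen_vs P)"
    and "jmap (u \<oplus>\<^bsub>jen_vs P\<^esub> v) = jmap u \<oplus>\<^bsub>jen_vs P\<^esub> jmap v"
    and "jmap (c \<odot>\<^bsub>jen_vs P\<^esub> v) = c \<odot>\<^bsub>jen_vs P\<^esub> jmap v"
proof -
  let ?V = "\<lambda>r. jen_factor TYPE('k) P r"
  have comp: "jmap v r \<in> carrier (scalar_ext (?V r)) \<and>
      jmap (u \<oplus>\<^bsub>jen_vs P\<^esub> v) r = (jmap u \<oplus>\<^bsub>jen_vs P\<^esub> jmap v) r \<and>
      jmap (c \<odot>\<^bsub>jen_vs P\<^esub> v) r = (c \<odot>\<^bsub>jen_vs P\<^esub> jmap v) r" if r: "r \<ge> 1" for r
  proof -
    obtain f where f: "f \<in> carrier (free_vs (carrier (?V r)))" "finite {z. f z \<noteq> 0}" "u r = scalar_ext_class (?V r) f"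
      using jen_component[OF u r] .
    obtain g where g: "g \<in> carrier (free_vs (carrier (?V r)))" "finite {z. g z \<noteq> 0}" "v r = scalar_ext_class (?V r) g"
      using jen_component[OF v r] .
    have fin: "finite {z. f z + g z \<noteq> 0}" "finite {z. c * g z \<noteq> 0}"
      by (rule finite_subset[of _ "{z. f z \<noteq> 0} \<union> {z. g z \<noteq> 0}"]; use f(2) g(2) in auto)+
    have "push_forward (image s) g \<in> carrier (free_vs (carrier (?V r)))"
      by (rule push_forward_linear(5)[OF g(2)]) (use g(1) image_jen_factor in \<open>auto simp: free_vs_simps(1)\<close>)
    then show ?thesis
      using r f g fin
      by (simp add: jen_map_def jen_vs_simps scalar_ext_ops push_forward_scalar_ext_class push_forward_linear)
  qed
  have ext: "x = y" if "\<And>r. r \<ge> 1 \<Longrightarrow> x r = y r" "x \<in> extensional {1..}" "y \<in> extensional {1..}" for x y :: "('p, 'k) jen"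
    using that by (intro extensionalityI[of x "{1..}" y]) auto
  show "jmap (u \<oplus>\<^bsub>jen_vs P\<^esub> v) = jmap u \<oplus>\<^bsub>jen_vs P\<^esub> jmap v"
    by (rule ext) (use comp in \<open>auto simp: jen_map_def jen_vs_simps\<close>)
  show "jmap (c \<odot>\<^bsub>jen_vs P\<^esub> v) = c \<odot>\<^bsub>jen_vs P\<^esub> jmap v"
    by (rule ext) (use comp in \<open>auto simp: jen_map_def jen_vs_simps\<close>)
  have "{r \<in> {1..}. jmap v r \<noteq> scalar_ext_class (?V r) (\<lambda>_. 0)} \<subseteq> {r \<in> {1..}. v r \<noteq> scalar_ext_class (?V r) (\<lambda>_. 0)}"
  proof -
    have "jmap v r = scalar_ext_class (?V r) (\<lambda>_. 0)" if "r \<ge> 1" "v r = scalar_ext_class (?V r) (\<lambda>_. 0)" for r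
      using that by (simp add: jen_map_def push_forward_scalar_ext_class push_forward_linear)
    then show ?thesis by auto
  qed
  then have "finite {r \<in> {1..}. jmap v r \<noteq> scalar_ext_class (?V r) (\<lambda>_. 0)}"
    by (rule finite_subset) (use v in \<open>simp add: jen_vs_simps\<close>)
  then show "jmap v \<in> carrier (jen_vs P)"
    using comp by (auto simp: jen_vs_simps(1) jen_map_def)
qed

text \<open>On the classes of group elements both claims say that an automorphism respects
  commutators and powers. The bracket then extends by bilinearity; the \<open>p\<close>-map is not
  additive, so its defect has to be transported as well.\<close>

lemma jmap_restricted_lie:
  fixes brk :: "('p, 'k::field) jen \<Rightarrow> ('p, 'k) jen \<Rightarrow> ('p, 'k) jen"
  assumes lie: "jen_restricted_lie p P brk pmap"
    and u: "u \<in> carrier (jen_vs P)" and v: "v \<in> carrier (jen_vs P)"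
  shows "jmap (brk u v) = brk (jmap u) (jmap v)" and "jmap (pmap v) = pmap (jmap v)"
proof -
  let ?J = "jen_vs P :: ('k, ('p, 'k) jen) module"
  have L: "restricted_lie_algebra ?J p brk pmap" using lie by (simp add: jen_restricted_lie_def)
  have V: "vec_space ?J" by (rule vec_space_of_module[OF restricted_lie_algebra.axioms(1)[OF L]])
  interpret J: vec_space ?J by (rule V)
  interpret L: restricted_lie_algebra ?J p brk pmap by (rule L)
  have brk_class: "brk (jen_class P r g) (jen_class P q h) = jen_class P (r + q) (grp_commutator P g h)"
    if "r \<ge> 1" "q \<ge> 1" "g \<in> jen_filt TYPE('k) P r" "h \<in> jen_filt TYPE('k) P q" for r q g h
    using lie that by (auto simp: jen_restricted_lie_def)
  have pmap_class: "pmap (jen_class P r g) = jen_class P (p * r) (g [^]\<^bsub>P\<^esub> p)"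
    if "r \<ge> 1" "g \<in> jen_filt TYPE('k) P r" for r g
    using lie that by (auto simp: jen_restricted_lie_def)
  have filt: "g \<in> carrier P" if "g \<in> jen_filt TYPE('k) P r" for g r
    using that jen_filt_carrier[of "TYPE('k)" P r] by blast
  note cl = jen_class_closed[where 'k = 'k]
  note jc = jmap_linear(1)[of "\<zero>\<^bsub>?J\<^esub>", OF J.zero_closed]
  note lin = jmap_linear(2) jmap_linear(3)[OF J.zero_closed]
  have jzero: "jmap \<zero>\<^bsub>?J\<^esub> = \<zero>\<^bsub>?J\<^esub>" using lin(2)[of "\<zero>\<^bsub>?J\<^esub>" 0] jc[OF J.zero_closed] by simp
  have brk_zero: "brk \<zero>\<^bsub>?J\<^esub> x = \<zero>\<^bsub>?J\<^esub>" "brk x \<zero>\<^bsub>?J\<^esub> = \<zero>\<^bsub>?J\<^esub>" if "x \<in> carrier ?J" for x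
    using L.brk_smult_left[OF J.zero_closed that, of 0] L.brk_smult_right[OF that J.zero_closed, of 0] that
    by (simp_all add: L.brk_closed)
  \<comment> \<open>The second argument is freed while the first is still a class; linearity in the
    first argument follows in the next step.\<close>
  have 1: "jmap (brk (jen_class P r g) x) = brk (jmap (jen_class P r g)) (jmap x)"
    if x: "x \<in> carrier ?J" and r: "r \<ge> 1" and g: "g \<in> jen_filt TYPE('k) P r" for x r g
    using V x
  proof (induction rule: jen_induct)
    case zero
    show ?case using cl[OF r g] jc by (simp add: brk_zero jzero)
  next
    case (add y c q h)
    have "jmap (brk (jen_class P r g) (jen_class P q h)) = brk (jmap (jen_class P r g)) (jmap (jen_class P q h))"
    proof -
      have c: "g \<in> carrier P" "h \<in> carrier P" "grp_commutator P g h \<in> carrier P"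
        using filt[OF g] filt[OF add.hyps(3)] by (simp_all add: grp_commutator_def)
      show ?thesis
        using r g add.hyps(2,3) jen_filt_closed[OF g] jen_filt_closed[OF add.hyps(3)] c
        by (simp add: brk_class jmap_class s_commutator)
    qed
    then show ?case
      using cl[OF r g] cl[OF add.hyps(2,3)] add.hyps(1) add.IH jc
      by (simp add: lin L.brk_add_right L.brk_smult_right L.brk_closed)
  qed
  have brk: "jmap (brk u v) = brk (jmap u) (jmap v)"
    if u: "u \<in> carrier ?J" and v: "v \<in> carrier ?J" for u v
    using V u
  proof (induction rule: jen_induct)
    case zero
    show ?case using v jc by (simp add: brk_zero jzero)
  next
    case (add y c r g)
    then show ?case
      using cl[OF add.hyps(2,3)] v jc 1[OF v add.hyps(2,3)]
      by (simp add: lin L.brk_add_left L.brk_smult_left L.brk_closed)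
  qed
  show "jmap (brk u v) = brk (jmap u) (jmap v)" by (rule brk[OF u v])
  have ad_closed: "ad_coeff ?J brk x y m j \<in> carrier ?J" if "x \<in> carrier ?J" "y \<in> carrier ?J" for x y m j
    using that by (induction m arbitrary: j) (auto simp: L.brk_closed)
  \<comment> \<open>The correction terms in Jacobson's formula are combinations of iterated
    brackets, so they are carried along by compatibility with the bracket.\<close>
  have ad: "jmap (ad_coeff ?J brk x y m j) = ad_coeff ?J brk (jmap x) (jmap y) m j"
    if "x \<in> carrier ?J" "y \<in> carrier ?J" for x y m j
    using that by (induction m arbitrary: j) (auto simp: ad_closed L.brk_closed lin jzero brk)
  show "jmap (pmap v) = pmap (jmap v)"
    using V v
  proof (induction rule: jen_induct)
    case zero
    \<comment> \<open>By homogeneity with scalar 0: since \<open>p\<close> is positive, the scalar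
      0^p is 0.\<close>
    have "pmap \<zero>\<^bsub>?J\<^esub> = \<zero>\<^bsub>?J\<^esub>"
      using L.pmap_smult[OF J.zero_closed, of 0] L.pmap_closed[OF J.zero_closed] prime_gt_0_nat[OF L.prime_p]
      by (simp add: power_0_left)
    then show ?case by (simp add: jzero)
  next
    case (add y c r g)
    let ?x = "c \<odot>\<^bsub>?J\<^esub> jen_class P r g"
    let ?t = "\<lambda>x y i. inverse (of_nat i) \<odot>\<^bsub>?J\<^esub> ad_coeff ?J brk x y (p - 1) (i - 1)"
    have x: "?x \<in> carrier ?J" using cl[OF add.hyps(2,3)] by simp
    have "jmap (pmap (jen_class P r g)) = pmap (jmap (jen_class P r g))"
      using add.hyps(2,3) jen_filt_closed[OF add.hyps(3)] filt[OF add.hyps(3)]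
      by (simp add: pmap_class jmap_class s_pow)
    then have px: "jmap (pmap ?x) = pmap (jmap ?x)"
      using cl[OF add.hyps(2,3)] jc by (simp add: L.pmap_smult lin L.pmap_closed)
    have "jmap (\<Oplus>\<^bsub>?J\<^esub>i\<in>{1..<p}. ?t ?x y i) = (\<Oplus>\<^bsub>?J\<^esub>i\<in>{1..<p}. jmap (?t ?x y i))"
    proof (rule finsum_hom[where h = "jen_map s" and A = ?J and B = ?J and f = "?t ?x y" and I = "{1..<p}"])
      show "?t ?x y \<in> {1..<p} \<rightarrow> carrier ?J" using x add.hyps(1) ad_closed by auto
    qed (use J.abelian_group_axioms lin(1) jc in auto)
    also have "\<dots> = (\<Oplus>\<^bsub>?J\<^esub>i\<in>{1..<p}. ?t (jmap ?x) (jmap y) i)"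
      by (rule J.finsum_cong') (use x add ad_closed jc in \<open>auto simp: lin ad\<close>)
    finally have sum: "jmap (\<Oplus>\<^bsub>?J\<^esub>i\<in>{1..<p}. ?t ?x y i) = (\<Oplus>\<^bsub>?J\<^esub>i\<in>{1..<p}. ?t (jmap ?x) (jmap y) i)" .
    have fs: "(\<Oplus>\<^bsub>?J\<^esub>i\<in>{1..<p}. ?t ?x y i) \<in> carrier ?J"
      using x add ad_closed by (intro J.finsum_closed) auto
    have "jmap (pmap (?x \<oplus>\<^bsub>?J\<^esub> y)) = jmap (pmap ?x) \<oplus>\<^bsub>?J\<^esub> jmap (pmap y) \<oplus>\<^bsub>?J\<^esub> jmap (\<Oplus>\<^bsub>?J\<^esub>i\<in>{1..<p}. ?t ?x y i)"
      unfolding L.pmap_add[OF x add.hyps(1)] using x add.hyps(1) fs by (simp add: lin(1) L.pmap_closed)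
    also have "\<dots> = pmap (jmap ?x) \<oplus>\<^bsub>?J\<^esub> pmap (jmap y) \<oplus>\<^bsub>?J\<^esub> (\<Oplus>\<^bsub>?J\<^esub>i\<in>{1..<p}. ?t (jmap ?x) (jmap y) i)"
      by (simp only: px add.IH sum)
    also have "\<dots> = pmap (jmap ?x \<oplus>\<^bsub>?J\<^esub> jmap y)"
      using L.pmap_add[OF jc[OF x] jc[OF add.hyps(1)]] by simp
    also have "jmap ?x \<oplus>\<^bsub>?J\<^esub> jmap y = jmap (?x \<oplus>\<^bsub>?J\<^esub> y)" using lin(1)[OF x add.hyps(1)] by simp
    finally show ?case .
  qed
qed

end

section \<open>Actions on restricted enveloping algebras\<close>

text \<open>The inclusion of \<open>U\<close> is multiplicative and every element is a sum of
  products of elements of \<open>U\<close> and of \<open>H\<close>, so generators of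
  \<open>U\<close> together with \<open>H\<close> suffice.\<close>

lemma (in algebra_action) UH_generated:
  assumes gen: "carrier U \<subseteq> gen_subalg U G" and G: "G \<subseteq> carrier U"
  shows "carrier UH \<subseteq> gen_subalg UH ((\<lambda>h. skew_group_incl U H (basis_elt h)) ` carrier H \<union> skew_coeff_incl U H ` G)"
    (is "_ \<subseteq> gen_subalg UH ?G")
proof
  have coeff: "skew_coeff_incl U H x \<in> gen_subalg UH ?G" if "x \<in> gen_subalg U G" for x
    using that
  proof induction
    case one
    show ?case using gen_subalg.one[of UH ?G] by (simp add: skew_coeff_incl_eq UH_ops(4))
  next
    case (gen x)
    then show ?case by (intro gen_subalg.gen) auto
  next
    case (add x y)
    then have "x \<in> carrier U" "y \<in> carrier U" using U.gen_subalg_carrier[OF G] by auto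
    with add.IH show ?case by (simp add: skew_coeff_incl_eq single_add_smult gen_subalg.add)
  next
    case (mult x y)
    then have "x \<in> carrier U" "y \<in> carrier U" using U.gen_subalg_carrier[OF G] by auto
    then have "single \<one>\<^bsub>H\<^esub> (x \<otimes>\<^bsub>U\<^esub> y) = single \<one>\<^bsub>H\<^esub> x \<otimes>\<^bsub>UH\<^esub> single \<one>\<^bsub>H\<^esub> y"
      by (simp add: single_mult act_one)
    with mult.IH show ?case by (simp add: skew_coeff_incl_eq gen_subalg.mult)
  next
    case (smult x c)
    then have "x \<in> carrier U" using U.gen_subalg_carrier[OF G] by auto
    with smult.IH show ?case by (simp add: skew_coeff_incl_eq single_add_smult gen_subalg.smult)
  qed
  fix a assume "a \<in> carrier UH"
  then show "a \<in> gen_subalg UH ?G"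
  proof (induction rule: UH_induct)
    case zero
    have "0 \<odot>\<^bsub>UH\<^esub> \<one>\<^bsub>UH\<^esub> \<in> gen_subalg UH ?G" by (intro gen_subalg.smult gen_subalg.one)
    then show ?case by simp
  next
    case (add a h x)
    have "single h x \<in> gen_subalg UH ?G"
      unfolding single_decomp[OF add.hyps(2,3)]
      using add.hyps gen by (intro gen_subalg.mult[OF coeff gen_subalg.gen]) auto
    then show ?case using add.IH by (rule gen_subalg.add)
  qed
qed

section \<open>Functoriality of the restricted enveloping algebra\<close>

abbreviation words :: "'v set \<Rightarrow> 'v list monoid" where
  "words Y \<equiv> \<lparr>carrier = lists Y, monoid.mult = (@), one = []\<rparr>"

lemma monoid_words: "Group.monoid (words Y)"
  by (rule monoidI) auto

lemma free_alg_field_algebra: "field_algebra (free_alg Y :: ('k::field, 'v list \<Rightarrow> 'k) module)"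
  unfolding free_alg_def by (rule monoid_alg_field_algebra[OF monoid_words])

lemma free_alg_basis: "v \<in> Y \<Longrightarrow> basis_elt [v] \<in> carrier (free_alg Y)"
  unfolding free_alg_def by (rule basis_elt_carrier) simp

definition restricted_lie_hom ::
  "('k::field, 'v) module \<Rightarrow> ('v \<Rightarrow> 'v \<Rightarrow> 'v) \<Rightarrow> ('v \<Rightarrow> 'v) \<Rightarrow> ('v \<Rightarrow> 'v) \<Rightarrow> bool" where
  "restricted_lie_hom V brk pmap s \<longleftrightarrow>
    (\<forall>x\<in>carrier V. s x \<in> carrier V \<and> s (pmap x) = pmap (s x) \<and> (\<forall>c. s (c \<odot>\<^bsub>V\<^esub> x) = c \<odot>\<^bsub>V\<^esub> s x) \<and>
      (\<forall>y\<in>carrier V. s (x \<oplus>\<^bsub>V\<^esub> y) = s x \<oplus>\<^bsub>V\<^esub> s y \<and> s (brk x y) = brk (s x) (s y)))"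

context restricted_lie_algebra
begin

abbreviation T where "T \<equiv> free_alg (carrier V) :: ('k, 'v list \<Rightarrow> 'k) module"
abbreviation U where "U \<equiv> uenv p V brk pmap"
abbreviation J where "J \<equiv> uenv_ideal p V brk pmap"

lemma V_closed:
  "x \<in> carrier V \<Longrightarrow> y \<in> carrier V \<Longrightarrow> x \<oplus>\<^bsub>V\<^esub> y \<in> carrier V" "x \<in> carrier V \<Longrightarrow> c \<odot>\<^bsub>V\<^esub> x \<in> carrier V"
  using vec_space.smult_closed[OF vec_space_of_module[OF module_axioms]] by auto

lemma uenv_relsI:
  assumes "v \<in> carrier V"
  shows "w \<in> carrier V \<Longrightarrow> basis_elt [v \<oplus>\<^bsub>V\<^esub> w] \<ominus>\<^bsub>T\<^esub> basis_elt [v] \<ominus>\<^bsub>T\<^esub> basis_elt [w] \<in> uenv_rels p V brk pmap"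
    and "basis_elt [c \<odot>\<^bsub>V\<^esub> v] \<ominus>\<^bsub>T\<^esub> c \<odot>\<^bsub>T\<^esub> basis_elt [v] \<in> uenv_rels p V brk pmap"
    and "w \<in> carrier V \<Longrightarrow> (basis_elt [v] \<otimes>\<^bsub>T\<^esub> basis_elt [w]) \<ominus>\<^bsub>T\<^esub> (basis_elt [w] \<otimes>\<^bsub>T\<^esub> basis_elt [v])
      \<ominus>\<^bsub>T\<^esub> basis_elt [brk v w] \<in> uenv_rels p V brk pmap"
    and "basis_elt [v] [^]\<^bsub>T\<^esub> p \<ominus>\<^bsub>T\<^esub> basis_elt [pmap v] \<in> uenv_rels p V brk pmap"
  unfolding uenv_rels_def Let_def Un_iff mem_Collect_eq using assms by blast+

lemma uenv_relsE:
  assumes "f \<in> uenv_rels p V brk pmap"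
    and "\<And>v w. v \<in> carrier V \<Longrightarrow> w \<in> carrier V \<Longrightarrow>
      f = basis_elt [v \<oplus>\<^bsub>V\<^esub> w] \<ominus>\<^bsub>T\<^esub> basis_elt [v] \<ominus>\<^bsub>T\<^esub> basis_elt [w] \<Longrightarrow> Q"
    and "\<And>c v. v \<in> carrier V \<Longrightarrow> f = basis_elt [c \<odot>\<^bsub>V\<^esub> v] \<ominus>\<^bsub>T\<^esub> c \<odot>\<^bsub>T\<^esub> basis_elt [v] \<Longrightarrow> Q"
    and "\<And>v w. v \<in> carrier V \<Longrightarrow> w \<in> carrier V \<Longrightarrow>
      f = (basis_elt [v] \<otimes>\<^bsub>T\<^esub> basis_elt [w]) \<ominus>\<^bsub>T\<^esub> (basis_elt [w] \<otimes>\<^bsub>T\<^esub> basis_elt [v])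
        \<ominus>\<^bsub>T\<^esub> basis_elt [brk v w] \<Longrightarrow> Q"
    and "\<And>v. v \<in> carrier V \<Longrightarrow> f = basis_elt [v] [^]\<^bsub>T\<^esub> p \<ominus>\<^bsub>T\<^esub> basis_elt [pmap v] \<Longrightarrow> Q"
  shows Q
  using assms(1) unfolding uenv_rels_def Let_def Un_iff mem_Collect_eq
  by (elim disjE exE conjE) (erule assms(2-5); assumption)+

lemma uenv_rels_carrier: "uenv_rels p V brk pmap \<subseteq> carrier T"
proof -
  interpret T: field_algebra T by (rule free_alg_field_algebra)
  show ?thesis
  proof
    fix f assume "f \<in> uenv_rels p V brk pmap"
    then show "f \<in> carrier T"
      by (rule uenv_relsE)
        (use V_closed brk_closed pmap_closed in
          \<open>auto intro!: T.minus_closed T.m_closed T.smult_closed T.nat_pow_closed free_alg_basis\<close>)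
  qed
qed

lemma uenv_ideal: "ideal J T"
proof -
  interpret T: field_algebra T by (rule free_alg_field_algebra)
  show ?thesis unfolding uenv_ideal_def by (rule T.genideal_ideal[OF uenv_rels_carrier])
qed

lemma rels_in_ideal: "f \<in> uenv_rels p V brk pmap \<Longrightarrow> f \<in> J"
proof -
  interpret T: field_algebra T by (rule free_alg_field_algebra)
  show "f \<in> uenv_rels p V brk pmap \<Longrightarrow> f \<in> J"
    unfolding uenv_ideal_def using T.genideal_self[OF uenv_rels_carrier] by auto
qed

lemma U_field_algebra: "field_algebra U"
proof -
  interpret T: field_algebra T by (rule free_alg_field_algebra)
  show ?thesis unfolding uenv_def by (rule T.quot_alg_field_algebra[OF uenv_ideal])
qed

lemma proj_alg_hom: "(\<lambda>f. J +>\<^bsub>T\<^esub> f) \<in> alg_hom T U"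
proof -
  interpret T: field_algebra T by (rule free_alg_field_algebra)
  show ?thesis unfolding uenv_def by (rule T.quot_alg_proj[OF uenv_ideal])
qed

lemma U_carrier: "carrier U = (\<lambda>f. J +>\<^bsub>T\<^esub> f) ` carrier T"
  unfolding uenv_def by (rule quot_alg_carrier)

lemma proj_eqI:
  assumes "f \<in> carrier T" "g \<in> carrier T" "f \<ominus>\<^bsub>T\<^esub> g \<in> J"
  shows "J +>\<^bsub>T\<^esub> f = J +>\<^bsub>T\<^esub> g"
proof -
  interpret T: field_algebra T by (rule free_alg_field_algebra)
  interpret J: ideal J T by (rule uenv_ideal)
  have "f = (f \<ominus>\<^bsub>T\<^esub> g) \<oplus>\<^bsub>T\<^esub> g"
    using assms by (simp add: a_minus_def T.a_assoc T.l_neg)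
  then have "f \<in> J +>\<^bsub>T\<^esub> g" using assms(3) by (auto simp: a_r_coset_def')
  then show ?thesis
    using assms(2) by (intro T.a_repr_independence[symmetric]) (auto simp: J.a_subgroup)
qed

lemma uenv_incl_linear:
  assumes "x \<in> carrier V" "y \<in> carrier V"
  shows "uenv_incl p V brk pmap x \<in> carrier U"
    and "uenv_incl p V brk pmap (x \<oplus>\<^bsub>V\<^esub> y) = uenv_incl p V brk pmap x \<oplus>\<^bsub>U\<^esub> uenv_incl p V brk pmap y"
    and "uenv_incl p V brk pmap (c \<odot>\<^bsub>V\<^esub> x) = c \<odot>\<^bsub>U\<^esub> uenv_incl p V brk pmap x"
proof -
  interpret T: field_algebra T by (rule free_alg_field_algebra)
  let ?b = "\<lambda>v. basis_elt [v] :: 'v list \<Rightarrow> 'k"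
  have b: "v \<in> carrier V \<Longrightarrow> ?b v \<in> carrier T" for v by (rule free_alg_basis)
  have hom: "J +>\<^bsub>T\<^esub> (f \<oplus>\<^bsub>T\<^esub> g) = (J +>\<^bsub>T\<^esub> f) \<oplus>\<^bsub>U\<^esub> (J +>\<^bsub>T\<^esub> g)" "J +>\<^bsub>T\<^esub> (c \<odot>\<^bsub>T\<^esub> f) = c \<odot>\<^bsub>U\<^esub> (J +>\<^bsub>T\<^esub> f)"
    if "f \<in> carrier T" "g \<in> carrier T" for f g c
    using proj_alg_hom that by (auto simp: alg_hom_def ring_hom_def)
  show "uenv_incl p V brk pmap x \<in> carrier U"
    using b[OF assms(1)] by (auto simp: uenv_incl_def U_carrier)
  have "?b (x \<oplus>\<^bsub>V\<^esub> y) \<ominus>\<^bsub>T\<^esub> ?b x \<ominus>\<^bsub>T\<^esub> ?b y \<in> J"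
    by (rule rels_in_ideal[OF uenv_relsI(1)[OF assms]])
  moreover have "?b (x \<oplus>\<^bsub>V\<^esub> y) \<ominus>\<^bsub>T\<^esub> ?b x \<ominus>\<^bsub>T\<^esub> ?b y = ?b (x \<oplus>\<^bsub>V\<^esub> y) \<ominus>\<^bsub>T\<^esub> (?b x \<oplus>\<^bsub>T\<^esub> ?b y)"
    using b[OF assms(1)] b[OF assms(2)] b[OF V_closed(1)[OF assms]]
    by (simp add: a_minus_def T.minus_add T.a_assoc)
  ultimately have "J +>\<^bsub>T\<^esub> ?b (x \<oplus>\<^bsub>V\<^esub> y) = J +>\<^bsub>T\<^esub> (?b x \<oplus>\<^bsub>T\<^esub> ?b y)"
    using b assms V_closed(1) by (intro proj_eqI) auto
  then show "uenv_incl p V brk pmap (x \<oplus>\<^bsub>V\<^esub> y) = uenv_incl p V brk pmap x \<oplus>\<^bsub>U\<^esub> uenv_incl p V brk pmap y"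
    using hom(1)[OF b[OF assms(1)] b[OF assms(2)]] by (simp add: uenv_incl_def)
  have "?b (c \<odot>\<^bsub>V\<^esub> x) \<ominus>\<^bsub>T\<^esub> c \<odot>\<^bsub>T\<^esub> ?b x \<in> J"
    by (rule rels_in_ideal[OF uenv_relsI(2)[OF assms(1)]])
  then have "J +>\<^bsub>T\<^esub> ?b (c \<odot>\<^bsub>V\<^esub> x) = J +>\<^bsub>T\<^esub> (c \<odot>\<^bsub>T\<^esub> ?b x)"
    using b assms V_closed(2) by (intro proj_eqI) auto
  then show "uenv_incl p V brk pmap (c \<odot>\<^bsub>V\<^esub> x) = c \<odot>\<^bsub>U\<^esub> uenv_incl p V brk pmap x"
    using hom(2)[OF b[OF assms(1)] b[OF assms(1)]] by (simp add: uenv_incl_def)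
qed

text \<open>The free algebra is spanned by words, and a word is the product of its letters.\<close>

lemma U_generated: "carrier U \<subseteq> gen_subalg U (uenv_incl p V brk pmap ` carrier V)" (is "_ \<subseteq> gen_subalg U ?G")
proof
  interpret T: field_algebra T by (rule free_alg_field_algebra)
  interpret U: field_algebra U by (rule U_field_algebra)
  interpret proj: ring_hom_ring T U "\<lambda>f. J +>\<^bsub>T\<^esub> f"
    using proj_alg_hom by (intro ring_hom_ringI2 T.ring_axioms U.ring_axioms) (simp add: alg_hom_def)
  have proj_smult: "J +>\<^bsub>T\<^esub> (c \<odot>\<^bsub>T\<^esub> f) = c \<odot>\<^bsub>U\<^esub> (J +>\<^bsub>T\<^esub> f)" if "f \<in> carrier T" for c f
    using proj_alg_hom that by (simp add: alg_hom_def)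
  have T_eq: "T = monoid_alg (words (carrier V))" by (simp add: free_alg_def)
  have bc: "(basis_elt l :: 'v list \<Rightarrow> 'k) \<in> carrier T" if "l \<in> lists (carrier V)" for l
    unfolding T_eq by (rule basis_elt_carrier) (use that in simp)
  have word: "J +>\<^bsub>T\<^esub> basis_elt l \<in> gen_subalg U ?G" if "l \<in> lists (carrier V)" for l
    using that
  proof (induction l)
    case Nil
    have "basis_elt [] = \<one>\<^bsub>T\<^esub>" by (simp add: free_alg_def)
    then show ?case using proj.hom_one gen_subalg.one[of U ?G] by simp
  next
    case (Cons v l)
    have "(basis_elt (v # l) :: 'v list \<Rightarrow> 'k) = basis_elt [v] \<otimes>\<^bsub>T\<^esub> basis_elt l"
      unfolding T_eq basis_elt_mult by simp
    then have "J +>\<^bsub>T\<^esub> basis_elt (v # l) = (J +>\<^bsub>T\<^esub> basis_elt [v]) \<otimes>\<^bsub>U\<^esub> (J +>\<^bsub>T\<^esub> basis_elt l)"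
      using bc[of "[v]"] bc[of l] Cons by simp
    moreover have "J +>\<^bsub>T\<^esub> basis_elt [v] \<in> gen_subalg U ?G"
      using Cons by (intro gen_subalg.gen) (auto simp: uenv_incl_def)
    ultimately show ?case using Cons by (simp add: gen_subalg.mult)
  qed
  fix x assume "x \<in> carrier U"
  then obtain f where f: "f \<in> carrier T" "x = J +>\<^bsub>T\<^esub> f" unfolding U_carrier by blast
  have "f \<in> carrier (monoid_alg (words (carrier V)))" using f(1) by (simp add: free_alg_def)
  then have "f \<in> carrier T \<and> J +>\<^bsub>T\<^esub> f \<in> gen_subalg U ?G"
  proof (induction rule: monoid_alg_induct)
    case zero
    have "0 \<odot>\<^bsub>U\<^esub> \<one>\<^bsub>U\<^esub> \<in> gen_subalg U ?G" by (intro gen_subalg.smult gen_subalg.one)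
    moreover have "(\<lambda>_. 0) = \<zero>\<^bsub>T\<^esub>" by (simp add: free_alg_def)
    ultimately show ?case using proj.hom_zero by simp
  next
    case (add f c l)
    have l: "l \<in> lists (carrier V)" using add by simp
    have "c \<odot>\<^bsub>monoid_alg (words (carrier V))\<^esub> basis_elt l \<oplus>\<^bsub>monoid_alg (words (carrier V))\<^esub> f =
      c \<odot>\<^bsub>T\<^esub> basis_elt l \<oplus>\<^bsub>T\<^esub> f" unfolding T_eq ..
    then show ?case
      using add.IH bc[OF l] word[OF l]
      by (simp add: proj_smult gen_subalg.add gen_subalg.smult del: monoid_alg_simps)
  qed
  then show "x \<in> gen_subalg U ?G" by (simp add: f(2))
qed

text \<open>The map on words sends each defining relation to a relation of the same kind.\<close>

lemma map_hom:
  assumes "restricted_lie_hom V brk pmap s"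
  shows "push_forward (map s) \<in> alg_hom T T" and "f \<in> J \<Longrightarrow> push_forward (map s) f \<in> J"
proof -
  interpret T: field_algebra T by (rule free_alg_field_algebra)
  interpret J: ideal J T by (rule uenv_ideal)
  let ?F = "push_forward (map s) :: ('v list \<Rightarrow> 'k) \<Rightarrow> _" and ?b = "\<lambda>v. basis_elt [v] :: 'v list \<Rightarrow> 'k"
  have s: "s x \<in> carrier V" "s (pmap x) = pmap (s x)" "s (c \<odot>\<^bsub>V\<^esub> x) = c \<odot>\<^bsub>V\<^esub> s x"
    "y \<in> carrier V \<Longrightarrow> s (x \<oplus>\<^bsub>V\<^esub> y) = s x \<oplus>\<^bsub>V\<^esub> s y" "y \<in> carrier V \<Longrightarrow> s (brk x y) = brk (s x) (s y)"
    if "x \<in> carrier V" for x y c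
    using assms that by (auto simp: restricted_lie_hom_def)
  show hom: "?F \<in> alg_hom T T"
    unfolding free_alg_def
    by (rule push_forward_alg_hom[OF monoid_words monoid_words]) (use s(1) in auto)
  interpret F: ring_hom_ring T T ?F
    using hom by (intro ring_hom_ringI2 T.ring_axioms) (simp add: alg_hom_def)
  have F_smult: "?F (c \<odot>\<^bsub>T\<^esub> f) = c \<odot>\<^bsub>T\<^esub> ?F f" if "f \<in> carrier T" for c f
    using hom that by (simp add: alg_hom_def)
  have F_minus: "?F (f \<ominus>\<^bsub>T\<^esub> g) = ?F f \<ominus>\<^bsub>T\<^esub> ?F g" if "f \<in> carrier T" "g \<in> carrier T" for f g
    using that by (simp add: a_minus_def)
  have F_pow: "?F (f [^]\<^bsub>T\<^esub> (m::nat)) = ?F f [^]\<^bsub>T\<^esub> m" if "f \<in> carrier T" for f m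
    using that by (induction m) auto
  have F_b: "?F (?b v) = ?b (s v)" for v using push_forward_linear(3)[of "map s" "[v]"] by simp
  have b: "v \<in> carrier V \<Longrightarrow> ?b v \<in> carrier T" for v by (rule free_alg_basis)
  have rels: "?F f \<in> uenv_rels p V brk pmap" if "f \<in> uenv_rels p V brk pmap" for f
  proof -
    from that show ?thesis
    proof (rule uenv_relsE)
      fix v w assume vw: "v \<in> carrier V" "w \<in> carrier V" "f = ?b (v \<oplus>\<^bsub>V\<^esub> w) \<ominus>\<^bsub>T\<^esub> ?b v \<ominus>\<^bsub>T\<^esub> ?b w"
      have "?F f = ?b (s v \<oplus>\<^bsub>V\<^esub> s w) \<ominus>\<^bsub>T\<^esub> ?b (s v) \<ominus>\<^bsub>T\<^esub> ?b (s w)"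
        using vw b V_closed by (simp add: F_minus F_b s)
      then show ?thesis using uenv_relsI(1)[of "s v" "s w"] vw s(1) by simp
    next
      fix c v assume v: "v \<in> carrier V" "f = ?b (c \<odot>\<^bsub>V\<^esub> v) \<ominus>\<^bsub>T\<^esub> c \<odot>\<^bsub>T\<^esub> ?b v"
      have "?F f = ?b (c \<odot>\<^bsub>V\<^esub> s v) \<ominus>\<^bsub>T\<^esub> c \<odot>\<^bsub>T\<^esub> ?b (s v)"
        using v b V_closed by (simp add: F_minus F_b F_smult s)
      then show ?thesis using uenv_relsI(2)[of "s v" c] v s(1) by simp
    next
      fix v w assume vw: "v \<in> carrier V" "w \<in> carrier V"
        "f = (?b v \<otimes>\<^bsub>T\<^esub> ?b w) \<ominus>\<^bsub>T\<^esub> (?b w \<otimes>\<^bsub>T\<^esub> ?b v) \<ominus>\<^bsub>T\<^esub> ?b (brk v w)"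
      have "?F f = (?b (s v) \<otimes>\<^bsub>T\<^esub> ?b (s w)) \<ominus>\<^bsub>T\<^esub> (?b (s w) \<otimes>\<^bsub>T\<^esub> ?b (s v)) \<ominus>\<^bsub>T\<^esub> ?b (brk (s v) (s w))"
        using vw b brk_closed by (simp add: F_minus F_b s)
      then show ?thesis using uenv_relsI(3)[of "s v" "s w"] vw s(1) by simp
    next
      fix v assume v: "v \<in> carrier V" "f = ?b v [^]\<^bsub>T\<^esub> p \<ominus>\<^bsub>T\<^esub> ?b (pmap v)"
      have "?F f = ?b (s v) [^]\<^bsub>T\<^esub> p \<ominus>\<^bsub>T\<^esub> ?b (pmap (s v))"
        using v b pmap_closed by (simp add: F_minus F_b F_pow s)
      then show ?thesis using uenv_relsI(4)[of "s v"] v s(1) by simp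
    qed
  qed
  \<comment> \<open>The preimage of the ideal is itself a two-sided ideal and contains the
    relations, so by minimality it contains the ideal they generate.\<close>
  have "ideal {f \<in> carrier T. ?F f \<in> J} T"
  proof (rule idealI[OF T.ring_axioms])
    show "subgroup {f \<in> carrier T. ?F f \<in> J} (add_monoid T)"
    proof (rule T.add.subgroupI)
      have "\<zero>\<^bsub>T\<^esub> \<in> {f \<in> carrier T. ?F f \<in> J}" by simp
      then show "{f \<in> carrier T. ?F f \<in> J} \<noteq> {}" by blast
    qed auto
  qed (auto simp: J.I_l_closed J.I_r_closed)
  moreover have "uenv_rels p V brk pmap \<subseteq> {f \<in> carrier T. ?F f \<in> J}"
    using uenv_rels_carrier rels rels_in_ideal by auto
  ultimately have "J \<subseteq> {f \<in> carrier T. ?F f \<in> J}"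
    using T.genideal_minimal by (simp only: uenv_ideal_def)
  then show "f \<in> J \<Longrightarrow> ?F f \<in> J" by blast
qed

lemma free_alg_free_vs: "carrier T = carrier (free_vs (lists (carrier V)))"
  by (simp add: free_alg_def monoid_alg_def)

text \<open>As for the scalar extension, the image of a coset is a full coset because the ideal is
  mapped onto itself; the right inverse \<open>s'\<close> gives surjectivity.\<close>

lemma uenv_map_coset:
  assumes s: "restricted_lie_hom V brk pmap s" "restricted_lie_hom V brk pmap s'"
    and inv: "\<And>x. x \<in> carrier V \<Longrightarrow> s (s' x) = x" and f: "f \<in> carrier T"
  shows "uenv_map s (J +>\<^bsub>T\<^esub> f) = J +>\<^bsub>T\<^esub> push_forward (map s) f"
proof -
  interpret J: ideal J T by (rule uenv_ideal)
  let ?F = "push_forward (map s) :: ('v list \<Rightarrow> 'k) \<Rightarrow> _"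
  have add: "?F (h \<oplus>\<^bsub>T\<^esub> f) = ?F h \<oplus>\<^bsub>T\<^esub> ?F f" if "h \<in> J" for h
    using map_hom(1)[OF s(1)] f J.Icarr[OF that] by (simp add: alg_hom_def ring_hom_def)
  have surj: "?F (push_forward (map s') h) = h" if "h \<in> J" for h
  proof -
    have h: "h \<in> carrier (free_vs (lists (carrier V)))" using J.Icarr[OF that] by (simp add: free_alg_free_vs)
    have "map s (map s' l) = l" if "l \<in> lists (carrier V)" for l
      using that inv by (induction l) auto
    then show ?thesis
      using push_forward_comp_cong[OF h, of "map s" "map s'" "\<lambda>l. l"] push_forward_id[OF h, of "\<lambda>l. l"] by simp
  qed
  have "?F ` J = J"
  proof (intro equalityI subsetI)
    fix h assume "h \<in> J"
    then show "h \<in> ?F ` J" using surj[of h] map_hom(2)[OF s(2), of h] by (metis image_eqI)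
  qed (use map_hom(2)[OF s(1)] in auto)
  have "uenv_map s (J +>\<^bsub>T\<^esub> f) = (\<lambda>h. ?F (h \<oplus>\<^bsub>T\<^esub> f)) ` J"
    by (auto simp: uenv_map_def a_r_coset_def')
  also have "\<dots> = (\<lambda>h. h \<oplus>\<^bsub>T\<^esub> ?F f) ` ?F ` J" using add by (simp add: image_image)
  also have "?F ` J = J" by fact
  finally show ?thesis by (auto simp: a_r_coset_def')
qed

lemma uenv_algebra_action:
  assumes H: "group H" "finite (carrier H)"
    and S: "\<And>h. h \<in> carrier H \<Longrightarrow> restricted_lie_hom V brk pmap (S h)"
    and S_mult: "\<And>g h x. g \<in> carrier H \<Longrightarrow> h \<in> carrier H \<Longrightarrow> x \<in> carrier V \<Longrightarrow> S (g \<otimes>\<^bsub>H\<^esub> h) x = S g (S h x)"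
    and S_one: "\<And>x. x \<in> carrier V \<Longrightarrow> S \<one>\<^bsub>H\<^esub> x = x"
  shows "algebra_action U H (\<lambda>h. uenv_map (S h))"
    and "\<And>h v. h \<in> carrier H \<Longrightarrow> v \<in> carrier V \<Longrightarrow>
      uenv_map (S h) (uenv_incl p V brk pmap v) = uenv_incl p V brk pmap (S h v)"
proof -
  interpret H: group H by fact
  interpret T: field_algebra T by (rule free_alg_field_algebra)
  interpret U: field_algebra U by (rule U_field_algebra)
  let ?F = "\<lambda>h. push_forward (map (S h)) :: ('v list \<Rightarrow> 'k) \<Rightarrow> _"
  \<comment> \<open>The action of the inverse group element serves as the inverse map, by
    \<open>S_mult\<close> and \<open>S_one\<close>.\<close>
  have coset: "uenv_map (S h) (J +>\<^bsub>T\<^esub> f) = J +>\<^bsub>T\<^esub> ?F h f" if h: "h \<in> carrier H" and f: "f \<in> carrier T" for h f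
    by (rule uenv_map_coset[OF S[OF h] S[OF H.inv_closed[OF h]] _ f])
      (use h S_mult[OF h H.inv_closed[OF h]] S_one in simp)
  show "uenv_map (S h) (uenv_incl p V brk pmap v) = uenv_incl p V brk pmap (S h v)"
    if "h \<in> carrier H" "v \<in> carrier V" for h v
  proof -
    have "?F h (basis_elt [v]) = basis_elt [S h v]"
      using push_forward_linear(3)[of "map (S h)" "[v]"] by simp
    then show ?thesis using coset[OF that(1) free_alg_basis[OF that(2)]] by (simp add: uenv_incl_def)
  qed
  have F: "?F h \<in> ring_hom T T" "\<And>c f. f \<in> carrier T \<Longrightarrow> ?F h (c \<odot>\<^bsub>T\<^esub> f) = c \<odot>\<^bsub>T\<^esub> ?F h f" if "h \<in> carrier H" for h
    using map_hom(1)[OF S[OF that]] by (auto simp: alg_hom_def)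
  note F_simps = ring_hom_closed[OF F(1)] ring_hom_mult[OF F(1)] ring_hom_add[OF F(1)] ring_hom_one[OF F(1)] F(2)
  interpret proj: ring_hom_ring T U "\<lambda>f. J +>\<^bsub>T\<^esub> f"
    using proj_alg_hom by (intro ring_hom_ringI2 T.ring_axioms U.ring_axioms) (simp add: alg_hom_def)
  have proj_smult: "J +>\<^bsub>T\<^esub> (c \<odot>\<^bsub>T\<^esub> f) = c \<odot>\<^bsub>U\<^esub> (J +>\<^bsub>T\<^esub> f)" if "f \<in> carrier T" for c f
    using proj_alg_hom that by (simp add: alg_hom_def)
  have F_closed: "?F h f \<in> carrier (free_vs (lists (carrier V)))" if "h \<in> carrier H" "f \<in> carrier T" for h f
    using F_simps(1)[OF that] by (simp add: free_alg_free_vs)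
  show "algebra_action U H (\<lambda>h. uenv_map (S h))"
  proof (intro algebra_action.intro algebra_action_axioms.intro U_field_algebra H)
    fix h assume h: "h \<in> carrier H"
    have "uenv_map (S h) \<in> ring_hom U U"
    proof (rule ring_hom_memI)
      fix x assume "x \<in> carrier U"
      then obtain f where "f \<in> carrier T" "x = J +>\<^bsub>T\<^esub> f" unfolding U_carrier by blast
      then show "uenv_map (S h) x \<in> carrier U" using h by (simp add: coset F_simps)
    next
      fix x y assume "x \<in> carrier U" "y \<in> carrier U"
      then obtain f g where fg: "f \<in> carrier T" "x = J +>\<^bsub>T\<^esub> f" "g \<in> carrier T" "y = J +>\<^bsub>T\<^esub> g"
        unfolding U_carrier by blast
      have "uenv_map (S h) (J +>\<^bsub>T\<^esub> (f \<otimes>\<^bsub>T\<^esub> g)) = uenv_map (S h) x \<otimes>\<^bsub>U\<^esub> uenv_map (S h) y"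
        using h fg by (simp add: coset F_simps del: proj.hom_mult)  (simp add: F_simps h)
      then show "uenv_map (S h) (x \<otimes>\<^bsub>U\<^esub> y) = uenv_map (S h) x \<otimes>\<^bsub>U\<^esub> uenv_map (S h) y" using fg by simp
      have "uenv_map (S h) (J +>\<^bsub>T\<^esub> (f \<oplus>\<^bsub>T\<^esub> g)) = uenv_map (S h) x \<oplus>\<^bsub>U\<^esub> uenv_map (S h) y"
        using h fg by (simp add: coset F_simps del: proj.hom_add) (simp add: F_simps h)
      then show "uenv_map (S h) (x \<oplus>\<^bsub>U\<^esub> y) = uenv_map (S h) x \<oplus>\<^bsub>U\<^esub> uenv_map (S h) y" using fg by simp
    next
      show "uenv_map (S h) \<one>\<^bsub>U\<^esub> = \<one>\<^bsub>U\<^esub>"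
        using coset[OF h T.one_closed] F_simps(4)[OF h] proj.hom_one by simp
    qed
    moreover have "uenv_map (S h) (c \<odot>\<^bsub>U\<^esub> x) = c \<odot>\<^bsub>U\<^esub> uenv_map (S h) x" if "x \<in> carrier U" for c x
    proof -
      obtain f where f: "f \<in> carrier T" "x = J +>\<^bsub>T\<^esub> f" using \<open>x \<in> carrier U\<close> unfolding U_carrier by blast
      show ?thesis
        using h coset[OF h T.smult_closed[OF f(1)], of c] coset[OF h f(1)] f(1) F_simps(1)[OF h f(1)]
        by (simp add: f(2) proj_smult F_simps(5))
    qed
    ultimately show "uenv_map (S h) \<in> alg_hom U U" by (simp add: alg_hom_def)
  next
    fix g h x assume gh: "g \<in> carrier H" "h \<in> carrier H" and "x \<in> carrier U"
    then obtain f where f: "f \<in> carrier T" "x = J +>\<^bsub>T\<^esub> f" unfolding U_carrier by blast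
    have "map (S g) (map (S h) l) = map (S (g \<otimes>\<^bsub>H\<^esub> h)) l" if "l \<in> lists (carrier V)" for l
      using that S_mult[OF gh] by (induction l) auto
    then have "?F g (?F h f) = ?F (g \<otimes>\<^bsub>H\<^esub> h) f"
      using f(1) by (intro push_forward_comp_cong) (auto simp: free_alg_free_vs)
    then show "uenv_map (S (g \<otimes>\<^bsub>H\<^esub> h)) x = uenv_map (S g) (uenv_map (S h) x)"
      using gh f by (simp add: coset F_simps)
  next
    fix x assume "x \<in> carrier U"
    then obtain f where f: "f \<in> carrier T" "x = J +>\<^bsub>T\<^esub> f" unfolding U_carrier by blast
    have "map (S \<one>\<^bsub>H\<^esub>) l = l" if "l \<in> lists (carrier V)" for l
      using that S_one by (induction l) auto
    then have "?F \<one>\<^bsub>H\<^esub> f = f" using f(1) by (intro push_forward_id) (auto simp: free_alg_free_vs)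
    then show "uenv_map (S \<one>\<^bsub>H\<^esub>) x = x" using f by (simp add: coset)
  qed
qed

end

section \<open>The action of H and the identification of the two subalgebras\<close>

lemma inflated_chars_props:
  assumes "Z \<lhd> H" and psi: "psi \<in> inflated_chars H Z"
  shows "psi \<in> hom H (units_grp :: 'k::field monoid)" and "z \<in> Z \<Longrightarrow> psi z = 1"
proof -
  interpret normal Z H by fact
  obtain f where f: "f \<in> hom (H Mod Z) (units_grp :: 'k monoid)" "psi = (\<lambda>g\<in>carrier H. f (Z #>\<^bsub>H\<^esub> g))"
    using psi by (auto simp: inflated_chars_def)
  have coset: "Z #>\<^bsub>H\<^esub> g \<in> carrier (H Mod Z)" if "g \<in> carrier H" for g
    using that by (auto simp: FactGroup_def RCOSETS_def)
  have mult: "psi (g \<otimes>\<^bsub>H\<^esub> h) = psi g * psi h" if "g \<in> carrier H" "h \<in> carrier H" for g h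
  proof -
    have "f ((Z #>\<^bsub>H\<^esub> g) <#>\<^bsub>H\<^esub> (Z #>\<^bsub>H\<^esub> h)) = f (Z #>\<^bsub>H\<^esub> g) * f (Z #>\<^bsub>H\<^esub> h)"
      using f(1) coset[OF that(1)] coset[OF that(2)] by (simp add: hom_def FactGroup_def)
    then have "f (Z #>\<^bsub>H\<^esub> (g \<otimes>\<^bsub>H\<^esub> h)) = f (Z #>\<^bsub>H\<^esub> g) * f (Z #>\<^bsub>H\<^esub> h)"
      unfolding rcos_sum[OF that] .
    then show ?thesis using that by (simp add: f(2))
  qed
  have nz: "psi g \<noteq> 0" if "g \<in> carrier H" for g
    using f(1) coset[OF that] that by (auto simp: f(2) hom_def)
  show "psi \<in> hom H units_grp" using mult nz by (auto simp: hom_def)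
  have one: "psi \<one>\<^bsub>H\<^esub> = 1" using mult[of "\<one>\<^bsub>H\<^esub>" "\<one>\<^bsub>H\<^esub>"] nz[of "\<one>\<^bsub>H\<^esub>"] by simp
  show "psi z = 1" if z: "z \<in> Z"
  proof -
    have "Z #>\<^bsub>H\<^esub> z = Z #>\<^bsub>H\<^esub> \<one>\<^bsub>H\<^esub>" using z by (simp add: rcos_const coset_mult_one subset)
    then show ?thesis using z one by (simp add: f(2))
  qed
qed

lemma (in vec_space) linear_finsum:
  assumes S: "\<And>x. x \<in> carrier V \<Longrightarrow> S x \<in> carrier W" "vec_space W"
    and add: "\<And>x y. x \<in> carrier V \<Longrightarrow> y \<in> carrier V \<Longrightarrow> S (x \<oplus> y) = S x \<oplus>\<^bsub>W\<^esub> S y"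
    and smult: "\<And>c x. x \<in> carrier V \<Longrightarrow> S (c \<odot> x) = c \<odot>\<^bsub>W\<^esub> S x"
    and f: "f \<in> I \<rightarrow> carrier V"
  shows "S (\<Oplus>i\<in>I. c i \<odot> f i) = (\<Oplus>\<^bsub>W\<^esub>i\<in>I. c i \<odot>\<^bsub>W\<^esub> S (f i))"
proof -
  interpret W: vec_space W by fact
  have "S (\<Oplus>i\<in>I. c i \<odot> f i) = (\<Oplus>\<^bsub>W\<^esub>i\<in>I. S (c i \<odot> f i))"
    by (rule finsum_hom) (use abelian_group_axioms W.abelian_group_axioms S(1) add f in auto)
  also have "\<dots> = (\<Oplus>\<^bsub>W\<^esub>i\<in>I. c i \<odot>\<^bsub>W\<^esub> S (f i))"
    by (rule W.finsum_cong') (use S(1) smult f in \<open>auto simp: Pi_iff\<close>)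
  finally show ?thesis .
qed

lemma (in field_algebra) gen_subalg_trans:
  assumes "x \<in> gen_subalg A G" "\<And>y. y \<in> G \<Longrightarrow> y \<in> gen_subalg A G'"
  shows "x \<in> gen_subalg A G'"
  using assms(1) by induction (auto intro: gen_subalg.intros assms(2))

lemma (in field_algebra) gen_subalg_finsum:
  assumes "finite I" "\<And>i. i \<in> I \<Longrightarrow> f i \<in> gen_subalg A G" "G \<subseteq> carrier A"
  shows "(\<Oplus>i\<in>I. f i) \<in> gen_subalg A G"
  using assms(1,2)
proof (induction I rule: finite_induct)
  case empty
  have "0 \<odot> \<one> \<in> gen_subalg A G" by (intro gen_subalg.smult gen_subalg.one)
  then show ?case by simp
next
  case (insert i I)
  then have "(\<Oplus>i\<in>insert i I. f i) = f i \<oplus> (\<Oplus>i\<in>I. f i)"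
    using gen_subalg_carrier[OF assms(3)] by (intro finsum_insert) auto
  then show ?case using insert by (simp add: gen_subalg.add)
qed

theorem theorem3p14:
  fixes p n :: nat
    and P :: "'p monoid" and L :: "('p \<Rightarrow> 'p) set"
    and alpha :: "(('p \<Rightarrow> 'p) \<times> ('p \<Rightarrow> 'p) \<Rightarrow> 'k::alg_closed_field) set"
    and a :: "('p \<Rightarrow> 'p) \<times> ('p \<Rightarrow> 'p) \<Rightarrow> 'k"
    and H :: "'h monoid" and Z :: "'h set" and pr :: "'h \<Rightarrow> ('p \<Rightarrow> 'p)"
    and chi :: "'h \<Rightarrow> 'k" and lift :: "('p \<Rightarrow> 'p) \<Rightarrow> 'h"
    and phi0 :: "'h \<Rightarrow> 'k" and xi :: "('h \<Rightarrow> 'k) \<Rightarrow> 'h \<Rightarrow> 'k"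
    and gg :: "('h \<Rightarrow> 'k) \<Rightarrow> ('h \<Rightarrow> 'k) \<Rightarrow> 'h"
    and brk :: "('p, 'k) jen \<Rightarrow> ('p, 'k) jen \<Rightarrow> ('p, 'k) jen"
    and pmap :: "('p, 'k) jen \<Rightarrow> ('p, 'k) jen"
    and w :: "nat \<Rightarrow> ('p, 'k) jen" and psi :: "nat \<Rightarrow> 'h \<Rightarrow> 'k"
    and Irr :: "('h \<Rightarrow> 'k) set" and kH :: "('k, 'h \<Rightarrow> 'k) module"
    and e :: "'h \<Rightarrow> 'k" and ei :: "('h \<Rightarrow> 'k) \<Rightarrow> 'h \<Rightarrow> 'k"
    and Jen :: "('k, ('p, 'k) jen) module"
    and U :: "('k, (('p, 'k) jen list \<Rightarrow> 'k) set) module"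
    and UH B :: "('k, 'h \<Rightarrow> (('p, 'k) jen list \<Rightarrow> 'k) set) module"
    and u :: "('p, 'k) jen \<Rightarrow> 'h \<Rightarrow> (('p, 'k) jen list \<Rightarrow> 'k) set"
    and k :: "('h \<Rightarrow> 'k) \<Rightarrow> 'h \<Rightarrow> (('p, 'k) jen list \<Rightarrow> 'k) set"
    and AA MM :: "('h \<Rightarrow> (('p, 'k) jen list \<Rightarrow> 'k) set) set"
  (* p, k, P, L *)
  assumes "Factorial_Ring.prime p" and "CHAR('k) = p"
    and "group P" and "finite (carrier P)" and "card (carrier P) = p ^ n"
    and "subgroup L (AutoGroup P)" and "comm_group (AutoGroup P\<lparr>carrier := L\<rparr>)"
    and "coprime (card L) p"
  (* alpha and its cocycle *)
    and "alpha \<in> carrier (cohomology2 (AutoGroup P\<lparr>carrier := L\<rparr>))" and "a \<in> alpha"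
    and "group.ord (cocycles2 (AutoGroup P\<lparr>carrier := L\<rparr>)) a =
         group.ord (cohomology2 (AutoGroup P\<lparr>carrier := L\<rparr>)) alpha"
  (* the central extension H of L by Z, and chi *)
    and "group H" and "finite (carrier H)" and "coprime (card (carrier H)) p"
    and "Z \<subseteq> grp_center H"
    and "pr \<in> hom H (AutoGroup P\<lparr>carrier := L\<rparr>)" and "pr ` carrier H = L"
    and "kernel H (AutoGroup P\<lparr>carrier := L\<rparr>) pr = Z"
    and "Z = derived H (carrier H)"
    and "chi \<in> hom (H\<lparr>carrier := Z\<rparr>) units_grp" and "inj_on chi Z"
    and "\<And>x. x \<in> L \<Longrightarrow> lift x \<in> carrier H \<and> pr (lift x) = x"
    and "\<And>x y. x \<in> L \<Longrightarrow> y \<in> L \<Longrightarrow>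
           a (x, y) = chi (lift x \<otimes>\<^bsub>H\<^esub> lift y \<otimes>\<^bsub>H\<^esub> inv\<^bsub>H\<^esub> (lift (x \<otimes>\<^bsub>AutoGroup P\<^esub> y)))"
  defines "kH \<equiv> monoid_alg H"
    and "e \<equiv> char_idem H Z chi"
    and "Irr \<equiv> chars_over H Z chi"
    and "ei \<equiv> char_idem H (grp_center H)"
  (* phi_0, xi_phi and g_{psi,phi} *)
  assumes "phi0 \<in> Irr"
    and "\<And>phi. phi \<in> Irr \<Longrightarrow> xi phi \<in> inflated_chars H Z"
    and "\<And>phi z. phi \<in> Irr \<Longrightarrow> z \<in> grp_center H \<Longrightarrow> xi phi z = phi z * inverse (phi0 z)"
    and "xi phi0 = (\<lambda>h\<in>carrier H. 1)"
    and "\<And>ps phi. ps \<in> inflated_chars H Z \<Longrightarrow> phi \<in> Irr \<Longrightarrow>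
           gg ps phi \<in> carrier H \<and>
           comm_char H chi (gg ps phi) =
             (\<lambda>h\<in>carrier H. xi (char_twist H phi ps) h * inverse (xi phi h) * inverse (ps h))"
  (* the Jennings restricted Lie algebra and its basis *)
  defines "Jen \<equiv> jen_vs P"
  assumes "jen_restricted_lie p P brk pmap"
    and "indexed_basis Jen n w"
    and "\<And>i. i \<in> {1..n} \<Longrightarrow> jen_homogeneous P (w i)"
    and "\<And>i. i \<in> {1..n} \<Longrightarrow> psi i \<in> inflated_chars H Z"
    and "\<And>i g. i \<in> {1..n} \<Longrightarrow> g \<in> carrier H \<Longrightarrow>
           jen_map (pr g) (w i) = psi i g \<odot>\<^bsub>Jen\<^esub> w i"
  defines "U \<equiv> uenv p Jen brk pmap"
    and "UH \<equiv> skew_group_alg U H (\<lambda>h. uenv_map (jen_map (pr h)))"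
    and "u \<equiv> \<lambda>v. skew_coeff_incl U H (uenv_incl p Jen brk pmap v)"
    and "k \<equiv> skew_group_incl U H"
    and "B \<equiv> corner_alg UH (k e)"
    and "AA \<equiv> gen_subalg B
           ((\<lambda>phi. k (ei phi)) ` Irr \<union>
            {k (basis_elt (gg (psi i) phi)) \<otimes>\<^bsub>UH\<^esub> u (w i) \<otimes>\<^bsub>UH\<^esub> k (ei phi) |i phi.
               i \<in> {1..n} \<and> phi \<in> Irr})"
    and "MM \<equiv> k ` matrix_embedding H Irr xi ` carrier (corner_alg kH (ei phi0))"
  shows "\<exists>f \<in> alg_iso (tensor_alg (B\<lparr>carrier := AA\<rparr>) (B\<lparr>carrier := MM\<rparr>)) B.
           \<forall>x\<in>AA. \<forall>m\<in>MM.
             f (pure_tensor (B\<lparr>carrier := AA\<rparr>) (B\<lparr>carrier := MM\<rparr>) x m) = x \<otimes>\<^bsub>B\<^esub> m"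
proof -
  note [simp del] = monoid_alg_simps
  note prime_p = assms(1) and char_p = assms(2) and P_group = assms(3)
    and L = assms(6) and H_group = assms(12) and finite_H = assms(13) and coprime_H = assms(14)
    and Z_center = assms(15) and pr = assms(16,17) and ker = assms(18) and Z_derived = assms(19)
    and chi = assms(20,21)
  note kH = kH_def and Irr = Irr_def and ei = ei_def and Jen = Jen_def
  note phi0 = assms(28) and xi = assms(29,30) and gg = assms(32)
  note lie = assms(34) and basis = assms(35) and psi = assms(37) and eigen = assms(38)
  interpret P: group P by (rule P_group)
  interpret H: group H by (rule H_group)
  interpret Aut: group "AutoGroup P" by (rule P.AutoGroup)
  have L_group: "group (AutoGroup P\<lparr>carrier := L\<rparr>)"
    by (rule subgroup.subgroup_is_group[OF L Aut.is_group])
  interpret pr: group_hom H "AutoGroup P\<lparr>carrier := L\<rparr>" pr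
    using pr(1) L_group by (intro group_hom.intro group_hom_axioms.intro H_group)
  have Z_normal: "Z \<lhd> H" using pr.normal_kernel ker by simp
  then have Z_subgroup: "subgroup Z H" by (rule normal_imp_subgroup)
  have pr_aut: "pr h \<in> hom P P" "pr h \<in> carrier P \<rightarrow> carrier P" if "h \<in> carrier H" for h
    using that pr(2) subgroup.subset[OF L] by (auto simp: AutoGroup_def auto_def hom_def)
  have Aut_mult: "x \<otimes>\<^bsub>AutoGroup P\<lparr>carrier := L\<rparr>\<^esub> y = compose (carrier P) x y" if "x \<in> L" "y \<in> L" for x y
    using that subgroup.subset[OF L] by (auto simp: AutoGroup_def BijGroup_def auto_def)
  \<comment> \<open>The product of automorphisms is composition restricted to
    \<open>carrier P\<close>, so these identities are available only at points of
    \<open>P\<close>.\<close>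
  have pr_comp: "pr g (pr h x) = pr (g \<otimes>\<^bsub>H\<^esub> h) x" if "g \<in> carrier H" "h \<in> carrier H" "x \<in> carrier P" for g h x
    using that pr(2) Aut_mult[of "pr g" "pr h"] by (auto simp: compose_def)
  have pr_one: "pr \<one>\<^bsub>H\<^esub> x = x" if "x \<in> carrier P" for x
    using that pr.hom_one by (simp add: AutoGroup_def BijGroup_def)
  have aut: "group_automorphism P (pr h) (pr (inv\<^bsub>H\<^esub> h))" if h: "h \<in> carrier H" for h
  proof -
    have h': "inv\<^bsub>H\<^esub> h \<in> carrier H" using h by simp
    show ?thesis
      by unfold_locales
        (use pr_aut(1)[OF h] pr_aut(1)[OF h'] h in \<open>simp_all add: pr_comp pr_one del: pr.hom_inv pr.hom_one\<close>)
  qed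

  have Jen_lie: "restricted_lie_algebra Jen p brk pmap"
    using lie by (simp add: jen_restricted_lie_def Jen)
  have Jen_vs: "vec_space Jen"
    by (rule vec_space_of_module[OF restricted_lie_algebra.axioms(1)[OF Jen_lie]])
  interpret Jen: vec_space Jen by (rule Jen_vs)
  interpret lie: restricted_lie_algebra Jen p brk pmap by (rule Jen_lie)
  define S :: "'h \<Rightarrow> ('p, 'k) jen \<Rightarrow> ('p, 'k) jen" where "S h = jen_map (pr h)" for h
  have S_hom: "restricted_lie_hom Jen brk pmap (S h)" if "h \<in> carrier H" for h
  proof -
    interpret group_automorphism P "pr h" "pr (inv\<^bsub>H\<^esub> h)" by (rule aut[OF that])
    show ?thesis
      unfolding restricted_lie_hom_def S_def Jen
      using jmap_linear(1,3)[of "\<zero>\<^bsub>Jen\<^esub>"] jmap_linear(2) jmap_restricted_lie[OF lie] Jen.zero_closed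
      by (auto simp: Jen)
  qed
  have S_lin: "S h x \<in> carrier Jen" "S h (c \<odot>\<^bsub>Jen\<^esub> x) = c \<odot>\<^bsub>Jen\<^esub> S h x"
    "y \<in> carrier Jen \<Longrightarrow> S h (x \<oplus>\<^bsub>Jen\<^esub> y) = S h x \<oplus>\<^bsub>Jen\<^esub> S h y"
    if "h \<in> carrier H" "x \<in> carrier Jen" for h x y c
    using S_hom[OF that(1)] that(2) by (auto simp: restricted_lie_hom_def)
  have w: "w i \<in> carrier Jen" if "i \<in> {1..n}" for i
    using basis that by (auto simp: indexed_basis_def)
  have expand: "\<exists>c. v = (\<Oplus>\<^bsub>Jen\<^esub>i\<in>{1..n}. c i \<odot>\<^bsub>Jen\<^esub> w i)" if "v \<in> carrier Jen" for v
    using basis that by (auto simp: indexed_basis_def)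
  have S_sum: "S h (\<Oplus>\<^bsub>Jen\<^esub>i\<in>{1..n}. c i \<odot>\<^bsub>Jen\<^esub> w i) = (\<Oplus>\<^bsub>Jen\<^esub>i\<in>{1..n}. (c i * psi i h) \<odot>\<^bsub>Jen\<^esub> w i)"
    if h: "h \<in> carrier H" for h c
  proof -
    have "S h (\<Oplus>\<^bsub>Jen\<^esub>i\<in>{1..n}. c i \<odot>\<^bsub>Jen\<^esub> w i) = (\<Oplus>\<^bsub>Jen\<^esub>i\<in>{1..n}. c i \<odot>\<^bsub>Jen\<^esub> S h (w i))"
      by (rule Jen.linear_finsum) (use S_lin[OF h] w Jen_vs in auto)
    also have "\<dots> = (\<Oplus>\<^bsub>Jen\<^esub>i\<in>{1..n}. (c i * psi i h) \<odot>\<^bsub>Jen\<^esub> w i)"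
      by (rule Jen.finsum_cong') (use h w eigen in \<open>auto simp: S_def Jen.smult_smult\<close>)
    finally show ?thesis .
  qed
  note psi_hom = inflated_chars_props(1)[OF Z_normal psi] and psi_Z = inflated_chars_props(2)[OF Z_normal psi]
  have psi_mult: "psi i (g \<otimes>\<^bsub>H\<^esub> h) = psi i g * psi i h" if "i \<in> {1..n}" "g \<in> carrier H" "h \<in> carrier H" for i g h
    using psi_hom[OF that(1)] that(2,3) by (auto simp: hom_def)
  have psi_one: "psi i \<one>\<^bsub>H\<^esub> = 1" if "i \<in> {1..n}" for i
    using psi_Z[OF that] subgroup.one_closed[OF Z_subgroup] by simp
  \<comment> \<open>In the eigenbasis the action is diagonal, so its multiplicativity reduces to
    that of the characters \<open>psi i\<close> and does not require composing maps of
    cosets.\<close>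
  have S_mult: "S (g \<otimes>\<^bsub>H\<^esub> h) x = S g (S h x)"
    if gh: "g \<in> carrier H" "h \<in> carrier H" and x: "x \<in> carrier Jen" for g h x
  proof -
    obtain c where c: "x = (\<Oplus>\<^bsub>Jen\<^esub>i\<in>{1..n}. c i \<odot>\<^bsub>Jen\<^esub> w i)" using expand[OF x] by auto
    show ?thesis
      unfolding c S_sum[OF gh(1)] S_sum[OF gh(2)] S_sum[OF H.m_closed[OF gh]]
      by (rule Jen.finsum_cong') (use gh w in \<open>auto simp: psi_mult mult_ac\<close>)
  qed
  have S_one: "S \<one>\<^bsub>H\<^esub> x = x" if x: "x \<in> carrier Jen" for x
  proof -
    obtain c where c: "x = (\<Oplus>\<^bsub>Jen\<^esub>i\<in>{1..n}. c i \<odot>\<^bsub>Jen\<^esub> w i)" using expand[OF x] by auto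
    show ?thesis
      unfolding c S_sum[OF H.one_closed]
      by (rule Jen.finsum_cong') (use w in \<open>auto simp: psi_one\<close>)
  qed
  have action: "algebra_action U H (\<lambda>h. uenv_map (S h))"
    unfolding U_def by (rule lie.uenv_algebra_action(1)[OF H_group finite_H S_hom S_mult S_one])
  have act_incl: "uenv_map (S h) (uenv_incl p Jen brk pmap v) = uenv_incl p Jen brk pmap (S h v)"
    if "h \<in> carrier H" "v \<in> carrier Jen" for h v
    by (rule lie.uenv_algebra_action(2)[OF H_group finite_H S_hom S_mult S_one]) (use that in auto)
  interpret act: algebra_action U H "\<lambda>h. uenv_map (S h)" by (rule action)
  have UH: "UH = skew_group_alg U H (\<lambda>h. uenv_map (S h))" by (simp add: UH_def S_def)
  define incl where "incl = uenv_incl p Jen brk pmap"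
  note incl_linear = lie.uenv_incl_linear[folded U_def incl_def]
  have incl: "incl v \<in> carrier U" "incl (c \<odot>\<^bsub>Jen\<^esub> v) = c \<odot>\<^bsub>U\<^esub> incl v"
    "v' \<in> carrier Jen \<Longrightarrow> incl (v \<oplus>\<^bsub>Jen\<^esub> v') = incl v \<oplus>\<^bsub>U\<^esub> incl v'"
    if "v \<in> carrier Jen" for v v' c
    by (rule incl_linear(1)[OF that that], rule incl_linear(3)[OF that that], rule incl_linear(2)[OF that])
  \<comment> \<open>The inclusion of the Lie algebra is linear, so the finitely many basis vectors
    already generate.\<close>
  have U_gen: "carrier U \<subseteq> gen_subalg U (incl ` w ` {1..n})"
  proof
    have wG: "incl ` w ` {1..n} \<subseteq> carrier U" using incl(1) w by auto
    have "incl v \<in> gen_subalg U (incl ` w ` {1..n})" if v: "v \<in> carrier Jen" for v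
    proof -
      obtain c where c: "v = (\<Oplus>\<^bsub>Jen\<^esub>i\<in>{1..n}. c i \<odot>\<^bsub>Jen\<^esub> w i)" using expand[OF v] by auto
      have "incl v = (\<Oplus>\<^bsub>U\<^esub>i\<in>{1..n}. c i \<odot>\<^bsub>U\<^esub> incl (w i))"
        unfolding c by (rule Jen.linear_finsum) (use incl w act.U.vec_space_axioms in auto)
      also have "\<dots> \<in> gen_subalg U (incl ` w ` {1..n})"
        by (rule act.U.gen_subalg_finsum[OF _ gen_subalg.smult[OF gen_subalg.gen] wG]) auto
      finally show ?thesis .
    qed
    then have gens: "y \<in> gen_subalg U (incl ` w ` {1..n})" if "y \<in> incl ` carrier Jen" for y using that by auto
    fix x assume "x \<in> carrier U"
    then have "x \<in> gen_subalg U (incl ` carrier Jen)" using lie.U_generated[folded U_def incl_def] by auto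
    then show "x \<in> gen_subalg U (incl ` w ` {1..n})" using gens by (rule act.U.gen_subalg_trans)
  qed

  define K where "K h = k (basis_elt h)" for h
  define W where "W i = u (w i)" for i
  interpret UH: field_algebra UH unfolding UH by (rule act.UH_field_algebra)
  interpret kH: field_algebra kH unfolding kH by (rule monoid_alg_field_algebra[OF H.is_monoid])
  have k_hom: "k \<in> alg_hom kH UH" unfolding k_def kH UH by (rule act.skew_group_incl_alg_hom)
  have k_lin: "f \<in> carrier kH \<Longrightarrow> k f \<in> carrier UH" "f \<in> carrier kH \<Longrightarrow> k (c \<odot>\<^bsub>kH\<^esub> f) = c \<odot>\<^bsub>UH\<^esub> k f"
    "f \<in> carrier kH \<Longrightarrow> g \<in> carrier kH \<Longrightarrow> k (f \<oplus>\<^bsub>kH\<^esub> g) = k f \<oplus>\<^bsub>UH\<^esub> k g"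
    "f \<in> carrier kH \<Longrightarrow> g \<in> carrier kH \<Longrightarrow> k (f \<otimes>\<^bsub>kH\<^esub> g) = k f \<otimes>\<^bsub>UH\<^esub> k g"
    "k \<one>\<^bsub>kH\<^esub> = \<one>\<^bsub>UH\<^esub>" for f g c
    using k_hom by (auto simp: alg_hom_def ring_hom_def)
  have bH: "basis_elt h \<in> carrier kH" if "h \<in> carrier H" for h
    unfolding kH using that by (rule basis_elt_carrier)
  have u_eq: "u v = skew_coeff_incl U H (incl v)" for v by (simp add: u_def incl_def)
  have coeff: "x \<in> carrier U \<Longrightarrow> skew_coeff_incl U H x \<in> carrier UH"
    "x \<in> carrier U \<Longrightarrow> skew_coeff_incl U H (c \<odot>\<^bsub>U\<^esub> x) = c \<odot>\<^bsub>UH\<^esub> skew_coeff_incl U H x" for x c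
    using act.skew_coeff_incl_alg_hom unfolding UH[symmetric] by (auto simp: alg_hom_def ring_hom_def)
  have K_closed: "K h \<in> carrier UH" if "h \<in> carrier H" for h using that by (simp add: K_def k_lin bH)
  have W_closed: "W i \<in> carrier UH" if "i \<in> {1..n}" for i
    using that by (simp add: W_def u_eq coeff incl w)

  have xi_hom: "xi phi \<in> hom H units_grp" if "phi \<in> Irr" for phi
    by (rule inflated_chars_props(1)[OF Z_normal xi(1)[OF that]])

  interpret TA: twisted_action UH H K Z chi phi0 xi "{1..n}" W psi "\<lambda>i phi. gg (psi i) phi"
  proof (intro twisted_action.intro twisted_action_axioms.intro)
    show "field_algebra UH" by (rule UH.field_algebra_axioms)
    show "of_nat (card (carrier H)) \<noteq> (0::'k)"
      using prime_p char_p coprime_H by (metis of_nat_eq_0_iff_char_dvd coprime_common_divisor dvd_refl not_prime_unit)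
    show "K (g \<otimes>\<^bsub>H\<^esub> h) = K g \<otimes>\<^bsub>UH\<^esub> K h" if "g \<in> carrier H" "h \<in> carrier H" for g h
      using that by (simp add: K_def k_lin(4)[symmetric] bH) (simp add: kH basis_elt_mult)
    show "K \<one>\<^bsub>H\<^esub> = \<one>\<^bsub>UH\<^esub>" using k_lin(5) by (simp add: K_def kH monoid_alg_simps)
    show "grp_commutator H g h \<in> Z" if "g \<in> carrier H" "h \<in> carrier H" for g h
      unfolding Z_derived derived_def grp_commutator_def using that by (intro generate.incl) auto
    show "K h \<otimes>\<^bsub>UH\<^esub> W i = psi i h \<odot>\<^bsub>UH\<^esub> (W i \<otimes>\<^bsub>UH\<^esub> K h)" if h: "h \<in> carrier H" and i: "i \<in> {1..n}" for h i
    proof -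
      have "uenv_map (S h) (incl (w i)) = psi i h \<odot>\<^bsub>U\<^esub> incl (w i)"
        using act_incl[OF h w[OF i]] eigen[OF i h] w[OF i] by (simp add: S_def incl_def[symmetric] incl)
      then show ?thesis
        using act.skew_commute[OF h incl(1)[OF w[OF i]]] coeff incl(1)[OF w[OF i]] K_closed[OF h]
        by (simp add: K_def W_def u_eq k_def[symmetric] UH[symmetric] UH.smult_mult_left)
    qed
    show "gg (psi i) phi \<in> carrier H" if "i \<in> {1..n}" "phi \<in> chars_over H Z chi" for i phi
      using gg[OF psi[OF that(1)]] that(2) by (simp add: Irr)
    show "chi (grp_commutator H h (gg (psi i) phi)) =
        xi (char_twist H phi (psi i)) h * inverse (xi phi h) * inverse (psi i h)"
      if "i \<in> {1..n}" "phi \<in> chars_over H Z chi" "h \<in> carrier H" for i phi h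
    proof -
      have "comm_char H chi (gg (psi i) phi) h = xi (char_twist H phi (psi i)) h * inverse (xi phi h) * inverse (psi i h)"
        using gg[OF psi[OF that(1)], of phi] that(2,3) by (simp add: Irr)
      then show ?thesis using that(3) by (simp add: comm_char_def)
    qed
    have "skew_coeff_incl U H ` incl ` w ` {1..n} = W ` {1..n}"
      by (simp add: image_image W_def u_eq)
    then show "carrier UH \<subseteq> gen_subalg UH (K ` carrier H \<union> W ` {1..n})"
      using act.UH_generated[OF U_gen] incl(1) w
      by (simp add: UH[symmetric] K_def k_def[symmetric] image_subset_iff)
  qed (use H_group finite_H K_closed Z_subgroup Z_center chi phi0 xi psi_hom psi_Z W_closed
      xi_hom in \<open>auto simp: Irr\<close>)

  have k_sum: "k f = (\<Oplus>\<^bsub>UH\<^esub>h\<in>N. f h \<odot>\<^bsub>UH\<^esub> K h)" if "N \<subseteq> carrier H" "\<And>h. f h \<noteq> 0 \<Longrightarrow> h \<in> N" for f N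
  proof -
    have fin: "finite N" using that(1) finite_H by (rule finite_subset)
    then have "f \<in> carrier (monoid_alg H)"
      using that by (auto simp: monoid_alg_carrier intro: finite_subset[of _ N])
    then have "k f = lin_ext UH (\<lambda>h. act.single h \<one>\<^bsub>U\<^esub>) f"
      unfolding k_def UH by (rule act.skew_group_incl_eq)
    also have "\<dots> = (\<Oplus>\<^bsub>UH\<^esub>h\<in>N. f h \<odot>\<^bsub>UH\<^esub> act.single h \<one>\<^bsub>U\<^esub>)"
      unfolding UH using fin that by (intro act.UH.lin_ext_superset) auto
    also have "\<dots> = (\<Oplus>\<^bsub>UH\<^esub>h\<in>N. f h \<odot>\<^bsub>UH\<^esub> K h)"
      using that(1) K_closed
      by (intro UH.finsum_cong') (auto simp: K_def k_def act.skew_group_incl_basis subset_iff)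
    finally show ?thesis .
  qed
  have k_idem: "k (char_idem H N phi) = TA.avg N phi" if N: "N \<subseteq> carrier H" for N phi
  proof -
    have "k (char_idem H N phi) = (\<Oplus>\<^bsub>UH\<^esub>h\<in>N. char_idem H N phi h \<odot>\<^bsub>UH\<^esub> K h)"
      by (rule k_sum[OF N]) (simp add: char_idem_def split: if_splits)
    also have "\<dots> = TA.avg N phi"
      unfolding TA.avg_def using N K_closed by (intro UH.finsum_cong') (auto simp: char_idem_def)
    finally show ?thesis .
  qed
  have k_e: "k e = TA.e" by (simp add: e_def TA.e_def k_idem TA.Z.subset)
  have k_ei: "k (ei phi) = TA.E phi" for phi by (simp add: ei k_idem TA.C.subset)
  have ei_kH: "ei phi \<in> carrier kH" for phi
    unfolding kH ei using TA.C.subset TA.finite_C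
    by (auto simp: monoid_alg_carrier char_idem_def intro: finite_subset[of _ "grp_center H"])
  have B: "B = TA.B" by (simp add: B_def k_e)
  have AA: "AA = TA.AA"
    unfolding AA_def TA.AA_def B TA.V_def by (simp add: k_ei Irr K_def W_def)

  \<comment> \<open>The element m_h while still in the group algebra, before the inclusion
    \<open>k\<close>.\<close>
  define mm where "mm h = (\<Oplus>\<^bsub>kH\<^esub>phi\<in>Irr. inverse (xi phi h) \<odot>\<^bsub>kH\<^esub> (basis_elt h \<otimes>\<^bsub>kH\<^esub> ei phi))" for h
  have mm_kH: "mm h \<in> carrier kH" if "h \<in> carrier H" for h
    unfolding mm_def using that bH ei_kH by (intro kH.finsum_closed) auto
  have k_mm: "k (mm h) = TA.m h" if h: "h \<in> carrier H" for h
  proof -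
    have "k (mm h) = (\<Oplus>\<^bsub>UH\<^esub>phi\<in>Irr. inverse (xi phi h) \<odot>\<^bsub>UH\<^esub> k (basis_elt h \<otimes>\<^bsub>kH\<^esub> ei phi))"
      unfolding mm_def by (rule kH.linear_finsum) (use k_lin UH.vec_space_axioms h bH ei_kH in auto)
    then show ?thesis using h by (simp add: TA.m_def Irr k_lin bH ei_kH k_ei K_def)
  qed
  \<comment> \<open>Through \<open>k\<close> the embedding is the linear extension of
    \<open>TA.m\<close>; this holds on the whole group algebra, not only on the corner.\<close>
  have embed: "k (matrix_embedding H Irr xi y) = lin_ext UH TA.m y" if y: "y \<in> carrier kH" for y
  proof -
    have "k (matrix_embedding H Irr xi y) = k (\<Oplus>\<^bsub>kH\<^esub>h\<in>carrier H. y h \<odot>\<^bsub>kH\<^esub> mm h)"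
      by (simp only: matrix_embedding_def Let_def mm_def kH ei)
    also have "\<dots> = (\<Oplus>\<^bsub>UH\<^esub>h\<in>carrier H. y h \<odot>\<^bsub>UH\<^esub> k (mm h))"
      by (rule kH.linear_finsum) (use k_lin UH.vec_space_axioms mm_kH in auto)
    also have "\<dots> = (\<Oplus>\<^bsub>UH\<^esub>h\<in>carrier H. y h \<odot>\<^bsub>UH\<^esub> TA.m h)"
      by (rule UH.finsum_cong') (auto simp: k_mm)
    also have "\<dots> = lin_ext UH TA.m y"
      using y finite_H by (intro UH.lin_ext_superset[symmetric]) (auto simp: kH monoid_alg_carrier)
    finally show ?thesis .
  qed
  have m_fun: "TA.m \<in> carrier H \<rightarrow> carrier UH" by simp
  note lin_ext = UH.lin_ext_add[OF m_fun, folded kH_def] UH.lin_ext_smult[OF m_fun, folded kH_def]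
    UH.lin_ext_closed[OF m_fun, folded kH_def]
  \<comment> \<open>\<open>h\<close> and h e_(phi_0) have the same image, so restricting the
    embedding to the corner does not shrink its range.\<close>
  have embed_basis: "lin_ext UH TA.m (basis_elt h \<otimes>\<^bsub>kH\<^esub> ei phi0) = TA.m h" if h: "h \<in> carrier H" for h
  proof -
    have "matrix_embedding H Irr xi (basis_elt h \<otimes>\<^bsub>kH\<^esub> ei phi0) = mm h"
      unfolding mm_def kH ei
      by (rule matrix_embedding_basis[of H Irr Z chi phi0 xi h])
        (use H_group finite_H TA.card_C TA.finite_Irr TA.xi_hom xi phi0 h in \<open>auto simp: Irr\<close>)
    then show ?thesis
      using embed[of "basis_elt h \<otimes>\<^bsub>kH\<^esub> ei phi0"] k_mm[OF h] bH[OF h] ei_kH by simp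
  qed
  have MM: "MM = TA.MM"
  proof (intro equalityI subsetI)
    fix x assume "x \<in> MM"
    then obtain y where "y \<in> carrier (corner_alg kH (ei phi0))" and x: "x = k (matrix_embedding H Irr xi y)"
      by (auto simp: MM_def)
    then have y: "y \<in> carrier kH" using ei_kH by (auto simp: corner_alg_def)
    have "x = (\<Oplus>\<^bsub>UH\<^esub>h\<in>carrier H. y h \<odot>\<^bsub>UH\<^esub> TA.m h)"
      unfolding x embed[OF y] using y finite_H
      by (intro UH.lin_ext_superset) (auto simp: kH monoid_alg_carrier)
    then show "x \<in> TA.MM" by (auto simp: TA.MM_def)
  next
    fix x assume "x \<in> TA.MM"
    then obtain c where x: "x = (\<Oplus>\<^bsub>UH\<^esub>h\<in>carrier H. c h \<odot>\<^bsub>UH\<^esub> TA.m h)" by (auto simp: TA.MM_def)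
    \<comment> \<open>The preimage is a combination of the h e_(phi_0); the next step factors out
      the idempotent to place it in the corner.\<close>
    define y where "y = (\<Oplus>\<^bsub>kH\<^esub>h\<in>carrier H. c h \<odot>\<^bsub>kH\<^esub> (basis_elt h \<otimes>\<^bsub>kH\<^esub> ei phi0))"
    have y_eq: "y = (\<Oplus>\<^bsub>kH\<^esub>h\<in>carrier H. c h \<odot>\<^bsub>kH\<^esub> basis_elt h) \<otimes>\<^bsub>kH\<^esub> ei phi0"
    proof -
      have "y = (\<Oplus>\<^bsub>kH\<^esub>h\<in>carrier H. (c h \<odot>\<^bsub>kH\<^esub> basis_elt h) \<otimes>\<^bsub>kH\<^esub> ei phi0)"
        unfolding y_def by (rule kH.finsum_cong') (use bH ei_kH in \<open>auto simp: kH.smult_mult_left\<close>)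
      then show ?thesis using finite_H bH ei_kH by (subst kH.finsum_ldistr) auto
    qed
    have "(\<Oplus>\<^bsub>kH\<^esub>h\<in>carrier H. c h \<odot>\<^bsub>kH\<^esub> basis_elt h) \<in> carrier kH" using bH by (intro kH.finsum_closed) auto
    then have y: "y \<in> carrier (corner_alg kH (ei phi0))" "y \<in> carrier kH"
      using ei_kH unfolding y_eq by (auto simp: corner_alg_def)
    have "lin_ext UH TA.m y =
        (\<Oplus>\<^bsub>UH\<^esub>h\<in>carrier H. c h \<odot>\<^bsub>UH\<^esub> lin_ext UH TA.m (basis_elt h \<otimes>\<^bsub>kH\<^esub> ei phi0))"
      unfolding y_def by (rule kH.linear_finsum) (use lin_ext UH.vec_space_axioms bH ei_kH in auto)
    also have "\<dots> = x" unfolding x by (rule UH.finsum_cong') (auto simp: embed_basis)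
    finally have "x = k (matrix_embedding H Irr xi y)" using embed[OF y(2)] by simp
    then show "x \<in> MM" using y(1) by (simp add: MM_def)
  qed
  show ?thesis
    unfolding B AA MM by (rule TA.tensor_iso)
qed

end
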